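(* Let $G,H$ be reflexive undirected graphs, $\alpha,\beta:G\to H$ homomorphisms and $q\in V(G)$. Let $\bar\Pi$ be the set of all walks that are $H$-realizable for $\alpha,\beta,q$. Then one of the following holds: (1) $\bar\Pi=\emptyset$; (2) $\bar\Pi=\{Q\}$ for some $Q\in\pi(H)$; (3) $\bar\Pi=\{R^nP: n\in\mathbb{Z}\}$ for some $R,P\in\pi(H)$; (4) $\bar\Pi$ contains all reduced walks from $\alpha(q)$ to $\beta(q)$. Furthermore, one can determine in time $O(|V(G)|\cdot|E(G)|+|E(H)|)$ which case holds and output $Q$, respectively $R,P$, in cases (2) and (3), with $|Q|,|R|,|P|$ bounded by $O(|V(G)|\cdot|E(G)|+|E(H)|)$. Case (4) happens when $\alpha(C)=\beta(C)=\varepsilon$ in $\pi(H)$ for all closed walks $C$ in $G$.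
   Context: Reflexive: every vertex has a loop. $G,H$ connected with at least two vertices. A walk is $(v_1v_2)\cdots(v_{n-1}v_n)$ with $v_iv_{i+1}$ edges; closed if $v_n=v_1$; $\varepsilon$ is the empty walk; $\alpha(W)$ is the image walk. Reduction deletes $(v_iv_{i+1})(v_{i+1}v_{i+2})$ when $v_i=v_{i+2}$, or a loop step $(v_iv_i)$; a walk is reduced if no reduction applies; $\pi(H)$ is walks up to having the same reduction, with concatenation; $R^n$ is $n$-fold concatenation (inverse for $n<0$). An $H$-recoloring sequence from $\alpha$ to $\beta$ is a sequence $\sigma_0=\alpha,\dots,\sigma_\ell=\beta$ of homomorphisms $G\to H$ such that $\sigma_i,\sigma_{i+1}$ differ on exactly one vertex $u$ and $\sigma_i(u)\sigma_{i+1}(u)\in E(H)$; it satisfies the push-or-pull property if whenever $u$ changes color from $a$ to $b$, every neighbor of $u$ has color $a$ or $b$. $S(v)$ denotes the walk of successive colors of $v$. A reduced walk $Q$ from $\alpha(q)$ to $\beta(q)$ is $H$-realizable for $\alpha,\beta,q$ if there is an $H$-recoloring sequence $S$ from $\alpha$ to $\beta$ satisfying the push-or-pull property with $Q=S(q)$ in $\pi(H)$. *)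

theory Defs
  imports "Graph_Theory.Graph_Theory" "HOL-Library.FuncSet"
begin

section \<open>Reflexive graphs and homomorphisms\<close>

text \<open>
  A finite undirected graph, possibly with loops, is a finite symmetric digraph without parallel
  arcs (\<^locale>\<open>pair_pseudo_graph\<close>): an edge \<open>uv\<close> is the pair of arcs \<open>(u, v)\<close>, \<open>(v, u)\<close>, a loop is
  one arc.
\<close>

definition reflexive_graph :: "'a pair_pre_digraph \<Rightarrow> bool" where
  "reflexive_graph G \<longleftrightarrow> pair_pseudo_graph G \<and> (\<forall>v \<in> pverts G. (v, v) \<in> parcs G)"

definition conn_reflexive_graph :: "'a pair_pre_digraph \<Rightarrow> bool" where
  "conn_reflexive_graph G \<longleftrightarrow> reflexive_graph G \<and> connected (with_proj G) \<and> card (pverts G) \<ge> 2"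

definition edges :: "'a pair_pre_digraph \<Rightarrow> 'a set set" where
  "edges G = {{u, v} | u v. (u, v) \<in> parcs G}"

text \<open>
  Homomorphisms are \<^const>\<open>undefined\<close> outside the vertex set, so that equality of homomorphisms
  is equality on the vertices.
\<close>

definition homs :: "'a pair_pre_digraph \<Rightarrow> 'b pair_pre_digraph \<Rightarrow> ('a \<Rightarrow> 'b) set" where
  "homs G H = {f \<in> pverts G \<rightarrow>\<^sub>E pverts H. \<forall>(u, v) \<in> parcs G. (f u, f v) \<in> parcs H}"

definition hom_pair ::
  "'a pair_pre_digraph \<Rightarrow> 'b pair_pre_digraph \<Rightarrow> ('a \<Rightarrow> 'b) \<Rightarrow> ('a \<Rightarrow> 'b) \<Rightarrow> 'a \<Rightarrow> bool" where
  "hom_pair G H \<alpha> \<beta> q \<longleftrightarrow>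
     conn_reflexive_graph G \<and> conn_reflexive_graph H \<and>
     \<alpha> \<in> homs G H \<and> \<beta> \<in> homs G H \<and> q \<in> pverts G"

section \<open>Walks up to reduction\<close>

text \<open>
  A walk is its list of arcs. The empty walk \<open>[]\<close> is a walk from \<open>v\<close> to \<open>v\<close> for every vertex \<open>v\<close>.
\<close>

abbreviation is_walk :: "'a pair_pre_digraph \<Rightarrow> 'a \<Rightarrow> ('a \<times> 'a) list \<Rightarrow> 'a \<Rightarrow> bool" where
  "is_walk G u W v \<equiv> pre_digraph.awalk (with_proj G) u W v"

definition walks :: "'a pair_pre_digraph \<Rightarrow> ('a \<times> 'a) list set" where
  "walks G = {W. \<exists>u v. is_walk G u W v}"

definition closed_walks :: "'a pair_pre_digraph \<Rightarrow> ('a \<times> 'a) list set" where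
  "closed_walks G = {W. \<exists>v. is_walk G v W v}"

definition map_walk :: "('a \<Rightarrow> 'b) \<Rightarrow> ('a \<times> 'a) list \<Rightarrow> ('b \<times> 'b) list" where
  "map_walk f W = map (map_prod f f) W"

inductive reduces :: "('a \<times> 'a) list \<Rightarrow> ('a \<times> 'a) list \<Rightarrow> bool" where
  backtrack: "reduces (X @ [(u, v), (v, u)] @ Y) (X @ Y)"
| loop: "reduces (X @ [(v, v)] @ Y) (X @ Y)"

definition reduced :: "('a \<times> 'a) list \<Rightarrow> bool" where
  "reduced W \<longleftrightarrow> (\<nexists>W'. reduces W W')"

definition same_reduction :: "('a \<times> 'a) list \<Rightarrow> ('a \<times> 'a) list \<Rightarrow> bool" where
  "same_reduction W W' \<longleftrightarrow> (\<exists>T. reduced T \<and> reduces\<^sup>*\<^sup>* W T \<and> reduces\<^sup>*\<^sup>* W' T)"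

text \<open>
  The element of \<open>\<pi>(H)\<close> represented by a walk \<open>W\<close> of \<open>H\<close>.
\<close>

definition pi_class :: "'a pair_pre_digraph \<Rightarrow> ('a \<times> 'a) list \<Rightarrow> ('a \<times> 'a) list set" where
  "pi_class H W = {(X, Y). X \<in> walks H \<and> Y \<in> walks H \<and> same_reduction X Y} `` {W}"

definition walk_pow :: "('a \<times> 'a) list \<Rightarrow> int \<Rightarrow> ('a \<times> 'a) list" where
  "walk_pow R n =
     (if n \<ge> 0 then concat (replicate (nat n) R) else concat (replicate (nat (- n)) (rev_path R)))"

section \<open>Recoloring sequences\<close>

definition recolor_step ::
  "'a pair_pre_digraph \<Rightarrow> 'b pair_pre_digraph \<Rightarrow> ('a \<Rightarrow> 'b) \<Rightarrow> ('a \<Rightarrow> 'b) \<Rightarrow> bool" where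
  "recolor_step G H \<sigma> \<tau> \<longleftrightarrow>
     (\<exists>u \<in> pverts G. \<sigma> u \<noteq> \<tau> u \<and> (\<forall>v \<in> pverts G - {u}. \<sigma> v = \<tau> v) \<and> (\<sigma> u, \<tau> u) \<in> parcs H)"

definition recolor_seq ::
  "'a pair_pre_digraph \<Rightarrow> 'b pair_pre_digraph \<Rightarrow> ('a \<Rightarrow> 'b) \<Rightarrow> ('a \<Rightarrow> 'b) \<Rightarrow> ('a \<Rightarrow> 'b) list \<Rightarrow> bool" where
  "recolor_seq G H \<alpha> \<beta> S \<longleftrightarrow>
     S \<noteq> [] \<and> hd S = \<alpha> \<and> last S = \<beta> \<and> set S \<subseteq> homs G H \<and> successively (recolor_step G H) S"

definition push_or_pull :: "'a pair_pre_digraph \<Rightarrow> ('a \<Rightarrow> 'b) list \<Rightarrow> bool" where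
  "push_or_pull G S \<longleftrightarrow>
     successively (\<lambda>\<sigma> \<tau>. \<forall>u \<in> pverts G. \<sigma> u \<noteq> \<tau> u \<longrightarrow>
       (\<forall>v. (u, v) \<in> parcs G \<longrightarrow> \<sigma> v \<in> {\<sigma> u, \<tau> u})) S"

text \<open>
  The walk \<open>S(v)\<close>. A step of \<open>S\<close> that does not recolor \<open>v\<close> contributes a loop, which vanishes in
  \<open>\<pi>(H)\<close>.
\<close>

definition color_walk :: "('a \<Rightarrow> 'b) list \<Rightarrow> 'a \<Rightarrow> ('b \<times> 'b) list" where
  "color_walk S v = zip (map (\<lambda>\<sigma>. \<sigma> v) (butlast S)) (map (\<lambda>\<sigma>. \<sigma> v) (tl S))"

definition realizable ::
  "'a pair_pre_digraph \<Rightarrow> 'b pair_pre_digraph \<Rightarrow> ('a \<Rightarrow> 'b) \<Rightarrow> ('a \<Rightarrow> 'b) \<Rightarrow> 'a \<Rightarrow>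
   ('b \<times> 'b) list \<Rightarrow> bool" where
  "realizable G H \<alpha> \<beta> q Q \<longleftrightarrow>
     is_walk H (\<alpha> q) Q (\<beta> q) \<and> reduced Q \<and>
     (\<exists>S. recolor_seq G H \<alpha> \<beta> S \<and> push_or_pull G S \<and> pi_class H Q = pi_class H (color_walk S q))"

definition realizable_walks ::
  "'a pair_pre_digraph \<Rightarrow> 'b pair_pre_digraph \<Rightarrow> ('a \<Rightarrow> 'b) \<Rightarrow> ('a \<Rightarrow> 'b) \<Rightarrow> 'a \<Rightarrow>
   ('b \<times> 'b) list set" where
  "realizable_walks G H \<alpha> \<beta> q = {Q. realizable G H \<alpha> \<beta> q Q}"

section \<open>The four outcomes\<close>

text \<open>
  Elements of \<open>\<pi>(H)\<close> are given by representing walks, and set equations are equations between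
  subsets of \<open>\<pi>(H)\<close>. For \<open>R\<^sup>nP\<close> to be composable and to run from \<open>\<alpha>(q)\<close> to \<open>\<beta>(q)\<close>, the walk \<open>R\<close>
  is closed at \<open>\<alpha>(q)\<close> and \<open>P\<close> leads from \<open>\<alpha>(q)\<close> to \<open>\<beta>(q)\<close>.
\<close>

definition outcome_none ::
  "'a pair_pre_digraph \<Rightarrow> 'b pair_pre_digraph \<Rightarrow> ('a \<Rightarrow> 'b) \<Rightarrow> ('a \<Rightarrow> 'b) \<Rightarrow> 'a \<Rightarrow> bool" where
  "outcome_none G H \<alpha> \<beta> q \<longleftrightarrow> realizable_walks G H \<alpha> \<beta> q = {}"

definition outcome_single ::
  "'a pair_pre_digraph \<Rightarrow> 'b pair_pre_digraph \<Rightarrow> ('a \<Rightarrow> 'b) \<Rightarrow> ('a \<Rightarrow> 'b) \<Rightarrow> 'a \<Rightarrow>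
   ('b \<times> 'b) list \<Rightarrow> bool" where
  "outcome_single G H \<alpha> \<beta> q Q \<longleftrightarrow>
     Q \<in> walks H \<and> pi_class H ` realizable_walks G H \<alpha> \<beta> q = {pi_class H Q}"

definition outcome_powers ::
  "'a pair_pre_digraph \<Rightarrow> 'b pair_pre_digraph \<Rightarrow> ('a \<Rightarrow> 'b) \<Rightarrow> ('a \<Rightarrow> 'b) \<Rightarrow> 'a \<Rightarrow>
   ('b \<times> 'b) list \<Rightarrow> ('b \<times> 'b) list \<Rightarrow> bool" where
  "outcome_powers G H \<alpha> \<beta> q R P \<longleftrightarrow>
     is_walk H (\<alpha> q) R (\<alpha> q) \<and> is_walk H (\<alpha> q) P (\<beta> q) \<and>
     pi_class H ` realizable_walks G H \<alpha> \<beta> q = {pi_class H (walk_pow R n @ P) | n :: int. True}"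

definition outcome_all ::
  "'a pair_pre_digraph \<Rightarrow> 'b pair_pre_digraph \<Rightarrow> ('a \<Rightarrow> 'b) \<Rightarrow> ('a \<Rightarrow> 'b) \<Rightarrow> 'a \<Rightarrow> bool" where
  "outcome_all G H \<alpha> \<beta> q \<longleftrightarrow>
     {Q. is_walk H (\<alpha> q) Q (\<beta> q) \<and> reduced Q} \<subseteq> realizable_walks G H \<alpha> \<beta> q"

section \<open>Running time\<close>

text \<open>
  Time is measured on a word RAM with structured control flow. The memory consists of registers
  and arrays, numbered by \<^typ>\<open>nat\<close>, of which a program accesses finitely many. Every node of an
  evaluated expression and every executed instruction costs one unit. All values that occur are
  bounded by \<open>w\<close>; a program that exceeds this bound is stuck.
\<close>

datatype rop = Add | Sub | Mul | Div | Mod | Less | Equal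

datatype rexp = Const nat | Reg nat | Elem nat rexp | Op rop rexp rexp

datatype com =
    Skip
  | Assign nat rexp
  | Store nat rexp rexp
  | Seq com com
  | If rexp com com
  | While rexp com

record ram_state =
  regs :: "nat \<Rightarrow> nat"
  arrays :: "nat \<Rightarrow> nat \<Rightarrow> nat"

fun apply_op :: "rop \<Rightarrow> nat \<Rightarrow> nat \<Rightarrow> nat" where
  "apply_op Add x y = x + y"
| "apply_op Sub x y = x - y"
| "apply_op Mul x y = x * y"
| "apply_op Div x y = x div y"
| "apply_op Mod x y = x mod y"
| "apply_op Less x y = (if x < y then 1 else 0)"
| "apply_op Equal x y = (if x = y then 1 else 0)"

fun eval_rexp :: "ram_state \<Rightarrow> rexp \<Rightarrow> nat" where
  "eval_rexp s (Const k) = k"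
| "eval_rexp s (Reg x) = regs s x"
| "eval_rexp s (Elem a e) = arrays s a (eval_rexp s e)"
| "eval_rexp s (Op f e1 e2) = apply_op f (eval_rexp s e1) (eval_rexp s e2)"

fun cost :: "rexp \<Rightarrow> nat" where
  "cost (Const k) = 1"
| "cost (Reg x) = 1"
| "cost (Elem a e) = 1 + cost e"
| "cost (Op f e1 e2) = 1 + cost e1 + cost e2"

fun fits :: "nat \<Rightarrow> ram_state \<Rightarrow> rexp \<Rightarrow> bool" where
  "fits w s (Const k) \<longleftrightarrow> k \<le> w"
| "fits w s (Reg x) \<longleftrightarrow> regs s x \<le> w"
| "fits w s (Elem a e) \<longleftrightarrow> fits w s e \<and> arrays s a (eval_rexp s e) \<le> w"
| "fits w s (Op f e1 e2) \<longleftrightarrow>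
     fits w s e1 \<and> fits w s e2 \<and> apply_op f (eval_rexp s e1) (eval_rexp s e2) \<le> w"

text \<open>
  \<open>run w c s t s'\<close>: with word bound \<open>w\<close>, the program \<open>c\<close> started in \<open>s\<close> halts in \<open>s'\<close> after \<open>t\<close>
  units of time.
\<close>

inductive run :: "nat \<Rightarrow> com \<Rightarrow> ram_state \<Rightarrow> nat \<Rightarrow> ram_state \<Rightarrow> bool" for w :: nat where
  Skip: "run w Skip s 1 s"
| Assign: "fits w s e \<Longrightarrow>
    run w (Assign x e) s (1 + cost e) (s\<lparr>regs := (regs s)(x := eval_rexp s e)\<rparr>)"
| Store: "fits w s i \<Longrightarrow> fits w s e \<Longrightarrow>
    run w (Store a i e) s (1 + cost i + cost e)
      (s\<lparr>arrays := (arrays s)(a := (arrays s a)(eval_rexp s i := eval_rexp s e))\<rparr>)"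
| Seq: "run w c1 s t1 s' \<Longrightarrow> run w c2 s' t2 s'' \<Longrightarrow> run w (Seq c1 c2) s (t1 + t2) s''"
| If_true: "fits w s e \<Longrightarrow> eval_rexp s e \<noteq> 0 \<Longrightarrow> run w c1 s t s' \<Longrightarrow>
    run w (If e c1 c2) s (1 + cost e + t) s'"
| If_false: "fits w s e \<Longrightarrow> eval_rexp s e = 0 \<Longrightarrow> run w c2 s t s' \<Longrightarrow>
    run w (If e c1 c2) s (1 + cost e + t) s'"
| While_true: "fits w s e \<Longrightarrow> eval_rexp s e \<noteq> 0 \<Longrightarrow> run w c s t1 s' \<Longrightarrow>
    run w (While e c) s' t2 s'' \<Longrightarrow> run w (While e c) s (1 + cost e + t1 + t2) s''"
| While_false: "fits w s e \<Longrightarrow> eval_rexp s e = 0 \<Longrightarrow> run w (While e c) s (1 + cost e) s"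

text \<open>
  Inputs have vertex sets \<open>{0..<n}\<close>; \<open>gs\<close> and \<open>hs\<close> list the arcs of \<open>G\<close> and \<open>H\<close> in any order (so
  an edge that is not a loop is listed in both directions). All other memory is zero.
\<close>

definition list_array :: "nat list \<Rightarrow> nat \<Rightarrow> nat" where
  "list_array xs i = (if i < length xs then xs ! i else 0)"

definition input_state ::
  "nat \<Rightarrow> (nat \<times> nat) list \<Rightarrow> nat \<Rightarrow> (nat \<times> nat) list \<Rightarrow> (nat \<Rightarrow> nat) \<Rightarrow> (nat \<Rightarrow> nat) \<Rightarrow> nat \<Rightarrow>
   ram_state" where
  "input_state nG gs nH hs \<alpha> \<beta> q =
     \<lparr>regs = list_array [nG, length gs, nH, length hs, q],
      arrays = (\<lambda>_ _. 0)
        (0 := list_array (map fst gs), 1 := list_array (map snd gs),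
         2 := list_array (map fst hs), 3 := list_array (map snd hs),
         4 := list_array (map \<alpha> [0..<nG]), 5 := list_array (map \<beta> [0..<nG]))\<rparr>"

definition stored_walk :: "ram_state \<Rightarrow> nat \<Rightarrow> nat \<Rightarrow> nat \<Rightarrow> (nat \<times> nat) list" where
  "stored_walk s a b k = map (\<lambda>i. (arrays s a i, arrays s b i)) [0..<k]"

text \<open>
  The final state \<open>s\<close> names an outcome that holds in register 0 and contains the walks that belong
  to it, in reduced form and of length at most \<open>l\<close>.
\<close>

definition correct_output ::
  "nat pair_pre_digraph \<Rightarrow> nat pair_pre_digraph \<Rightarrow> (nat \<Rightarrow> nat) \<Rightarrow> (nat \<Rightarrow> nat) \<Rightarrow> nat \<Rightarrow> nat \<Rightarrow>
   ram_state \<Rightarrow> bool" where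
  "correct_output G H \<alpha> \<beta> q l s \<longleftrightarrow>
     (regs s 0 = 1 \<and> outcome_none G H \<alpha> \<beta> q) \<or>
     (regs s 0 = 2 \<and>
       (\<exists>Q. Q = stored_walk s 0 1 (regs s 1) \<and>
            reduced Q \<and> length Q \<le> l \<and> outcome_single G H \<alpha> \<beta> q Q)) \<or>
     (regs s 0 = 3 \<and>
       (\<exists>R P. R = stored_walk s 0 1 (regs s 1) \<and> P = stored_walk s 2 3 (regs s 2) \<and>
            reduced R \<and> reduced P \<and> length R \<le> l \<and> length P \<le> l \<and>
            outcome_powers G H \<alpha> \<beta> q R P)) \<or>
     (regs s 0 = 4 \<and> outcome_all G H \<alpha> \<beta> q)"

definition size_bound :: "'a pair_pre_digraph \<Rightarrow> 'b pair_pre_digraph \<Rightarrow> nat" where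
  "size_bound G H = card (pverts G) * card (edges G) + card (edges H)"

end

theory Submission
  imports Defs
begin

text \<open>
  For a push-or-pull sequence \<open>S\<close> and a walk \<open>W\<close> from \<open>q\<close> to \<open>v\<close>, the walk \<open>S(q)\<close> determines
  \<open>S(v) = \<alpha>(W)\<^sup>-\<^sup>1S(q)\<beta>(W)\<close>. So a realizable walk \<open>Q\<close> is valid: \<open>\<alpha>(C)Q = Q\<beta>(C)\<close> for the closed walks
  \<open>C\<close> at \<open>q\<close>, for which the fundamental closed walks of a spanning tree suffice. A valid \<open>Q\<close> is
  realizable if and only if there is no cycle of vertices each of which is blocked in its next move
  by the following one. The vertices of such a cycle lie on a tight closed walk, whose image under
  \<open>\<alpha>\<close> is not \<open>\<epsilon>\<close> and which no recoloring sequence can move. Hence a blocking cycle of one valid walk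
  determines the only possible realizable \<open>Q\<close> by \<open>S(v) = \<epsilon>\<close>.

  The validity equations are solved in the free group of reduced arc lists, connected or not, which
  contains the groupoid \<open>\<pi>(H)\<close> and acts on the tree of its elements. If \<open>\<alpha>(C)\<close> and \<open>\<beta>(C)\<close> are not
  \<open>\<epsilon>\<close>, they translate the tree along axes, and a solution maps the axis of \<open>\<beta>(C)\<close> to the axis of
  \<open>\<alpha>(C)\<close>, so the solutions for one \<open>C\<close> are \<open>R\<^sup>nP\<close> for a generator \<open>R\<close> of the centralizer of \<open>\<alpha>(C)\<close>.
  If all closed walks have images that commute with \<open>\<alpha>(C)\<close>, all or none of these are valid.
  Otherwise two axes with a bounded overlap leave at most one of them. In both cases the shift along
  the axis is bounded by a multiple of \<open>|V(G)|\<close>, and each candidate is tested in time \<open>O(|V(G)|)\<close>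
  against \<open>C\<close> and one closed walk that does not commute with it.
\<close>

section \<open>The group of reduced walks\<close>

text \<open>The full test of one candidate against all fundamental closed walks takes time of order
  |V(G)||E(G)|, and the number of shifts to be considered is of order |V(G)|, so only a few
  candidates can get the full test. Two observations make this enough. If any valid walk exists,
  then a candidate that solves the equations for \<open>C\<close> and the second closed walk is
  valid, so an invalid first hit already refutes solvability. And if two members of an orbit
  \<open>R^n P\<close> of valid walks are realizable, then no member has a blocking cycle, so
  \<open>P\<close> and \<open>RP\<close> decide the whole orbit.

  This adds no solutions: translations carry arcs to arcs, so every solution for a nontrivial
  \<open>C\<close> is a walk of \<open>H\<close> with the right ends.

  A cycle of blocking arcs persists under a push-or-pull move and under its reverse. Used forward,
  this shows that the absence of cycles is necessary; used backward, that it is preserved while a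
  sequence is constructed.\<close>

definition cancel_cons :: "'a \<times> 'a \<Rightarrow> ('a \<times> 'a) list \<Rightarrow> ('a \<times> 'a) list" where
  "cancel_cons x W =
     (if fst x = snd x then W else
      case W of [] \<Rightarrow> [x] | y # W' \<Rightarrow> if y = (snd x, fst x) then W' else x # W)"

fun is_red :: "('a \<times> 'a) list \<Rightarrow> bool" where
  "is_red [] = True"
| "is_red [x] = (fst x \<noteq> snd x)"
| "is_red (x # y # W) = (fst x \<noteq> snd x \<and> y \<noteq> (snd x, fst x) \<and> is_red (y # W))"

lemma is_red_Cons:
  "is_red (x # W) \<longleftrightarrow> fst x \<noteq> snd x \<and> (W \<noteq> [] \<longrightarrow> hd W \<noteq> (snd x, fst x)) \<and> is_red W"
  by (cases W) auto

lemma is_red_append: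
  "is_red (X @ Y) \<longleftrightarrow> is_red X \<and> is_red Y \<and>
     (X \<noteq> [] \<longrightarrow> Y \<noteq> [] \<longrightarrow> hd Y \<noteq> (snd (last X), fst (last X)))"
  by (induction X) (auto simp: is_red_Cons)

definition red :: "('a \<times> 'a) list \<Rightarrow> ('a \<times> 'a) list" where
  "red W = foldr cancel_cons W []"

lemma reduces_Cons: "reduces W W' \<Longrightarrow> reduces (x # W) (x # W')"
proof (induction rule: reduces.induct)
  case (backtrack X u v Y)
  show ?case using reduces.backtrack[of "x # X" u v Y] by simp
next
  case (loop X v Y)
  show ?case using reduces.loop[of "x # X" v Y] by simp
qed

lemma reduced_iff_is_red: "reduced W \<longleftrightarrow> is_red W"
proof
  assume r: "reduced W"
  show "is_red W"
    using r
  proof (induction W)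
    case (Cons x W)
    have "reduced W"
      using Cons.prems reduces_Cons unfolding reduced_def by blast
    moreover have "fst x \<noteq> snd x"
      using Cons.prems reduces.loop[of "[]" "fst x" W] unfolding reduced_def by (metis append_Cons append_Nil prod.collapse)
    moreover have "W = [] \<or> hd W \<noteq> (snd x, fst x)"
    proof (rule ccontr)
      assume "\<not> ?thesis"
      then obtain W' where "W = (snd x, fst x) # W'" by (cases W) auto
      then show False
        using Cons.prems reduces.backtrack[of "[]" "fst x" "snd x" W'] unfolding reduced_def
        by (metis append_Cons append_Nil prod.collapse)
    qed
    ultimately show ?case using Cons.IH by (auto simp: is_red_Cons)
  qed simp
next
  assume r: "is_red W"
  show "reduced W"
    unfolding reduced_def
  proof
    assume "\<exists>W'. reduces W W'"
    then obtain W' where "reduces W W'" ..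
    then show False
      using r by cases (auto simp: is_red_append is_red_Cons)
  qed
qed

lemma is_red_cancel_cons: "is_red W \<Longrightarrow> is_red (cancel_cons x W)"
  by (auto simp: cancel_cons_def is_red_Cons split: list.split)

lemma is_red_red: "is_red (red W)"
  unfolding red_def by (induction W) (auto intro: is_red_cancel_cons)

lemma is_red_fold_cancel: "is_red W \<Longrightarrow> is_red (foldr cancel_cons X W)"
  by (induction X) (auto intro: is_red_cancel_cons)

lemma cancel_cons_inverse: "is_red W \<Longrightarrow> cancel_cons (a, b) (cancel_cons (b, a) W) = W"
  by (auto simp: cancel_cons_def is_red_Cons split: list.splits)

lemma cancel_cons_is_red: "is_red (x # W) \<Longrightarrow> cancel_cons x W = x # W"
  by (auto simp: cancel_cons_def is_red_Cons split: list.splits)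

lemma red_is_red: "is_red W \<Longrightarrow> red W = W"
  unfolding red_def
proof (induction W)
  case (Cons x W)
  then show ?case using cancel_cons_is_red[of x W] by (simp add: is_red_Cons)
qed simp

text \<open>Van der Waerden's argument in place of confluence: by \<open>cancel_cons_inverse\<close>
  an arc acts on the reduced words as a permutation, inverse to that of the reversed arc. So a word
  acts in the same way before and after a cancellation, and \<open>red\<close> is invariant under
  reduction.\<close>

lemma fold_cancel_cons:
  "is_red W \<Longrightarrow> foldr cancel_cons (cancel_cons x X) W = cancel_cons x (foldr cancel_cons X W)"
proof (cases X)
  case Nil
  then show ?thesis by (cases x) (auto simp: cancel_cons_def)
next
  case (Cons y Y)
  assume W: "is_red W"
  show ?thesis
  proof (cases "fst x \<noteq> snd x \<and> y = (snd x, fst x)")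
    case True
    then show ?thesis
      using cancel_cons_inverse[OF is_red_fold_cancel[OF W], of "fst x" "snd x" Y] Cons
      by (simp add: cancel_cons_def)
  next
    case False
    then show ?thesis using Cons by (auto simp: cancel_cons_def)
  qed
qed

lemma fold_cancel_red: "is_red W \<Longrightarrow> foldr cancel_cons (red X) W = foldr cancel_cons X W"
proof (induction X)
  case (Cons x X)
  have "red (x # X) = cancel_cons x (red X)" by (simp add: red_def)
  then have "foldr cancel_cons (red (x # X)) W = cancel_cons x (foldr cancel_cons (red X) W)"
    using fold_cancel_cons[OF Cons.prems, of x "red X"] by simp
  then show ?case using Cons by simp
qed (simp add: red_def)

lemma red_append: "red (X @ Y) = red (red X @ red Y)"
proof -
  have "red (red X @ red Y) = foldr cancel_cons (red X) (foldr cancel_cons (red Y) [])"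
    by (simp add: red_def)
  also have "\<dots> = foldr cancel_cons X (foldr cancel_cons Y [])"
    by (simp add: fold_cancel_red is_red_fold_cancel)
  finally show ?thesis by (simp add: red_def)
qed

lemma red_reduces: "reduces W W' \<Longrightarrow> red W = red W'"
proof (induction rule: reduces.induct)
  case (backtrack X u v Y)
  show ?case
    using cancel_cons_inverse[OF is_red_red[of Y], of u v] by (simp add: red_def)
next
  case (loop X v Y)
  show ?case by (simp add: red_def cancel_cons_def)
qed

lemma reduces_rtranclp_Cons: "reduces\<^sup>*\<^sup>* W W' \<Longrightarrow> reduces\<^sup>*\<^sup>* (x # W) (x # W')"
  by (induction rule: rtranclp_induct) (auto intro: reduces_Cons rtranclp.rtrancl_into_rtrancl)

lemma reduces_red: "reduces\<^sup>*\<^sup>* W (red W)"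
proof (induction W)
  case (Cons x W)
  have "reduces\<^sup>*\<^sup>* (x # red W) (cancel_cons x (red W))"
  proof (cases "fst x = snd x")
    case True
    then show ?thesis using reduces.loop[of "[]" "fst x" "red W"]
      by (cases x) (auto simp: cancel_cons_def)
  next
    case False
    then show ?thesis using reduces.backtrack[of "[]" "fst x" "snd x"]
      by (cases x) (auto simp: cancel_cons_def split: list.splits)
  qed
  moreover have "red (x # W) = cancel_cons x (red W)" by (simp add: red_def)
  ultimately show ?case using reduces_rtranclp_Cons[OF Cons.IH, of x] by simp
qed (simp add: red_def)

text \<open>Every reduction step leaves \<open>red\<close> unchanged, and \<open>red W\<close> is
  reached from \<open>W\<close> by such steps, so it is the only reduced word that can be
  reached.\<close>

lemma same_reduction_iff: "same_reduction X Y \<longleftrightarrow> red X = red Y"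
proof
  assume "same_reduction X Y"
  then obtain T where T: "reduces\<^sup>*\<^sup>* X T" "reduces\<^sup>*\<^sup>* Y T"
    unfolding same_reduction_def by blast
  have "reduces\<^sup>*\<^sup>* Z T \<Longrightarrow> red Z = red T" for Z
    by (induction rule: rtranclp_induct) (auto dest: red_reduces)
  then show "red X = red Y" using T by metis
next
  assume "red X = red Y"
  then show "same_reduction X Y"
    unfolding same_reduction_def using reduces_red is_red_red reduced_iff_is_red by metis
qed

lemma rev_path_last: "W \<noteq> [] \<Longrightarrow> last (rev_path W) = (snd (hd W), fst (hd W))"
  by (cases W) auto

lemma length_rev_path[simp]: "length (rev_path W) = length W"
  by (induction W) auto

lemma is_red_rev_path[simp]: "is_red (rev_path W) \<longleftrightarrow> is_red W"
proof (induction W)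
  case (Cons x W)
  then show ?case
    by (cases x) (auto simp: is_red_Cons is_red_append rev_path_last)
qed simp

text \<open>The free group with one generator for each unordered pair of distinct vertices:
  \<open>(b, a)\<close> is the inverse of \<open>(a, b)\<close>, and loops are trivial. It is
  written additively, as an instance of \<open>group_add\<close>, although it is not
  commutative.\<close>

typedef 'a fg = "{W :: ('a \<times> 'a) list. is_red W}"
  morphisms rep mk
  by (rule exI[of _ "[]"]) simp

lemma is_red_rep[simp]: "is_red (rep p)"
  using rep[of p] by simp

lemma rep_mk[simp]: "is_red W \<Longrightarrow> rep (mk W) = W"
  by (simp add: mk_inverse)

lemma mk_rep[simp]: "mk (rep p) = p"
  by (simp add: rep_inverse)

definition cls :: "('a \<times> 'a) list \<Rightarrow> 'a fg" where
  "cls W = mk (red W)"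

lemma rep_cls: "rep (cls W) = red W"
  by (simp add: cls_def is_red_red)

lemma cls_rep[simp]: "cls (rep p) = p"
  by (simp add: cls_def red_is_red)

lemma rep_cls_is_red: "is_red W \<Longrightarrow> rep (cls W) = W"
  by (simp add: rep_cls red_is_red)

lemma red_rev_path: "red (rev_path W @ W) = []"
proof (induction W)
  case Nil
  then show ?case by (simp add: red_def)
next
  case (Cons x W)
  have "red (rev_path (x # W) @ x # W) = foldr cancel_cons (rev_path W) (cancel_cons (snd x, fst x) (cancel_cons x (red W)))"
    by (simp add: red_def)
  also have "\<dots> = foldr cancel_cons (rev_path W) (red W)"
    using cancel_cons_inverse[OF is_red_red, of "snd x" "fst x" W] by simp
  finally show ?case using Cons by (simp add: red_def)
qed

instantiation fg :: (type) group_add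
begin

definition zero_fg :: "'a fg" where "zero_fg = cls []"
definition plus_fg :: "'a fg \<Rightarrow> 'a fg \<Rightarrow> 'a fg" where "plus_fg p r = cls (rep p @ rep r)"
definition uminus_fg :: "'a fg \<Rightarrow> 'a fg" where "uminus_fg p = cls (rev_path (rep p))"
definition minus_fg :: "'a fg \<Rightarrow> 'a fg \<Rightarrow> 'a fg" where "minus_fg p r = p + - r"

instance
proof
  fix a b c :: "'a fg"
  have red3: "red (red (X @ Y) @ Z) = red (X @ red (Y @ Z))" for X Y Z :: "('a \<times> 'a) list"
    by (metis append.assoc red_append red_is_red is_red_red)
  show "a + b + c = a + (b + c)"
    using red3 by (simp add: plus_fg_def rep_cls) (simp add: cls_def)
  show "0 + a = a" "a + 0 = a"
    by (simp_all add: plus_fg_def zero_fg_def rep_cls) (simp_all add: red_def)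
  show "- a + a = 0"
    using red_rev_path[of "rep a"]
    by (simp add: plus_fg_def zero_fg_def uminus_fg_def rep_cls red_is_red) (simp add: cls_def red_def)
  show "a + - b = a - b" by (simp add: minus_fg_def)
qed

end

lemma rep_zero[simp]: "rep 0 = []"
  by (simp add: zero_fg_def rep_cls) (simp add: red_def)

lemma rep_eq_Nil[simp]: "rep p = [] \<longleftrightarrow> p = 0"
  by (metis rep_zero rep_inject)

lemma rep_uminus: "rep (- p) = rev_path (rep p)"
  by (simp add: uminus_fg_def rep_cls red_is_red)

lemma cls_Nil[simp]: "cls [] = 0"
  by (simp add: zero_fg_def)

lemma cls_append: "cls (X @ Y) = cls X + cls Y"
  using red_append[of X Y] by (simp add: plus_fg_def rep_cls cls_def red_is_red is_red_red)

lemma cls_Cons: "cls (x # Y) = cls [x] + cls Y"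
  using cls_append[of "[x]" Y] by simp

lemma cls_rev_path: "cls (rev_path W) = - cls W"
proof -
  have "cls (rev_path W) + cls W = 0"
    using red_rev_path[of W] unfolding cls_append[symmetric]
    by (simp add: cls_def zero_fg_def) (simp add: red_def)
  then show ?thesis by (simp add: eq_neg_iff_add_eq_0)
qed

lemma cls_eq_iff: "cls X = cls Y \<longleftrightarrow> red X = red Y"
  by (metis rep_cls cls_def)

definition ed :: "'a \<Rightarrow> 'a \<Rightarrow> 'a fg" where
  "ed a b = cls [(a, b)]"

lemma ed_self[simp]: "ed a a = 0"
  by (simp add: ed_def cls_def red_def cancel_cons_def zero_fg_def)

lemma uminus_ed[simp]: "- ed a b = ed b a"
  using cls_rev_path[of "[(a, b)]"] by (simp add: ed_def)

lemma ed_add_swap[simp]: "ed a b + ed b a = 0" "ed a b + (ed b a + p) = p"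
  by (metis uminus_ed add.right_inverse, metis uminus_ed add_minus_cancel)

lemma rep_ed: "a \<noteq> b \<Longrightarrow> rep (ed a b) = [(a, b)]"
  by (simp add: ed_def rep_cls_is_red)

lemma rep_ed_add: "rep (ed a b + p) = cancel_cons (a, b) (rep p)"
proof -
  have "red ((a,b) # rep p) = cancel_cons (a,b) (red (rep p))" by (simp add: red_def)
  moreover have "ed a b + p = cls ((a,b) # rep p)" by (subst cls_Cons) (simp add: ed_def)
  ultimately show ?thesis by (simp add: rep_cls red_is_red)
qed

definition len :: "'a fg \<Rightarrow> nat" where
  "len p = length (rep p)"

lemma len_zero[simp]: "len 0 = 0" by (simp add: len_def)

lemma len_eq_0[simp]: "len p = 0 \<longleftrightarrow> p = 0" by (simp add: len_def)

lemma len_uminus[simp]: "len (- p) = len p"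
  by (simp add: len_def rep_uminus)

text \<open>Reduced words cancel only in one block where they meet. Bounds on the length of products
  and the overlap of geodesics are read off from this splitting.\<close>

lemma rep_add_cancel:
  obtains u c v where "rep p = u @ c" "rep r = rev_path c @ v" "rep (p + r) = u @ v"
proof -
  have "\<exists>u c v. X = u @ c \<and> Y = rev_path c @ v \<and> foldr cancel_cons X Y = u @ v"
    if "is_red X" "is_red Y" for X Y :: "('a \<times> 'a) list"
    using that
  proof (induction X)
    case Nil
    then show ?case by (intro exI[of _ "[]"] exI[of _ Y]) simp
  next
    case (Cons x X)
    then have "is_red X" by (simp add: is_red_Cons)
    with Cons obtain u c v where X: "X = u @ c" and Y: "Y = rev_path c @ v"
      and F: "foldr cancel_cons X Y = u @ v" by blast
    show ?case
    proof (cases "u = []")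
      case False
      then obtain y u' where "u = y # u'" by (cases u) auto
      then have "cancel_cons x (u @ v) = x # u @ v"
        using Cons.prems X by (auto simp: cancel_cons_def is_red_Cons)
      then show ?thesis using X Y F by (intro exI[of _ "x # u"] exI[of _ c] exI[of _ v]) simp
    next
      \<comment> \<open>Only here does the new arc meet \<open>v\<close>, so that the cancelled
        block may grow by one.\<close>
      case u: True
      show ?thesis
      proof (cases "v \<noteq> [] \<and> hd v = (snd x, fst x)")
        case True
        then obtain v' where v': "v = (snd x, fst x) # v'" by (cases v) auto
        have "cancel_cons x v = v'" using Cons.prems by (simp add: v' cancel_cons_def is_red_Cons)
        then have "foldr cancel_cons (x # X) Y = [] @ v'" using F u by simp
        moreover have "x # X = [] @ (x # c)" "Y = rev_path (x # c) @ v'" using X Y u v' by simp_all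
        ultimately show ?thesis by metis
      next
        case False
        then have "cancel_cons x v = x # v"
          using Cons.prems by (auto simp: cancel_cons_def is_red_Cons split: list.splits)
        then show ?thesis using X Y F u
          by (intro exI[of _ "[x]"] exI[of _ c] exI[of _ v]) simp
      qed
    qed
  qed
  from this[of "rep p" "rep r"] obtain u c v where *: "rep p = u @ c" "rep r = rev_path c @ v"
    "foldr cancel_cons (rep p) (rep r) = u @ v" by auto
  have "rep (p + r) = foldr cancel_cons (rep p) (red (rep r))"
    by (simp add: plus_fg_def rep_cls) (simp add: red_def)
  then have "rep (p + r) = u @ v" using *(3) red_is_red[OF is_red_rep[of r]] by simp
  with * that show thesis by blast
qed

lemma len_add_le: "len (p + r) \<le> len p + len r"
  by (rule rep_add_cancel[of p r]) (simp add: len_def)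

lemma rep_add: "len (p + r) = len p + len r \<Longrightarrow> rep (p + r) = rep p @ rep r"
  by (rule rep_add_cancel[of p r]) (simp add: len_def)

section \<open>Walks in a symmetric reflexive graph\<close>

text \<open>Defined for arbitrary lists of vertices. As \<open>ed x x = 0\<close>, repetitions of a
  vertex do not count, so lists can be padded; the program uses this to give its walks a fixed
  length.\<close>

fun path :: "'a list \<Rightarrow> 'a fg" where
  "path [] = 0"
| "path [x] = 0"
| "path (x # y # xs) = ed x y + path (y # xs)"

fun arcs_of :: "'a list \<Rightarrow> ('a \<times> 'a) list" where
  "arcs_of [] = []"
| "arcs_of [x] = []"
| "arcs_of (x # y # xs) = (x, y) # arcs_of (y # xs)"

lemma cls_arcs_of: "cls (arcs_of xs) = path xs"
  by (induction xs rule: path.induct) (auto simp: cls_Cons[of _ "arcs_of _"] ed_def)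

lemma path_append:
  "xs \<noteq> [] \<Longrightarrow> ys \<noteq> [] \<Longrightarrow> path (xs @ ys) = path xs + ed (last xs) (hd ys) + path ys"
proof (induction xs rule: path.induct)
  case (2 x)
  then show ?case by (cases ys) auto
qed (auto simp: add.assoc)

lemma path_snoc: "xs \<noteq> [] \<Longrightarrow> path (xs @ [y]) = path xs + ed (last xs) y"
  by (simp add: path_append)

lemma path_rev: "path (rev xs) = - path xs"
proof (induction xs rule: path.induct)
  case (3 x y xs)
  have "path (rev (x # y # xs)) = path (rev (y # xs) @ [x])" by simp
  also have "\<dots> = path (rev (y # xs)) + ed y x" by (subst path_snoc) simp_all
  finally show ?case using 3 by (simp add: minus_add)
qed auto

lemma path_const: "set xs \<subseteq> {a} \<Longrightarrow> path xs = 0"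
  by (induction xs rule: path.induct) auto

lemma map_walk_arcs_of: "map_walk f (arcs_of xs) = arcs_of (map f xs)"
  by (induction xs rule: arcs_of.induct) (auto simp: map_walk_def)

lemma length_arcs_of[simp]: "length (arcs_of xs) = length xs - 1"
  by (induction xs rule: arcs_of.induct) auto

lemma arcs_of_nth: "Suc i < length xs \<Longrightarrow> arcs_of xs ! i = (xs ! i, xs ! Suc i)"
proof (induction xs arbitrary: i rule: arcs_of.induct)
  case (3 x y xs)
  then show ?case by (cases i) auto
qed auto

lemma arcs_of_conv_map: "arcs_of xs = map (\<lambda>i. (xs ! i, xs ! Suc i)) [0..<length xs - 1]"
  by (rule nth_equalityI) (auto simp: arcs_of_nth)

lemma is_walk_Nil[simp]: "is_walk G u [] v \<longleftrightarrow> u = v \<and> u \<in> pverts G"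
  by (auto simp: pre_digraph.awalk_def pre_digraph.cas.simps)

locale refl_graph = pair_pseudo_graph G for G :: "'a pair_pre_digraph" +
  assumes loops: "v \<in> pverts G \<Longrightarrow> (v, v) \<in> parcs G"
begin

lemma walk_Cons[simp]:
  "is_walk G u (e # W) v \<longleftrightarrow> fst e = u \<and> e \<in> parcs G \<and> is_walk G (snd e) W v"
  using awalk_Cons_iff[of u e W v] by auto

lemma walk_append:
  "is_walk G u (X @ Y) v \<longleftrightarrow> (\<exists>w. is_walk G u X w \<and> is_walk G w Y v)"
  by (induction X arbitrary: u) (auto simp: awalk_hd_in_verts)

lemma walk_rev: "is_walk G u W v \<Longrightarrow> is_walk G v (rev_path W) u"
  by simp

lemma walk_cancel_cons:
  "e \<in> parcs G \<Longrightarrow> is_walk G (snd e) W v \<Longrightarrow> is_walk G (fst e) (cancel_cons e W) v"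
  by (auto simp: cancel_cons_def split: list.split)

lemma walk_red: "is_walk G u W v \<Longrightarrow> is_walk G u (red W) v"
proof (induction W arbitrary: u)
  case (Cons e W)
  then have "is_walk G u (cancel_cons e (red W)) v"
    using walk_cancel_cons[of e "red W" v] by auto
  then show ?case by (simp add: red_def)
qed (simp add: red_def)

definition pwalk :: "'a \<Rightarrow> 'a fg \<Rightarrow> 'a \<Rightarrow> bool" where
  "pwalk u p v \<longleftrightarrow> is_walk G u (rep p) v"

lemma pwalk_cls: "is_walk G u W v \<Longrightarrow> pwalk u (cls W) v"
  by (simp add: pwalk_def rep_cls walk_red)

lemma pwalk_zero[simp]: "pwalk u 0 v \<longleftrightarrow> u = v \<and> u \<in> pverts G"
  by (simp add: pwalk_def)

lemma pwalk_add: "pwalk u p w \<Longrightarrow> pwalk w r v \<Longrightarrow> pwalk u (p + r) v"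
  unfolding plus_fg_def by (rule pwalk_cls) (auto simp: pwalk_def walk_append)

lemma pwalk_uminus: "pwalk u p v \<Longrightarrow> pwalk v (- p) u"
  by (simp add: pwalk_def rep_uminus)

lemma pwalk_ed: "(u, v) \<in> parcs G \<Longrightarrow> pwalk u (ed u v) v"
  unfolding ed_def by (rule pwalk_cls) (auto simp: wellformed')

definition vwalk :: "'a list \<Rightarrow> bool" where
  "vwalk xs \<longleftrightarrow> xs \<noteq> [] \<and> set xs \<subseteq> pverts G \<and> successively (\<lambda>u v. (u, v) \<in> parcs G) xs"

lemma vwalk_walk: "vwalk xs \<Longrightarrow> is_walk G (hd xs) (arcs_of xs) (last xs)"
  unfolding vwalk_def by (induction xs rule: arcs_of.induct) auto

lemma vwalk_append:
  "vwalk xs \<Longrightarrow> vwalk ys \<Longrightarrow> (last xs, hd ys) \<in> parcs G \<Longrightarrow> vwalk (xs @ ys)"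
  by (auto simp: vwalk_def successively_append_iff)

lemma vwalk_rev:
  assumes xs: "vwalk xs"
  shows "vwalk (rev xs)"
proof -
  have "successively (\<lambda>x y. (y, x) \<in> parcs G) xs"
    by (rule successively_mono[of "\<lambda>u v. (u, v) \<in> parcs G"]) (use xs arcs_symmetric in \<open>auto simp: vwalk_def\<close>)
  then show ?thesis using xs by (simp add: vwalk_def)
qed

lemma vwalk_pwalk: "vwalk xs \<Longrightarrow> pwalk (hd xs) (path xs) (last xs)"
  using pwalk_cls[OF vwalk_walk] by (simp add: cls_arcs_of)

lemma pi_class_eq_iff:
  assumes "X \<in> walks G" "Y \<in> walks G"
  shows "pi_class G X = pi_class G Y \<longleftrightarrow> cls X = cls Y"
proof
  assume "pi_class G X = pi_class G Y"
  moreover have "X \<in> pi_class G X" using assms by (simp add: pi_class_def same_reduction_iff)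
  ultimately show "cls X = cls Y" by (simp add: pi_class_def same_reduction_iff cls_eq_iff)
next
  assume "cls X = cls Y"
  then show "pi_class G X = pi_class G Y" using assms by (auto simp: pi_class_def same_reduction_iff cls_eq_iff)
qed

end

lemma refl_graph_iff: "reflexive_graph G \<longleftrightarrow> refl_graph G"
  by (auto simp: reflexive_graph_def refl_graph_def refl_graph_axioms_def)

section \<open>Recoloring sequences and blocking vertices\<close>

lemma rep_ed_Cons: "is_red ((a, b) # T) \<Longrightarrow> mk ((a, b) # T) = ed a b + mk T"
proof -
  assume r: "is_red ((a, b) # T)"
  then have "is_red T" by (simp add: is_red_Cons)
  then have "rep (ed a b + mk T) = (a, b) # T"
    using cancel_cons_is_red[OF r] by (simp add: rep_ed_add)
  then show ?thesis by (metis mk_rep)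
qed

locale hom_graphs = G: refl_graph G + H: refl_graph H
  for G :: "'a pair_pre_digraph" and H :: "'b pair_pre_digraph"
begin

text \<open>The conjugation relation between the walks of two vertices, stated for single arcs of
  \<open>G\<close>; \<open>compat_vwalk\<close> extends it to walks.\<close>

definition compat :: "('a \<Rightarrow> 'b) \<Rightarrow> ('a \<Rightarrow> 'b) \<Rightarrow> ('a \<Rightarrow> 'b fg) \<Rightarrow> bool" where
  "compat \<alpha> \<beta> S \<longleftrightarrow>
     (\<forall>(u, v) \<in> parcs G. S u = ed (\<alpha> u) (\<alpha> v) + S v + ed (\<beta> v) (\<beta> u))"

text \<open>The next color of \<open>v\<close> is the second vertex of its walk. By push-or-pull,
  \<open>v\<close> has to wait as long as a neighbor \<open>u\<close> has a third color.\<close>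

definition blocking :: "('a \<Rightarrow> 'b) \<Rightarrow> ('a \<Rightarrow> 'b fg) \<Rightarrow> ('a \<times> 'a) set" where
  "blocking \<alpha> S = {(v, u) \<in> parcs G. S v \<noteq> 0 \<and> \<alpha> u \<noteq> \<alpha> v \<and> \<alpha> u \<noteq> snd (hd (rep (S v)))}"

definition pwalks :: "('a \<Rightarrow> 'b) \<Rightarrow> ('a \<Rightarrow> 'b) \<Rightarrow> ('a \<Rightarrow> 'b fg) \<Rightarrow> bool" where
  "pwalks \<alpha> \<beta> S \<longleftrightarrow> (\<forall>v \<in> pverts G. H.pwalk (\<alpha> v) (S v) (\<beta> v))"

lemma homs_arc: "\<alpha> \<in> homs G H \<Longrightarrow> (u, v) \<in> parcs G \<Longrightarrow> (\<alpha> u, \<alpha> v) \<in> parcs H"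
  by (auto simp: homs_def)

lemma homs_vert: "\<alpha> \<in> homs G H \<Longrightarrow> u \<in> pverts G \<Longrightarrow> \<alpha> u \<in> pverts H"
  by (auto simp: homs_def)

lemma homs_eqI: "\<alpha> \<in> homs G H \<Longrightarrow> \<beta> \<in> homs G H \<Longrightarrow> (\<And>v. v \<in> pverts G \<Longrightarrow> \<alpha> v = \<beta> v) \<Longrightarrow> \<alpha> = \<beta>"
  unfolding homs_def by (auto intro: PiE_ext)

lemma pwalk_hd:
  assumes "H.pwalk a p b" "p \<noteq> 0"
  shows "rep p = (a, snd (hd (rep p))) # tl (rep p)" "(a, snd (hd (rep p))) \<in> parcs H"
  using assms by (cases "rep p"; auto simp: H.pwalk_def)+

text \<open>
  A blocker of \<open>v\<close> has to move to the color of \<open>v\<close> before \<open>v\<close> can move.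
\<close>
lemma blocking_next:
  assumes c: "compat \<alpha> \<beta> S" and w: "pwalks \<alpha> \<beta> S" and b: "(v, u) \<in> blocking \<alpha> S"
  shows "S u \<noteq> 0" "fst (hd (rep (S u))) = \<alpha> u" "snd (hd (rep (S u))) = \<alpha> v"
proof -
  from b have e: "(v, u) \<in> parcs G" and n: "S v \<noteq> 0" "\<alpha> u \<noteq> \<alpha> v" "\<alpha> u \<noteq> snd (hd (rep (S v)))"
    by (auto simp: blocking_def)
  have "(u, v) \<in> parcs G" using e by (rule G.arcs_symmetric)
  then have Su: "S u = ed (\<alpha> u) (\<alpha> v) + S v + ed (\<beta> v) (\<beta> u)" using c by (auto simp: compat_def)
  obtain T where T: "rep (S v) = (\<alpha> v, snd (hd (rep (S v)))) # T"
    using pwalk_hd(1) w n(1) e unfolding pwalks_def by (metis G.in_arcsD1)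
  \<comment> \<open>Nothing cancels: \<open>S v\<close> starts at \<open>\<alpha> v\<close> and,
    since \<open>u\<close> blocks, does not continue to \<open>\<alpha> u\<close>.\<close>
  have *: "rep (ed (\<alpha> u) (\<alpha> v) + S v) = (\<alpha> u, \<alpha> v) # rep (S v)"
    unfolding rep_ed_add using n(2,3) arg_cong[OF T, of "case_list [] (\<lambda>y _. [y])"]
    by (cases "rep (S v)") (auto simp: cancel_cons_def)
  obtain x y W where xy: "rep (ed (\<alpha> u) (\<alpha> v) + S v) = x # y # W"
    using * T by auto
  obtain l c r where d: "rep (ed (\<alpha> u) (\<alpha> v) + S v) = l @ c" "rep (ed (\<beta> v) (\<beta> u)) = rev_path c @ r"
    "rep (S u) = l @ r"
    using rep_add_cancel[of "ed (\<alpha> u) (\<alpha> v) + S v" "ed (\<beta> v) (\<beta> u)"] Su by metis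
  \<comment> \<open>The last factor is at most one arc, so it cannot cancel the first of at least
    two arcs.\<close>
  have "length (rep (ed (\<beta> v) (\<beta> u))) \<le> 1" by (cases "\<beta> v = \<beta> u") (auto simp: rep_ed)
  then have "length c \<le> 1" using arg_cong[OF d(2), of length] by simp
  then have "l \<noteq> []" using d(1) xy by auto
  then have "hd (rep (S u)) = (\<alpha> u, \<alpha> v)" "rep (S u) \<noteq> []" using d(1,3) * by (cases l; auto)+
  then show "S u \<noteq> 0" "fst (hd (rep (S u))) = \<alpha> u" "snd (hd (rep (S u))) = \<alpha> v" by auto
qed

text \<open>Cycles are replaced by sets in which every vertex has a successor and a predecessor,
  because such a set survives a move as a whole. The two together show that no vertex of the set can
  move.\<close>

definition bicore :: "('a \<times> 'a) set \<Rightarrow> 'a set \<Rightarrow> bool" where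
  "bicore B X \<longleftrightarrow> X \<noteq> {} \<and> (\<forall>x \<in> X. (\<exists>y \<in> X. (x, y) \<in> B) \<and> (\<exists>y \<in> X. (y, x) \<in> B))"

lemma finite_blocking: "finite (blocking \<alpha> S)"
  by (rule finite_subset[OF _ G.pair_finite_arcs]) (auto simp: blocking_def)

lemma cycle_bicore:
  assumes "(v, v) \<in> B\<^sup>+"
  shows "bicore B {x. (x, x) \<in> B\<^sup>+}"
  unfolding bicore_def
proof (intro conjI ballI)
  show "{x. (x, x) \<in> B\<^sup>+} \<noteq> {}" using assms by auto
  fix x assume "x \<in> {x. (x, x) \<in> B\<^sup>+}"
  then have x: "(x, x) \<in> B\<^sup>+" by simp
  from tranclD[OF x] obtain y where y: "(x, y) \<in> B" "(y, x) \<in> B\<^sup>*" by blast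
  then have "(y, y) \<in> B\<^sup>+" by (rule rtrancl_into_trancl1[rotated])
  then show "\<exists>y \<in> {x. (x, x) \<in> B\<^sup>+}. (x, y) \<in> B" using y by auto
  from tranclD2[OF x] obtain z where z: "(x, z) \<in> B\<^sup>*" "(z, x) \<in> B" by blast
  then have "(z, z) \<in> B\<^sup>+" by (rule rtrancl_into_trancl2[rotated])
  then show "\<exists>y \<in> {x. (x, x) \<in> B\<^sup>+}. (y, x) \<in> B" using z by auto
qed

lemma not_acyclicI:
  assumes "finite B" "X \<noteq> {}" "\<And>x. x \<in> X \<Longrightarrow> \<exists>y \<in> X. (x, y) \<in> B"
  shows "\<not> acyclic B"
proof
  assume "acyclic B"
  then have "wf (B\<inverse>)" using assms(1) by (rule finite_acyclic_wf_converse[rotated])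
  then obtain z where "z \<in> X" "\<And>y. (y, z) \<in> B\<inverse> \<Longrightarrow> y \<notin> X"
    using assms(2) by (metis wfE_min all_not_in_conv)
  then show False using assms(3) by blast
qed

lemma acyclic_blocking_iff: "acyclic (blocking \<alpha> S) \<longleftrightarrow> (\<nexists>X. bicore (blocking \<alpha> S) X)"
proof
  assume "acyclic (blocking \<alpha> S)"
  then show "\<nexists>X. bicore (blocking \<alpha> S) X"
    using not_acyclicI[OF finite_blocking] unfolding bicore_def by meson
next
  assume "\<nexists>X. bicore (blocking \<alpha> S) X"
  then show "acyclic (blocking \<alpha> S)" using cycle_bicore unfolding acyclic_def by blast
qed

text \<open>
  In a cycle of blocking arcs, the two neighbors of a vertex have different colors, both
  different from its own, so the vertex cannot be recolored.
\<close>
lemma bicore_move: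
  assumes c: "compat \<alpha> \<beta> S" and w: "pwalks \<alpha> \<beta> S"
    and X: "bicore (blocking \<alpha> S) X"
    and nb: "\<And>v. (x, v) \<in> parcs G \<Longrightarrow> \<alpha> v \<in> {\<alpha> x, b}"
    and \<alpha>': "\<And>v. v \<in> pverts G \<Longrightarrow> v \<noteq> x \<Longrightarrow> \<alpha>' v = \<alpha> v"
    and S': "\<And>v. v \<in> pverts G \<Longrightarrow> v \<noteq> x \<Longrightarrow> S' v = S v"
  shows "bicore (blocking \<alpha>' S') X"
proof -
  have "x \<notin> X"
  proof
    assume "x \<in> X"
    then obtain u p where u: "(x, u) \<in> blocking \<alpha> S" and p: "(p, x) \<in> blocking \<alpha> S"
      using X unfolding bicore_def by blast
    have "(x, p) \<in> parcs G" "\<alpha> p \<noteq> \<alpha> x" using p G.arcs_symmetric by (auto simp: blocking_def)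
    then have "\<alpha> p = b" using nb by blast
    moreover have "snd (hd (rep (S x))) = \<alpha> p" using blocking_next[OF c w p] by simp
    ultimately show False using u nb[of u] by (auto simp: blocking_def)
  qed
  have "(u, v) \<in> blocking \<alpha>' S'" if "(u, v) \<in> blocking \<alpha> S" "u \<in> X" "v \<in> X" for u v
  proof -
    have "u \<noteq> x" "v \<noteq> x" using that \<open>x \<notin> X\<close> by auto
    then show ?thesis
      using that(1) \<alpha>'[of u] \<alpha>'[of v] S'[of u] G.in_arcsD1[of u v] G.in_arcsD2[of u v]
      by (auto simp: blocking_def)
  qed
  then show ?thesis using X unfolding bicore_def by blast
qed

text \<open>The neighbors of \<open>x\<close> have color \<open>\<alpha> x\<close> or
  \<open>b\<close>, so in \<open>ed b (\<alpha> x) + ed (\<alpha> x) (\<alpha> v) = ed b (\<alpha>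
  v)\<close> either the second arc is trivial or the two arcs cancel. Hence the change of
  \<open>S x\<close> is absorbed in every equation at \<open>x\<close>.\<close>

lemma compat_move:
  assumes c: "compat \<alpha> \<beta> S"
    and x: "x \<in> pverts G"
    and nb: "\<And>v. (x, v) \<in> parcs G \<Longrightarrow> \<alpha> v \<in> {\<alpha> x, b}"
    and \<alpha>': "\<And>v. v \<in> pverts G \<Longrightarrow> \<alpha>' v = (if v = x then b else \<alpha> v)"
    and S': "\<And>v. v \<in> pverts G \<Longrightarrow> S' v = (if v = x then ed b (\<alpha> x) + S x else S v)"
  shows "compat \<alpha>' \<beta> S'"
  unfolding compat_def
proof clarify
  fix u v assume uv: "(u, v) \<in> parcs G"
  then have in_V: "u \<in> pverts G" "v \<in> pverts G" using G.wellformed' by auto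
  have Su: "S u = ed (\<alpha> u) (\<alpha> v) + S v + ed (\<beta> v) (\<beta> u)" using c uv by (auto simp: compat_def)
  have 1: "ed b (\<alpha> x) + ed (\<alpha> x) (\<alpha> v) = ed b (\<alpha> v)" if "u = x"
    using nb[of v] uv that by auto
  have 2: "ed (\<alpha> u) (\<alpha> x) + ed (\<alpha> x) b = ed (\<alpha> u) b" if "v = x"
    using nb[of u] G.arcs_symmetric[OF uv] that by auto
  have "ed b (\<alpha> v) + S v + ed (\<beta> v) (\<beta> u) = ed b (\<alpha> u) + S u" if "u = x"
    using 1[OF that] that unfolding Su by (simp flip: add.assoc)
  moreover have "ed (\<alpha> u) b + (ed b (\<alpha> v) + S v) = ed (\<alpha> u) (\<alpha> v) + S v" if "v = x"
    unfolding 2[OF that, symmetric] using that by (simp add: add.assoc)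
  ultimately show "S' u = ed (\<alpha>' u) (\<alpha>' v) + S' v + ed (\<beta> v) (\<beta> u)"
    using Su in_V by (cases "u = x"; cases "v = x") (auto simp: \<alpha>' S' add.assoc)
qed

section \<open>Recoloring sequences and compatible families\<close>

lemma color_walk_single[simp]: "color_walk [\<sigma>] v = []"
  by (simp add: color_walk_def)

lemma color_walk_Cons: "color_walk (\<sigma> # \<tau> # S) v = (\<sigma> v, \<tau> v) # color_walk (\<tau> # S) v"
  by (simp add: color_walk_def)

lemma cls_color_walk_Cons:
  "cls (color_walk (\<sigma> # \<tau> # S) v) = ed (\<sigma> v) (\<tau> v) + cls (color_walk (\<tau> # S) v)"
  unfolding color_walk_Cons by (subst cls_Cons) (simp add: ed_def)

lemma recolor_seq_Cons:
  "recolor_seq G H \<alpha> \<beta> (\<sigma> # \<tau> # S) \<longleftrightarrow>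
     \<sigma> = \<alpha> \<and> \<alpha> \<in> homs G H \<and> recolor_step G H \<alpha> \<tau> \<and> recolor_seq G H \<tau> \<beta> (\<tau> # S)"
  by (auto simp: recolor_seq_def)

text \<open>Induction from the end of the sequence, where all walks are empty and nothing blocks. A
  cycle of blocking arcs before a step would survive the step by \<open>bicore_move\<close>,
  contrary to the induction hypothesis.\<close>

lemma recoloring_necessary:
  assumes "recolor_seq G H \<alpha> \<beta> T" "push_or_pull G T"
  shows "compat \<alpha> \<beta> (\<lambda>v. cls (color_walk T v)) \<and> pwalks \<alpha> \<beta> (\<lambda>v. cls (color_walk T v)) \<and>
         acyclic (blocking \<alpha> (\<lambda>v. cls (color_walk T v)))"
  using assms
proof (induction T arbitrary: \<alpha>)
  case Nil
  then show ?case by (simp add: recolor_seq_def)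
next
  case (Cons \<sigma> T)
  show ?case
  proof (cases T)
    case Nil
    then have "\<sigma> = \<alpha>" "\<beta> = \<alpha>" "\<alpha> \<in> homs G H" using Cons.prems by (auto simp: recolor_seq_def)
    then show ?thesis using Nil homs_vert
      by (auto simp: compat_def pwalks_def blocking_def acyclic_def)
  next
    case T: (Cons \<tau> U)
    have s: "\<sigma> = \<alpha>" "\<alpha> \<in> homs G H" "recolor_step G H \<alpha> \<tau>" "recolor_seq G H \<tau> \<beta> T"
      using Cons.prems(1) by (auto simp: T recolor_seq_Cons)
    have pp: "push_or_pull G T"
      and p: "\<And>u v. u \<in> pverts G \<Longrightarrow> \<alpha> u \<noteq> \<tau> u \<Longrightarrow> (u, v) \<in> parcs G \<Longrightarrow> \<alpha> v \<in> {\<alpha> u, \<tau> u}"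
      using Cons.prems(2) s(1) unfolding T push_or_pull_def by auto
    obtain x where x: "x \<in> pverts G" "\<alpha> x \<noteq> \<tau> x" "\<And>v. v \<in> pverts G \<Longrightarrow> v \<noteq> x \<Longrightarrow> \<alpha> v = \<tau> v"
      "(\<alpha> x, \<tau> x) \<in> parcs H" using s(3) by (auto simp: recolor_step_def)
    let ?S = "\<lambda>v. cls (color_walk (\<sigma> # T) v)" and ?S' = "\<lambda>v. cls (color_walk T v)"
    have S: "?S v = ed (\<alpha> v) (\<tau> v) + ?S' v" for v
      by (simp add: s(1) T cls_color_walk_Cons)
    note IH = Cons.IH[OF s(4) pp]
    have nb: "\<And>v. (x, v) \<in> parcs G \<Longrightarrow> \<alpha> v \<in> {\<alpha> x, \<tau> x}" using p x by blast
    have nb': "\<tau> v \<in> {\<tau> x, \<alpha> x}" if "(x, v) \<in> parcs G" for v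
      using nb[OF that] x(3)[of v] G.in_arcsD2[OF that] by (cases "v = x") auto
    \<comment> \<open>\<open>compat_move\<close> is applied to the reverse move, from
      \<open>\<tau>\<close> back to \<open>\<alpha>\<close>, which is push-or-pull as well.\<close>
    have "compat \<alpha> \<beta> ?S"
    proof (rule compat_move[of \<tau> \<beta> ?S' x "\<alpha> x"])
      show "?S v = (if v = x then ed (\<alpha> x) (\<tau> x) + ?S' x else ?S' v)" if "v \<in> pverts G" for v
        using x(3)[OF that] by (cases "v = x") (auto simp: S)
      show "\<alpha> v = (if v = x then \<alpha> x else \<tau> v)" if "v \<in> pverts G" for v
        using x(3)[OF that] by auto
    qed (use IH x nb' in auto)
    moreover have pw: "pwalks \<alpha> \<beta> ?S"
      unfolding pwalks_def
    proof
      fix v assume v: "v \<in> pverts G"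
      have e: "(\<alpha> v, \<tau> v) \<in> parcs H"
        using x(3)[OF v] x(4) homs_vert[OF s(2) v] H.loops by (cases "v = x") auto
      then show "H.pwalk (\<alpha> v) (?S v) (\<beta> v)"
        unfolding S using IH v by (intro H.pwalk_add[OF H.pwalk_ed[OF e]]) (auto simp: pwalks_def)
    qed
    moreover have "acyclic (blocking \<alpha> ?S)"
      unfolding acyclic_blocking_iff
    proof
      assume "\<exists>X. bicore (blocking \<alpha> ?S) X"
      then obtain X where X: "bicore (blocking \<alpha> ?S) X" ..
      have "bicore (blocking \<tau> ?S') X"
        by (rule bicore_move[OF calculation X nb]) (auto simp: S x(3))
      then show False using IH by (auto simp: acyclic_blocking_iff)
    qed
    ultimately show ?thesis by blast
  qed
qed

text \<open>Induction on the total length of the walks. If blocking is acyclic, some vertex that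
  still has to move is not blocked, and it can take the first step of its walk.\<close>

lemma recoloring_sufficient:
  assumes "\<alpha> \<in> homs G H" "\<beta> \<in> homs G H"
    and "compat \<alpha> \<beta> S" "pwalks \<alpha> \<beta> S" "acyclic (blocking \<alpha> S)"
  shows "\<exists>T. recolor_seq G H \<alpha> \<beta> T \<and> push_or_pull G T \<and> (\<forall>v \<in> pverts G. cls (color_walk T v) = S v)"
  using assms
proof (induction "\<Sum>v\<in>pverts G. len (S v)" arbitrary: \<alpha> S rule: less_induct)
  case less
  note \<alpha> = less.prems(1) and \<beta> = less.prems(2) and c = less.prems(3) and w = less.prems(4)
    and ac = less.prems(5)
  show ?case
  proof (cases "\<forall>v \<in> pverts G. S v = 0")
    case True
    then have "\<alpha> = \<beta>" using w \<alpha> \<beta> by (intro homs_eqI) (auto simp: pwalks_def)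
    then show ?thesis using True \<alpha>
      by (intro exI[of _ "[\<alpha>]"]) (auto simp: recolor_seq_def push_or_pull_def)
  next
    case False
    then have ne: "{v \<in> pverts G. S v \<noteq> 0} \<noteq> {}" by auto
    \<comment> \<open>By \<open>blocking_next\<close> a blocker has to move itself. If all moving
      vertices were blocked, each would have a blocker among them, which a finite acyclic relation
      excludes.\<close>
    have "\<exists>x \<in> {v \<in> pverts G. S v \<noteq> 0}. \<forall>u. (x, u) \<notin> blocking \<alpha> S"
    proof (rule ccontr)
      assume "\<not> ?thesis"
      then have nxt: "\<exists>u. (x, u) \<in> blocking \<alpha> S" if "x \<in> {v \<in> pverts G. S v \<noteq> 0}" for x
        using that by blast
      have "\<exists>y \<in> {v \<in> pverts G. S v \<noteq> 0}. (x, y) \<in> blocking \<alpha> S"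
        if x: "x \<in> {v \<in> pverts G. S v \<noteq> 0}" for x
      proof -
        obtain u where u: "(x, u) \<in> blocking \<alpha> S" using nxt[OF x] ..
        then have "u \<in> pverts G" by (auto simp: blocking_def intro: G.in_arcsD2)
        then show ?thesis using u blocking_next(1)[OF c w u] by blast
      qed
      then show False using not_acyclicI[OF finite_blocking ne] ac by blast
    qed
    then obtain x where x: "x \<in> pverts G" "S x \<noteq> 0" and unb: "\<And>u. (x, u) \<notin> blocking \<alpha> S" by auto
    define b where "b = snd (hd (rep (S x)))"
    define U where "U = tl (rep (S x))"
    have pwx: "H.pwalk (\<alpha> x) (S x) (\<beta> x)" using w x by (auto simp: pwalks_def)
    have repx: "rep (S x) = (\<alpha> x, b) # U" and ab: "(\<alpha> x, b) \<in> parcs H"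
      using pwalk_hd[OF pwx x(2)] unfolding b_def U_def by auto
    have redU: "is_red ((\<alpha> x, b) # U)" using repx by (metis is_red_rep)
    then have redU': "is_red U" and nab: "\<alpha> x \<noteq> b" by (auto simp: is_red_Cons)
    have Sx: "S x = ed (\<alpha> x) b + mk U" using rep_ed_Cons[OF redU] repx by (metis mk_rep)
    have nb: "\<alpha> v \<in> {\<alpha> x, b}" if "(x, v) \<in> parcs G" for v
      using unb[of v] that x(2) by (auto simp: blocking_def b_def)
    define \<alpha>' where "\<alpha>' = \<alpha>(x := b)"
    define S' where "S' = S(x := mk U)"
    have S'x: "mk U = ed b (\<alpha> x) + S x" by (simp add: Sx)
    have \<alpha>'H: "\<alpha>' \<in> homs G H"
    proof -
      have "b \<in> pverts H" using ab by (rule H.in_arcsD2)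
      then have "\<alpha>' \<in> pverts G \<rightarrow>\<^sub>E pverts H" using \<alpha> x by (auto simp: \<alpha>'_def homs_def PiE_def extensional_def)
      moreover have "(\<alpha>' u, \<alpha>' v) \<in> parcs H" if uv: "(u, v) \<in> parcs G" for u v
      proof -
        have bb: "(b, b) \<in> parcs H" "(b, \<alpha> x) \<in> parcs H"
          using ab H.arcs_symmetric H.loops H.in_arcsD2 by blast+
        show ?thesis
          using nb[of v] nb[of u] uv G.arcs_symmetric[OF uv] bb ab homs_arc[OF \<alpha> uv]
          by (cases "u = x"; cases "v = x") (auto simp: \<alpha>'_def)
      qed
      ultimately show ?thesis by (auto simp: homs_def)
    qed
    have c': "compat \<alpha>' \<beta> S'"
      by (rule compat_move[OF c x(1) nb]) (auto simp: \<alpha>'_def S'_def S'x)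
    have w': "pwalks \<alpha>' \<beta> S'"
      unfolding pwalks_def
    proof
      fix v assume v: "v \<in> pverts G"
      have "H.pwalk b (mk U) (\<beta> x)"
        unfolding S'x by (rule H.pwalk_add[OF H.pwalk_ed[OF H.arcs_symmetric[OF ab]] pwx])
      then show "H.pwalk (\<alpha>' v) (S' v) (\<beta> v)" using w v by (auto simp: pwalks_def \<alpha>'_def S'_def)
    qed
    \<comment> \<open>The reverse of the move is push-or-pull too, so a cycle after the move would
      have been there before it.\<close>
    have ac': "acyclic (blocking \<alpha>' S')"
      unfolding acyclic_blocking_iff
    proof
      assume "\<exists>X. bicore (blocking \<alpha>' S') X"
      then obtain X where X: "bicore (blocking \<alpha>' S') X" ..
      have nb': "\<alpha>' v \<in> {\<alpha>' x, \<alpha> x}" if "(x, v) \<in> parcs G" for v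
        using nb[OF that] by (auto simp: \<alpha>'_def)
      have "bicore (blocking \<alpha> S) X"
        by (rule bicore_move[OF c' w' X nb']) (auto simp: \<alpha>'_def S'_def)
      then show False using ac by (auto simp: acyclic_blocking_iff)
    qed
    have "len (S' x) < len (S x)" using repx redU' by (simp add: len_def S'_def)
    then have "(\<Sum>v\<in>pverts G. len (S' v)) < (\<Sum>v\<in>pverts G. len (S v))"
      using x(1) G.pair_finite_verts by (intro sum_strict_mono_ex1) (auto simp: S'_def)
    from less.hyps[OF this \<alpha>'H \<beta> c' w' ac'] obtain T where T: "recolor_seq G H \<alpha>' \<beta> T"
      "push_or_pull G T" "\<And>v. v \<in> pverts G \<Longrightarrow> cls (color_walk T v) = S' v" by blast
    obtain T' where T': "T = \<alpha>' # T'" using T(1) by (cases T) (auto simp: recolor_seq_def)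
    have "recolor_step G H \<alpha> \<alpha>'"
      unfolding recolor_step_def using x nab ab by (intro bexI[of _ x]) (auto simp: \<alpha>'_def)
    then have "recolor_seq G H \<alpha> \<beta> (\<alpha> # T)" using T(1) \<alpha> by (simp add: T' recolor_seq_Cons)
    moreover have "push_or_pull G (\<alpha> # T)"
      using T(2) nb by (auto simp: T' push_or_pull_def \<alpha>'_def)
    moreover have "cls (color_walk (\<alpha> # T) v) = S v" if "v \<in> pverts G" for v
    proof -
      have "cls (color_walk (\<alpha> # T) v) = ed (\<alpha> v) (\<alpha>' v) + S' v"
        using T(3)[OF that] by (simp add: T' cls_color_walk_Cons)
      then show ?thesis by (auto simp: \<alpha>'_def S'_def Sx)
    qed
    ultimately show ?thesis by blast
  qed
qed

text \<open>
  The vertices on a cycle of blocking arcs lie on a tight closed walk, whose vertices are frozen.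
\<close>
lemma cycle_frozen:
  assumes c: "compat \<alpha> \<beta> S" and w: "pwalks \<alpha> \<beta> S" and cyc: "(v, v) \<in> (blocking \<alpha> S)\<^sup>+"
    and c': "compat \<alpha> \<beta> S'" and w': "pwalks \<alpha> \<beta> S'" and ac: "acyclic (blocking \<alpha> S')"
  shows "S' v = 0"
proof (rule ccontr)
  assume nz: "S' v \<noteq> 0"
  define X where "X = {x. (x, x) \<in> (blocking \<alpha> S)\<^sup>+}"
  have X: "bicore (blocking \<alpha> S) X" unfolding X_def using cycle_bicore[OF cyc] .
  define Z where "Z = blocking \<alpha> S \<inter> X \<times> X"
  \<comment> \<open>As a blocker of \<open>x\<close>, the vertex \<open>y\<close> moves to the color
    of \<open>x\<close> next, and \<open>u\<close> does not have this color because it blocks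
    \<open>y\<close>. So the images of blocking chains never turn back.\<close>
  have turn: "\<alpha> x \<noteq> \<alpha> u" if "(x, y) \<in> Z" "(y, u) \<in> Z" for x y u
  proof -
    have "(x, y) \<in> blocking \<alpha> S" "(y, u) \<in> blocking \<alpha> S" using that by (auto simp: Z_def)
    then show ?thesis using blocking_next(3)[OF c w, of x y] by (auto simp: blocking_def)
  qed
  have Zarc: "(x, y) \<in> parcs G" "\<alpha> x \<noteq> \<alpha> y" if "(x, y) \<in> Z" for x y
    using that by (auto simp: Z_def blocking_def)
  have Zsucc: "\<exists>u. (x, u) \<in> Z" and Zpred: "\<exists>p. (p, x) \<in> Z" if "x \<in> X" for x
    using X that by (auto simp: bicore_def Z_def)
  have ZX: "x \<in> X" "y \<in> X" if "(x, y) \<in> Z" for x y using that by (auto simp: Z_def)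
  have "v \<in> X" using cyc by (simp add: X_def)
  then obtain u p where u: "(v, u) \<in> Z" and p: "(p, v) \<in> Z" using Zsucc Zpred by blast
  have blk: "(y, z) \<in> blocking \<alpha> S'"
    if "(y, z) \<in> parcs G" "\<alpha> z \<noteq> \<alpha> y" "\<alpha> z \<noteq> \<alpha> x" "(x, y) \<in> blocking \<alpha> S'" for x y z
    using blocking_next[OF c' w' that(4)] that by (auto simp: blocking_def)
  show False
  \<comment> \<open>Since \<open>u\<close> and \<open>p\<close> have different colors, the first
    move of \<open>v\<close> under \<open>S'\<close> misses one of them, and this neighbor blocks
    \<open>v\<close>. By \<open>blk\<close> the blocking then propagates along \<open>Z\<close>,
    forward in the case of \<open>u\<close> and backward in that of \<open>p\<close>.\<close>
  proof (cases "\<alpha> u = snd (hd (rep (S' v)))")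
    case False
    define Y where "Y = {y. \<exists>x. (x, y) \<in> Z \<and> (x, y) \<in> blocking \<alpha> S'}"
    have "(v, u) \<in> blocking \<alpha> S'" using False u nz Zarc[OF u] by (auto simp: blocking_def)
    then have "Y \<noteq> {}" using u by (auto simp: Y_def)
    moreover have "\<exists>z \<in> Y. (y, z) \<in> blocking \<alpha> S'" if y: "y \<in> Y" for y
    proof -
      obtain x where x: "(x, y) \<in> Z" "(x, y) \<in> blocking \<alpha> S'" using y unfolding Y_def by blast
      obtain z where z: "(y, z) \<in> Z" using Zsucc ZX x by blast
      have "(y, z) \<in> blocking \<alpha> S'" using blk[OF Zarc(1)[OF z] _ _ x(2)] Zarc(2)[OF z] turn[OF x(1) z] by auto
      then show ?thesis using z by (auto simp: Y_def)
    qed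
    ultimately show False using not_acyclicI[OF finite_blocking] ac by blast
  next
    case True
    define Y where "Y = {y. \<exists>x. (y, x) \<in> Z \<and> (x, y) \<in> blocking \<alpha> S'}"
    have "(v, p) \<in> blocking \<alpha> S'"
      using True turn[OF p u] nz Zarc[OF p] G.arcs_symmetric by (auto simp: blocking_def)
    then have "Y \<noteq> {}" using p by (auto simp: Y_def)
    moreover have "\<exists>z \<in> Y. (y, z) \<in> blocking \<alpha> S'" if y: "y \<in> Y" for y
    proof -
      obtain x where x: "(y, x) \<in> Z" "(x, y) \<in> blocking \<alpha> S'" using y unfolding Y_def by blast
      obtain z where z: "(z, y) \<in> Z" using Zpred ZX x by blast
      have "(y, z) \<in> blocking \<alpha> S'"
        using blk[OF G.arcs_symmetric[OF Zarc(1)[OF z]] _ _ x(2)] Zarc(2)[OF z] turn[OF z x(1)] by auto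
      then show ?thesis using z by (auto simp: Y_def)
    qed
    ultimately show False using not_acyclicI[OF finite_blocking] ac by blast
  qed
qed

end

section \<open>Axes of translations\<close>

fun ntimes :: "nat \<Rightarrow> 'a fg \<Rightarrow> 'a fg" where
  "ntimes 0 x = 0"
| "ntimes (Suc n) x = x + ntimes n x"

definition ztimes :: "int \<Rightarrow> 'a fg \<Rightarrow> 'a fg" where
  "ztimes n x = (if n \<ge> 0 then ntimes (nat n) x else ntimes (nat (- n)) (- x))"

lemma ztimes_0[simp]: "ztimes 0 x = 0"
  by (simp add: ztimes_def)

lemma ztimes_1[simp]: "ztimes 1 x = x"
  by (simp add: ztimes_def)

lemma ztimes_Suc: "ztimes (n + 1) x = x + ztimes n x"
proof (cases "n \<ge> 0")
  case True
  then have "nat (n + 1) = Suc (nat n)" by simp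
  then show ?thesis using True by (simp add: ztimes_def)
next
  case False
  then have "nat (- n) = Suc (nat (- (n + 1)))" by simp
  then show ?thesis using False by (auto simp: ztimes_def simp flip: add.assoc)
qed

lemma ztimes_pred: "ztimes (n - 1) x = - x + ztimes n x"
  using ztimes_Suc[of "n - 1" x] by (simp flip: add.assoc)

lemma ztimes_minus: "ztimes (- n) x + ztimes n x = 0"
proof -
  \<comment> \<open>The induction carries along that \<open>x\<close> commutes with its multiples,
    because the recursion adds \<open>x\<close> on the left only.\<close>
  have "ztimes (- int n) x + ztimes (int n) x = 0 \<and> ztimes (int n) x + ztimes (- int n) x = 0 \<and>
      x + ztimes (int n) x = ztimes (int n) x + x" for n
  proof (induction n)
    case (Suc n)
    have 1: "ztimes (int (Suc n)) x = x + ztimes (int n) x" using ztimes_Suc[of "int n" x] by (simp add: add.commute)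
    have "- int (Suc n) = - int n - 1" by simp
    then have 2: "ztimes (- int (Suc n)) x = - x + ztimes (- int n) x" using ztimes_pred[of "- int n" x] by presburger
    have 3: "ztimes (int (Suc n)) x = ztimes (int n) x + x" using Suc 1 by simp
    have 4: "ztimes (int (Suc n)) x + ztimes (- int (Suc n)) x = 0"
    proof -
      have "ztimes (int (Suc n)) x + ztimes (- int (Suc n)) x = ztimes (int n) x + ztimes (- int n) x"
        unfolding 2 3 by (simp add: add.assoc del: add_uminus_conv_diff)
      then show ?thesis using Suc by presburger
    qed
    then have "ztimes (- int (Suc n)) x = - ztimes (int (Suc n)) x"
      by (rule minus_unique[symmetric])
    then have 5: "ztimes (- int (Suc n)) x + ztimes (int (Suc n)) x = 0" by simp
    have 6: "x + ztimes (int (Suc n)) x = ztimes (int (Suc n)) x + x"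
      using 1 3 by (metis add.assoc)
    show ?case using 4 5 6 by blast
  qed simp
  from this[of "nat \<bar>n\<bar>"] show ?thesis by (cases "n \<ge> 0") auto
qed

text \<open>
  The elements of the group are the vertices of a tree, with distance \<open>len (- p + r)\<close>, on which the
  group acts from the left. A line is a two-way infinite geodesic of this tree.
\<close>
definition line :: "(int \<Rightarrow> 'a fg) \<Rightarrow> bool" where
  "line \<gamma> \<longleftrightarrow> (\<forall>i j. len (- \<gamma> i + \<gamma> j) = nat \<bar>j - i\<bar>)"

definition axis :: "(int \<Rightarrow> 'a fg) \<Rightarrow> 'a fg \<Rightarrow> int \<Rightarrow> bool" where
  "axis \<gamma> x d \<longleftrightarrow> line \<gamma> \<and> d > 0 \<and> (\<forall>k. x + \<gamma> k = \<gamma> (k + d))"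

lemma line_inj: "line \<gamma> \<Longrightarrow> \<gamma> i = \<gamma> j \<longleftrightarrow> i = j"
proof
  assume "line \<gamma>" "\<gamma> i = \<gamma> j"
  then have "nat \<bar>j - i\<bar> = 0" unfolding line_def by (metis add.left_inverse len_zero)
  then show "i = j" by simp
qed simp

lemma diff_translate: "- (h + p) + (h + r) = - p + (r :: 'a fg)"
  by (simp add: minus_add add.assoc del: add_uminus_conv_diff)

lemma line_translate: "line \<gamma> \<Longrightarrow> line (\<lambda>k. h + \<gamma> k)"
  by (simp add: line_def diff_translate)

text \<open>
  Two geodesics agree outside of neighborhoods of their ends: all but the first \<open>u\<close> and last \<open>v\<close>
  points of the first one lie on the second, if \<open>u\<close> and \<open>v\<close> are the distances of the starting points
  and of the endpoints.
\<close>
lemma line_overlap: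
  assumes \<gamma>: "line \<gamma>" and \<eta>: "line \<eta>" and ab: "a \<le> a'" "b \<le> b'"
  shows "\<exists>t. \<forall>k. a + len (- \<eta> b + \<gamma> a) \<le> k \<longrightarrow> k + len (- \<eta> b' + \<gamma> a') \<le> a' \<longrightarrow> \<gamma> k = \<eta> (k + t)"
proof -
  \<comment> \<open>Along a line, the words of initial segments are prefixes of the word of the
    whole segment.\<close>
  have pre: "rep (- \<xi> a + \<xi> k) = take (nat (k - a)) (rep (- \<xi> a + \<xi> a'))"
    if "line \<xi>" "a \<le> k" "k \<le> a'" for \<xi> :: "int \<Rightarrow> 'a fg" and a k a' :: int
  proof -
    have *: "- \<xi> a + \<xi> a' = (- \<xi> a + \<xi> k) + (- \<xi> k + \<xi> a')" by (simp add: add.assoc)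
    have "len (- \<xi> a + \<xi> a') = len (- \<xi> a + \<xi> k) + len (- \<xi> k + \<xi> a')"
      using that unfolding line_def by simp
    then have "rep (- \<xi> a + \<xi> a') = rep (- \<xi> a + \<xi> k) @ rep (- \<xi> k + \<xi> a')"
      unfolding * by (rule rep_add)
    moreover have "length (rep (- \<xi> a + \<xi> k)) = nat (k - a)"
      using that unfolding line_def len_def by simp
    ultimately show ?thesis by simp
  qed
  define u where "u = - \<eta> b + \<gamma> a"
  define v where "v = - \<eta> b' + \<gamma> a'"
  define X where "X = rep (- \<gamma> a + \<gamma> a')"
  define Y where "Y = rep (- \<eta> b + \<eta> b')"
  have lX: "length X = nat (a' - a)" using \<gamma> ab by (simp add: X_def line_def flip: len_def)
  \<comment> \<open>Two routes from \<open>\<eta> b\<close> to \<open>\<gamma> a'\<close>, over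
    \<open>\<gamma> a\<close> and over \<open>\<eta> b'\<close>. Their common reduced word is split
    in two ways.\<close>
  have eq: "u + (- \<gamma> a + \<gamma> a') = (- \<eta> b + \<eta> b') + v"
    by (simp add: u_def v_def add.assoc)
  obtain u1 c X' where d1: "rep u = u1 @ c" "X = rev_path c @ X'" "rep (u + (- \<gamma> a + \<gamma> a')) = u1 @ X'"
    unfolding X_def by (rule rep_add_cancel)
  obtain Y' c' v2 where d2: "Y = Y' @ c'" "rep v = rev_path c' @ v2" "rep ((- \<eta> b + \<eta> b') + v) = Y' @ v2"
    unfolding Y_def by (rule rep_add_cancel)
  have eq': "u1 @ X' = Y' @ v2" using d1(3) d2(3) eq by simp
  have lu: "len u = length u1 + length c" using d1(1) by (simp add: len_def)
  have lv: "len v = length c' + length v2" using d2(2) by (simp add: len_def)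
  \<comment> \<open>On the first route, \<open>\<gamma> k\<close> comes after \<open>u1\<close> and
    the \<open>k - a - length c\<close> arcs of the segment that are not cancelled. This is its
    position on \<open>\<eta>\<close>, counted from \<open>b\<close>.\<close>
  define t where "t = b - a + int (length u1) - int (length c)"
  have "\<gamma> k = \<eta> (k + t)" if k: "a + len u \<le> k" "k + len v \<le> a'" for k
  proof -
    define i where "i = nat (k - a)"
    have ki: "k = a + int i" and il: "len u \<le> i" "i + len v \<le> length X"
      using k lX by (auto simp: i_def)
    have XY: "length u1 + length X' = length Y' + length v2" using arg_cong[OF eq', of length] by simp
    have jY: "length u1 + (i - length c) \<le> length Y'" using il lu lv XY d1(2) by simp
    have tk: "take i X = rev_path c @ take (i - length c) X'" using d1(2) il lu by simp
    have rk: "rep (- \<gamma> a + \<gamma> k) = take i X"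
      using pre[OF \<gamma>, of a k a'] il lu k ki by (simp add: X_def)
    have g: "- \<gamma> a + \<gamma> k = cls (rev_path c @ take (i - length c) X')"
      unfolding tk[symmetric] rk[symmetric] by simp
    have "rep (u + (- \<gamma> a + \<gamma> k)) = u1 @ take (i - length c) X'"
    proof -
      have "u + (- \<gamma> a + \<gamma> k) = cls ((u1 @ c) @ (rev_path c @ take (i - length c) X'))"
        unfolding g cls_append[of "u1 @ c"] by (simp flip: d1(1))
      also have "\<dots> = cls (u1 @ take (i - length c) X')"
        by (simp add: cls_append cls_rev_path add.assoc)
      finally have "u + (- \<gamma> a + \<gamma> k) = cls (u1 @ take (i - length c) X')" .
      moreover have "is_red (u1 @ take (i - length c) X')"
      proof -
        have "is_red (u1 @ X')" using d1(3) by (metis is_red_rep)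
        then have "is_red ((u1 @ take (i - length c) X') @ drop (i - length c) X')" by simp
        then show ?thesis using is_red_append by blast
      qed
      ultimately show ?thesis by (simp add: rep_cls_is_red)
    qed
    also have "u1 @ take (i - length c) X' = take (length u1 + (i - length c)) (u1 @ X')" by simp
    also have "\<dots> = take (length u1 + (i - length c)) Y" unfolding eq' d2(1) using jY by simp
    also have "\<dots> = rep (- \<eta> b + \<eta> (k + t))"
    proof -
      have "int (length Y) = b' - b" using \<eta> ab by (simp add: Y_def line_def flip: len_def)
      then have "b \<le> k + t" "k + t \<le> b'" "nat (k + t - b) = length u1 + (i - length c)"
        using jY d2(1) il lu by (auto simp: t_def ki)
      then show ?thesis using pre[OF \<eta>, of b "k + t" b'] by (simp add: Y_def)
    qed
    finally have "u + (- \<gamma> a + \<gamma> k) = - \<eta> b + \<eta> (k + t)" by (simp add: rep_inject)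
    then show ?thesis by (simp add: u_def add.assoc)
  qed
  then show ?thesis unfolding u_def v_def by blast
qed

lemma axis_ztimes: "axis \<gamma> x d \<Longrightarrow> ztimes n x + \<gamma> k = \<gamma> (k + n * d)"
proof (induction n rule: int_induct[where k = 0])
  case (step1 i)
  then have "ztimes (i + 1) x + \<gamma> k = x + \<gamma> (k + i * d)" by (simp add: ztimes_Suc add.assoc)
  also have "\<dots> = \<gamma> (k + (i + 1) * d)" using step1.prems by (simp add: axis_def algebra_simps)
  finally show ?case .
next
  case (step2 i)
  have "x + \<gamma> (k + (i - 1) * d) = \<gamma> (k + i * d)" using step2.prems by (simp add: axis_def algebra_simps)
  then have "- x + \<gamma> (k + i * d) = \<gamma> (k + (i - 1) * d)" by (metis minus_add_cancel)
  then show ?case using step2 by (simp add: ztimes_pred add.assoc)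
qed simp

text \<open>Powers of \<open>x\<close> keep the distance between corresponding points of the two
  lines, so long segments have close ends and must overlap. The overlap exceeds a period, which
  makes the periods equal and extends the overlap to the whole line.\<close>

lemma axis_unique:
  assumes \<gamma>: "axis \<gamma> x d" and \<eta>: "axis \<eta> x d'"
  shows "\<exists>t. \<forall>k. \<eta> k = \<gamma> (k + t)"
proof -
  have l: "line \<gamma>" "line \<eta>" and d: "d > 0" "d' > 0" using \<gamma> \<eta> by (auto simp: axis_def)
  define D where "D = int (len (- \<gamma> 0 + \<eta> 0))"
  \<comment> \<open>The segments reach from \<open>- N\<close> to \<open>N\<close> periods and lose
    \<open>D\<close> points at each end. With one period more than \<open>D\<close>, the overlap
    still contains all positions from \<open>- d'\<close> to \<open>d'\<close>.\<close>
  define N where "N = D + 1"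
  have D: "D \<ge> 0" by (simp add: D_def)
  have dist: "len (- \<gamma> (n * d) + \<eta> (n * d')) = len (- \<gamma> 0 + \<eta> 0)" for n
  proof -
    have "\<gamma> (n * d) = ztimes n x + \<gamma> 0" "\<eta> (n * d') = ztimes n x + \<eta> 0"
      using axis_ztimes[OF \<gamma>, of n 0] axis_ztimes[OF \<eta>, of n 0] by auto
    then show ?thesis by (simp add: diff_translate)
  qed
  have le: "- N * d' \<le> N * d'" "- N * d \<le> N * d" using D d by (auto simp: N_def)
  obtain t where t: "\<And>k. - N * d' + D \<le> k \<Longrightarrow> k + D \<le> N * d' \<Longrightarrow> \<eta> k = \<gamma> (k + t)"
    using line_overlap[OF l(2,1) le] unfolding dist D_def by blast
  have "D * 1 \<le> D * d'" using D d by (intro mult_left_mono) auto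
  then have r: "\<eta> k = \<gamma> (k + t)" if "- d' \<le> k" "k \<le> d'" for k
    using that by (intro t) (auto simp: N_def algebra_simps)
  have "\<gamma> (d' + t) = x + \<eta> 0" using r[of d'] d \<eta> by (simp add: axis_def)
  also have "\<dots> = \<gamma> (t + d)" using r[of 0] d \<gamma> by (simp add: axis_def)
  finally have dd: "d' = d" using line_inj[OF l(1)] by (metis add.commute add_left_cancel)
  have "\<eta> k = \<gamma> (k + t)" for k
  proof -
    have k: "k = k mod d + (k div d) * d" by simp
    have "\<eta> k = ztimes (k div d) x + \<eta> (k mod d)" using axis_ztimes[OF \<eta>] dd k by metis
    also have "\<eta> (k mod d) = \<gamma> (k mod d + t)" using d dd pos_mod_bound[of d k] pos_mod_sign[of d k] by (intro r) linarith+
    also have "ztimes (k div d) x + \<dots> = \<gamma> (k mod d + t + (k div d) * d)" using axis_ztimes[OF \<gamma>] by simp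
    also have "k mod d + t + (k div d) * d = k + t" by simp
    finally show ?thesis .
  qed
  then show ?thesis by blast
qed

text \<open>\<open>Q\<close> carries the axis of \<open>x'\<close> to an axis of its conjugate by
  \<open>Q\<close>, which is \<open>x\<close>, and \<open>x\<close> has only one axis up to a shift
  of the parameter.\<close>

lemma axis_intertwine:
  assumes "axis \<gamma> x d" "axis \<gamma>' x' d'" "x + Q = Q + x'"
  shows "\<exists>s. \<forall>k. Q + \<gamma>' k = \<gamma> (k + s)"
proof -
  have "x + (Q + \<gamma>' k) = Q + \<gamma>' (k + d')" for k
    using assms by (metis add.assoc axis_def)
  then have "axis (\<lambda>k. Q + \<gamma>' k) x d'"
    using assms(2) line_translate[of \<gamma>' Q] by (simp add: axis_def)
  from axis_unique[OF assms(1) this] show ?thesis .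
qed

text \<open>Shifts of a line commute on that line, and the group acts freely on the tree: elements
  that agree at one point are equal.\<close>

lemma translations_commute:
  fixes \<gamma> :: "int \<Rightarrow> 'a fg"
  assumes h: "\<And>k. h + \<gamma> k = \<gamma> (k + s)" and h': "\<And>k. h' + \<gamma> k = \<gamma> (k + s')"
  shows "h + h' = h' + h"
proof -
  have "h + h' + \<gamma> 0 = h' + h + \<gamma> 0" by (simp add: add.assoc h h' add.commute[of s])
  then show ?thesis by simp
qed

text \<open>What commutes with \<open>x\<close> shifts its axis and is determined by the shift, so
  the centralizer is a subgroup of the integers with least positive element \<open>r\<close>.
  Division with remainder shows that \<open>r\<close> generates it.\<close>

lemma axis_centralizer:
  assumes x: "axis \<gamma> x d" and r: "r > 0" "(\<gamma> r - \<gamma> 0) + x = x + (\<gamma> r - \<gamma> 0)"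
    and least: "\<And>k. 0 < k \<Longrightarrow> k < r \<Longrightarrow> (\<gamma> k - \<gamma> 0) + x \<noteq> x + (\<gamma> k - \<gamma> 0)"
  shows "h + x = x + h \<longleftrightarrow> (\<exists>n. h = ztimes n (\<gamma> r - \<gamma> 0))"
    and "axis \<gamma> (\<gamma> r - \<gamma> 0) r"
proof -
  have l: "line \<gamma>" using x by (simp add: axis_def)
  have tr: "\<exists>s. \<forall>k. h + \<gamma> k = \<gamma> (k + s)" if "h + x = x + h" for h
    using axis_intertwine[OF x x] that by simp
  obtain s where s: "\<And>k. (\<gamma> r - \<gamma> 0) + \<gamma> k = \<gamma> (k + s)" using tr[OF r(2)] by blast
  have "s = r" using s[of 0] line_inj[OF l] by simp
  then show R: "axis \<gamma> (\<gamma> r - \<gamma> 0) r" using s l r by (simp add: axis_def)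
  show "h + x = x + h \<longleftrightarrow> (\<exists>n. h = ztimes n (\<gamma> r - \<gamma> 0))"
  proof
    assume "h + x = x + h"
    from tr[OF this] obtain s where s: "\<And>k. h + \<gamma> k = \<gamma> (k + s)" by blast
    define h' where "h' = ztimes (- (s div r)) (\<gamma> r - \<gamma> 0) + h"
    have h': "h' + \<gamma> k = \<gamma> (k + s mod r)" for k
    proof -
      have "h' + \<gamma> k = \<gamma> (k + s + - (s div r) * r)"
        by (simp only: h'_def add.assoc s axis_ztimes[OF R])
      also have "k + s + - (s div r) * r = k + s mod r" by (simp add: minus_div_mult_eq_mod[symmetric])
      finally show ?thesis .
    qed
    have "h' + x = x + h'"
      by (rule translations_commute[of h' \<gamma> _ x d]) (use h' x in \<open>auto simp: axis_def\<close>)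
    moreover have "h' = \<gamma> (s mod r) - \<gamma> 0" using h'[of 0] by (metis add.left_neutral add_diff_cancel)
    ultimately have "s mod r = 0"
      using least[of "s mod r"] r(1) pos_mod_bound[of r s] pos_mod_sign[of r s] by fastforce
    then have "h' + \<gamma> 0 = \<gamma> 0" using h'[of 0] by simp
    then have "h' = 0" by (metis add_diff_cancel diff_self)
    then have "ztimes (s div r) (\<gamma> r - \<gamma> 0) + h' = ztimes (s div r) (\<gamma> r - \<gamma> 0)" by simp
    then have "h = ztimes (s div r) (\<gamma> r - \<gamma> 0)"
      using ztimes_minus[of "- (s div r)" "\<gamma> r - \<gamma> 0"] unfolding h'_def by (simp flip: add.assoc)
    then show "\<exists>n. h = ztimes n (\<gamma> r - \<gamma> 0)" ..
  next
    assume "\<exists>n. h = ztimes n (\<gamma> r - \<gamma> 0)"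
    then obtain n where n: "h = ztimes n (\<gamma> r - \<gamma> 0)" ..
    show "h + x = x + h"
      by (rule translations_commute[of h \<gamma> "n * r" x d])
        (use x in \<open>auto simp: n axis_ztimes[OF R] axis_def\<close>)
  qed
qed

text \<open>
  A long common translation would make the axis of \<open>x\<close> and its image under \<open>h\<close> overlap in more
  than a period.
\<close>
lemma axis_shift_bound:
  assumes x: "axis \<gamma> x d" and l': "line \<gamma>'" and Q: "\<And>k. Q + \<gamma>' k = \<gamma> (k + s)"
    and h: "h + Q = Q + \<delta>" and nc: "h + x \<noteq> x + h"
  shows "\<bar>s\<bar> \<le> len h + 2 * len (\<gamma> 0) + len \<delta> + 2 * len (\<gamma>' 0) + d"
proof (rule ccontr)
  \<comment> \<open>\<open>u\<close> and \<open>v\<close> are the distances by which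
    \<open>h\<close> moves \<open>\<gamma> 0\<close> and \<open>\<gamma> s\<close>. Since
    \<open>\<gamma> s\<close> is the image of \<open>\<gamma>' 0\<close> under \<open>Q\<close>, the
    second is the distance by which \<open>\<delta>\<close> moves
    \<open>\<gamma>' 0\<close>.\<close>
  define u where "u = int (len (- \<gamma> 0 + (h + \<gamma> 0)))"
  define v where "v = int (len (- \<gamma> s + (h + \<gamma> s)))"
  have conj: "len (- p + (y + p)) \<le> len y + 2 * len p" for y p :: "'a fg"
    using len_add_le[of "- p" "y + p"] len_add_le[of y p] by simp
  have "\<gamma> s = Q + \<gamma>' 0" using Q[of 0] by simp
  then have "- \<gamma> s + (h + \<gamma> s) = - \<gamma>' 0 + (\<delta> + \<gamma>' 0)"
    using h by (simp add: minus_add add.assoc) (simp flip: add.assoc add: h)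
  then have uv: "u \<le> len h + 2 * len (\<gamma> 0)" "v \<le> len \<delta> + 2 * len (\<gamma>' 0)"
    using conj[of "\<gamma> 0" h] conj[of "\<gamma>' 0" \<delta>] by (simp_all add: u_def v_def)
  have l: "line \<gamma>" "line (\<lambda>k. h + \<gamma> k)" and d: "d > 0"
    using x line_translate by (auto simp: axis_def)
  \<comment> \<open>If \<open>h\<close> shifts two points a period apart by the same amount, then
    \<open>h + x\<close> and \<open>x + h\<close> agree at a point and are equal.\<close>
  have contra: False if "h + \<gamma> k = \<gamma> (k + t)" "h + \<gamma> (k + d) = \<gamma> (k + d + t)" for k t
  proof -
    have "h + x + \<gamma> k = h + \<gamma> (k + d)" using x by (simp add: axis_def add.assoc)
    also have "\<dots> = x + \<gamma> (k + t)" using x that by (simp add: axis_def algebra_simps)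
    also have "\<dots> = x + h + \<gamma> k" using that by (simp add: add.assoc)
    finally show False using nc by simp
  qed
  assume "\<not> ?thesis"
  then consider "s > u + v + d" | "- s > u + v + d" using uv by linarith
  then show False
  proof cases
    case 1
    then have "0 \<le> s" using d by (simp add: u_def v_def)
    from line_overlap[OF l(2,1) this this] obtain t where
      "\<And>k. 0 + u \<le> k \<Longrightarrow> k + v \<le> s \<Longrightarrow> h + \<gamma> k = \<gamma> (k + t)" unfolding u_def v_def by blast
    from this[of u] this[of "u + d"] show False using contra 1 d by simp
  next
    case 2
    then have "s \<le> 0" using d by (simp add: u_def v_def)
    from line_overlap[OF l(2,1) this this] obtain t where
      "\<And>k. s + v \<le> k \<Longrightarrow> k + u \<le> 0 \<Longrightarrow> h + \<gamma> k = \<gamma> (k + t)" unfolding u_def v_def by blast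
    from this[of "s + v"] this[of "s + v + d"] show False using contra 2 d by simp
  qed
qed

section \<open>The axis of a closed walk\<close>

definition trail_of :: "(int \<Rightarrow> 'a) \<Rightarrow> (int \<Rightarrow> 'a fg) \<Rightarrow> bool" where
  "trail_of z \<gamma> \<longleftrightarrow> (\<forall>k. \<gamma> (k + 1) = \<gamma> k + ed (z k) (z (k + 1)))"

lemma ex_trail: "\<exists>\<gamma>. \<gamma> 0 = A \<and> trail_of z \<gamma>"
proof -
  define f where "f = rec_nat A (\<lambda>n p. p + ed (z (int n)) (z (int n + 1)))"
  define g where "g = rec_nat A (\<lambda>n p. p + ed (z (- int n)) (z (- int n - 1)))"
  define \<gamma> where "\<gamma> = (\<lambda>k. if k \<ge> 0 then f (nat k) else g (nat (- k)))"
  have "\<gamma> (k + 1) = \<gamma> k + ed (z k) (z (k + 1))" for k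
  proof (cases "k \<ge> 0")
    case True
    then have "nat (k + 1) = Suc (nat k)" by simp
    then show ?thesis using True by (simp add: \<gamma>_def f_def)
  next
    case False
    define n where "n = nat (- k - 1)"
    have k: "k = - int n - 1" using False by (simp add: n_def)
    have "\<gamma> (k + 1) = g n" by (cases "n = 0") (auto simp: \<gamma>_def k f_def g_def)
    moreover have "\<gamma> k = g n + ed (z (- int n)) (z (- int n - 1))"
    proof -
      have "nat (- k) = Suc n" using k by simp
      then show ?thesis using False by (simp add: \<gamma>_def g_def)
    qed
    ultimately show ?thesis by (simp add: k add.assoc)
  qed
  moreover have "\<gamma> 0 = A" by (simp add: \<gamma>_def f_def)
  ultimately show ?thesis unfolding trail_of_def by blast
qed

text \<open>A trail without stops and reversals spells reduced words, so the distance of two of its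
  points is the number of steps between them.\<close>

lemma trail_line:
  assumes t: "trail_of z \<gamma>" and z: "\<And>k. z k \<noteq> z (k + 1)" "\<And>k. z k \<noteq> z (k + 2)"
  shows "line \<gamma>"
proof -
  let ?E = "\<lambda>i n. map (\<lambda>j. (z (i + int j), z (i + int j + 1))) [0..<n]"
  have E: "- \<gamma> i + \<gamma> (i + int n) = cls (?E i n) \<and> is_red (?E i n)" for i n
  proof (induction n)
    case (Suc n)
    have "- \<gamma> i + \<gamma> (i + int (Suc n)) = (- \<gamma> i + \<gamma> (i + int n)) + ed (z (i + int n)) (z (i + int n + 1))"
      using t[unfolded trail_of_def, rule_format, of "i + int n"] by (simp add: add.assoc add.commute[of 1])
    also have "\<dots> = cls (?E i (Suc n))" using Suc by (simp add: cls_append ed_def)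
    finally have 1: "- \<gamma> i + \<gamma> (i + int (Suc n)) = cls (?E i (Suc n))" .
    have "is_red (?E i (Suc n))"
    proof (cases n)
      case 0
      then show ?thesis using z(1)[of i] by simp
    next
      case (Suc m)
      have "z (i + int m) \<noteq> z (i + int m + 2)" by (rule z(2))
      then have "z (i + int m) \<noteq> z (i + int n + 1)" using Suc by (simp add: algebra_simps)
      then show ?thesis using Suc.IH z(1)[of "i + int n"] by (auto simp: is_red_append Suc)
    qed
    then show ?case using 1 by simp
  qed simp
  have le: "len (- \<gamma> i + \<gamma> j) = nat (j - i)" if "i \<le> j" for i j
    using E[of i "nat (j - i)"] that by (simp add: len_def rep_cls_is_red)
  show ?thesis
    unfolding line_def
  proof (intro allI)
    fix i j
    have "len (- \<gamma> i + \<gamma> j) = len (- \<gamma> j + \<gamma> i)"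
      using len_uminus[of "- \<gamma> i + \<gamma> j"] by (simp add: minus_add)
    then show "len (- \<gamma> i + \<gamma> j) = nat \<bar>j - i\<bar>" using le[of i j] le[of j i] by (cases "i \<le> j") auto
  qed
qed

lemma is_red_arcs_nth:
  assumes "is_red (arcs_of xs)"
  shows "Suc j < length xs \<Longrightarrow> xs ! j \<noteq> xs ! Suc j"
    and "Suc (Suc j) < length xs \<Longrightarrow> xs ! j \<noteq> xs ! Suc (Suc j)"
proof -
  show "xs ! j \<noteq> xs ! Suc j" if "Suc j < length xs"
    using assms that
  proof (induction xs arbitrary: j rule: arcs_of.induct)
    case (3 x y xs)
    then show ?case by (cases j) (auto simp: is_red_Cons)
  qed auto
  show "xs ! j \<noteq> xs ! Suc (Suc j)" if "Suc (Suc j) < length xs"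
    using assms that
  proof (induction xs arbitrary: j rule: arcs_of.induct)
    case (3 x y xs)
    then show ?case by (cases j; cases xs) (auto simp: is_red_Cons)
  qed auto
qed

section \<open>Cyclic reduction of closed walks\<close>

definition palindromic :: "'a list \<Rightarrow> nat \<Rightarrow> bool" where
  "palindromic xs i \<longleftrightarrow> 2 * i < length xs \<and> (\<forall>j \<le> i. xs ! j = xs ! (length xs - 1 - j))"

text \<open>A closed walk that folds up completely has a loop or a backtrack in its middle. In a
  reduced one, at least three arcs are left between the two tails.\<close>

lemma palindromic_length:
  assumes "is_red (arcs_of xs)" "palindromic xs i" "length xs \<ge> 2"
  shows "2 * i + 4 \<le> length xs"
proof (rule ccontr)
  assume "\<not> ?thesis"
  then consider "length xs = 2 * i + 1" | "length xs = 2 * i + 2" | "length xs = 2 * i + 3"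
    using assms(2) unfolding palindromic_def by linarith
  then show False
  proof cases
    case 1
    then obtain j where j: "i = Suc j" using assms(3) by (cases i) auto
    have "xs ! j = xs ! (length xs - 1 - j)" using assms(2) j unfolding palindromic_def by simp
    moreover have "length xs - 1 - j = Suc (Suc j)" using 1 j by simp
    ultimately show False using is_red_arcs_nth(2)[OF assms(1), of j] 1 j by simp
  next
    case 2
    have "xs ! i = xs ! (length xs - 1 - i)" using assms(2) unfolding palindromic_def by simp
    moreover have "length xs - 1 - i = Suc i" using 2 by simp
    ultimately show False using is_red_arcs_nth(1)[OF assms(1), of i] 2 by simp
  next
    case 3
    have "xs ! i = xs ! (length xs - 1 - i)" using assms(2) unfolding palindromic_def by simp
    moreover have "length xs - 1 - i = Suc (Suc i)" using 3 by simp
    ultimately show False using is_red_arcs_nth(2)[OF assms(1), of i] 3 by simp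
  qed
qed

lemma palindromic_Suc:
  assumes "is_red (arcs_of xs)" "palindromic xs i" "length xs \<ge> 2"
    and "xs ! Suc i = xs ! (length xs - 1 - Suc i)"
  shows "palindromic xs (Suc i)"
  using assms palindromic_length[OF assms(1-3)] by (auto simp: palindromic_def le_Suc_eq)

definition core_index :: "'a list \<Rightarrow> nat \<Rightarrow> bool" where
  "core_index xs i \<longleftrightarrow> palindromic xs i \<and> xs ! Suc i \<noteq> xs ! (length xs - 1 - Suc i)"

definition core_length :: "'a list \<Rightarrow> nat \<Rightarrow> nat" where
  "core_length xs i = length xs - 1 - 2 * i"

definition core_walk :: "'a list \<Rightarrow> nat \<Rightarrow> int \<Rightarrow> 'a" where
  "core_walk xs i k = xs ! (i + nat (k mod int (core_length xs i)))"

lemma ex_core_index: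
  assumes "is_red (arcs_of xs)" "length xs \<ge> 2" "hd xs = last xs"
  shows "\<exists>i. core_index xs i"
proof (rule ccontr)
  assume n: "\<nexists>i. core_index xs i"
  have "palindromic xs i" for i
  proof (induction i)
    case 0
    have "xs \<noteq> []" using assms(2) by auto
    then show ?case using assms by (simp add: palindromic_def hd_conv_nth last_conv_nth)
  next
    case (Suc i)
    then show ?case using n palindromic_Suc[OF assms(1) Suc assms(2)] by (auto simp: core_index_def)
  qed
  then have "2 * length xs < length xs" unfolding palindromic_def by blast
  then show False by simp
qed

text \<open>The closed walk has the form \<open>t c t^-1\<close> with a cyclically reduced core
  \<open>c\<close>. So the tail \<open>t\<close>, continued by turns around \<open>c\<close> in both
  directions, traces a line, and the closed walk shifts this line by one turn.\<close>

lemma core_walk_axis: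
  assumes red: "is_red (arcs_of xs)" and len: "length xs \<ge> 2" and i: "core_index xs i"
    and \<gamma>: "\<gamma> 0 = path (take (Suc i) xs)" "trail_of (core_walk xs i) \<gamma>"
  shows "axis \<gamma> (path xs) (int (core_length xs i))"
    and "core_walk xs i k \<noteq> core_walk xs i (k + 1)"
    and "\<exists>j. Suc j < length xs \<and> core_walk xs i k = xs ! j \<and> core_walk xs i (k + 1) = xs ! Suc j"
proof -
  define L where "L = length xs - 1"
  define d where "d = core_length xs i"
  define z where "z = core_walk xs i"
  have pal: "palindromic xs i" and ne: "xs ! Suc i \<noteq> xs ! (L - Suc i)"
    using i by (auto simp: core_index_def L_def)
  have L: "2 * i + 3 \<le> L" "length xs = Suc L" using palindromic_length[OF red pal len] by (auto simp: L_def)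
  have "d = L - 2 * i" by (simp add: d_def core_length_def L_def)
  then have d: "d \<ge> 3" "i + d = L - i" using L(1) by auto
  have xd: "xs ! (i + d) = xs ! i" using pal unfolding d(2) palindromic_def L_def by simp
  have z: "z k = xs ! (i + nat (k mod int d))" for k by (simp add: z_def core_walk_def d_def)
  have zper: "z (k + int d) = z k" for k by (simp add: z)
  have zj: "z (int j) = xs ! (i + j)" if "j \<le> d" for j
    using that xd d by (cases "j = d") (auto simp: z zmod_int[symmetric])
  have zk: "z (k + int j) = z (k mod int d + int j)" for k j
    unfolding z by (simp add: mod_add_left_eq)
  have km: "k mod int d = int (nat (k mod int d))" "nat (k mod int d) < d" for k
  proof -
    have "0 < int d" using d by simp
    then have "0 \<le> k mod int d" "k mod int d < int d" by simp_all
    then show "k mod int d = int (nat (k mod int d))" "nat (k mod int d) < d" by linarith+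
  qed
  have z1: "z k = xs ! (i + nat (k mod int d))" "z (k + 1) = xs ! (i + Suc (nat (k mod int d)))" for k
  proof -
    show "z k = xs ! (i + nat (k mod int d))" by (rule z)
    have "z (k + 1) = z (int (Suc (nat (k mod int d))))" using zk[of k 1] km[of k] by (simp add: add.commute)
    then show "z (k + 1) = xs ! (i + Suc (nat (k mod int d)))" using zj[of "Suc (nat (k mod int d))"] km[of k] by simp
  qed
  have b: "i + Suc (nat (k mod int d)) \<le> L" for k using km(2)[of k] d by simp
  have zne: "z k \<noteq> z (k + 1)" for k
    using z1[of k] is_red_arcs_nth(1)[OF red, of "i + nat (k mod int d)"] b[of k] L by simp
  then show "core_walk xs i k \<noteq> core_walk xs i (k + 1)" by (simp add: z_def)
  show "\<exists>j. Suc j < length xs \<and> core_walk xs i k = xs ! j \<and> core_walk xs i (k + 1) = xs ! Suc j"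
    using z1[of k] b[of k] L by (intro exI[of _ "i + nat (k mod int d)"]) (simp add: z_def)
  have zne2: "z k \<noteq> z (k + 2)" for k
  proof (cases "Suc (Suc (nat (k mod int d))) \<le> d")
    case True
    have "z (k + 2) = z (int (Suc (Suc (nat (k mod int d)))))"
      using zk[of k 2] km(1)[of k] by (simp add: add.commute)
    then have "z (k + 2) = xs ! Suc (Suc (i + nat (k mod int d)))" using zj[OF True] by simp
    then show ?thesis
      using z1(1)[of k] is_red_arcs_nth(2)[OF red, of "i + nat (k mod int d)"] True d L by simp
  next
    \<comment> \<open>The seam between two turns, where \<open>core_index\<close> excludes a
      backtrack.\<close>
    case False
    then have k: "nat (k mod int d) = d - 1" using km(2)[of k] by simp
    have "z (k + 2) = z (int (d - 1) + 2)" using zk[of k 2] km(1)[of k] k by simp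
    also have "int (d - 1) + 2 = int 1 + int d" using d by simp
    also have "z \<dots> = xs ! Suc i" unfolding zper using zj[of 1] d by simp
    finally show ?thesis using z1(1)[of k] k ne d by simp
  qed
  have tr: "\<gamma> (k + 1) = \<gamma> k + ed (z k) (z (k + 1))" for k using \<gamma>(2) by (simp add: trail_of_def z_def)
  have \<gamma>j: "j \<le> d \<Longrightarrow> \<gamma> (int j) = path (take (Suc (i + j)) xs)" for j
  proof (induction j)
    case (Suc j)
    have "Suc (i + j) < length xs" using Suc.prems d L by simp
    then have "take (Suc (i + Suc j)) xs = take (Suc (i + j)) xs @ [xs ! (Suc (i + j))]"
      "last (take (Suc (i + j)) xs) = xs ! (i + j)" "take (Suc (i + j)) xs \<noteq> []"
      by (auto simp: take_Suc_conv_app_nth last_conv_nth)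
    then have "path (take (Suc (i + Suc j)) xs) = path (take (Suc (i + j)) xs) + ed (xs ! (i + j)) (xs ! Suc (i + j))"
      by (simp add: path_snoc)
    moreover have "z (int j) = xs ! (i + j)" "z (int j + 1) = xs ! Suc (i + j)"
      using zj[of j] zj[of "Suc j"] Suc.prems by (auto simp: add.commute)
    ultimately show ?case using Suc tr[of "int j"] by (simp add: add.commute[of 1])
  qed (simp add: \<gamma>)
  \<comment> \<open>The end of the closed walk is its beginning reversed and cancels against
    \<open>\<gamma> 0\<close>.\<close>
  have dr: "drop (L - i) xs = rev (take (Suc i) xs)"
  proof (rule nth_equalityI)
    show "length (drop (L - i) xs) = length (rev (take (Suc i) xs))" using L by simp
    fix j assume "j < length (drop (L - i) xs)"
    then have j: "j \<le> i" using L by simp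
    have "xs ! (i - j) = xs ! (L - (i - j))" using pal unfolding palindromic_def L_def by simp
    moreover have "L - (i - j) = L - i + j" using j L by simp
    ultimately show "drop (L - i) xs ! j = rev (take (Suc i) xs) ! j" using j L by (simp add: rev_nth)
  qed
  have base: "path xs + \<gamma> 0 = \<gamma> (int d)"
  proof -
    have spl: "xs = take (L - i) xs @ drop (L - i) xs" by simp
    have n0: "take (L - i) xs \<noteq> []" "drop (L - i) xs \<noteq> []" using L by auto
    have hd: "hd (drop (L - i) xs) = xs ! (L - i)" using L by (simp add: hd_drop_conv_nth)
    have "path xs = path (take (L - i) xs @ drop (L - i) xs)" by simp
    also have "\<dots> = path (take (L - i) xs) + ed (last (take (L - i) xs)) (xs ! (L - i)) + path (drop (L - i) xs)"
      unfolding path_append[OF n0] hd ..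
    also have "path (take (L - i) xs) + ed (last (take (L - i) xs)) (xs ! (L - i)) = path (take (Suc (L - i)) xs)"
      using L n0 by (simp add: path_snoc take_Suc_conv_app_nth)
    also have "path (drop (L - i) xs) = - \<gamma> 0" by (simp add: dr path_rev \<gamma>)
    finally have "path xs + \<gamma> 0 = path (take (Suc (L - i)) xs)" by (simp add: add.assoc)
    then show ?thesis using \<gamma>j[of d] d by simp
  qed
  have per: "path xs + \<gamma> k = \<gamma> (k + int d)" for k
  proof (induction k rule: int_induct[where k = 0])
    case (step1 k)
    have "path xs + \<gamma> (k + 1) = \<gamma> (k + int d) + ed (z k) (z (k + 1))"
      using step1 tr[of k] by (simp flip: add.assoc)
    also have "\<dots> = \<gamma> (k + int d) + ed (z (k + int d)) (z (k + int d + 1))"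
      using zper[of k] zper[of "k + 1"] by (simp add: algebra_simps)
    finally show ?case using tr[of "k + int d"] by (simp add: algebra_simps)
  next
    case (step2 k)
    have "\<gamma> k = \<gamma> (k - 1) + ed (z (k - 1)) (z k)" using tr[of "k - 1"] by simp
    then have 1: "\<gamma> (k - 1) = \<gamma> k + ed (z k) (z (k - 1))" by (simp add: add.assoc)
    have "\<gamma> (k + int d) = \<gamma> (k - 1 + int d) + ed (z (k - 1 + int d)) (z (k + int d))"
      using tr[of "k - 1 + int d"] by (simp add: algebra_simps)
    then have 2: "\<gamma> (k - 1 + int d) = \<gamma> (k + int d) + ed (z (k + int d)) (z (k - 1 + int d))" by (simp add: add.assoc)
    show ?case unfolding 1 2 zper using step2 by (simp flip: add.assoc)
  qed (simp add: base)
  have "line \<gamma>" using trail_line[OF \<gamma>(2)] zne zne2 by (simp add: z_def)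
  then show "axis \<gamma> (path xs) (int (core_length xs i))" using per d by (simp add: axis_def d_def)
qed

section \<open>Realizable walks\<close>

lemma cls_walk_pow: "cls (walk_pow R n) = ztimes n (cls R)"
proof -
  have "cls (concat (replicate k X)) = ntimes k (cls X)" for k :: nat and X :: "('a \<times> 'a) list"
    by (induction k) (auto simp: cls_append)
  then show ?thesis by (simp add: walk_pow_def ztimes_def cls_rev_path)
qed

lemma (in refl_graph) vwalk_of_walk:
  "is_walk G u W v \<Longrightarrow> \<exists>xs. vwalk xs \<and> hd xs = u \<and> last xs = v \<and> arcs_of xs = W"
proof (induction W arbitrary: u)
  case Nil
  then show ?case by (intro exI[of _ "[u]"]) (auto simp: vwalk_def)
next
  case (Cons e W)
  then obtain xs where xs: "vwalk xs" "hd xs = snd e" "last xs = v" "arcs_of xs = W" by auto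
  then obtain y ys where "xs = y # ys" by (cases xs) (auto simp: vwalk_def)
  then show ?case using xs Cons.prems
    by (intro exI[of _ "u # xs"]) (auto simp: vwalk_def wellformed')
qed

lemma (in refl_graph) walk_pow_walk: "is_walk G u R u \<Longrightarrow> is_walk G u (walk_pow R n) u"
proof -
  have "u \<in> pverts G \<Longrightarrow> is_walk G u X u \<Longrightarrow> is_walk G u (concat (replicate k X)) u" for k X
    by (induction k) (auto simp: walk_append)
  moreover assume "is_walk G u R u"
  ultimately show ?thesis using walk_rev awalk_hd_in_verts by (auto simp: walk_pow_def)
qed

lemma is_red_trail:
  assumes "\<And>i. z i \<noteq> z (Suc i)" "\<And>i. z i \<noteq> z (Suc (Suc i))"
  shows "is_red (map (\<lambda>j. (z j, z (Suc j))) [0..<n])"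
proof (induction n)
  case (Suc n)
  show ?case
  proof (cases n)
    case 0
    then show ?thesis using assms(1)[of 0] by simp
  next
    case (Suc m)
    then show ?thesis using Suc.IH assms(1)[of n] assms(2)[of m] by (auto simp: is_red_append)
  qed
qed simp

text \<open>\<open>W\<close> is an arbitrary choice of walks from \<open>q\<close>. The program
  takes it from a spanning tree and pads all walks to the same length; therefore \<open>W q\<close>
  is only asked to be constant.\<close>

locale recoloring = hom_graphs +
  fixes \<alpha> \<beta> :: "'a \<Rightarrow> 'b" and q :: 'a and W :: "'a \<Rightarrow> 'a list"
  assumes \<alpha>: "\<alpha> \<in> homs G H" and \<beta>: "\<beta> \<in> homs G H" and q: "q \<in> pverts G"
    and W: "v \<in> pverts G \<Longrightarrow> G.vwalk (W v)" "v \<in> pverts G \<Longrightarrow> hd (W v) = q" "v \<in> pverts G \<Longrightarrow> last (W v) = v"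
    and Wq: "set (W q) = {q}"
begin

definition tree_path :: "('a \<Rightarrow> 'b) \<Rightarrow> 'a \<Rightarrow> 'b fg" where
  "tree_path f v = path (map f (W v))"

text \<open>The image under \<open>f\<close> of the fundamental closed walk through the arc
  \<open>uv\<close>.\<close>

definition loop_of :: "('a \<Rightarrow> 'b) \<Rightarrow> 'a \<Rightarrow> 'a \<Rightarrow> 'b fg" where
  "loop_of f u v = tree_path f u + ed (f u) (f v) - tree_path f v"

lemma vwalk_map: "f \<in> homs G H \<Longrightarrow> G.vwalk xs \<Longrightarrow> H.vwalk (map f xs)"
  unfolding G.vwalk_def H.vwalk_def
  by (auto simp: successively_map homs_vert subset_iff intro: successively_mono homs_arc)

lemma tree_path_pwalk: "f \<in> homs G H \<Longrightarrow> v \<in> pverts G \<Longrightarrow> H.pwalk (f q) (tree_path f v) (f v)"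
proof -
  assume *: "f \<in> homs G H" "v \<in> pverts G"
  have "W v \<noteq> []" using W(1)[OF *(2)] by (simp add: G.vwalk_def)
  then show ?thesis
    using H.vwalk_pwalk[OF vwalk_map[OF *(1) W(1)[OF *(2)]]] W(2,3)[OF *(2)]
    by (simp add: tree_path_def hd_map last_map)
qed

lemma tree_path_q: "tree_path f q = 0"
  unfolding tree_path_def by (rule path_const[of _ "f q"]) (use Wq in auto)

lemma loop_of_pwalk: "f \<in> homs G H \<Longrightarrow> (u, v) \<in> parcs G \<Longrightarrow> H.pwalk (f q) (loop_of f u v) (f q)"
  unfolding loop_of_def diff_conv_add_uminus
  by (intro H.pwalk_add[OF H.pwalk_add[OF tree_path_pwalk H.pwalk_ed] H.pwalk_uminus[OF tree_path_pwalk]])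
    (auto intro: homs_arc dest: G.in_arcsD1 G.in_arcsD2)

definition trans_of :: "'b fg \<Rightarrow> 'a \<Rightarrow> 'b fg" where
  "trans_of Q v = - tree_path \<alpha> v + Q + tree_path \<beta> v"

definition valid :: "'b fg \<Rightarrow> bool" where
  "valid Q \<longleftrightarrow> (\<forall>(u, v) \<in> parcs G. loop_of \<alpha> u v + Q = Q + loop_of \<beta> u v)"

definition good :: "'b fg \<Rightarrow> bool" where
  "good Q \<longleftrightarrow> H.pwalk (\<alpha> q) Q (\<beta> q) \<and> valid Q \<and> acyclic (blocking \<alpha> (trans_of Q))"

lemma trans_of_q: "trans_of Q q = Q"
  by (simp add: trans_of_def tree_path_q)

text \<open>For each arc, adding \<open>tree_path \<alpha> u\<close> on the left and
  \<open>ed (\<beta> u) (\<beta> v) - tree_path \<beta> v\<close> on the right turns one equation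
  into the other.\<close>

lemma compat_iff_valid: "compat \<alpha> \<beta> (trans_of Q) \<longleftrightarrow> valid Q"
proof -
  have "trans_of Q u = ed (\<alpha> u) (\<alpha> v) + trans_of Q v + ed (\<beta> v) (\<beta> u) \<longleftrightarrow>
      loop_of \<alpha> u v + Q = Q + loop_of \<beta> u v" for u v
  proof -
    let ?l = "tree_path \<alpha> u" and ?r = "ed (\<beta> u) (\<beta> v) - tree_path \<beta> v"
    have 1: "?l + trans_of Q u + ?r = Q + loop_of \<beta> u v"
      unfolding trans_of_def loop_of_def diff_conv_add_uminus by (simp only: add.assoc add_minus_cancel)
    have 2: "?l + (ed (\<alpha> u) (\<alpha> v) + trans_of Q v + ed (\<beta> v) (\<beta> u)) + ?r = loop_of \<alpha> u v + Q"
      unfolding trans_of_def loop_of_def diff_conv_add_uminus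
      by (simp only: add.assoc add_minus_cancel ed_add_swap right_minus add_0_right)
    show ?thesis unfolding 1[symmetric] 2[symmetric] by auto
  qed
  then show ?thesis unfolding compat_def valid_def by blast
qed

lemma compat_vwalk:
  "compat \<alpha> \<beta> S \<Longrightarrow> G.vwalk xs \<Longrightarrow> S (hd xs) = path (map \<alpha> xs) + S (last xs) - path (map \<beta> xs)"
proof (induction xs rule: path.induct)
  case (3 x y xs)
  then have xy: "(x, y) \<in> parcs G" "G.vwalk (y # xs)" by (auto simp: G.vwalk_def)
  then have "S x = ed (\<alpha> x) (\<alpha> y) + S y + ed (\<beta> y) (\<beta> x)" using 3(2) by (auto simp: compat_def)
  moreover have "S y = path (map \<alpha> (y # xs)) + S (last (y # xs)) - path (map \<beta> (y # xs))"
    using 3(1)[OF 3(2) xy(2)] by simp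
  ultimately show ?case
    by (simp add: minus_add add.assoc diff_conv_add_uminus del: add_uminus_conv_diff)
qed (auto simp: G.vwalk_def)

lemma compat_trans_of:
  assumes "compat \<alpha> \<beta> S" "v \<in> pverts G"
  shows "S v = trans_of (S q) v"
proof -
  have "S q = tree_path \<alpha> v + S v - tree_path \<beta> v"
    using compat_vwalk[OF assms(1) W(1)[OF assms(2)]] W(2,3)[OF assms(2)] by (simp add: tree_path_def)
  then show ?thesis by (simp add: trans_of_def diff_conv_add_uminus add.assoc del: add_uminus_conv_diff)
qed

lemma compat_cong: "(\<And>v. v \<in> pverts G \<Longrightarrow> S v = S' v) \<Longrightarrow> compat \<alpha> \<beta> S = compat \<alpha> \<beta> S'"
  unfolding compat_def using G.in_arcsD1 G.in_arcsD2 by (auto simp: split_beta)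

lemma blocking_cong: "(\<And>v. v \<in> pverts G \<Longrightarrow> S v = S' v) \<Longrightarrow> blocking \<alpha> S = blocking \<alpha> S'"
  unfolding blocking_def using G.in_arcsD1 by auto

lemma pwalks_trans_of: "H.pwalk (\<alpha> q) Q (\<beta> q) \<Longrightarrow> pwalks \<alpha> \<beta> (trans_of Q)"
  unfolding pwalks_def trans_of_def
  using H.pwalk_add[OF H.pwalk_add[OF H.pwalk_uminus[OF tree_path_pwalk[OF \<alpha>]]] tree_path_pwalk[OF \<beta>]] by blast

lemma color_walk_walk:
  "recolor_seq G H \<sigma> \<tau> T \<Longrightarrow> v \<in> pverts G \<Longrightarrow> is_walk H (\<sigma> v) (color_walk T v) (\<tau> v)"
proof (induction T arbitrary: \<sigma>)
  case (Cons \<sigma>' T)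
  show ?case
  proof (cases T)
    case Nil
    then show ?thesis using Cons.prems homs_vert by (auto simp: recolor_seq_def)
  next
    case T: (Cons \<rho> U)
    have s: "\<sigma>' = \<sigma>" "\<sigma> \<in> homs G H" "recolor_step G H \<sigma> \<rho>" "recolor_seq G H \<rho> \<tau> T"
      using Cons.prems(1) by (auto simp: T recolor_seq_Cons)
    have "(\<sigma> v, \<rho> v) \<in> parcs H"
      using s(3) H.loops[OF homs_vert[OF s(2) Cons.prems(2)]] Cons.prems(2)
      by (cases "\<sigma> v = \<rho> v") (auto simp: recolor_step_def)
    then show ?thesis using Cons.IH[OF s(4) Cons.prems(2)] s(1) by (simp add: T color_walk_Cons)
  qed
qed (simp add: recolor_seq_def)

text \<open>A recoloring sequence yields a compatible family, which is determined by its member at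
  \<open>q\<close>. Conversely \<open>trans_of Q\<close> is such a family, and
  \<open>recoloring_sufficient\<close> plays it as a sequence.\<close>

theorem realizable_iff: "realizable G H \<alpha> \<beta> q X \<longleftrightarrow> (\<exists>Q. X = rep Q \<and> good Q)"
proof
  assume r: "realizable G H \<alpha> \<beta> q X"
  then obtain T where T: "recolor_seq G H \<alpha> \<beta> T" "push_or_pull G T" "pi_class H X = pi_class H (color_walk T q)"
    and X: "is_walk H (\<alpha> q) X (\<beta> q)" "is_red X" unfolding realizable_def reduced_iff_is_red by blast
  have Xc: "cls X = cls (color_walk T q)"
    using T(3) H.pi_class_eq_iff[of X "color_walk T q"] X color_walk_walk[OF T(1) q] by (auto simp: walks_def)
  let ?S = "\<lambda>v. cls (color_walk T v)"
  note n = recoloring_necessary[OF T(1,2)]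
  have S: "?S v = trans_of (cls X) v" if "v \<in> pverts G" for v
    using compat_trans_of[of ?S v] n that Xc by simp
  have "H.pwalk (\<alpha> q) (cls X) (\<beta> q)" using X by (simp add: H.pwalk_cls)
  moreover have "valid (cls X)"
    using n compat_cong[of ?S "trans_of (cls X)"] S by (simp add: compat_iff_valid)
  moreover have "acyclic (blocking \<alpha> (trans_of (cls X)))"
    using n blocking_cong[of ?S "trans_of (cls X)"] S by simp
  ultimately show "\<exists>Q. X = rep Q \<and> good Q"
    using X by (intro exI[of _ "cls X"]) (auto simp: good_def rep_cls_is_red)
next
  assume "\<exists>Q. X = rep Q \<and> good Q"
  then obtain Q where Q: "X = rep Q" "good Q" by blast
  then have *: "H.pwalk (\<alpha> q) Q (\<beta> q)" "compat \<alpha> \<beta> (trans_of Q)" "acyclic (blocking \<alpha> (trans_of Q))"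
    by (auto simp: good_def compat_iff_valid)
  obtain T where T: "recolor_seq G H \<alpha> \<beta> T" "push_or_pull G T"
    "\<And>v. v \<in> pverts G \<Longrightarrow> cls (color_walk T v) = trans_of Q v"
    using recoloring_sufficient[OF \<alpha> \<beta> *(2) pwalks_trans_of[OF *(1)] *(3)] by blast
  have X: "is_walk H (\<alpha> q) X (\<beta> q)" using * Q by (simp add: H.pwalk_def)
  have "cls X = cls (color_walk T q)" using T(3)[OF q] Q by (simp add: trans_of_q)
  then have "pi_class H X = pi_class H (color_walk T q)"
    using H.pi_class_eq_iff[of X "color_walk T q"] X color_walk_walk[OF T(1) q] by (auto simp: walks_def)
  then show "realizable G H \<alpha> \<beta> q X"
    unfolding realizable_def reduced_iff_is_red using T X Q by auto
qed

lemma realizable_walks_eq: "realizable_walks G H \<alpha> \<beta> q = rep ` {Q. good Q}"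
  by (auto simp: realizable_walks_def realizable_iff)

lemma outcome_noneI: "(\<And>Q. \<not> good Q) \<Longrightarrow> outcome_none G H \<alpha> \<beta> q"
  by (simp add: outcome_none_def realizable_walks_eq)

lemma outcome_singleI:
  assumes "\<And>Q. good Q \<longleftrightarrow> Q = P"
  shows "outcome_single G H \<alpha> \<beta> q (rep P)"
  using assms by (auto simp: outcome_single_def realizable_walks_eq good_def H.pwalk_def walks_def)

lemma outcome_powersI:
  assumes R: "H.pwalk (\<alpha> q) R (\<alpha> q)" and P: "H.pwalk (\<alpha> q) P (\<beta> q)"
    and good: "\<And>Q. good Q \<longleftrightarrow> (\<exists>n. Q = ztimes n R + P)"
  shows "outcome_powers G H \<alpha> \<beta> q (rep R) (rep P)"
proof -
  have *: "pi_class H (walk_pow (rep R) n @ rep P) = pi_class H (rep (ztimes n R + P))" for n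
  proof -
    have c: "cls (walk_pow (rep R) n @ rep P) = ztimes n R + P" by (simp add: cls_append cls_walk_pow)
    have w: "is_walk H (\<alpha> q) (walk_pow (rep R) n @ rep P) (\<beta> q)"
      using H.walk_pow_walk R P unfolding H.pwalk_def H.walk_append by blast
    then have "is_walk H (\<alpha> q) (rep (ztimes n R + P)) (\<beta> q)" using H.pwalk_cls c unfolding H.pwalk_def by metis
    then have "walk_pow (rep R) n @ rep P \<in> walks H" "rep (ztimes n R + P) \<in> walks H"
      using w unfolding walks_def by blast+
    then show ?thesis using H.pi_class_eq_iff c by simp
  qed
  show ?thesis
    unfolding outcome_powers_def realizable_walks_eq *
    using R P good unfolding H.pwalk_def image_image by (auto simp: image_iff)
qed

section \<open>The trivial case\<close>

text \<open>If the closed walks are trivial, \<open>tree_path \<alpha>\<close> is a potential on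
  \<open>G\<close>. Along an endless chain of blocking arcs the colors spell a reduced word of
  growing length, so the potential would take infinitely many values on finitely many
  vertices.\<close>

lemma trivial_all:
  assumes "\<And>u v. (u, v) \<in> parcs G \<Longrightarrow> loop_of \<alpha> u v = 0 \<and> loop_of \<beta> u v = 0"
  shows "outcome_all G H \<alpha> \<beta> q"
proof -
  have valid: "valid Q" for Q using assms by (auto simp: valid_def)
  have pot: "tree_path \<alpha> v = tree_path \<alpha> u + ed (\<alpha> u) (\<alpha> v)" if "(u, v) \<in> parcs G" for u v
  proof -
    have "tree_path \<alpha> u + ed (\<alpha> u) (\<alpha> v) - tree_path \<alpha> v = 0"
      using assms[OF that] by (simp add: loop_of_def)
    then show ?thesis by simp
  qed
  have "acyclic (blocking \<alpha> (trans_of Q))" if Q: "H.pwalk (\<alpha> q) Q (\<beta> q)" for Q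
    unfolding acyclic_blocking_iff
  proof
    let ?B = "blocking \<alpha> (trans_of Q)"
    assume "\<exists>X. bicore ?B X"
    then obtain X x where X: "bicore ?B X" and x: "x \<in> X" unfolding bicore_def by blast
    have c: "compat \<alpha> \<beta> (trans_of Q)" using valid by (simp add: compat_iff_valid)
    obtain s where s: "\<And>y. y \<in> X \<Longrightarrow> s y \<in> X \<and> (y, s y) \<in> ?B"
      using bchoice[of X "\<lambda>y u. u \<in> X \<and> (y, u) \<in> ?B"] X unfolding bicore_def by blast
    define f where "f i = (s ^^ i) x" for i
    have fX: "f i \<in> X" for i using x s by (induction i) (auto simp: f_def)
    have fB: "(f i, f (Suc i)) \<in> ?B" for i using s[OF fX[of i]] by (simp add: f_def)
    have n1: "\<alpha> (f i) \<noteq> \<alpha> (f (Suc i))" for i using fB[of i] by (auto simp: blocking_def)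
    have n2: "\<alpha> (f i) \<noteq> \<alpha> (f (Suc (Suc i)))" for i
      using blocking_next(3)[OF c pwalks_trans_of[OF Q] fB[of i]] fB[of "Suc i"] by (auto simp: blocking_def)
    let ?E = "\<lambda>n. map (\<lambda>j. (\<alpha> (f j), \<alpha> (f (Suc j)))) [0..<n]"
    have E: "- tree_path \<alpha> (f 0) + tree_path \<alpha> (f n) = cls (?E n)" for n
    proof (induction n)
      case (Suc n)
      have "(f n, f (Suc n)) \<in> parcs G" using fB[of n] by (auto simp: blocking_def)
      then show ?case using Suc pot by (simp add: cls_append ed_def flip: add.assoc)
    qed simp
    have "len (- tree_path \<alpha> (f 0) + tree_path \<alpha> (f n)) = n" for n
      using is_red_trail[of "\<lambda>i. \<alpha> (f i)", OF n1 n2] by (simp add: E len_def rep_cls_is_red)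
    then have "inj f" by (metis injI)
    moreover have "range f \<subseteq> pverts G" using fB G.in_arcsD1 by (auto simp: blocking_def)
    ultimately show False using G.pair_finite_verts by (meson finite_subset range_inj_infinite)
  qed
  then have "good Q" if "H.pwalk (\<alpha> q) Q (\<beta> q)" for Q using that valid by (simp add: good_def)
  then have "X \<in> rep ` {Q. good Q}" if "is_walk H (\<alpha> q) X (\<beta> q)" "is_red X" for X
    using that by (intro image_eqI[of _ _ "cls X"]) (auto simp: rep_cls_is_red H.pwalk_def)
  then show ?thesis
    unfolding outcome_all_def realizable_walks_eq reduced_iff_is_red by blast
qed

lemma trivial_none:
  assumes "\<And>u v. (u, v) \<in> parcs G \<Longrightarrow> loop_of \<alpha> u v = 0"
    and "(u, v) \<in> parcs G" "loop_of \<beta> u v \<noteq> 0"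
  shows "outcome_none G H \<alpha> \<beta> q"
proof (rule outcome_noneI)
  fix Q
  have "valid Q \<Longrightarrow> 0 + Q = Q + loop_of \<beta> u v" using assms(1,2) unfolding valid_def by fastforce
  moreover have "Q + loop_of \<beta> u v \<noteq> Q" using assms(3) by (metis add.right_neutral add_left_cancel)
  ultimately show "\<not> good Q" by (auto simp: good_def)
qed

section \<open>The cyclic case\<close>

text \<open>By \<open>cycle_frozen\<close> a vertex on a blocking cycle of one valid walk does not
  move under any realizable one, and \<open>trans_of Q v = 0\<close> can be solved for
  \<open>Q\<close>.\<close>

lemma good_cycle:
  assumes "H.pwalk (\<alpha> q) P (\<beta> q)" "valid P" "(v, v) \<in> (blocking \<alpha> (trans_of P))\<^sup>+" "good Q"
  shows "\<alpha> v = \<beta> v" "Q = tree_path \<alpha> v - tree_path \<beta> v"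
proof -
  have Q: "H.pwalk (\<alpha> q) Q (\<beta> q)" "valid Q" "acyclic (blocking \<alpha> (trans_of Q))"
    using assms(4) by (auto simp: good_def)
  have 0: "trans_of Q v = 0"
    using cycle_frozen[of \<alpha> \<beta> "trans_of P" v "trans_of Q"] assms Q pwalks_trans_of
    by (auto simp: compat_iff_valid)
  obtain u where "(v, u) \<in> blocking \<alpha> (trans_of P)" using tranclD[OF assms(3)] by blast
  then have v: "v \<in> pverts G" by (auto simp: blocking_def dest: G.in_arcsD1)
  show "\<alpha> v = \<beta> v" using pwalks_trans_of[OF Q(1)] v 0 by (auto simp: pwalks_def)
  have "Q + tree_path \<beta> v = tree_path \<alpha> v"
    using 0 unfolding trans_of_def by (metis add.assoc add.right_neutral add_minus_cancel)
  then show "Q = tree_path \<alpha> v - tree_path \<beta> v" by (metis add_diff_cancel)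
qed

lemma not_acyclic_cycle: "\<not> acyclic B \<Longrightarrow> \<exists>v. (v, v) \<in> B\<^sup>+"
  by (simp add: acyclic_def)

text \<open>
  \<open>Q\<close> is the only candidate that does not move the vertex \<open>v\<close> of the tight closed walk.
\<close>
lemma cycle_outcome:
  assumes P: "H.pwalk (\<alpha> q) P (\<beta> q)" "valid P" "(v, v) \<in> (blocking \<alpha> (trans_of P))\<^sup>+"
    and Q: "Q = tree_path \<alpha> v - tree_path \<beta> v"
  shows "\<alpha> v \<noteq> \<beta> v \<Longrightarrow> outcome_none G H \<alpha> \<beta> q"
    and "\<alpha> v = \<beta> v \<Longrightarrow> valid Q \<Longrightarrow> acyclic (blocking \<alpha> (trans_of Q)) \<Longrightarrow> outcome_single G H \<alpha> \<beta> q (rep Q)"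
    and "\<not> (valid Q \<and> acyclic (blocking \<alpha> (trans_of Q))) \<Longrightarrow> outcome_none G H \<alpha> \<beta> q"
proof -
  note c = good_cycle[OF P]
  show "\<alpha> v \<noteq> \<beta> v \<Longrightarrow> outcome_none G H \<alpha> \<beta> q" using c(1) by (intro outcome_noneI) blast
  show "outcome_none G H \<alpha> \<beta> q" if "\<not> (valid Q \<and> acyclic (blocking \<alpha> (trans_of Q)))"
    using c(2) that unfolding Q by (intro outcome_noneI) (metis good_def)
  assume *: "\<alpha> v = \<beta> v" "valid Q" "acyclic (blocking \<alpha> (trans_of Q))"
  obtain u where "(v, u) \<in> blocking \<alpha> (trans_of P)" using tranclD[OF P(3)] by blast
  then have v: "v \<in> pverts G" by (auto simp: blocking_def dest: G.in_arcsD1)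
  have "H.pwalk (\<alpha> q) Q (\<beta> q)"
    unfolding Q diff_conv_add_uminus
    by (rule H.pwalk_add[OF tree_path_pwalk[OF \<alpha> v]])
      (use H.pwalk_uminus[OF tree_path_pwalk[OF \<beta> v]] *(1) in simp)
  then have "good Q" using * by (simp add: good_def)
  then show "outcome_single G H \<alpha> \<beta> q (rep Q)" using c(2) Q by (intro outcome_singleI) blast
qed

text \<open>By \<open>good_cycle\<close> a blocking cycle of any valid walk allows only one good
  walk. So if \<open>P\<close> and \<open>R + P\<close> are good, no member of the orbit has a
  cycle; and if \<open>R + P\<close> is valid but has one, every good walk equals
  \<open>P\<close>.\<close>

lemma powers_outcome:
  assumes R: "H.pwalk (\<alpha> q) R (\<alpha> q)" "R \<noteq> 0" and P: "good P"
    and all: "\<And>Q. valid Q \<Longrightarrow> \<exists>n. Q = ztimes n R + P"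
    and all': "valid (R + P) \<Longrightarrow> (\<And>n. valid (ztimes n R + P))"
    and single: "\<not> valid (R + P) \<Longrightarrow> (\<And>Q. valid Q \<Longrightarrow> Q = P)"
  shows "good (R + P) \<Longrightarrow> outcome_powers G H \<alpha> \<beta> q (rep R) (rep P)"
    and "\<not> good (R + P) \<Longrightarrow> outcome_single G H \<alpha> \<beta> q (rep P)"
proof -
  have Pw: "H.pwalk (\<alpha> q) P (\<beta> q)" using P by (simp add: good_def)
  have pw: "H.pwalk (\<alpha> q) (ztimes n R + P) (\<beta> q)" for n
  proof -
    have w: "is_walk H (\<alpha> q) (walk_pow (rep R) n) (\<alpha> q)" using R by (intro H.walk_pow_walk) (simp add: H.pwalk_def)
    have "H.pwalk (\<alpha> q) (ztimes n R) (\<alpha> q)"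
      using H.pwalk_cls[OF w] by (simp add: cls_walk_pow)
    then show ?thesis using Pw by (rule H.pwalk_add)
  qed
  show "outcome_powers G H \<alpha> \<beta> q (rep R) (rep P)" if RP: "good (R + P)"
  proof (rule outcome_powersI[OF R(1) Pw])
    fix Q
    show "good Q \<longleftrightarrow> (\<exists>n. Q = ztimes n R + P)"
    proof
      assume "good Q"
      then show "\<exists>n. Q = ztimes n R + P" using all by (simp add: good_def)
    next
      assume "\<exists>n. Q = ztimes n R + P"
      then obtain n where n: "Q = ztimes n R + P" ..
      have v: "valid Q" using all' RP by (simp add: n good_def)
      show "good Q"
      proof (rule ccontr)
        assume "\<not> good Q"
        then have "\<not> acyclic (blocking \<alpha> (trans_of Q))" using v pw n by (auto simp: good_def)
        then obtain x where x: "(x, x) \<in> (blocking \<alpha> (trans_of Q))\<^sup>+" using not_acyclic_cycle by blast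
        have "R + P = 0 + P" using good_cycle(2)[OF _ v x] pw n P RP by (metis add_0)
        then have "R = 0" by (simp only: add_right_cancel)
        then show False using R(2) by simp
      qed
    qed
  qed
  show "outcome_single G H \<alpha> \<beta> q (rep P)" if RP: "\<not> good (R + P)"
  proof (rule outcome_singleI)
    fix Q
    show "good Q \<longleftrightarrow> Q = P"
    proof
      assume Q: "good Q"
      show "Q = P"
      proof (cases "valid (R + P)")
        case True
        then have "\<not> acyclic (blocking \<alpha> (trans_of (R + P)))" using RP pw[of 1] by (auto simp: good_def)
        then obtain x where x: "(x, x) \<in> (blocking \<alpha> (trans_of (R + P)))\<^sup>+" using not_acyclic_cycle by blast
        show ?thesis using good_cycle(2)[OF _ True x] pw[of 1] P Q by (metis ztimes_1)
      next
        case False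
        then show ?thesis using single Q by (simp add: good_def)
      qed
    qed (use P in simp)
  qed
qed

section \<open>Axes of the images of fundamental closed walks\<close>

definition core_data :: "('a \<Rightarrow> 'b) \<Rightarrow> 'a \<Rightarrow> 'a \<Rightarrow> 'b list \<Rightarrow> nat \<Rightarrow> (int \<Rightarrow> 'b fg) \<Rightarrow> bool" where
  "core_data f u v xs i \<gamma> \<longleftrightarrow>
     (u, v) \<in> parcs G \<and> loop_of f u v \<noteq> 0 \<and> H.vwalk xs \<and> is_red (arcs_of xs) \<and> path xs = loop_of f u v \<and>
     hd xs = f q \<and> core_index xs i \<and> \<gamma> 0 = path (take (Suc i) xs) \<and> trail_of (core_walk xs i) \<gamma>"

lemma core_data_length: "core_data f u v xs i \<gamma> \<Longrightarrow> length xs \<ge> 2"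
  unfolding core_data_def by (cases xs rule: path.cases) auto

lemma core_data_axis:
  assumes "core_data f u v xs i \<gamma>"
  shows "axis \<gamma> (loop_of f u v) (int (core_length xs i))" "trail_of (core_walk xs i) \<gamma>"
    "core_walk xs i k \<noteq> core_walk xs i (k + 1)" "(core_walk xs i k, core_walk xs i (k + 1)) \<in> parcs H"
proof -
  note c = assms[unfolded core_data_def]
  note a = core_walk_axis[of xs i \<gamma>]
  show "axis \<gamma> (loop_of f u v) (int (core_length xs i))" "trail_of (core_walk xs i) \<gamma>"
    "core_walk xs i k \<noteq> core_walk xs i (k + 1)"
    using a(1,2) c core_data_length[OF assms] by auto
  obtain j where j: "Suc j < length xs" "core_walk xs i k = xs ! j" "core_walk xs i (k + 1) = xs ! Suc j"
    using a(3) c core_data_length[OF assms] by blast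
  show "(core_walk xs i k, core_walk xs i (k + 1)) \<in> parcs H"
    using c j by (simp add: H.vwalk_def successively_conv_nth)
qed

text \<open>Makes points of the axis walks of \<open>H\<close>, so that
  \<open>\<gamma> s - \<eta> 0\<close> is a walk of \<open>H\<close> as soon as the colors at its
  seam agree.\<close>

lemma core_data_pwalk:
  assumes "core_data f u v xs i \<gamma>"
  shows "H.pwalk (f q) (\<gamma> k) (core_walk xs i k)"
proof (induction k rule: int_induct[where k = 0])
  case base
  note c = assms[unfolded core_data_def]
  have i: "i < length xs" using c by (auto simp: core_index_def palindromic_def)
  have "H.vwalk (take (Suc i) xs)"
    using c i unfolding H.vwalk_def by (metis append_take_drop_id successively_append_iff set_take_subset subset_trans take_eq_Nil nat.simps(3))
  moreover have "last (take (Suc i) xs) = core_walk xs i 0" "hd (take (Suc i) xs) = f q"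
    using i c by (auto simp: take_Suc_conv_app_nth core_walk_def) (auto simp: hd_append hd_conv_nth)
  ultimately show ?case using H.vwalk_pwalk c by metis
next
  case (step1 k)
  then show ?case
    using core_data_axis(2,4)[OF assms] H.pwalk_add[OF step1(2) H.pwalk_ed] by (metis trail_of_def)
next
  case (step2 k)
  have "\<gamma> k = \<gamma> (k - 1) + ed (core_walk xs i (k - 1)) (core_walk xs i k)"
    using core_data_axis(2)[OF assms] unfolding trail_of_def by (metis diff_add_cancel)
  then have 1: "\<gamma> (k - 1) = \<gamma> k + ed (core_walk xs i k) (core_walk xs i (k - 1))" by (simp add: add.assoc)
  have "(core_walk xs i k, core_walk xs i (k - 1)) \<in> parcs H"
    using core_data_axis(4)[OF assms, of "k - 1"] H.arcs_symmetric by simp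
  then show ?case unfolding 1 using H.pwalk_add[OF step2(2) H.pwalk_ed] by blast
qed

lemma ex_core_data:
  assumes f: "f \<in> homs G H" and e: "(u, v) \<in> parcs G" "loop_of f u v \<noteq> 0"
  shows "\<exists>xs i \<gamma>. core_data f u v xs i \<gamma>"
proof -
  have "is_walk H (f q) (rep (loop_of f u v)) (f q)"
    using loop_of_pwalk[OF f e(1)] by (simp add: H.pwalk_def)
  from H.vwalk_of_walk[OF this] obtain xs where xs: "H.vwalk xs" "hd xs = f q" "last xs = f q"
    "arcs_of xs = rep (loop_of f u v)" by blast
  have p: "path xs = loop_of f u v" using cls_arcs_of[of xs] xs(4) by simp
  have r: "is_red (arcs_of xs)" using xs(4) by simp
  have "length xs \<ge> 2" using p e(2) by (cases xs rule: path.cases) auto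
  then obtain i where "core_index xs i" using ex_core_index[OF r] xs by auto
  moreover obtain \<gamma> where "\<gamma> 0 = path (take (Suc i) xs)" "trail_of (core_walk xs i) \<gamma>"
    using ex_trail by blast
  ultimately show ?thesis using xs p r e unfolding core_data_def by blast
qed

text \<open>\<open>Q\<close> maps one axis onto the other and so arcs to arcs; comparing the arcs at
  position 0 gives the equality of colors. Thus every solution in the group is a walk of
  \<open>H\<close> between the right ends.\<close>

lemma core_intertwine:
  assumes x: "core_data f u v xs i \<gamma>" and y: "core_data f' u' v' ys j \<eta>"
    and Q: "loop_of f u v + Q = Q + loop_of f' u' v'"
  shows "\<exists>s. (\<forall>k. Q + \<eta> k = \<gamma> (k + s)) \<and> Q = \<gamma> s - \<eta> 0 \<and> core_walk xs i s = core_walk ys j 0"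
    and "H.pwalk (f q) Q (f' q)"
proof -
  obtain s where s: "\<And>k. Q + \<eta> k = \<gamma> (k + s)"
    using axis_intertwine[OF core_data_axis(1)[OF x] core_data_axis(1)[OF y] Q] by blast
  have Qs: "Q = \<gamma> s - \<eta> 0" using s[of 0] by (metis add.left_neutral add_diff_cancel)
  have "ed (core_walk ys j 0) (core_walk ys j 1) = - \<eta> 0 + \<eta> 1"
    using core_data_axis(2)[OF y] unfolding trail_of_def by (metis add_0 minus_add_cancel)
  also have "\<dots> = - \<gamma> s + \<gamma> (s + 1)"
    using s[of 0] s[of 1] diff_translate[of Q "\<eta> 0" "\<eta> 1"] by (simp add: add.commute)
  also have "\<dots> = ed (core_walk xs i s) (core_walk xs i (s + 1))"
    using core_data_axis(2)[OF x] unfolding trail_of_def by (metis minus_add_cancel)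
  finally have z: "core_walk xs i s = core_walk ys j 0"
    using core_data_axis(3)[OF x, of s] core_data_axis(3)[OF y, of 0] by (metis add_0 list.inject prod.inject rep_ed)
  show "\<exists>s. (\<forall>k. Q + \<eta> k = \<gamma> (k + s)) \<and> Q = \<gamma> s - \<eta> 0 \<and> core_walk xs i s = core_walk ys j 0"
    using s Qs z by blast
  show "H.pwalk (f q) Q (f' q)"
    unfolding Qs diff_conv_add_uminus
    using H.pwalk_add[OF core_data_pwalk[OF x, of s]] H.pwalk_uminus[OF core_data_pwalk[OF y, of 0]] z by metis
qed

end

lemma ztimes_commute: "h + x = x + h \<Longrightarrow> h + ztimes n x = ztimes n x + h"
proof (induction n rule: int_induct[where k = 0])
  case (step1 n)
  then show ?case unfolding ztimes_Suc by (metis add.assoc)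
next
  case (step2 n)
  have "h + - x = - x + h" using step2.prems by (metis add.assoc add.right_inverse add_0_right minus_add_cancel)
  then show ?case using step2 unfolding ztimes_pred by (metis add.assoc)
qed simp

text \<open>A nonzero power has the same line as axis, so an element that commutes with the power
  already shifts this line.\<close>

lemma axis_ztimes_centralizer:
  assumes R: "axis \<gamma> R r" and n: "n \<noteq> 0" and h: "h + ztimes n R = ztimes n R + h"
  shows "\<exists>s. \<forall>k. h + \<gamma> k = \<gamma> (k + s)"
proof -
  have "\<exists>m > 0. h + ztimes m R = ztimes m R + h"
  proof (cases "n > 0")
    case False
    have "ztimes (- n) R = - ztimes n R" using ztimes_minus[of n R] by (simp add: eq_neg_iff_add_eq_0)
    moreover have "h + - ztimes n R = - ztimes n R + h"
      using h by (metis add.assoc add.right_inverse add_0_right minus_add_cancel)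
    ultimately show ?thesis using n False by (intro exI[of _ "- n"]) auto
  qed (use h in auto)
  then obtain m where m: "m > 0" "h + ztimes m R = ztimes m R + h" by blast
  have "axis \<gamma> (ztimes m R) (m * r)"
    using R m(1) by (auto simp: axis_ztimes[OF R] axis_def)
  then show ?thesis using axis_intertwine[of \<gamma> "ztimes m R" "m * r" \<gamma> "ztimes m R" "m * r" h] m(2) by simp
qed

section \<open>The orbit of solutions for one closed walk\<close>

locale core = recoloring +
  fixes u0 v0 :: 'a and xs ys :: "'b list" and i j :: nat and \<gamma> \<eta> :: "int \<Rightarrow> 'b fg"
  assumes X: "core_data \<alpha> u0 v0 xs i \<gamma>" and Y: "core_data \<beta> u0 v0 ys j \<eta>"
begin

abbreviation "g \<equiv> loop_of \<alpha> u0 v0"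
abbreviation "g' \<equiv> loop_of \<beta> u0 v0"

lemma arc0: "(u0, v0) \<in> parcs G"
  using X by (simp add: core_data_def)

lemma valid_core: "valid Q \<Longrightarrow> g + Q = Q + g'"
  using arc0 by (auto simp: valid_def)

lemma line_\<gamma>: "line \<gamma>" and line_\<eta>: "line \<eta>"
  using core_data_axis(1)[OF X] core_data_axis(1)[OF Y] by (auto simp: axis_def)

text \<open>Stated with the comparison of colors that the program makes, so that the first hit of
  its search is the least period.\<close>

definition period :: "nat \<Rightarrow> bool" where
  "period r \<longleftrightarrow> 0 < r \<and> core_walk xs i (int r) = core_walk xs i 0 \<and> (\<gamma> (int r) - \<gamma> 0) + g = g + (\<gamma> (int r) - \<gamma> 0)"

lemma period_core_length: "period (core_length xs i)"
proof -
  have "g + \<gamma> 0 = \<gamma> (int (core_length xs i))" "core_length xs i > 0"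
    using core_data_axis(1)[OF X] by (auto simp: axis_def)
  then have "\<gamma> (int (core_length xs i)) - \<gamma> 0 = g" by (metis add_diff_cancel)
  then show ?thesis using \<open>core_length xs i > 0\<close> by (simp add: period_def core_walk_def)
qed

text \<open>
  Walks valid for one closed walk \<open>C\<close> with \<open>\<alpha>(C) = g \<noteq> \<epsilon>\<close> form one orbit of \<open>R\<close>. Either all closed
  walks give powers of \<open>R\<close>, and then \<open>C\<close> is as good as all of them, or some closed walk does not
  commute with \<open>C\<close>, and the two determine the solution.
\<close>
definition witness :: "'a \<Rightarrow> 'a \<Rightarrow> bool" where
  "witness u v \<longleftrightarrow> (u, v) \<in> parcs G \<and>
     (loop_of \<alpha> u v + g \<noteq> g + loop_of \<alpha> u v \<or>
      (u, v) = (u0, v0) \<and> (\<forall>(x, y) \<in> parcs G. loop_of \<alpha> x y + g = g + loop_of \<alpha> x y))"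

definition pass :: "'a \<Rightarrow> 'a \<Rightarrow> 'b fg \<Rightarrow> bool" where
  "pass u v Q \<longleftrightarrow> g + Q = Q + g' \<and> loop_of \<alpha> u v + Q = Q + loop_of \<beta> u v"

context
  fixes r :: nat
  assumes r: "period r" and least: "\<And>k. 0 < k \<Longrightarrow> k < r \<Longrightarrow> \<not> period k"
begin

abbreviation "R \<equiv> \<gamma> (int r) - \<gamma> 0"

text \<open>By \<open>core_intertwine\<close> a shift that commutes with \<open>g\<close> also
  preserves the color. So minimality among periods is minimality among all commuting shifts, as
  \<open>axis_centralizer\<close> asks for.\<close>

lemma least': "0 < k \<Longrightarrow> k < int r \<Longrightarrow> (\<gamma> k - \<gamma> 0) + g \<noteq> g + (\<gamma> k - \<gamma> 0)"
proof
  assume k: "0 < k" "k < int r" "(\<gamma> k - \<gamma> 0) + g = g + (\<gamma> k - \<gamma> 0)"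
  obtain s where s: "\<gamma> k - \<gamma> 0 = \<gamma> s - \<gamma> 0" "core_walk xs i s = core_walk xs i 0"
    using core_intertwine(1)[OF X X k(3)[symmetric]] by blast
  then have "\<gamma> k = \<gamma> s" by (metis diff_add_cancel)
  then have "s = k" using line_inj[OF line_\<gamma>] by metis
  then have "core_walk xs i k = core_walk xs i 0" using s(2) by blast
  moreover have "int (nat k) = k" "0 < nat k" using k(1) by auto
  ultimately have "period (nat k)" unfolding period_def using k(3) by presburger
  then show False using least[of "nat k"] k by simp
qed

lemma centralizer: "h + g = g + h \<longleftrightarrow> (\<exists>n. h = ztimes n R)"
  and axis_R: "axis \<gamma> R (int r)"
  using axis_centralizer[OF core_data_axis(1)[OF X], of "int r"] r least' by (auto simp: period_def)

lemma R_pwalk: "H.pwalk (\<alpha> q) R (\<alpha> q)"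
  using core_intertwine(2)[OF X X] r by (auto simp: period_def)

lemma R_nonzero: "R \<noteq> 0"
proof
  assume "R = 0"
  then have "\<gamma> (int r) = \<gamma> 0" by simp
  then show False using line_inj[OF line_\<gamma>, of "int r" 0] r by (simp add: period_def)
qed

lemma centralizer_power:
  assumes "h + ztimes n R = ztimes n R + h" "n \<noteq> 0"
  shows "h + g = g + h" "h + R = R + h"
proof -
  obtain s where s: "\<And>k. h + \<gamma> k = \<gamma> (k + s)" using axis_ztimes_centralizer[OF axis_R assms(2,1)] by blast
  have "g + \<gamma> k = \<gamma> (k + int (core_length xs i))" "R + \<gamma> k = \<gamma> (k + int r)" for k
    using core_data_axis(1)[OF X] axis_R by (auto simp: axis_def)
  then show "h + g = g + h" "h + R = R + h" using translations_commute s by blast+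
qed

text \<open>The difference of two solutions commutes with \<open>g\<close>.\<close>

lemma solution_power:
  assumes "g + P = P + g'" "g + Q = Q + g'"
  shows "\<exists>n. Q = ztimes n R + P"
proof -
  have "- P + g = g' + - P" using assms(1) by (metis add.assoc add.right_inverse add_0_right minus_add_cancel)
  then have "(Q - P) + g = g + (Q - P)"
    using assms(2) unfolding diff_conv_add_uminus by (metis add.assoc)
  then obtain n where "Q - P = ztimes n R" using centralizer by blast
  then have "Q = ztimes n R + P" by (metis diff_add_cancel)
  then show ?thesis ..
qed

lemma shift_valid:
  assumes P: "valid P" and c: "\<And>u v. (u, v) \<in> parcs G \<Longrightarrow> loop_of \<alpha> u v + h = h + loop_of \<alpha> u v"
  shows "valid (h + P)"
  unfolding valid_def
proof clarify
  fix u v assume e: "(u, v) \<in> parcs G"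
  have "loop_of \<alpha> u v + P = P + loop_of \<beta> u v" using P e by (auto simp: valid_def)
  then show "loop_of \<alpha> u v + (h + P) = h + P + loop_of \<beta> u v" using c[OF e] by (metis add.assoc)
qed

lemma shift_valid_commute:
  assumes P: "valid P" and hP: "valid (h + P)" and e: "(u, v) \<in> parcs G"
  shows "loop_of \<alpha> u v + h = h + loop_of \<alpha> u v"
proof -
  have 1: "loop_of \<alpha> u v + P = P + loop_of \<beta> u v" "loop_of \<alpha> u v + (h + P) = h + P + loop_of \<beta> u v"
    using P hP e by (auto simp: valid_def)
  then have "loop_of \<alpha> u v + h + P = h + loop_of \<alpha> u v + P" by (metis add.assoc)
  then show ?thesis by simp
qed

text \<open>Two different valid walks differ by a nonzero power of \<open>R\<close> that commutes
  with the images of all closed walks. By \<open>centralizer_power\<close> then so does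
  \<open>R\<close>, and the whole orbit is valid.\<close>

lemma valid_powers:
  assumes P: "valid P"
  shows "valid Q \<Longrightarrow> \<exists>n. Q = ztimes n R + P" and "valid (R + P) \<Longrightarrow> valid (ztimes n R + P)"
    and "\<not> valid (R + P) \<Longrightarrow> valid Q \<Longrightarrow> Q = P"
proof -
  show ex: "\<exists>n. Q = ztimes n R + P" if "valid Q" using solution_power valid_core P that by blast
  show "valid (ztimes n R + P)" if "valid (R + P)"
    by (rule shift_valid[OF P]) (intro ztimes_commute shift_valid_commute[OF P that])
  show "Q = P" if "\<not> valid (R + P)" "valid Q"
  proof (rule ccontr)
    assume "Q \<noteq> P"
    from ex[OF that(2)] obtain n where n: "Q = ztimes n R + P" ..
    then have n0: "n \<noteq> 0" using \<open>Q \<noteq> P\<close> by auto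
    have "loop_of \<alpha> u v + R = R + loop_of \<alpha> u v" if e: "(u, v) \<in> parcs G" for u v
      using centralizer_power(2)[OF shift_valid_commute[OF P _ e] n0] \<open>valid Q\<close> n by blast
    then show False using shift_valid[OF P] that by blast
  qed
qed

lemma valid_pwalk: "valid P \<Longrightarrow> H.pwalk (\<alpha> q) P (\<beta> q)"
  using core_intertwine(2)[OF X Y] valid_core by blast

lemma period_outcome:
  assumes P: "valid P" "acyclic (blocking \<alpha> (trans_of P))"
  shows "valid (R + P) \<Longrightarrow> acyclic (blocking \<alpha> (trans_of (R + P))) \<Longrightarrow> outcome_powers G H \<alpha> \<beta> q (rep R) (rep P)"
    and "\<not> (valid (R + P) \<and> acyclic (blocking \<alpha> (trans_of (R + P)))) \<Longrightarrow> outcome_single G H \<alpha> \<beta> q (rep P)"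
  using powers_outcome[OF R_pwalk R_nonzero, of P] valid_powers[OF P(1)] P valid_pwalk
  by (auto simp: good_def)

text \<open>If the witness commutes with \<open>g\<close>, all images are powers of
  \<open>R\<close>, and every shift of a valid walk is valid. If not, the witness pins down the
  shift. In both cases an invalid hit of the search proves that there is no valid walk.\<close>

lemma pass_valid:
  assumes w: "witness u v" and P: "pass u v P" and Q: "valid Q"
  shows "valid P"
proof -
  have gP: "g + P = P + g'" and hP: "loop_of \<alpha> u v + P = P + loop_of \<beta> u v" using P by (auto simp: pass_def)
  obtain n where n: "P = ztimes n R + Q" using solution_power[OF valid_core[OF Q] gP] by blast
  show ?thesis
  proof (cases "loop_of \<alpha> u v + g = g + loop_of \<alpha> u v")
    case True
    then have com: "loop_of \<alpha> x y + g = g + loop_of \<alpha> x y" if "(x, y) \<in> parcs G" for x y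
      using w that by (auto simp: witness_def)
    have "loop_of \<alpha> x y + ztimes n R = ztimes n R + loop_of \<alpha> x y" if e: "(x, y) \<in> parcs G" for x y
    proof -
      obtain m where m: "loop_of \<alpha> x y = ztimes m R" using com[OF e] centralizer by blast
      have "R + ztimes m R = ztimes m R + R" by (rule ztimes_commute) simp
      then show ?thesis unfolding m by (intro ztimes_commute) simp
    qed
    then show ?thesis unfolding n by (rule shift_valid[OF Q])
  next
    case False
    have "loop_of \<alpha> u v + Q = Q + loop_of \<beta> u v" using Q w by (auto simp: valid_def witness_def)
    then have "loop_of \<alpha> u v + ztimes n R + Q = ztimes n R + loop_of \<alpha> u v + Q"
      using hP unfolding n by (metis add.assoc)
    then have "n = 0" using centralizer_power(1)[of "loop_of \<alpha> u v" n] False by auto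
    then show ?thesis using n Q by simp
  qed
qed

text \<open>A witness that does not commute with \<open>g\<close> bounds the shift by
  \<open>axis_shift_bound\<close>. In the other case \<open>g\<close> carries solutions to
  solutions, so the shift can be reduced modulo the length of the core.\<close>

lemma search_complete:
  assumes w: "witness u v" and Q: "valid Q"
    and N: "\<And>x y. (x, y) \<in> parcs G \<Longrightarrow> len (loop_of \<alpha> x y) \<le> 2 * N \<and> len (loop_of \<beta> x y) \<le> 2 * N"
  shows "\<exists>s. \<bar>s\<bar> \<le> 10 * int N \<and> core_walk xs i s = core_walk ys j 0 \<and> pass u v (\<gamma> s - \<eta> 0)"
proof -
  obtain s where s: "\<And>k. Q + \<eta> k = \<gamma> (k + s)" "Q = \<gamma> s - \<eta> 0" "core_walk xs i s = core_walk ys j 0"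
    using core_intertwine(1)[OF X Y valid_core[OF Q]] by blast
  \<comment> \<open>The core and the tail, once in each direction, make up the reduced closed walk,
    which has at most \<open>2 * N\<close> arcs.\<close>
  have len_core: "int (core_length zs k) + 2 * int (len (\<xi> 0)) \<le> 2 * int N"
    if c: "core_data f u0 v0 zs k \<xi>" and l: "len (loop_of f u0 v0) \<le> 2 * N" for f zs k and \<xi> :: "int \<Rightarrow> 'b fg"
  proof -
    have c': "is_red (arcs_of zs)" "path zs = loop_of f u0 v0" "core_index zs k" "\<xi> 0 = path (take (Suc k) zs)"
      using c by (auto simp: core_data_def)
    have "rep (path zs) = arcs_of zs" using c'(1) rep_cls_is_red[of "arcs_of zs"] by (simp add: cls_arcs_of)
    then have "length zs - 1 \<le> 2 * N" using l c'(2) by (simp add: len_def)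
    moreover have "len (path ws) \<le> length ws - 1" for ws :: "'b list"
    proof (induction ws rule: path.induct)
      case (3 x y ws)
      have "len (ed x y) \<le> 1" by (cases "x = y") (auto simp: len_def rep_ed)
      then show ?case using 3 len_add_le[of "ed x y" "path (y # ws)"] by simp
    qed auto
    then have "len (\<xi> 0) \<le> k" using c'(4) by (metis diff_Suc_1 length_take min.cobounded2 diff_le_mono le_trans)
    moreover have "2 * k + 4 \<le> length zs"
      using palindromic_length[OF c'(1)] c'(3) core_data_length[OF c] by (auto simp: core_index_def)
    ultimately show ?thesis by (simp add: core_length_def)
  qed
  note lx = len_core[OF X conjunct1[OF N[OF arc0]]] and ly = len_core[OF Y conjunct2[OF N[OF arc0]]]
  have d: "axis \<gamma> g (int (core_length xs i))" by (rule core_data_axis(1)[OF X])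
  show ?thesis
  proof (cases "loop_of \<alpha> u v + g = g + loop_of \<alpha> u v")
    case False
    have e: "(u, v) \<in> parcs G" using w by (simp add: witness_def)
    have "loop_of \<alpha> u v + Q = Q + loop_of \<beta> u v" using Q e by (auto simp: valid_def)
    \<comment> \<open>The terms add up to at most \<open>8 * N\<close>: two closed walks, and two
      tails taken twice, one of them together with its core, contribute at most \<open>2 * N\<close>
      each. The factor 10 leaves room.\<close>
    from axis_shift_bound[OF d line_\<eta> s(1) this False] N[OF e] lx ly
    have "\<bar>s\<bar> \<le> 10 * int N" by linarith
    moreover have "pass u v Q" using Q e valid_core by (auto simp: pass_def valid_def)
    ultimately show ?thesis using s by blast
  next
    case True
    then have uv: "u = u0" "v = v0" using w by (auto simp: witness_def)
    define l where "l = int (core_length xs i)"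
    have l: "l > 0" using d by (simp add: axis_def l_def)
    define t where "t = s mod l"
    have t: "0 \<le> t" "t < l" using l by (simp_all add: t_def)
    have "ztimes (- (s div l)) g + \<gamma> s = \<gamma> (s + - (s div l) * l)" using axis_ztimes[OF d] by (simp only: l_def)
    also have "s + - (s div l) * l = t" by (simp add: t_def minus_div_mult_eq_mod[symmetric])
    finally have Qt: "ztimes (- (s div l)) g + Q = \<gamma> t - \<eta> 0"
      unfolding s(2) diff_conv_add_uminus by (metis add.assoc)
    have "g + (ztimes n g + Q) = (ztimes n g + Q) + g'" for n
    proof -
      have "g + ztimes n g = ztimes n g + g" by (rule ztimes_commute) simp
      then have "g + (ztimes n g + Q) = ztimes n g + (g + Q)" by (simp flip: add.assoc)
      also have "\<dots> = ztimes n g + (Q + g')" using valid_core[OF Q] by simp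
      finally show ?thesis by (simp add: add.assoc)
    qed
    from this[of "- (s div l)"] have "g + (\<gamma> t - \<eta> 0) = (\<gamma> t - \<eta> 0) + g'" unfolding Qt .
    then have "pass u v (\<gamma> t - \<eta> 0)" by (simp add: pass_def uv)
    moreover have "core_walk xs i t = core_walk ys j 0"
      using s(3) unfolding t_def l_def core_walk_def by simp
    moreover have "\<bar>t\<bar> \<le> 10 * int N" using t lx l unfolding l_def by linarith
    ultimately show ?thesis by blast
  qed
qed

end

end

theorem (in recoloring) outcome_exists:
  "outcome_none G H \<alpha> \<beta> q \<or> (\<exists>Q. outcome_single G H \<alpha> \<beta> q Q) \<or>
   (\<exists>R P. outcome_powers G H \<alpha> \<beta> q R P) \<or> outcome_all G H \<alpha> \<beta> q"
proof (cases "\<exists>P. good P")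
  case False
  then show ?thesis using outcome_noneI by blast
next
  case True
  then obtain P where P: "good P" ..
  show ?thesis
  proof (cases "\<forall>(u, v) \<in> parcs G. loop_of \<alpha> u v = 0")
    case triv: True
    have "loop_of \<beta> u v = 0" if e: "(u, v) \<in> parcs G" for u v
    proof -
      have "loop_of \<alpha> u v + P = P + loop_of \<beta> u v" "loop_of \<alpha> u v = 0"
        using P e triv by (auto simp: good_def valid_def)
      then show ?thesis by (metis add.right_neutral add_0 add_left_cancel)
    qed
    then show ?thesis using trivial_all triv by fast
  next
    case False
    then obtain u v where e: "(u, v) \<in> parcs G" "loop_of \<alpha> u v \<noteq> 0" by blast
    have "loop_of \<alpha> u v + P = P + loop_of \<beta> u v" using P e by (auto simp: good_def valid_def)
    then have "loop_of \<beta> u v \<noteq> 0" using e(2) by (metis add_0 add_0_right add_right_cancel)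
    then obtain xs i \<gamma> ys j \<eta> where "core_data \<alpha> u v xs i \<gamma>" "core_data \<beta> u v ys j \<eta>"
      using ex_core_data \<alpha> \<beta> e by metis
    then interpret core G H \<alpha> \<beta> q W u v xs ys i j \<gamma> \<eta> by unfold_locales
    obtain r where "period r" "\<And>k. 0 < k \<Longrightarrow> k < r \<Longrightarrow> \<not> period k"
      using exists_least_iff[of period] period_core_length by blast
    from period_outcome[OF this, of P] P show ?thesis unfolding good_def by blast
  qed
qed

section \<open>The classification\<close>

text \<open>\<open>connected\<close> is strong connectivity of the symmetric closure, and a
  symmetric graph is its own closure.\<close>

lemma conn_reflexive_graph_reachable:
  assumes "conn_reflexive_graph G" "u \<in> pverts G" "v \<in> pverts G"
  shows "\<exists>p. is_walk G u p v"
proof -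
  interpret refl_graph G using assms(1) by (simp add: conn_reflexive_graph_def refl_graph_iff)
  have "(\<Union>e \<in> parcs G. {(fst e, snd e), (snd e, fst e)}) = parcs G"
    using arcs_symmetric by auto
  then have "mk_symmetric (with_proj G) = G" by (simp add: mk_symmetric_def)
  then have "strongly_connected (with_proj G)"
    using assms(1) by (simp add: conn_reflexive_graph_def connected_def)
  then have "u \<rightarrow>\<^sup>*\<^bsub>with_proj G\<^esub> v"
    using assms(2,3) by (simp add: strongly_connected_def)
  then show ?thesis by (simp add: reachable_awalk)
qed

lemma hom_pair_recoloring:
  assumes "hom_pair G H \<alpha> \<beta> q"
    and "\<And>v. v \<in> pverts G \<Longrightarrow> refl_graph.vwalk G (W v) \<and> hd (W v) = q \<and> last (W v) = v" "set (W q) = {q}"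
  shows "recoloring G H \<alpha> \<beta> q W"
proof -
  have "refl_graph G" "refl_graph H"
    using assms(1) by (auto simp: hom_pair_def conn_reflexive_graph_def refl_graph_iff)
  then interpret hom_graphs G H by (rule hom_graphs.intro)
  show ?thesis using assms by unfold_locales (auto simp: hom_pair_def)
qed

lemma ex_recoloring:
  assumes h: "hom_pair G H \<alpha> \<beta> q"
  shows "\<exists>W. recoloring G H \<alpha> \<beta> q W"
proof -
  have G: "refl_graph G" "conn_reflexive_graph G" and q: "q \<in> pverts G"
    using h by (auto simp: hom_pair_def conn_reflexive_graph_def refl_graph_iff)
  have "\<exists>xs. refl_graph.vwalk G xs \<and> hd xs = q \<and> last xs = v \<and> (v = q \<longrightarrow> xs = [q])" if "v \<in> pverts G" for v
  proof (cases "v = q")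
    case True
    then show ?thesis using q by (intro exI[of _ "[q]"]) (auto simp: refl_graph.vwalk_def[OF G(1)])
  next
    case False
    then show ?thesis
      using conn_reflexive_graph_reachable[OF G(2) q that] refl_graph.vwalk_of_walk[OF G(1)] by blast
  qed
  then obtain W where W: "\<And>v. v \<in> pverts G \<Longrightarrow>
      refl_graph.vwalk G (W v) \<and> hd (W v) = q \<and> last (W v) = v \<and> (v = q \<longrightarrow> W v = [q])"
    by metis
  have "recoloring G H \<alpha> \<beta> q W"
    by (rule hom_pair_recoloring[OF h]) (use W q in auto)
  then show ?thesis by (intro exI[of _ W])
qed

context recoloring
begin

definition closed_path :: "'a \<Rightarrow> 'a \<Rightarrow> 'a list" where
  "closed_path u v = W u @ rev (W v)"

lemma path_closed_path:
  assumes "u \<in> pverts G" "v \<in> pverts G"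
  shows "path (map f (closed_path u v)) = loop_of f u v"
proof -
  have "W u \<noteq> []" "W v \<noteq> []" using W(1) assms by (auto simp: G.vwalk_def)
  then show ?thesis
    using W(3) assms
    by (simp add: closed_path_def path_append path_rev loop_of_def tree_path_def last_map hd_map hd_rev flip: rev_map)
qed

lemma closed_path_vwalk:
  assumes "(u, v) \<in> parcs G"
  shows "G.vwalk (closed_path u v)" "hd (closed_path u v) = q" "last (closed_path u v) = q"
proof -
  have V: "u \<in> pverts G" "v \<in> pverts G" using assms G.in_arcsD1 G.in_arcsD2 by auto
  then have ne: "W u \<noteq> []" "W v \<noteq> []" using W(1) by (auto simp: G.vwalk_def)
  show "G.vwalk (closed_path u v)"
    unfolding closed_path_def
    by (rule G.vwalk_append) (use W V G.vwalk_rev ne assms in \<open>auto simp: hd_rev\<close>)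
  show "hd (closed_path u v) = q" "last (closed_path u v) = q"
    using ne W(2) V by (auto simp: closed_path_def last_rev)
qed

lemma trivial_closed_walks:
  assumes "\<forall>C \<in> closed_walks G. pi_class H (map_walk f C) = pi_class H []"
    and f: "f \<in> homs G H" and e: "(u, v) \<in> parcs G"
  shows "loop_of f u v = 0"
proof -
  let ?C = "arcs_of (closed_path u v)"
  have "?C \<in> closed_walks G"
    using G.vwalk_walk[OF closed_path_vwalk(1)[OF e]] closed_path_vwalk(2,3)[OF e]
    unfolding closed_walks_def by auto
  then have "pi_class H (map_walk f ?C) = pi_class H []" using assms(1) by blast
  moreover have "map_walk f ?C \<in> walks H"
    using H.vwalk_walk[OF vwalk_map[OF f closed_path_vwalk(1)[OF e]]]
    unfolding map_walk_arcs_of walks_def by blast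
  moreover have "is_walk H (f q) [] (f q)" using homs_vert[OF f q] by simp
  then have "[] \<in> walks H" unfolding walks_def by blast
  ultimately have "cls (map_walk f ?C) = 0" using H.pi_class_eq_iff by fastforce
  then show ?thesis
    using path_closed_path[of u v f] e G.in_arcsD1 G.in_arcsD2
    by (auto simp: map_walk_arcs_of cls_arcs_of)
qed

end

theorem classification:
  assumes "hom_pair G H \<alpha> \<beta> q"
  shows "outcome_none G H \<alpha> \<beta> q \<or> (\<exists>Q. outcome_single G H \<alpha> \<beta> q Q) \<or>
      (\<exists>R P. outcome_powers G H \<alpha> \<beta> q R P) \<or> outcome_all G H \<alpha> \<beta> q"
    and "(\<forall>C \<in> closed_walks G. pi_class H (map_walk \<alpha> C) = pi_class H [] \<and>
            pi_class H (map_walk \<beta> C) = pi_class H []) \<Longrightarrow> outcome_all G H \<alpha> \<beta> q"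
proof -
  obtain W where "recoloring G H \<alpha> \<beta> q W" using ex_recoloring[OF assms] ..
  then interpret recoloring G H \<alpha> \<beta> q W .
  show "outcome_none G H \<alpha> \<beta> q \<or> (\<exists>Q. outcome_single G H \<alpha> \<beta> q Q) \<or>
      (\<exists>R P. outcome_powers G H \<alpha> \<beta> q R P) \<or> outcome_all G H \<alpha> \<beta> q"
    by (rule outcome_exists)
  assume *: "\<forall>C \<in> closed_walks G. pi_class H (map_walk \<alpha> C) = pi_class H [] \<and>
            pi_class H (map_walk \<beta> C) = pi_class H []"
  show "outcome_all G H \<alpha> \<beta> q"
    by (rule trivial_all) (use * trivial_closed_walks[OF _ \<alpha>] trivial_closed_walks[OF _ \<beta>] in blast)
qed

section \<open>Programs with bounded loops\<close>

text \<open>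
  Registers below 10 are constants of a program; register 9 contains a bound \<open>V\<close> on all values, and
  addition is modulo \<open>V\<close>, so that no program can exceed the word bound. The loop \<open>For i x b\<close> runs
  \<open>i\<close> from 0 to the value of the constant register \<open>x\<close>.
\<close>

datatype stm =
    Nop
  | Set nat rexp
  | Put nat rexp rexp
  | Then stm stm (infixr \<open>;;\<close> 60)
  | Cond rexp stm stm
  | For nat nat stm

primrec compile :: "stm \<Rightarrow> com" where
  "compile Nop = Skip"
| "compile (Set x e) = Assign x e"
| "compile (Put a i e) = Store a i e"
| "compile (c ;; d) = Seq (compile c) (compile d)"
| "compile (Cond e c d) = If e (compile c) (compile d)"
| "compile (For i x b) =
     Seq (Assign i (Const 0))
       (While (Op Less (Reg i) (Reg x)) (Seq (compile b) (Assign i (Op Add (Reg i) (Const 1)))))"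

definition setreg :: "nat \<Rightarrow> nat \<Rightarrow> ram_state \<Rightarrow> ram_state" where
  "setreg x v s = s\<lparr>regs := (regs s)(x := v)\<rparr>"

definition setarr :: "nat \<Rightarrow> nat \<Rightarrow> nat \<Rightarrow> ram_state \<Rightarrow> ram_state" where
  "setarr a i v s = s\<lparr>arrays := (arrays s)(a := (arrays s a)(i := v))\<rparr>"

lemma regs_setreg[simp]: "regs (setreg x v s) y = (if y = x then v else regs s y)"
  and arrays_setreg[simp]: "arrays (setreg x v s) = arrays s"
  and regs_setarr[simp]: "regs (setarr a i v s) = regs s"
  and arrays_setarr[simp]: "arrays (setarr a i v s) b = (if b = a then (arrays s a)(i := v) else arrays s b)"
  by (simp_all add: setreg_def setarr_def)

text \<open>A total function, so that results of programs are computed by rewriting. That the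
  machine reaches them within the word bound is shown once, in \<open>run_sem\<close>.\<close>

primrec sem :: "stm \<Rightarrow> ram_state \<Rightarrow> ram_state" where
  "sem Nop s = s"
| "sem (Set x e) s = setreg x (eval_rexp s e) s"
| "sem (Put a i e) s = setarr a (eval_rexp s i) (eval_rexp s e) s"
| "sem (c ;; d) s = sem d (sem c s)"
| "sem (Cond e c d) s = (if eval_rexp s e \<noteq> 0 then sem c s else sem d s)"
| "sem (For i x b) s = ((\<lambda>s. setreg i (regs s i + 1) (sem b s)) ^^ regs s x) (setreg i 0 s)"

primrec wregs :: "stm \<Rightarrow> nat set" where
  "wregs Nop = {}"
| "wregs (Set x e) = {x}"
| "wregs (Put a i e) = {}"
| "wregs (c ;; d) = wregs c \<union> wregs d"
| "wregs (Cond e c d) = wregs c \<union> wregs d"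
| "wregs (For i x b) = insert i (wregs b)"

primrec warrs :: "stm \<Rightarrow> nat set" where
  "warrs Nop = {}"
| "warrs (Set x e) = {}"
| "warrs (Put a i e) = {a}"
| "warrs (c ;; d) = warrs c \<union> warrs d"
| "warrs (Cond e c d) = warrs c \<union> warrs d"
| "warrs (For i x b) = warrs b"

lemma regs_sem: "y \<notin> wregs p \<Longrightarrow> regs (sem p s) y = regs s y"
proof (induction p arbitrary: s)
  case (For i x b)
  have "regs (((\<lambda>s. setreg i (regs s i + 1) (sem b s)) ^^ k) (setreg i 0 s)) y = regs s y" for k
    using For by (induction k) auto
  then show ?case by simp
qed auto

lemma arrays_sem: "a \<notin> warrs p \<Longrightarrow> arrays (sem p s) a = arrays s a"
proof (induction p arbitrary: s)
  case (For i x b)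
  have "arrays (((\<lambda>s. setreg i (regs s i + 1) (sem b s)) ^^ k) (setreg i 0 s)) a = arrays s a" for k
    using For by (induction k) auto
  then show ?case by simp
qed auto

text \<open>Expressions whose value stays within the bound on all values: constants are small, and
  sums occur only modulo register 9.\<close>

fun bexp :: "rexp \<Rightarrow> bool" where
  "bexp (Const k) \<longleftrightarrow> k \<le> 10"
| "bexp (Reg x) \<longleftrightarrow> True"
| "bexp (Elem a e) \<longleftrightarrow> bexp e"
| "bexp (Op Sub e1 e2) \<longleftrightarrow> bexp e1 \<and> bexp e2"
| "bexp (Op Less e1 e2) \<longleftrightarrow> bexp e1 \<and> bexp e2"
| "bexp (Op Equal e1 e2) \<longleftrightarrow> bexp e1 \<and> bexp e2"
| "bexp (Op Mod (Op Add e1 e2) e) \<longleftrightarrow> bexp e1 \<and> bexp e2 \<and> e = Reg 9"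
| "bexp _ \<longleftrightarrow> False"

primrec safe :: "stm \<Rightarrow> bool" where
  "safe Nop \<longleftrightarrow> True"
| "safe (Set x e) \<longleftrightarrow> 10 \<le> x \<and> bexp e"
| "safe (Put a i e) \<longleftrightarrow> bexp i \<and> bexp e"
| "safe (c ;; d) \<longleftrightarrow> safe c \<and> safe d"
| "safe (Cond e c d) \<longleftrightarrow> bexp e \<and> safe c \<and> safe d"
| "safe (For i x b) \<longleftrightarrow> 10 \<le> i \<and> x < 10 \<and> i \<notin> wregs b \<and> safe b"

lemma safe_wregs: "safe p \<Longrightarrow> y < 10 \<Longrightarrow> y \<notin> wregs p"
  by (induction p) auto

text \<open>A bound read off from the program text: \<open>u\<close> bounds the constant registers,
  and both branches of a conditional count. In a loop, 6 pays for setting the counter and for the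
  last test, 8 for the test and the increment of one round.\<close>

primrec tm :: "(nat \<Rightarrow> nat) \<Rightarrow> stm \<Rightarrow> nat" where
  "tm u Nop = 1"
| "tm u (Set x e) = 1 + cost e"
| "tm u (Put a i e) = 1 + cost i + cost e"
| "tm u (c ;; d) = tm u c + tm u d"
| "tm u (Cond e c d) = 1 + cost e + tm u c + tm u d"
| "tm u (For i x b) = 6 + u x * (tm u b + 8)"

definition bounded :: "nat \<Rightarrow> ram_state \<Rightarrow> bool" where
  "bounded V s \<longleftrightarrow> 10 \<le> V \<and> regs s 9 = V \<and> (\<forall>x. regs s x \<le> V) \<and> (\<forall>a i. arrays s a i \<le> V)"

lemma bexp_fits: "bounded V s \<Longrightarrow> 2 * V \<le> w \<Longrightarrow> bexp e \<Longrightarrow> eval_rexp s e \<le> V \<and> fits w s e"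
proof (induction e rule: bexp.induct)
  case (7 e1 e2 e)
  then have "eval_rexp s e1 \<le> V" "fits w s e1" "eval_rexp s e2 \<le> V" "fits w s e2" "e = Reg 9" by auto
  moreover have "regs s 9 = V" "0 < V" using 7(3) by (auto simp: bounded_def)
  moreover have "(eval_rexp s e1 + eval_rexp s e2) mod V \<le> V" using \<open>0 < V\<close> by (simp add: less_imp_le)
  moreover have "V \<le> w" using 7(4) by simp
  ultimately show ?case using 7(4) by (auto intro: le_trans[of _ V])
next
  case (3 a e)
  then have "arrays s a (eval_rexp s e) \<le> V" "V \<le> w" "fits w s e" by (auto simp: bounded_def)
  then show ?case by simp
next
  case (4 e1 e2)
  then have "eval_rexp s e1 \<le> V" "eval_rexp s e2 \<le> V" "fits w s e1" "fits w s e2" by auto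
  then show ?case using 4(4) by auto
qed (auto simp: bounded_def intro: le_trans)

lemma run_sem:
  assumes "safe p" "bounded V s" "2 * V \<le> w" "\<And>x. x < 10 \<Longrightarrow> regs s x \<le> u x"
  shows "\<exists>t \<le> tm u p. run w (compile p) s t (sem p s)" and "bounded V (sem p s)"
proof -
  have "bounded V (sem p s) \<and> (\<exists>t \<le> tm u p. run w (compile p) s t (sem p s))"
    using assms
  proof (induction p arbitrary: s)
    case Nop
    then show ?case using run.Skip[of w s] by auto
  next
    case (Set x e)
    then have "eval_rexp s e \<le> V" "fits w s e" using bexp_fits[OF Set.prems(2,3)] by auto
    then show ?case
      using Set.prems run.Assign[of w s e x] by (auto simp: bounded_def setreg_def)
  next
    case (Put a i e)
    then have "eval_rexp s i \<le> V" "fits w s i" "eval_rexp s e \<le> V" "fits w s e"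
      using bexp_fits[OF Put.prems(2,3)] by auto
    then show ?case
      using Put.prems run.Store[of w s i e a] by (auto simp: bounded_def setarr_def)
  next
    case (Then c d)
    have c: "bounded V (sem c s)" "\<exists>t \<le> tm u c. run w (compile c) s t (sem c s)"
      using Then.IH(1)[of s] Then.prems by auto
    have "\<And>x. x < 10 \<Longrightarrow> regs (sem c s) x \<le> u x"
      using Then.prems safe_wregs[of c] by (simp add: regs_sem)
    then have "bounded V (sem d (sem c s))" "\<exists>t \<le> tm u d. run w (compile d) (sem c s) t (sem d (sem c s))"
      using Then.IH(2)[of "sem c s"] Then.prems c by auto
    then show ?case using c run.Seq by simp (meson add_mono)
  next
    case (Cond e c d)
    then have e: "fits w s e" using bexp_fits[OF Cond.prems(2,3)] by auto
    show ?case
    proof (cases "eval_rexp s e \<noteq> 0")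
      case True
      then obtain t where "t \<le> tm u c" "run w (compile c) s t (sem c s)" "bounded V (sem c s)"
        using Cond.IH(1)[of s] Cond.prems by auto
      then show ?thesis using run.If_true[OF e True, of "compile c" t "sem c s" "compile d"] True
        by (auto intro!: exI[of _ "1 + cost e + t"])
    next
      case False
      then obtain t where "t \<le> tm u d" "run w (compile d) s t (sem d s)" "bounded V (sem d s)"
        using Cond.IH(2)[of s] Cond.prems by auto
      then show ?thesis using run.If_false[OF e, of "compile d" t "sem d s" "compile c"] False
        by (auto intro!: exI[of _ "1 + cost e + t"])
    qed
  next
    case (For i x b)
    let ?F = "\<lambda>s. setreg i (regs s i + 1) (sem b s)"
    let ?c = "While (Op Less (Reg i) (Reg x)) (Seq (compile b) (Assign i (Op Add (Reg i) (Const 1))))"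
    have sb: "safe b" "10 \<le> i" "x < 10" "i \<notin> wregs b" using For.prems by auto
    \<comment> \<open>Stated for \<open>k\<close> remaining rounds from an arbitrary state, so that
      the induction continues from the state after one round.\<close>
    have loop: "bounded V ((?F ^^ k) s') \<and> (\<exists>t \<le> 4 + k * (tm u b + 8). run w ?c s' t ((?F ^^ k) s'))"
      if "bounded V s'" "\<And>x. x < 10 \<Longrightarrow> regs s' x \<le> u x" "regs s' i + k = regs s' x" for k s'
      using that
    proof (induction k arbitrary: s')
      case 0
      have "1 \<le> w" "regs s' i \<le> w" "regs s' x \<le> w"
        using 0(1) For.prems(3) by (auto simp: bounded_def intro: le_trans[of _ V])
      then have "fits w s' (Op Less (Reg i) (Reg x))" by simp
      from run.While_false[OF this, of "Seq (compile b) (Assign i (Op Add (Reg i) (Const 1)))"] 0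
      show ?case by (auto simp: eval_nat_numeral intro!: exI[of _ "Suc (Suc (Suc (Suc 0)))"])
    next
      case (Suc k)
      have w: "1 \<le> w" "regs s' i \<le> w" "regs s' x \<le> w"
        using Suc(2) For.prems(3) by (auto simp: bounded_def intro: le_trans[of _ V])
      then have f: "fits w s' (Op Less (Reg i) (Reg x))" by simp
      obtain t1 where t1: "t1 \<le> tm u b" "run w (compile b) s' t1 (sem b s')" and bb: "bounded V (sem b s')"
        using For.IH[of s'] sb(1) Suc.prems For.prems(3) by auto
      have ri: "regs (sem b s') i = regs s' i" "regs (sem b s') x = regs s' x" "\<And>y. y < 10 \<Longrightarrow> regs (sem b s') y = regs s' y"
        using sb safe_wregs[OF sb(1)] by (auto simp: regs_sem)
      \<comment> \<open>The counter is below the loop bound, itself a register value, so its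
        increment needs no reduction modulo \<open>V\<close>.\<close>
      have iV: "regs s' i + 1 \<le> V" using Suc.prems(1,3) by (auto simp: bounded_def) (metis add_leD1 add_Suc_right Suc_leI le_add1 le_trans not_less_eq_eq)
      have a: "fits w (sem b s') (Op Add (Reg i) (Const 1))" using ri iV w For.prems(3) by simp
      have F: "?F s' = (sem b s')\<lparr>regs := (regs (sem b s'))(i := eval_rexp (sem b s') (Op Add (Reg i) (Const 1)))\<rparr>"
        using ri by (simp add: setreg_def)
      have r1: "run w (Seq (compile b) (Assign i (Op Add (Reg i) (Const 1)))) s' (t1 + 4) (?F s')"
        using run.Seq[OF t1(2) run.Assign[OF a, of i]] unfolding F by (simp add: eval_nat_numeral)
      have bF: "bounded V (?F s')" using bb iV sb(2) by (auto simp: bounded_def)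
      have uF: "\<And>y. y < 10 \<Longrightarrow> regs (?F s') y \<le> u y" using ri Suc.prems(2) sb(2) by auto
      have kF: "regs (?F s') i + k = regs (?F s') x" using ri Suc.prems(3) sb by auto
      from Suc.IH[OF bF uF kF] obtain t2 where t2: "t2 \<le> 4 + k * (tm u b + 8)" "run w ?c (?F s') t2 ((?F ^^ k) (?F s'))"
        and bk: "bounded V ((?F ^^ k) (?F s'))" by blast
      have fs: "(?F ^^ Suc k) s' = (?F ^^ k) (?F s')" by (simp only: funpow_Suc_right o_apply)
      have "eval_rexp s' (Op Less (Reg i) (Reg x)) \<noteq> 0" using Suc.prems(3) by simp
      from run.While_true[OF f this r1 t2(2)] have
        "run w ?c s' (1 + cost (Op Less (Reg i) (Reg x)) + (t1 + 4) + t2) ((?F ^^ Suc k) s')"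
        unfolding fs by simp
      moreover have "1 + cost (Op Less (Reg i) (Reg x)) + (t1 + 4) + t2 \<le> 4 + Suc k * (tm u b + 8)"
        using t1 t2 by simp
      ultimately show ?case using bk unfolding fs by blast
    qed
    have b0: "bounded V (setreg i 0 s)" using For.prems sb by (auto simp: bounded_def)
    have u0: "\<And>y. y < 10 \<Longrightarrow> regs (setreg i 0 s) y \<le> u y" using For.prems(4) sb by auto
    have k0: "regs (setreg i 0 s) i + regs s x = regs (setreg i 0 s) x" using sb by auto
    from loop[OF b0 u0 k0] obtain t where t: "t \<le> 4 + regs s x * (tm u b + 8)"
      "run w ?c (setreg i 0 s) t ((?F ^^ regs s x) (setreg i 0 s))" and bt: "bounded V ((?F ^^ regs s x) (setreg i 0 s))"
      by blast
    have "run w (Assign i (Const 0)) s 2 (setreg i 0 s)"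
      using run.Assign[of w s "Const 0" i] by (simp add: setreg_def numeral_2_eq_2)
    from run.Seq[OF this t(2)] have "run w (compile (For i x b)) s (2 + t) (sem (For i x b) s)" by simp
    moreover have "2 + t \<le> tm u (For i x b)"
    proof -
      have "regs s x * (tm u b + 8) \<le> u x * (tm u b + 8)" using For.prems(4) sb(3) by (intro mult_right_mono) auto
      then have "t \<le> 4 + u x * (tm u b + 8)" using t(1) by linarith
      then show ?thesis by simp
    qed
    ultimately have "\<exists>t \<le> tm u (For i x b). run w (compile (For i x b)) s t (sem (For i x b) s)" by blast
    moreover have "bounded V (sem (For i x b) s)" using bt by simp
    ultimately show ?case by blast
  qed
  then show "\<exists>t \<le> tm u p. run w (compile p) s t (sem p s)" "bounded V (sem p s)" by auto
qed

text \<open>An invariant rule with a frame: in the step, everything that the body does not write is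
  known to have its value from before the loop.\<close>

lemma sem_for:
  assumes i: "i \<notin> wregs b" and x: "x \<notin> wregs b" "x \<noteq> i"
    and 0: "P 0 (setreg i 0 s)"
    and Suc: "\<And>k s'. k < regs s x \<Longrightarrow> P k s' \<Longrightarrow> regs s' i = k \<Longrightarrow>
      (\<And>y. y \<notin> wregs b \<Longrightarrow> y \<noteq> i \<Longrightarrow> regs s' y = regs s y) \<Longrightarrow>
      (\<And>a. a \<notin> warrs b \<Longrightarrow> arrays s' a = arrays s a) \<Longrightarrow> P (Suc k) (setreg i (Suc k) (sem b s'))"
  shows "P (regs s x) (sem (For i x b) s)"
proof -
  let ?F = "\<lambda>s. setreg i (regs s i + 1) (sem b s)"
  have "k \<le> regs s x \<Longrightarrow> P k ((?F ^^ k) (setreg i 0 s)) \<and> regs ((?F ^^ k) (setreg i 0 s)) i = k \<and>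
      (\<forall>y. y \<notin> wregs b \<longrightarrow> y \<noteq> i \<longrightarrow> regs ((?F ^^ k) (setreg i 0 s)) y = regs s y) \<and>
      (\<forall>a. a \<notin> warrs b \<longrightarrow> arrays ((?F ^^ k) (setreg i 0 s)) a = arrays s a)" for k
  proof (induction k)
    case (Suc k)
    then have IH: "P k ((?F ^^ k) (setreg i 0 s))" "regs ((?F ^^ k) (setreg i 0 s)) i = k"
      "\<And>y. y \<notin> wregs b \<Longrightarrow> y \<noteq> i \<Longrightarrow> regs ((?F ^^ k) (setreg i 0 s)) y = regs s y"
      "\<And>a. a \<notin> warrs b \<Longrightarrow> arrays ((?F ^^ k) (setreg i 0 s)) a = arrays s a" by auto
    have "P (Suc k) (setreg i (Suc k) (sem b ((?F ^^ k) (setreg i 0 s))))"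
      by (rule assms(5)) (use Suc.prems IH in auto)
    then show ?case using IH i by (auto simp: regs_sem arrays_sem)
  qed (use 0 in auto)
  from this[of "regs s x"] show ?thesis by simp
qed

declare sem.simps(6) [simp del]

abbreviation plus_mod :: "rexp \<Rightarrow> rexp \<Rightarrow> rexp" (infixl \<open>.+\<close> 65) where
  "a .+ b \<equiv> Op Mod (Op Add a b) (Reg 9)"

abbreviation minus_op :: "rexp \<Rightarrow> rexp \<Rightarrow> rexp" (infixl \<open>.-\<close> 65) where
  "a .- b \<equiv> Op Sub a b"

section \<open>Reduction of walks with a stack\<close>

text \<open>
  Array 9 with top index in register 10 contains the vertices of the reduction of the walk \<open>xs\<close>.
\<close>
definition stack :: "ram_state \<Rightarrow> nat list" where
  "stack s = map (arrays s 9) [0..<Suc (regs s 10)]"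

definition stk :: "ram_state \<Rightarrow> nat list \<Rightarrow> bool" where
  "stk s xs \<longleftrightarrow> xs \<noteq> [] \<and> is_red (arcs_of (stack s)) \<and> path (stack s) = path xs \<and>
     hd (stack s) = hd xs \<and> last (stack s) = last xs \<and> regs s 10 < length xs"

definition RESET :: "rexp \<Rightarrow> stm" where
  "RESET e = Put 9 (Const 0) e ;; Set 10 (Const 0)"

text \<open>A repetition of the top vertex is a loop, and a return to the vertex below it is a
  backtrack; any other vertex keeps the walk reduced.\<close>

definition PUSH :: "rexp \<Rightarrow> stm" where
  "PUSH e = Set 11 e ;;
     Cond (Op Equal (Elem 9 (Reg 10)) (Reg 11)) Nop
      (Cond (Op Equal (Elem 9 (Reg 10 .- Const 1)) (Reg 11)) (Set 10 (Reg 10 .- Const 1))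
        (Set 10 (Reg 10 .+ Const 1) ;; Put 9 (Reg 10) (Reg 11)))"

lemma wregs_RESET[simp]: "wregs (RESET e) = {10}" and warrs_RESET[simp]: "warrs (RESET e) = {9}"
  and safe_RESET[simp]: "safe (RESET e) = bexp e" and tm_RESET[simp]: "tm u (RESET e) = 4 + cost e"
  by (auto simp: RESET_def)

lemma wregs_PUSH[simp]: "wregs (PUSH e) = {10, 11}" and warrs_PUSH[simp]: "warrs (PUSH e) = {9}"
  and safe_PUSH[simp]: "safe (PUSH e) = bexp e" and tm_PUSH[simp]: "tm u (PUSH e) = 27 + cost e"
  by (auto simp: PUSH_def)

lemma stk_reset: "stk (sem (RESET e) s) [eval_rexp s e]"
  by (simp add: RESET_def stk_def stack_def)

lemma rep_path_stack: "is_red (arcs_of vs) \<Longrightarrow> rep (path vs) = arcs_of vs"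
  using rep_cls_is_red[of "arcs_of vs"] by (simp add: cls_arcs_of)

lemma stk_len: "stk s xs \<Longrightarrow> regs s 10 = len (path xs)"
proof -
  assume s: "stk s xs"
  then have "rep (path xs) = arcs_of (stack s)" using rep_path_stack[of "stack s"] by (simp add: stk_def)
  moreover have "length (stack s) = Suc (regs s 10)" by (simp add: stack_def)
  ultimately show ?thesis by (simp add: len_def)
qed

lemma arcs_of_snoc: "xs \<noteq> [] \<Longrightarrow> arcs_of (xs @ [y]) = arcs_of xs @ [(last xs, y)]"
  by (induction xs rule: arcs_of.induct) auto

lemma stk_push:
  assumes s: "stk s xs" and V: "length xs < regs s 9"
  shows "stk (sem (PUSH e) s) (xs @ [eval_rexp s e])"
proof -
  define x where "x = eval_rexp s e"
  define l where "l = regs s 10"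
  define A where "A = arrays s 9"
  have st: "stack s = map A [0..<l] @ [A l]" by (simp add: stack_def A_def l_def)
  have c: "xs \<noteq> []" "is_red (arcs_of (stack s))" "path (stack s) = path xs" "hd (stack s) = hd xs"
    "A l = last xs" "l < length xs"
    using s st by (auto simp: stk_def l_def)
  have pxs: "path (xs @ [x]) = path (stack s) + ed (A l) x"
    using c by (simp add: path_snoc)
  have hd: "hd (xs @ [x]) = hd (stack s)" using c by simp
  show ?thesis
  proof (cases "A l = x")
    case True
    then have "sem (PUSH e) s = setreg 11 x s" by (simp add: PUSH_def x_def l_def A_def)
    moreover have "stack (setreg 11 x s) = stack s" by (simp add: stack_def)
    ultimately show ?thesis
      using c True pxs hd unfolding stk_def x_def[symmetric] by (auto simp: l_def st)
  next
    case ne: False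
    show ?thesis
    proof (cases "A (l - 1) = x")
      case True
      \<comment> \<open>On a stack with one entry, \<open>l - 1\<close> is 0 again, so the second
        comparison repeats the first and fails.\<close>
      then have l0: "0 < l" using ne by (cases l) auto
      have s': "sem (PUSH e) s = setreg 10 (l - 1) (setreg 11 x s)"
        using ne True by (simp add: PUSH_def x_def l_def A_def)
      define vs where "vs = map A [0..<l]"
      have vs: "stack s = vs @ [A l]" "vs \<noteq> []" using st l0 by (auto simp: vs_def)
      have st': "stack (sem (PUSH e) s) = vs"
        unfolding s' using l0 by (simp add: stack_def vs_def A_def del: upt_Suc)
      have lv: "last vs = x" using True l0 by (simp add: vs_def last_map)
      have "path (stack s) = path vs + ed x (A l)" using vs lv by (simp add: path_snoc)
      then have "path vs = path (xs @ [x])" unfolding pxs by (simp add: add.assoc)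
      moreover have "is_red (arcs_of vs)" using c(2) vs by (simp add: arcs_of_snoc is_red_append)
      moreover have "regs (sem (PUSH e) s) 10 < length (xs @ [x])" using s' c by simp
      ultimately show ?thesis
        unfolding stk_def st' x_def[symmetric] using lv hd vs by simp
    next
      case False
      \<comment> \<open>No wrap-around, since the top index is below the number of vertices pushed
        so far.\<close>
      have lV: "(l + 1) mod regs s 9 = l + 1" using c V by simp
      have s': "sem (PUSH e) s = setarr 9 (l + 1) x (setreg 10 (l + 1) (setreg 11 x s))"
        using ne False lV by (simp add: PUSH_def x_def l_def A_def)
      have st': "stack (sem (PUSH e) s) = stack s @ [x]"
        unfolding s' st by (simp add: stack_def A_def)
      have "is_red (arcs_of (stack s @ [x]))"
      proof (cases l)
        case 0
        then show ?thesis using ne st by simp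
      next
        case (Suc k)
        have "arcs_of (stack s) = arcs_of (map A [0..<l]) @ [(A k, A l)]"
          unfolding st using arcs_of_snoc[of "map A [0..<l]" "A l"] Suc by (simp add: last_map del: upt_Suc)
        then have "last (arcs_of (stack s)) = (A k, A l)" by simp
        moreover have "arcs_of (stack s @ [x]) = arcs_of (stack s) @ [(A l, x)]"
          unfolding st using arcs_of_snoc[of "map A [0..<l] @ [A l]" x] by simp
        moreover have "A k \<noteq> x" using False Suc by simp
        ultimately show ?thesis using c(2) ne by (simp add: is_red_append)
      qed
      moreover have "path (stack s @ [x]) = path (xs @ [x])"
        using pxs path_snoc[of "stack s" x] by (simp add: st)
      moreover have "regs (sem (PUSH e) s) 10 < length (xs @ [x])" using s' c by simp
      ultimately show ?thesis
        unfolding stk_def st' x_def[symmetric] using hd by (simp add: st hd_append)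
    qed
  qed
qed

lemma stk_cong: "regs s' 10 = regs s 10 \<Longrightarrow> arrays s' 9 = arrays s 9 \<Longrightarrow> stk s' xs = stk s xs"
  by (simp add: stk_def stack_def)

lemma stk_setreg[simp]: "x \<noteq> 10 \<Longrightarrow> stk (setreg x v s) xs = stk s xs"
  by (rule stk_cong) auto

text \<open>
  The pushed expression may depend on the loop counter \<open>i\<close> only, besides memory not used by the stack.
\<close>
lemma stk_push_for:
  assumes s: "stk s xs" and V: "length xs + regs s x \<le> regs s 9"
    and i: "i \<notin> {9, 10, 11}" "x \<notin> {10, 11, i}"
    and e: "\<And>s'. (\<And>y. y \<notin> {10, 11, i} \<Longrightarrow> regs s' y = regs s y) \<Longrightarrow>
      (\<And>a. a \<noteq> 9 \<Longrightarrow> arrays s' a = arrays s a) \<Longrightarrow> regs s' i < regs s x \<Longrightarrow> eval_rexp s' e = f (regs s' i)"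
  shows "stk (sem (For i x (PUSH e)) s) (xs @ map f [0..<regs s x])"
proof -
  have "(\<lambda>k (s' :: ram_state). stk s' (xs @ map f [0..<k])) (regs s x) (sem (For i x (PUSH e)) s)"
  proof (rule sem_for)
    fix k and s' :: ram_state
    assume k: "k < regs s x" "stk s' (xs @ map f [0..<k])" "regs s' i = k"
      and r: "\<And>y. y \<notin> wregs (PUSH e) \<Longrightarrow> y \<noteq> i \<Longrightarrow> regs s' y = regs s y"
      and a: "\<And>a. a \<notin> warrs (PUSH e) \<Longrightarrow> arrays s' a = arrays s a"
    have "eval_rexp s' e = f k" using e[of s'] r a k by auto
    moreover have "regs s' 9 = regs s 9" using r[of 9] i by simp
    ultimately show "stk (setreg i (Suc k) (sem (PUSH e) s')) (xs @ map f [0..<Suc k])"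
      using stk_push[OF k(2), of e] k(1) V i by simp
  qed (use i s in auto)
  then show ?thesis .
qed

section \<open>The spanning tree\<close>

text \<open>
  Memory layout: registers 0 to 4 contain the input, registers 5 to 9 the numbers \<open>2n\<close>, \<open>10n\<close>,
  \<open>20n + 1\<close>, \<open>100n\<close> and the bound on all values. Arrays 0, 1, 4 and 5 contain the input, array 6
  maps the vertices to their parents in the spanning tree.
\<close>

definition TREE :: stm where
  "TREE = Put 7 (Reg 4) (Const 1) ;; Put 6 (Reg 4) (Reg 4) ;;
     For 15 0 (For 16 1
       (Cond (Elem 7 (Elem 0 (Reg 16)))
         (Cond (Elem 7 (Elem 1 (Reg 16))) Nop
           (Put 7 (Elem 1 (Reg 16)) (Const 1) ;; Put 6 (Elem 1 (Reg 16)) (Elem 0 (Reg 16)))) Nop))"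

lemma wregs_TREE[simp]: "wregs TREE = {15, 16}" and warrs_TREE[simp]: "warrs TREE = {6, 7}"
  and safe_TREE[simp]: "safe TREE"
  by (auto simp: TREE_def)

locale ram_input =
  fixes G H :: "nat pair_pre_digraph" and \<alpha> \<beta> :: "nat \<Rightarrow> nat" and q n V :: nat and gs :: "(nat \<times> nat) list"
  assumes hp: "hom_pair G H \<alpha> \<beta> q" and VG: "pverts G = {..<n}" and gs: "set gs = parcs G"
    and V: "1000 * n + length gs < V"
begin

sublocale hom_graphs G H
  using hp by (intro hom_graphs.intro) (auto simp: hom_pair_def conn_reflexive_graph_def refl_graph_iff)

lemma q_less: "q < n" and n2: "2 \<le> n"
  using hp VG by (auto simp: hom_pair_def conn_reflexive_graph_def)

lemma \<alpha>H: "\<alpha> \<in> homs G H" and \<beta>H: "\<beta> \<in> homs G H"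
  using hp by (auto simp: hom_pair_def)

lemma gs_nth: "i < length gs \<Longrightarrow> (fst (gs ! i), snd (gs ! i)) \<in> parcs G"
  unfolding gs[symmetric] prod.collapse by (rule nth_mem)

lemma gs_ex: "(u, v) \<in> parcs G \<Longrightarrow> \<exists>i < length gs. gs ! i = (u, v)"
  using gs by (metis in_set_conv_nth)

lemma arc_less: "(u, v) \<in> parcs G \<Longrightarrow> u < n \<and> v < n"
  using G.in_arcsD1 G.in_arcsD2 VG by auto

definition inp :: "ram_state \<Rightarrow> bool" where
  "inp s \<longleftrightarrow> regs s 0 = n \<and> regs s 1 = length gs \<and> regs s 4 = q \<and> regs s 5 = 2 * n \<and> regs s 6 = 10 * n \<and>
     regs s 7 = 20 * n + 1 \<and> regs s 8 = 100 * n \<and> regs s 9 = V \<and>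
     (\<forall>i < length gs. arrays s 0 i = fst (gs ! i) \<and> arrays s 1 i = snd (gs ! i)) \<and>
     (\<forall>v < n. arrays s 4 v = \<alpha> v \<and> arrays s 5 v = \<beta> v)"

lemma inp_cong:
  "(\<And>x. x < 10 \<Longrightarrow> regs s' x = regs s x) \<Longrightarrow> (\<And>a. a \<in> {0, 1, 4, 5} \<Longrightarrow> arrays s' a = arrays s a) \<Longrightarrow>
     inp s' = inp s"
  by (simp add: inp_def)

lemma inp_sem: "safe p \<Longrightarrow> warrs p \<inter> {0, 1, 4, 5} = {} \<Longrightarrow> inp (sem p s) = inp s"
  by (rule inp_cong) (auto intro!: regs_sem arrays_sem dest: safe_wregs)

definition reached :: "(nat \<Rightarrow> nat) \<Rightarrow> nat set" where
  "reached A = {v. v < n \<and> A v \<noteq> 0}"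

text \<open>The depth is below the number of reached vertices. As the root is its own parent,
  exactly \<open>n - 1\<close> parent steps lead to it from every vertex in the end, whatever its
  depth.\<close>

definition tree_inv :: "(nat \<Rightarrow> nat) \<Rightarrow> (nat \<Rightarrow> nat) \<Rightarrow> bool" where
  "tree_inv A P \<longleftrightarrow> q \<in> reached A \<and> P q = q \<and>
     (\<forall>v \<in> reached A. P v \<in> reached A \<and> (v, P v) \<in> parcs G \<and> (\<exists>k < card (reached A). (P ^^ k) v = q))"

lemma reached_upd: "y < n \<Longrightarrow> reached (A(y := 1)) = insert y (reached A)"
  by (auto simp: reached_def)

lemma finite_reached[simp]: "finite (reached A)"
  by (simp add: reached_def)

lemma tree_inv_step:
  assumes t: "tree_inv A P" and e: "(x, y) \<in> parcs G" and x: "x \<in> reached A" and y: "y \<notin> reached A"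
  shows "tree_inv (A(y := 1)) (P(y := x))"
proof -
  have yn: "y < n" using arc_less[OF e] by simp
  have fp: "((P(y := x)) ^^ k) v = (P ^^ k) v \<and> (P ^^ k) v \<in> reached A" if "v \<in> reached A" for k v
  proof (induction k)
    case (Suc k)
    then have "(P ^^ k) v \<noteq> y" using y by auto
    then show ?case using Suc t by (auto simp: tree_inv_def)
  qed (use that in simp)
  have c: "card (insert y (reached A)) = Suc (card (reached A))" using y by simp
  show ?thesis
    unfolding tree_inv_def reached_upd[OF yn] c
  proof (intro conjI ballI)
    show "q \<in> insert y (reached A)" "(P(y := x)) q = q" using t y by (auto simp: tree_inv_def)
    fix v assume v: "v \<in> insert y (reached A)"
    show "(P(y := x)) v \<in> insert y (reached A)" using v t x by (auto simp: tree_inv_def)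
    show "(v, (P(y := x)) v) \<in> parcs G" using v t e G.arcs_symmetric by (auto simp: tree_inv_def)
    show "\<exists>k < Suc (card (reached A)). ((P(y := x)) ^^ k) v = q"
    proof (cases "v = y")
      case True
      obtain k where k: "k < card (reached A)" "(P ^^ k) x = q" using t x by (auto simp: tree_inv_def)
      have "((P(y := x)) ^^ Suc k) y = q" using fp[OF x, of k] k(2) by (simp add: funpow_Suc_right del: funpow.simps)
      then show ?thesis using k True by blast
    next
      case False
      then obtain k where k: "k < card (reached A)" "(P ^^ k) v = q" using t v by (auto simp: tree_inv_def)
      then show ?thesis using fp[of v k] v False by (intro exI[of _ k]) auto
    qed
  qed
qed

lemma reached_all:
  assumes "q \<in> reached A" "\<And>x y. (x, y) \<in> parcs G \<Longrightarrow> x \<in> reached A \<Longrightarrow> y \<in> reached A" "v < n"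
  shows "v \<in> reached A"
proof -
  have "conn_reflexive_graph G" "q \<in> pverts G" "v \<in> pverts G"
    using hp VG q_less assms(3) by (simp_all add: hom_pair_def)
  from conn_reflexive_graph_reachable[OF this] obtain p where p: "is_walk G q p v" ..
  have "is_walk G u p v \<Longrightarrow> u \<in> reached A \<Longrightarrow> v \<in> reached A" for u
  proof (induction p arbitrary: u)
    case (Cons e p)
    then have "(fst e, snd e) \<in> parcs G" "fst e = u" "is_walk G (snd e) p v" by auto
    then show ?case using Cons.IH Cons.prems(2) assms(2) by blast
  qed simp
  then show ?thesis using p assms(1) .
qed

text \<open>Each round scans all arcs, so a round that adds nothing shows that the reached set is
  closed under arcs, and it contains all vertices by connectivity. Otherwise the set grows in every
  round, and \<open>n\<close> rounds suffice.\<close>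

lemma TREE_spec:
  assumes s: "inp s" "\<And>i. arrays s 6 i = 0" "\<And>i. arrays s 7 i = 0"
  shows "inp (sem TREE s)" "arrays (sem TREE s) 6 q = q"
    and "\<And>v. v < n \<Longrightarrow> (v, arrays (sem TREE s) 6 v) \<in> parcs G"
    and "\<And>v. v < n \<Longrightarrow> ((arrays (sem TREE s) 6) ^^ (n - 1)) v = q"
proof -
  show "inp (sem TREE s)" using s(1) by (simp add: inp_sem)
  define body where "body = Cond (Elem 7 (Elem 0 (Reg 16)))
         (Cond (Elem 7 (Elem 1 (Reg 16))) Nop
           (Put 7 (Elem 1 (Reg 16)) (Const 1) ;; Put 6 (Elem 1 (Reg 16)) (Elem 0 (Reg 16)))) Nop"
  have wb: "wregs body = {}" "warrs body = {6, 7}" "safe body" by (auto simp: body_def)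
  define T where "T s \<longleftrightarrow> inp s \<and> tree_inv (arrays s 7) (arrays s 6)" for s :: ram_state
  define R where "R s = reached (arrays s 7)" for s :: ram_state
  have T_setreg: "T (setreg x v s) = T s" "R (setreg x v s) = R s" if "10 \<le> x" for x v s
    using that inp_cong[of "setreg x v s" s] by (auto simp: T_def R_def)
  have step: "T (sem body s')" "R s' \<subseteq> R (sem body s')"
    "fst (gs ! regs s' 16) \<in> R s' \<Longrightarrow> snd (gs ! regs s' 16) \<in> R (sem body s')"
    if s': "T s'" "regs s' 16 < length gs" for s'
  proof -
    obtain x y where xy: "gs ! regs s' 16 = (x, y)" by fastforce
    have a: "arrays s' 0 (regs s' 16) = x" "arrays s' 1 (regs s' 16) = y"
      using s' xy by (auto simp: T_def inp_def)
    have e: "(x, y) \<in> parcs G" using gs_nth[OF s'(2)] xy by simp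
    have n: "x < n" "y < n" using arc_less[OF e] by auto
    have i: "inp (sem body s')" using s' wb by (simp add: inp_sem T_def)
    have "T (sem body s') \<and> R s' \<subseteq> R (sem body s') \<and> (x \<in> R s' \<longrightarrow> y \<in> R (sem body s'))"
    proof (cases "x \<in> R s' \<and> y \<notin> R s'")
      case True
      then have "arrays (sem body s') 7 = (arrays s' 7)(y := 1)" "arrays (sem body s') 6 = (arrays s' 6)(y := x)"
        using n a by (auto simp: body_def R_def reached_def)
      then show ?thesis
        using tree_inv_step[OF _ e, of "arrays s' 7" "arrays s' 6"] True s'(1) i n
        unfolding T_def R_def by (simp only: reached_upd) blast
    next
      case False
      then have "sem body s' = s'" using n a by (auto simp: body_def R_def reached_def)
      then show ?thesis using False s'(1) by auto
    qed
    then show "T (sem body s')" "R s' \<subseteq> R (sem body s')"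
      "fst (gs ! regs s' 16) \<in> R s' \<Longrightarrow> snd (gs ! regs s' 16) \<in> R (sem body s')" using xy by auto
  qed
  have inner: "T (sem (For 16 1 body) s') \<and> R s' \<subseteq> R (sem (For 16 1 body) s') \<and>
      (\<forall>i < length gs. fst (gs ! i) \<in> R s' \<longrightarrow> snd (gs ! i) \<in> R (sem (For 16 1 body) s'))" if s': "T s'" for s'
  proof -
    have r1: "regs s' 1 = length gs" using s' by (simp add: T_def inp_def)
    have "(\<lambda>k s''. T s'' \<and> R s' \<subseteq> R s'' \<and> (\<forall>i < k. fst (gs ! i) \<in> R s' \<longrightarrow> snd (gs ! i) \<in> R s''))
      (regs s' 1) (sem (For 16 1 body) s')"
    proof (rule sem_for)
      fix k s''
      assume "k < regs s' 1" "T s'' \<and> R s' \<subseteq> R s'' \<and> (\<forall>i < k. fst (gs ! i) \<in> R s' \<longrightarrow> snd (gs ! i) \<in> R s'')"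
        "regs s'' 16 = k"
      then show "T (setreg 16 (Suc k) (sem body s'')) \<and> R s' \<subseteq> R (setreg 16 (Suc k) (sem body s'')) \<and>
        (\<forall>i < Suc k. fst (gs ! i) \<in> R s' \<longrightarrow> snd (gs ! i) \<in> R (setreg 16 (Suc k) (sem body s'')))"
        using step[of s''] r1 by (auto simp: T_setreg less_Suc_eq)
    qed (use s' wb T_setreg in auto)
    then show ?thesis unfolding r1 by blast
  qed
  define s0 where "s0 = sem (Put 7 (Reg 4) (Const 1) ;; Put 6 (Reg 4) (Reg 4)) s"
  have q': "regs s 4 = q" "regs s 0 = n" using s(1) by (auto simp: inp_def)
  have R0: "R s0 = {q}" using s(3) q_less q' by (auto simp: s0_def R_def reached_def)
  have T0: "T s0"
    unfolding T_def tree_inv_def R0[unfolded R_def]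
  proof (intro conjI)
    show "inp s0" unfolding s0_def using s(1) by (simp add: inp_sem del: sem.simps)
    have "(q, q) \<in> parcs G" using G.loops q_less VG by simp
    then show "q \<in> {q}" "arrays s0 6 q = q" "\<forall>v \<in> {q}. arrays s0 6 v \<in> {q} \<and> (v, arrays s0 6 v) \<in> parcs G \<and>
       (\<exists>k < card {q}. (arrays s0 6 ^^ k) v = q)" using q' by (auto simp: s0_def intro!: exI[of _ 0])
  qed
  have TREE: "sem TREE s = sem (For 15 0 (For 16 1 body)) s0" by (simp add: TREE_def s0_def body_def)
  have "(\<lambda>k (s' :: ram_state). T s' \<and> (k < card (R s') \<or> R s' = {..<n})) (regs s0 0) (sem (For 15 0 (For 16 1 body)) s0)"
  proof (rule sem_for)
    fix k and s' :: ram_state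
    assume s': "T s' \<and> (k < card (R s') \<or> R s' = {..<n})"
    let ?s = "sem (For 16 1 body) s'"
    note i = inner[OF conjunct1[OF s']]
    have "Suc k < card (R ?s) \<or> R ?s = {..<n}"
    proof (cases "R ?s = R s'")
      case True
      have "v \<in> R s'" if "v < n" for v
        unfolding R_def
      proof (rule reached_all[OF _ _ that])
        show "q \<in> reached (arrays s' 7)" using s' by (simp add: T_def tree_inv_def)
        show "y \<in> reached (arrays s' 7)" if "(x, y) \<in> parcs G" "x \<in> reached (arrays s' 7)" for x y
          using i True that gs_ex[OF that(1)] unfolding R_def by fastforce
      qed
      then have "R s' = {..<n}" by (auto simp: R_def reached_def)
      then show ?thesis using True by simp
    next
      case False
      then have "card (R s') < card (R ?s)" using i by (intro psubset_card_mono) (auto simp: R_def)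
      moreover have "R ?s = {..<n}" if "R s' = {..<n}" using i that by (auto simp: R_def reached_def)
      ultimately show ?thesis using s' by auto
    qed
    then show "T (setreg 15 (Suc k) ?s) \<and> (Suc k < card (R (setreg 15 (Suc k) ?s)) \<or> R (setreg 15 (Suc k) ?s) = {..<n})"
      using i by (simp add: T_setreg)
  qed (use T0 R0 wb in \<open>auto simp: T_setreg\<close>)
  moreover have "regs s0 0 = n" using q' by (simp add: s0_def)
  ultimately have fin: "T (sem TREE s)" "n < card (R (sem TREE s)) \<or> R (sem TREE s) = {..<n}"
    unfolding TREE by auto
  have "card (R (sem TREE s)) \<le> card {..<n}" by (rule card_mono) (auto simp: R_def reached_def)
  then have full: "R (sem TREE s) = {..<n}" using fin(2) by auto
  let ?P = "arrays (sem TREE s) 6"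
  have t: "tree_inv (arrays (sem TREE s) 7) ?P" using fin(1) by (simp add: T_def)
  show qq: "?P q = q" using t by (simp add: tree_inv_def)
  fix v assume v: "v < n"
  then have vR: "v \<in> reached (arrays (sem TREE s) 7)" using full by (simp add: R_def)
  show "(v, ?P v) \<in> parcs G" using t vR by (simp add: tree_inv_def)
  obtain k where k: "k < n" "(?P ^^ k) v = q"
    using t vR full unfolding tree_inv_def R_def by auto
  have "(?P ^^ j) q = q" for j by (induction j) (auto simp: qq)
  moreover have "n - 1 = (n - 1 - k) + k" using k by simp
  ultimately show "(?P ^^ (n - 1)) v = q" using k by (metis funpow_add o_apply)
qed

end

section \<open>Closed walks of the spanning tree\<close>

text \<open>Parents lead toward the root only, so both tree paths are read from their far ends,
  which are adjacent in the closed walk: one is written from the middle of the array to the left,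
  the other to the right.\<close>

definition LOAD :: "nat \<Rightarrow> rexp \<Rightarrow> rexp \<Rightarrow> stm" where
  "LOAD a ex ey = Set 13 ex ;; Set 14 ey ;;
     For 12 0 (Put a (Reg 0 .- Const 1 .- Reg 12) (Reg 13) ;; Set 13 (Elem 6 (Reg 13)) ;;
       Put a (Reg 0 .+ Reg 12) (Reg 14) ;; Set 14 (Elem 6 (Reg 14)))"

lemma wregs_LOAD[simp]: "wregs (LOAD a ex ey) = {12, 13, 14}" and warrs_LOAD[simp]: "warrs (LOAD a ex ey) = {a}"
  and safe_LOAD[simp]: "safe (LOAD a ex ey) = (bexp ex \<and> bexp ey)"
  by (auto simp: LOAD_def)

definition PUSHW :: "nat \<Rightarrow> nat \<Rightarrow> stm" where
  "PUSHW f a = For 12 5 (PUSH (Elem f (Elem a (Reg 12))))"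

definition PUSHR :: "nat \<Rightarrow> nat \<Rightarrow> stm" where
  "PUSHR f a = For 12 5 (PUSH (Elem f (Elem a (Reg 5 .- Const 1 .- Reg 12))))"

definition PUSHV :: "nat \<Rightarrow> stm" where
  "PUSHV a = For 12 8 (PUSH (Elem a (Reg 12)))"

definition PUSHVR :: "nat \<Rightarrow> stm" where
  "PUSHVR a = For 12 8 (PUSH (Elem a (Reg 8 .- Const 1 .- Reg 12)))"

lemma wregs_PUSHW[simp]: "wregs (PUSHW f a) = {10, 11, 12}" "wregs (PUSHR f a) = {10, 11, 12}"
    "wregs (PUSHV a) = {10, 11, 12}" "wregs (PUSHVR a) = {10, 11, 12}"
  and warrs_PUSHW[simp]: "warrs (PUSHW f a) = {9}" "warrs (PUSHR f a) = {9}" "warrs (PUSHV a) = {9}" "warrs (PUSHVR a) = {9}"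
  and safe_PUSHW[simp]: "safe (PUSHW f a)" "safe (PUSHR f a)" "safe (PUSHV a)" "safe (PUSHVR a)"
  by (auto simp: PUSHW_def PUSHR_def PUSHV_def PUSHVR_def)

definition SAVE :: "nat \<Rightarrow> nat \<Rightarrow> stm" where
  "SAVE a r = Set r (Reg 10) ;; For 12 8 (Cond (Op Less (Reg 10) (Reg 12)) (Put a (Reg 12) (Elem 9 (Reg 10)))
     (Put a (Reg 12) (Elem 9 (Reg 12))))"

lemma wregs_SAVE[simp]: "wregs (SAVE a r) = {r, 12}" and warrs_SAVE[simp]: "warrs (SAVE a r) = {a}"
  and safe_SAVE[simp]: "safe (SAVE a r) \<longleftrightarrow> 10 \<le> r"
  by (auto simp: SAVE_def)

definition vec :: "ram_state \<Rightarrow> nat \<Rightarrow> nat \<Rightarrow> nat list" where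
  "vec s a l = map (arrays s a) [0..<l]"

lemma length_vec[simp]: "length (vec s a l) = l"
  by (simp add: vec_def)

lemma vec_nth[simp]: "k < l \<Longrightarrow> vec s a l ! k = arrays s a k"
  by (simp add: vec_def)

lemma vec_sem: "a \<notin> warrs p \<Longrightarrow> vec (sem p s) a l = vec s a l"
  by (simp add: vec_def arrays_sem)

locale ram_tree = ram_input +
  fixes par :: "nat \<Rightarrow> nat"
  assumes par_q: "par q = q" and par_arc: "v < n \<Longrightarrow> (v, par v) \<in> parcs G"
    and par_root: "v < n \<Longrightarrow> (par ^^ (n - 1)) v = q"
begin

text \<open>Always \<open>n\<close> entries: shorter tree paths start with repetitions of
  \<open>q\<close>. This gives the loops over walks a constant bound.\<close>

definition W :: "nat \<Rightarrow> nat list" where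
  "W v = rev (map (\<lambda>i. (par ^^ i) v) [0..<n])"

lemma par_pow_less: "v < n \<Longrightarrow> (par ^^ i) v < n"
  using par_arc arc_less by (induction i) auto

sublocale recoloring G H \<alpha> \<beta> q W
proof (rule hom_pair_recoloring[OF hp])
  fix v assume "v \<in> pverts G"
  then have v: "v < n" using VG by simp
  have "G.vwalk (map (\<lambda>i. (par ^^ i) v) [0..<n])"
    unfolding G.vwalk_def successively_conv_nth using v par_arc par_pow_less n2 VG by auto
  then have "G.vwalk (W v)" unfolding W_def by (rule G.vwalk_rev)
  moreover have "hd (W v) = q" using par_root[OF v] n2 by (simp add: W_def hd_rev last_map)
  moreover have "last (W v) = v" using n2 by (simp add: W_def last_rev hd_map upt_rec)
  ultimately show "G.vwalk (W v) \<and> hd (W v) = q \<and> last (W v) = v" by simp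
next
  have "(par ^^ i) q = q" for i by (induction i) (auto simp: par_q)
  moreover have "0 \<in> {0..<n}" using n2 by simp
  ultimately show "set (W q) = {q}" by (auto simp: W_def image_iff)
qed

definition env :: "ram_state \<Rightarrow> bool" where
  "env s \<longleftrightarrow> inp s \<and> arrays s 6 = par"

lemma env_sem: "safe p \<Longrightarrow> warrs p \<inter> {0, 1, 4, 5, 6} = {} \<Longrightarrow> env (sem p s) = env s"
  using inp_sem[of p s] arrays_sem[of 6 p s] by (auto simp: env_def)

lemma env_regs[simp]: "env s \<Longrightarrow> regs s 0 = n" "env s \<Longrightarrow> regs s (Suc 0) = length gs" "env s \<Longrightarrow> regs s 4 = q"
  "env s \<Longrightarrow> regs s 5 = 2 * n" "env s \<Longrightarrow> regs s 6 = 10 * n" "env s \<Longrightarrow> regs s 7 = 20 * n + 1"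
  "env s \<Longrightarrow> regs s 8 = 100 * n" "env s \<Longrightarrow> regs s 9 = V"
  by (simp_all add: env_def inp_def)

lemma env_arcs: "env s \<Longrightarrow> i < length gs \<Longrightarrow> arrays s 0 i = fst (gs ! i) \<and> arrays s (Suc 0) i = snd (gs ! i)"
  unfolding env_def inp_def by simp

definition col :: "nat \<Rightarrow> nat \<Rightarrow> nat" where
  "col f = (if f = 4 then \<alpha> else \<beta>)"

lemma env_col: "env s \<Longrightarrow> f \<in> {4, 5} \<Longrightarrow> v < n \<Longrightarrow> arrays s f v = col f v"
  unfolding env_def inp_def col_def by auto

lemma closed_path_less: "u < n \<Longrightarrow> v < n \<Longrightarrow> x \<in> set (closed_path u v) \<Longrightarrow> x < n"
  by (auto simp: closed_path_def W_def par_pow_less)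

lemma length_W[simp]: "length (W v) = n"
  by (simp add: W_def)

lemma length_closed_path[simp]: "length (closed_path u v) = 2 * n"
  by (simp add: closed_path_def)

lemma LOAD_spec:
  assumes s: "env s" and a: "a \<notin> {0, 1, 4, 5, 6}"
    and u: "eval_rexp s ex = u" and v: "eval_rexp (setreg 13 u s) ey = v"
  shows "vec (sem (LOAD a ex ey) s) a (2 * n) = closed_path u v"
proof -
  define body where "body = Put a (Reg 0 .- Const 1 .- Reg 12) (Reg 13) ;; Set 13 (Elem 6 (Reg 13)) ;;
       Put a (Reg 0 .+ Reg 12) (Reg 14) ;; Set 14 (Elem 6 (Reg 14))"
  have wb: "wregs body = {13, 14}" "warrs body = {a}" by (auto simp: body_def)
  define s0 where "s0 = setreg 14 v (setreg 13 u s)"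
  have s0: "regs s0 0 = n" "regs s0 9 = V" "arrays s0 = arrays s" "arrays s 6 = par"
    using s by (simp_all add: s0_def) (simp add: env_def)
  have "(\<lambda>k (s' :: ram_state). regs s' 13 = (par ^^ k) u \<and> regs s' 14 = (par ^^ k) v \<and>
      (\<forall>i < k. arrays s' a (n - 1 - i) = (par ^^ i) u \<and> arrays s' a (n + i) = (par ^^ i) v))
      (regs s0 0) (sem (For 12 0 body) s0)"
  proof (rule sem_for)
    fix k and s' :: ram_state
    assume k: "k < regs s0 0" "regs s' 12 = k"
      and I: "regs s' 13 = (par ^^ k) u \<and> regs s' 14 = (par ^^ k) v \<and>
      (\<forall>i < k. arrays s' a (n - 1 - i) = (par ^^ i) u \<and> arrays s' a (n + i) = (par ^^ i) v)"
      and f: "\<And>y. y \<notin> wregs body \<Longrightarrow> y \<noteq> 12 \<Longrightarrow> regs s' y = regs s0 y"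
      "\<And>b. b \<notin> warrs body \<Longrightarrow> arrays s' b = arrays s0 b"
    have r: "regs s' 0 = n" "regs s' 9 = V" "arrays s' 6 = par" using f s0 wb a by auto
    have kn: "k < n" using k s0 by simp
    have ix: "(n + k) mod V = n + k" using V kn by simp
    show "regs (setreg 12 (Suc k) (sem body s')) 13 = (par ^^ Suc k) u \<and>
      regs (setreg 12 (Suc k) (sem body s')) 14 = (par ^^ Suc k) v \<and>
      (\<forall>i < Suc k. arrays (setreg 12 (Suc k) (sem body s')) a (n - 1 - i) = (par ^^ i) u \<and>
        arrays (setreg 12 (Suc k) (sem body s')) a (n + i) = (par ^^ i) v)"
    proof -
      have I': "regs s' 13 = (par ^^ k) u" "regs s' 14 = (par ^^ k) v"
        "\<And>i. i < k \<Longrightarrow> arrays s' a (n - 1 - i) = (par ^^ i) u \<and> arrays s' a (n + i) = (par ^^ i) v"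
        using I by blast+
      have B: "regs (sem body s') 13 = par ((par ^^ k) u)" "regs (sem body s') 14 = par ((par ^^ k) v)"
        "arrays (sem body s') a = (arrays s' a)(n - 1 - k := (par ^^ k) u, n + k := (par ^^ k) v)"
        using a by (simp_all add: body_def k(2) r ix I'(1,2))
      have "arrays (sem body s') a (n - 1 - i) = (par ^^ i) u \<and> arrays (sem body s') a (n + i) = (par ^^ i) v"
        if "i < Suc k" for i
        using I'(3)[of i] that kn unfolding B(3) by (cases "i = k") auto
      then show ?thesis by (simp add: B(1,2))
    qed
  qed (auto simp: wb s0_def)
  then have I: "\<And>i. i < n \<Longrightarrow> arrays (sem (For 12 0 body) s0) a (n - 1 - i) = (par ^^ i) u \<and>
      arrays (sem (For 12 0 body) s0) a (n + i) = (par ^^ i) v" using s0 by simp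
  have L: "sem (LOAD a ex ey) s = sem (For 12 0 body) s0"
    by (simp add: LOAD_def body_def s0_def u v)
  show ?thesis
    unfolding L
  proof (rule nth_equalityI)
    show "length (vec (sem (For 12 0 body) s0) a (2 * n)) = length (closed_path u v)" by simp
    fix j assume "j < length (vec (sem (For 12 0 body) s0) a (2 * n))"
    then have j: "j < 2 * n" by simp
    show "vec (sem (For 12 0 body) s0) a (2 * n) ! j = closed_path u v ! j"
    proof (cases "j < n")
      case True
      then show ?thesis using I[of "n - 1 - j"] j by (simp add: closed_path_def nth_append W_def rev_nth)
    next
      case False
      then have "j - n < n" using j by simp
      then show ?thesis using I[of "j - n"] j False by (simp add: closed_path_def nth_append W_def)
    qed
  qed
qed

section \<open>Pushing walks\<close>

lemma PUSHW_spec: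
  assumes s: "env s" "f \<in> {4, 5}" "a \<noteq> 9" "vec s a (2 * n) = cw" "\<And>x. x \<in> set cw \<Longrightarrow> x < n"
    and st: "stk s xs" and l: "length xs + 2 * n \<le> V"
  shows "stk (sem (PUSHW f a) s) (xs @ map (col f) cw)"
    and "stk (sem (PUSHR f a) s) (xs @ rev (map (col f) cw))"
proof -
  have r: "regs s 5 = 2 * n" "regs s 9 = V" using s by auto
  have len: "length cw = 2 * n" using s(4) by auto
  have cw: "arrays s a k = cw ! k" "cw ! k < n" if "k < 2 * n" for k
    using s(4,5) that len by auto
  have c: "arrays s f v = col f v" if "v < n" for v using env_col s that by blast
  have "stk (sem (For 12 5 (PUSH (Elem f (Elem a (Reg 12))))) s) (xs @ map (\<lambda>k. col f (cw ! k)) [0..<regs s 5])"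
    by (rule stk_push_for[OF st]) (use s l r cw c in auto)
  moreover have "map (\<lambda>k. col f (cw ! k)) [0..<regs s 5] = map (col f) cw"
    by (rule nth_equalityI) (use r len in auto)
  ultimately show "stk (sem (PUSHW f a) s) (xs @ map (col f) cw)" by (simp add: PUSHW_def)
  have "stk (sem (For 12 5 (PUSH (Elem f (Elem a (Reg 5 .- Const 1 .- Reg 12))))) s)
      (xs @ map (\<lambda>k. col f (cw ! (2 * n - 1 - k))) [0..<regs s 5])"
    by (rule stk_push_for[OF st]) (use s l r cw c in auto)
  moreover have "map (\<lambda>k. col f (cw ! (2 * n - 1 - k))) [0..<regs s 5] = rev (map (col f) cw)"
    by (rule nth_equalityI) (use r len in \<open>auto simp: rev_nth\<close>)
  ultimately show "stk (sem (PUSHR f a) s) (xs @ rev (map (col f) cw))" by (simp add: PUSHR_def)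
qed

lemma PUSHV_spec:
  assumes s: "env s" "a \<noteq> 9" and st: "stk s xs" and l: "length xs + 100 * n \<le> V"
  shows "stk (sem (PUSHV a) s) (xs @ vec s a (100 * n))"
    and "stk (sem (PUSHVR a) s) (xs @ rev (vec s a (100 * n)))"
proof -
  have r: "regs s 8 = 100 * n" "regs s 9 = V" using s by auto
  have "stk (sem (For 12 8 (PUSH (Elem a (Reg 12)))) s) (xs @ map (arrays s a) [0..<regs s 8])"
    by (rule stk_push_for[OF st]) (use s l r in auto)
  then show "stk (sem (PUSHV a) s) (xs @ vec s a (100 * n))" by (simp add: PUSHV_def vec_def r)
  have "stk (sem (For 12 8 (PUSH (Elem a (Reg 8 .- Const 1 .- Reg 12)))) s)
      (xs @ map (\<lambda>k. arrays s a (100 * n - 1 - k)) [0..<regs s 8])"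
    by (rule stk_push_for[OF st]) (use s l r in auto)
  moreover have "map (\<lambda>k. arrays s a (100 * n - 1 - k)) [0..<regs s 8] = rev (vec s a (100 * n))"
    by (rule nth_equalityI) (use r in \<open>auto simp: rev_nth\<close>)
  ultimately show "stk (sem (PUSHVR a) s) (xs @ rev (vec s a (100 * n)))" by (simp add: PUSHVR_def)
qed

text \<open>
  Reduced walks are stored with the last vertex repeated up to length \<open>100n\<close>.
\<close>
definition saved :: "ram_state \<Rightarrow> nat \<Rightarrow> nat \<Rightarrow> nat \<Rightarrow> nat \<Rightarrow> nat fg \<Rightarrow> bool" where
  "saved s a l x y p \<longleftrightarrow> l < 100 * n \<and> is_red (arcs_of (vec s a (Suc l))) \<and> path (vec s a (Suc l)) = p \<and>
     arrays s a 0 = x \<and> arrays s a l = y \<and> (\<forall>i. l < i \<longrightarrow> i < 100 * n \<longrightarrow> arrays s a i = y)"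

lemma saved_sem: "a \<notin> warrs c \<Longrightarrow> saved (sem c s) a l x y p = saved s a l x y p"
  by (simp add: saved_def vec_sem arrays_sem)

lemma saved_rep: "saved s a l x y p \<Longrightarrow> rep p = arcs_of (vec s a (Suc l))" "saved s a l x y p \<Longrightarrow> l = len p"
  using rep_path_stack[of "vec s a (Suc l)"] by (auto simp: saved_def len_def)

lemma saved_path:
  assumes "saved s a l x y p"
  shows "path (vec s a (100 * n)) = p" "hd (vec s a (100 * n)) = x" "last (vec s a (100 * n)) = y"
    "vec s a (100 * n) \<noteq> []"
proof -
  have l: "l < 100 * n" using assms by (simp add: saved_def)
  have n0: "100 * n \<noteq> 0" using l by simp
  define ys where "ys = map (arrays s a) [Suc l..<100 * n]"
  have v: "vec s a (100 * n) = vec s a (Suc l) @ ys"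
    using l upt_add_eq_append[of 0 "Suc l" "100 * n - Suc l"] by (simp add: vec_def ys_def del: upt_Suc)
  have ys: "set ys \<subseteq> {y}" using assms by (auto simp: ys_def saved_def)
  have y: "last (vec s a (Suc l)) = y" using assms by (simp add: vec_def saved_def)
  have "path (vec s a (Suc l) @ ys) = path (vec s a (Suc l))"
  proof (cases "ys = []")
    case False
    have ne: "vec s a (Suc l) \<noteq> []" by (simp add: vec_def)
    have "hd ys = y" using False ys by (cases ys) auto
    then show ?thesis unfolding path_append[OF ne False] y path_const[OF ys] by simp
  qed simp
  then show "path (vec s a (100 * n)) = p" using assms v by (simp add: saved_def)
  show ne: "vec s a (100 * n) \<noteq> []" using l by (auto simp: vec_def)
  show "hd (vec s a (100 * n)) = x" using assms n0 ne by (simp add: hd_conv_nth saved_def)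
  have "arrays s a (100 * n - 1) = y"
    using assms l by (cases "100 * n - 1 = l") (auto simp: saved_def)
  then show "last (vec s a (100 * n)) = y" using ne l by (simp add: last_conv_nth)
qed

lemma SAVE_spec:
  assumes s: "env s" "stk s xs" "len (path xs) < 100 * n" and a: "a \<noteq> 9" and r: "r \<notin> {8, 10, 12}"
  shows "saved (sem (SAVE a r) s) a (len (path xs)) (hd xs) (last xs) (path xs)"
    and "regs (sem (SAVE a r) s) r = len (path xs)"
proof -
  define body where "body = Cond (Op Less (Reg 10) (Reg 12)) (Put a (Reg 12) (Elem 9 (Reg 10)))
     (Put a (Reg 12) (Elem 9 (Reg 12)))"
  have wb: "wregs body = {}" "warrs body = {a}" by (auto simp: body_def)
  define s0 where "s0 = setreg r (regs s 10) s"
  define l where "l = len (path xs)"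
  have l: "regs s 10 = l" using stk_len[OF s(2)] by (simp add: l_def)
  have s0: "regs s0 8 = 100 * n" "regs s0 10 = l" "arrays s0 = arrays s"
    using s r l by (auto simp: s0_def)
  have S: "sem (SAVE a r) s = sem (For 12 8 body) s0" by (simp add: SAVE_def body_def s0_def)
  show "regs (sem (SAVE a r) s) r = len (path xs)"
    unfolding S using r wb l by (subst regs_sem) (auto simp: s0_def l_def)
  have "(\<lambda>k (s' :: ram_state). \<forall>i < k. arrays s' a i = arrays s 9 (min i l)) (regs s0 8) (sem (For 12 8 body) s0)"
  proof (rule sem_for)
    fix k and s' :: ram_state
    assume k: "regs s' 12 = k" and I: "\<forall>i < k. arrays s' a i = arrays s 9 (min i l)"
      and f: "\<And>y. y \<notin> wregs body \<Longrightarrow> y \<noteq> 12 \<Longrightarrow> regs s' y = regs s0 y"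
      "\<And>b. b \<notin> warrs body \<Longrightarrow> arrays s' b = arrays s0 b"
    have "regs s' 10 = l" "arrays s' 9 = arrays s 9" using f s0 wb a by auto
    then show "\<forall>i < Suc k. arrays (setreg 12 (Suc k) (sem body s')) a i = arrays s 9 (min i l)"
      using I k a by (auto simp: body_def less_Suc_eq)
  qed (use wb in auto)
  then have A: "arrays (sem (SAVE a r) s) a i = arrays s 9 (min i l)" if "i < 100 * n" for i
    using that s0 by (simp add: S)
  have l100: "l < 100 * n" using s by (simp add: l_def)
  have v: "vec (sem (SAVE a r) s) a (Suc l) = stack s"
    unfolding vec_def stack_def using A l l100 by (auto simp del: upt_Suc intro!: map_cong)
  have "hd (stack s) = arrays s 9 0" "last (stack s) = arrays s 9 l"
    using l by (simp_all add: stack_def hd_map last_map del: upt_Suc)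
  then show "saved (sem (SAVE a r) s) a (len (path xs)) (hd xs) (last xs) (path xs)"
    using s(2) l100 unfolding saved_def l_def[symmetric] v by (auto simp: stk_def A)
qed

end

section \<open>Testing and searching\<close>

text \<open>The stack is never empty, so it starts with the color of \<open>q\<close>, which the
  first push merely repeats.\<close>

definition LOOP :: "nat \<Rightarrow> nat \<Rightarrow> stm" where
  "LOOP f w = RESET (Elem f (Elem w (Const 0))) ;; PUSHW f w"

definition TEST :: "nat \<Rightarrow> nat \<Rightarrow> nat \<Rightarrow> nat \<Rightarrow> stm" where
  "TEST w f g a = LOOP f w ;; PUSHV a ;; PUSHR g w ;; PUSHVR a"

definition COPY :: "nat \<Rightarrow> nat \<Rightarrow> stm" where
  "COPY b a = For 12 8 (Put b (Reg 12) (Elem a (Reg 12)))"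

text \<open>
  Register \<open>r\<close> contains the length of the reduced closed walk in array \<open>a\<close>.
\<close>
definition CORE_INDEX :: "nat \<Rightarrow> nat \<Rightarrow> nat \<Rightarrow> stm" where
  "CORE_INDEX a r i = Set i (Const 0) ;;
     For 12 5 (Cond (Op Equal (Elem a (Reg i .+ Const 1)) (Elem a (Reg r .- (Reg i .+ Const 1))))
       (Set i (Reg i .+ Const 1)) Nop)"

text \<open>
  The walk \<open>\<gamma>\<close> along the axis, whose position in the cyclic core is in register 17: the core starts
  at the index in register 24 of the closed walk in array 11, whose length is in register 23.
\<close>
definition STEPB :: stm where
  "STEPB = Cond (Op Equal (Reg 17) (Reg 24)) (Set 17 (Reg 23 .- Reg 24)) Nop ;;
     Set 17 (Reg 17 .- Const 1) ;; PUSH (Elem 11 (Reg 17))"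

definition STEPF :: stm where
  "STEPF = Set 17 (Reg 17 .+ Const 1) ;;
     Cond (Op Equal (Reg 17) (Reg 23 .- Reg 24)) (Set 17 (Reg 24)) Nop ;; PUSH (Elem 11 (Reg 17))"

text \<open>Loop bounds are constant registers and the candidate number \<open>k\<close> in register
  16 is not negative, so the shift \<open>k - 10 * n\<close> is made by \<open>10 * n\<close> steps
  back and \<open>k\<close> steps forward; the stack removes the detour. Register 19 records whether
  the colors agree at the seam, where the tail of the other core is appended in reverse.\<close>

definition BUILD :: "nat \<Rightarrow> nat \<Rightarrow> stm" where
  "BUILD a j = RESET (Elem 11 (Const 0)) ;;
     For 12 5 (Cond (Op Less (Reg 24) (Reg 12)) Nop (PUSH (Elem 11 (Reg 12)))) ;;
     Set 17 (Reg 24) ;; For 12 6 STEPB ;; For 12 7 (Cond (Op Less (Reg 12) (Reg 16)) STEPF Nop) ;;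
     Set 19 (Op Equal (Elem 11 (Reg 17)) (Elem a (Reg j))) ;;
     For 12 5 (Cond (Op Less (Reg j) (Reg 12)) Nop (PUSH (Elem a (Reg j .- Reg 12))))"

text \<open>Serves two searches. For \<open>P\<close> the right side is \<open>\<beta>\<close> and
  all shifts from \<open>- 10 * n\<close> on are tried; for \<open>R\<close> both sides are
  \<open>\<alpha>\<close> and the shifts start at 1, so that the first hit is the least period.
  After a hit, register 18 makes the remaining rounds idle.\<close>

definition TRY :: "nat \<Rightarrow> nat \<Rightarrow> nat \<Rightarrow> rexp \<Rightarrow> nat \<Rightarrow> nat \<Rightarrow> stm" where
  "TRY a j f k b r = Cond (Reg 18) Nop (Cond (Op Less (Reg 16) k) Nop
     (BUILD a j ;; Cond (Reg 19)
       (SAVE 13 29 ;; TEST 8 4 f 13 ;; Cond (Reg 10) Nop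
         (TEST 10 4 f 13 ;; Cond (Reg 10) Nop (Set 18 (Const 1) ;; COPY b 13 ;; Set r (Reg 29)))) Nop))"

definition SEARCH :: "nat \<Rightarrow> nat \<Rightarrow> nat \<Rightarrow> rexp \<Rightarrow> nat \<Rightarrow> nat \<Rightarrow> stm" where
  "SEARCH a j f k b r = Set 18 (Const 0) ;; For 16 7 (TRY a j f k b r)"

lemma wregs_8[simp]: "wregs (LOOP f w) = {10, 11, 12}" "wregs (TEST w f g a) = {10, 11, 12}"
    "wregs (COPY b a) = {12}" "wregs (CORE_INDEX a r i) = {12, i}" "wregs STEPB = {10, 11, 17}" "wregs STEPF = {10, 11, 17}"
    "wregs (BUILD a j) = {10, 11, 12, 17, 19}" "wregs (TRY a j f k b r) = {10, 11, 12, 17, 18, 19, 29, r}"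
    "wregs (SEARCH a j f k b r) = {10, 11, 12, 16, 17, 18, 19, 29, r}"
  by (auto simp: LOOP_def TEST_def COPY_def CORE_INDEX_def STEPB_def STEPF_def BUILD_def TRY_def SEARCH_def)

lemma warrs_8[simp]: "warrs (LOOP f w) = {9}" "warrs (TEST w f g a) = {9}"
    "warrs (COPY b a) = {b}" "warrs (CORE_INDEX a r i) = {}" "warrs STEPB = {9}" "warrs STEPF = {9}"
    "warrs (BUILD a j) = {9}" "warrs (TRY a j f k b r) = {9, 13, b}" "warrs (SEARCH a j f k b r) = {9, 13, b}"
  by (auto simp: LOOP_def TEST_def COPY_def CORE_INDEX_def STEPB_def STEPF_def BUILD_def TRY_def SEARCH_def)

lemma safe_8[simp]: "safe (LOOP f w)" "safe (TEST w f g a)"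
    "safe (COPY b a)" "safe (CORE_INDEX a r i) \<longleftrightarrow> 10 \<le> i \<and> i \<noteq> 12" "safe STEPB" "safe STEPF" "safe (BUILD a j)"
    "safe (TRY a j f k b r) \<longleftrightarrow> 10 \<le> r \<and> bexp k" "safe (SEARCH a j f k b r) \<longleftrightarrow> 10 \<le> r \<and> r \<noteq> 16 \<and> bexp k"
  by (auto simp: LOOP_def TEST_def COPY_def CORE_INDEX_def STEPB_def STEPF_def BUILD_def TRY_def SEARCH_def)

context ram_tree
begin

lemma col_cases: "col 4 = \<alpha>" "col 5 = \<beta>"
  by (auto simp: col_def)

lemma closed_path_props:
  assumes "(u, v) \<in> parcs G"
  shows "hd (closed_path u v) = q" "last (closed_path u v) = q" "closed_path u v \<noteq> []"
    "\<And>x. x \<in> set (closed_path u v) \<Longrightarrow> x < n" "path (map f (closed_path u v)) = loop_of f u v"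
proof -
  have "G.vwalk (closed_path u v)" using closed_path_vwalk[OF assms] by simp
  then show "closed_path u v \<noteq> []" by (simp add: G.vwalk_def)
  show "hd (closed_path u v) = q" "last (closed_path u v) = q" using closed_path_vwalk[OF assms] by auto
  show "\<And>x. x \<in> set (closed_path u v) \<Longrightarrow> x < n" using closed_path_less arc_less[OF assms] by blast
  show "path (map f (closed_path u v)) = loop_of f u v"
    by (rule path_closed_path) (use arc_less[OF assms] VG in auto)
qed

lemma LOOP_spec:
  assumes s: "env s" "f \<in> {4, 5}" "w \<noteq> 9" "vec s w (2 * n) = closed_path u v" "(u, v) \<in> parcs G"
  shows "stk (sem (LOOP f w) s) (col f q # map (col f) (closed_path u v))"
    and "path (col f q # map (col f) (closed_path u v)) = loop_of (col f) u v"
proof -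
  note c = closed_path_props[OF s(5)]
  have n0: "0 < 2 * n" using n2 by simp
  then have "vec s w (2 * n) ! 0 = arrays s w 0" by (rule vec_nth)
  then have "arrays s w 0 = q" using s(4) c(1,3) by (simp add: hd_conv_nth)
  moreover have "q < n" by (rule q_less)
  ultimately have e: "eval_rexp s (Elem f (Elem w (Const 0))) = col f q" using env_col[OF s(1,2)] by simp
  define s1 where "s1 = sem (RESET (Elem f (Elem w (Const 0)))) s"
  have st: "stk s1 [col f q]" unfolding s1_def using stk_reset[of "Elem f (Elem w (Const 0))" s] e by simp
  have env: "env s1" unfolding s1_def using s(1) by (simp add: env_sem)
  have w: "vec s1 w (2 * n) = closed_path u v" unfolding s1_def using s by (simp add: vec_sem)
  have "stk (sem (PUSHW f w) s1) ([col f q] @ map (col f) (closed_path u v))"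
    by (rule PUSHW_spec(1)[OF env s(2,3) w c(4) st]) (use V in auto)
  then show "stk (sem (LOOP f w) s) (col f q # map (col f) (closed_path u v))" by (simp add: LOOP_def s1_def)
  have "path ([col f q] @ map (col f) (closed_path u v)) = loop_of (col f) u v"
    using c by (subst path_append) (auto simp: hd_map)
  then show "path (col f q # map (col f) (closed_path u v)) = loop_of (col f) u v" by simp
qed

text \<open>The pushed vertices spell \<open>f(C) p g(C)^-1 p^-1\<close>, which reduces to the empty
  walk exactly if \<open>p\<close> solves the equation for the closed walk \<open>C\<close>.\<close>

lemma TEST_spec:
  assumes s: "env s" "f \<in> {4, 5}" "g \<in> {4, 5}" "w \<noteq> 9" "a \<noteq> 9" "vec s w (2 * n) = closed_path u v" "(u, v) \<in> parcs G"
    and p: "saved s a l (col f q) (col g q) p"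
  shows "regs (sem (TEST w f g a) s) 10 = 0 \<longleftrightarrow> loop_of (col f) u v + p = p + loop_of (col g) u v"
proof -
  let ?cw = "closed_path u v"
  note c = closed_path_props[OF s(7)]
  define A where "A = col f q # map (col f) ?cw"
  define B where "B = rev (map (col g) ?cw)"
  define Q where "Q = vec s a (100 * n)"
  note pQ = saved_path[OF p, folded Q_def]
  have A: "A \<noteq> []" "last A = col f q" "path A = loop_of (col f) u v" "hd A = col f q" "length A = 2 * n + 1"
    using c LOOP_spec(2)[OF s(1,2,4,6,7)] by (auto simp: A_def last_map)
  have B: "B \<noteq> []" "hd B = col g q" "last B = col g q" "path B = - loop_of (col g) u v" "length B = 2 * n"
    using c by (auto simp: B_def hd_rev last_rev hd_map last_map path_rev)
  have lQ: "length Q = 100 * n" by (simp add: Q_def)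
  define s1 where "s1 = sem (LOOP f w) s"
  have 1: "stk s1 A" "env s1" "vec s1 w (2 * n) = ?cw" "vec s1 a (100 * n) = Q"
    using LOOP_spec(1)[OF s(1,2,4,6,7)] s by (simp_all add: A_def s1_def env_sem vec_sem Q_def)
  define s2 where "s2 = sem (PUSHV a) s1"
  have 2: "stk s2 (A @ Q)" "env s2" "vec s2 w (2 * n) = ?cw" "vec s2 a (100 * n) = Q"
    using PUSHV_spec(1)[OF 1(2) s(5) 1(1)] 1 A V s by (simp_all add: s2_def env_sem vec_sem)
  define s3 where "s3 = sem (PUSHR g w) s2"
  have "stk s3 ((A @ Q) @ B)"
    unfolding s3_def B_def by (rule PUSHW_spec(2)[OF 2(2) s(3,4) 2(3) c(4) 2(1)]) (use A lQ V in auto)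
  then have 3: "stk s3 ((A @ Q) @ B)" "env s3" "vec s3 a (100 * n) = Q"
    using 2 s by (simp_all add: s3_def env_sem vec_sem)
  have "stk (sem (PUSHVR a) s3) (((A @ Q) @ B) @ rev (vec s3 a (100 * n)))"
    by (rule PUSHV_spec(2)[OF 3(2) s(5) 3(1)]) (use A B lQ V in auto)
  then have st: "stk (sem (TEST w f g a) s) (((A @ Q) @ B) @ rev Q)"
    unfolding 3(3) by (simp add: TEST_def s1_def s2_def s3_def)
  have "path (((A @ Q) @ B) @ rev Q) = loop_of (col f) u v + p - loop_of (col g) u v - p"
    using A B pQ
    by (simp add: path_append path_rev hd_rev hd_append last_append diff_conv_add_uminus add.assoc del: append_assoc add_uminus_conv_diff)
  then have "regs (sem (TEST w f g a) s) 10 = 0 \<longleftrightarrow> loop_of (col f) u v + p - loop_of (col g) u v - p = 0"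
    using stk_len[OF st] by simp
  also have "\<dots> \<longleftrightarrow> loop_of (col f) u v + p = p + loop_of (col g) u v"
    by (metis diff_add_cancel add_diff_cancel right_minus_eq)
  finally show ?thesis .
qed

lemma COPY_spec:
  assumes "env s" "saved s a l x y p" "b \<noteq> a"
  shows "saved (sem (COPY b a) s) b l x y p"
proof -
  have r: "regs s 8 = 100 * n" using assms by simp
  have "(\<lambda>k (s' :: ram_state). \<forall>i < k. arrays s' b i = arrays s a i) (regs s 8) (sem (For 12 8 (Put b (Reg 12) (Elem a (Reg 12)))) s)"
  proof (rule sem_for)
    fix k and s' :: ram_state
    assume "regs s' 12 = k" "\<forall>i < k. arrays s' b i = arrays s a i"
      "\<And>c. c \<notin> warrs (Put b (Reg 12) (Elem a (Reg 12))) \<Longrightarrow> arrays s' c = arrays s c"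
    then show "\<forall>i < Suc k. arrays (setreg 12 (Suc k) (sem (Put b (Reg 12) (Elem a (Reg 12))) s')) b i = arrays s a i"
      using assms(3) by (auto simp: less_Suc_eq)
  qed auto
  then have A: "arrays (sem (COPY b a) s) b i = arrays s a i" if "i < 100 * n" for i using that r by (simp add: COPY_def)
  have l: "l < 100 * n" using assms by (simp add: saved_def)
  then have "vec (sem (COPY b a) s) b (Suc l) = vec s a (Suc l)"
    unfolding vec_def using A by (intro map_cong) auto
  then show ?thesis using assms(2) l A unfolding saved_def by auto
qed

lemma CORE_INDEX_spec:
  assumes s: "env s" and p: "saved s a l x x p" "p \<noteq> 0" "l \<le> 2 * n" and r: "regs s r = l" "r \<noteq> i" "r \<noteq> 12" "i \<ge> 10" "i \<noteq> 12"
  shows "core_index (vec s a (Suc l)) (regs (sem (CORE_INDEX a r i) s) i)"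
proof -
  define body where "body = Cond (Op Equal (Elem a (Reg i .+ Const 1)) (Elem a (Reg r .- (Reg i .+ Const 1))))
       (Set i (Reg i .+ Const 1)) Nop"
  have wb: "wregs body = {i}" "warrs body = {}" by (auto simp: body_def)
  define xs where "xs = vec s a (Suc l)"
  have red: "is_red (arcs_of xs)" using p(1) by (simp add: saved_def xs_def)
  have lp: "l = len p" using saved_rep[OF p(1)] by simp
  have "l \<noteq> 0" using p(2) lp by (metis len_eq_0)
  then have len: "length xs = Suc l" "2 \<le> length xs" by (simp_all add: xs_def)
  have xs: "xs ! k = arrays s a k" if "k \<le> l" for k using that by (simp add: xs_def)
  define s0 where "s0 = setreg i 0 s"
  have s0: "regs s0 5 = 2 * n" "regs s0 9 = V" "regs s0 r = l" "arrays s0 = arrays s" "regs s0 i = 0"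
    using s r by (auto simp: s0_def)
  \<comment> \<open>The index advances in every round before the first mismatch and is constant
    afterwards.\<close>
  define P where "P k s' \<longleftrightarrow> palindromic xs (regs s' i) \<and>
      (k \<le> regs s' i \<or> xs ! Suc (regs s' i) \<noteq> xs ! (length xs - 1 - Suc (regs s' i)))" for k and s' :: ram_state
  have "P (regs s0 5) (sem (For 12 5 body) s0)"
  proof (rule sem_for)
    show "P 0 (setreg 12 0 s0)"
      unfolding P_def using p(1) len r xs[of 0] xs[of l] s0 by (auto simp: palindromic_def saved_def)
    fix k and s' :: ram_state
    assume k: "k < regs s0 5" and I: "P k s'"
      and f: "\<And>y. y \<notin> wregs body \<Longrightarrow> y \<noteq> 12 \<Longrightarrow> regs s' y = regs s0 y"
      "\<And>b. b \<notin> warrs body \<Longrightarrow> arrays s' b = arrays s0 b"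
    define m where "m = regs s' i"
    have pm: "palindromic xs m" using I by (simp add: m_def P_def)
    have m: "2 * m + 4 \<le> Suc l" using palindromic_length[OF red pm len(2)] len by simp
    have R: "regs s' 9 = V" "regs s' r = l" "arrays s' a = arrays s a" using f s0 wb r by auto
    have mV: "(m + 1) mod V = Suc m" using m p(3) V by simp
    have c: "xs ! Suc m = arrays s a (Suc m)" "xs ! (length xs - 1 - Suc m) = arrays s a (l - Suc m)"
      using m len by (auto simp: xs)
    have "regs (sem body s') i = (if xs ! Suc m = xs ! (length xs - 1 - Suc m) then Suc m else m)"
      using R mV c by (simp add: body_def flip: m_def)
    then show "P (Suc k) (setreg 12 (Suc k) (sem body s'))"
      using I pm palindromic_Suc[OF red pm len(2)] r unfolding P_def by (auto simp: m_def)
  qed (use wb r in auto)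
  then have fin: "palindromic xs (regs (sem (CORE_INDEX a r i) s) i)"
    "2 * n \<le> regs (sem (CORE_INDEX a r i) s) i \<or> xs ! Suc (regs (sem (CORE_INDEX a r i) s) i) \<noteq>
      xs ! (length xs - 1 - Suc (regs (sem (CORE_INDEX a r i) s) i))"
    unfolding s0(1) P_def by (simp_all add: CORE_INDEX_def body_def s0_def)
  have "2 * regs (sem (CORE_INDEX a r i) s) i + 4 \<le> Suc l"
    using palindromic_length[OF red fin(1) len(2)] len by simp
  \<comment> \<open>By its length the walk cannot fold far enough for the index to advance in all
    \<open>2 * n\<close> rounds, so a mismatch has stopped it.\<close>
  then have "\<not> 2 * n \<le> regs (sem (CORE_INDEX a r i) s) i" using p(3) by simp
  then show ?thesis using fin by (simp add: core_index_def xs_def)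
qed

end

lemma mod_pred:
  assumes "0 < d"
  shows "nat ((t - 1) mod int d) = (if nat (t mod int d) = 0 then d - 1 else nat (t mod int d) - 1)"
    and "nat ((t + 1) mod int d) = (if nat (t mod int d) + 1 = d then 0 else nat (t mod int d) + 1)"
proof -
  have m: "0 \<le> t mod int d" "t mod int d < int d" using assms by simp_all
  have p: "(t - 1) mod int d = (t mod int d - 1) mod int d" "(t + 1) mod int d = (t mod int d + 1) mod int d"
    by (simp_all add: mod_diff_left_eq mod_add_left_eq)
  show "nat ((t - 1) mod int d) = (if nat (t mod int d) = 0 then d - 1 else nat (t mod int d) - 1)"
  proof (cases "t mod int d = 0")
    case True
    have "(-1) mod int d = int d - 1" using assms zmod_minus1[of "int d"] by simp
    then show ?thesis using True assms unfolding p by simp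
  next
    case False
    then have "(t mod int d - 1) mod int d = t mod int d - 1" using m by (intro mod_pos_pos_trivial) auto
    then show ?thesis using False m unfolding p by auto
  qed
  show "nat ((t + 1) mod int d) = (if nat (t mod int d) + 1 = d then 0 else nat (t mod int d) + 1)"
  proof (cases "t mod int d + 1 = int d")
    case True
    then have "nat (t mod int d) + 1 = d" using m by linarith
    then show ?thesis using True unfolding p by simp
  next
    case False
    then have "(t mod int d + 1) mod int d = t mod int d + 1" using m by (intro mod_pos_pos_trivial) auto
    moreover have "nat (t mod int d) + 1 \<noteq> d" using False m by linarith
    ultimately show ?thesis using m unfolding p by auto
  qed
qed

section \<open>Candidates along the axis\<close>

locale ram_core = ram_tree +
  fixes u0 v0 :: nat and xs ys :: "nat list" and i j :: nat and \<gamma> \<eta> :: "int \<Rightarrow> nat fg"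
  assumes X: "core_data \<alpha> u0 v0 xs i \<gamma>" and Y: "core_data \<beta> u0 v0 ys j \<eta>"
    and lx: "length xs \<le> 2 * n + 1" and ly: "length ys \<le> 2 * n + 1"
begin

sublocale core G H \<alpha> \<beta> q W u0 v0 xs ys i j \<gamma> \<eta>
  using X Y by unfold_locales

abbreviation "z \<equiv> core_walk xs i"
abbreviation "d \<equiv> core_length xs i"

lemma d: "0 < d" "length xs - 1 - i = i + d" "i + d < length xs"
proof -
  have "is_red (arcs_of xs)" "palindromic xs i" using X by (auto simp: core_data_def core_index_def)
  from palindromic_length[OF this core_data_length[OF X]]
  show "0 < d" "length xs - 1 - i = i + d" "i + d < length xs" by (auto simp: core_length_def)
qed

lemma z_pos: "nat (t mod int d) < d" "z t = xs ! (i + nat (t mod int d))"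
proof -
  have "0 \<le> t mod int d" "t mod int d < int d" using d by simp_all
  then show "nat (t mod int d) < d" by linarith
  show "z t = xs ! (i + nat (t mod int d))" by (simp add: core_walk_def)
qed

definition cenv :: "ram_state \<Rightarrow> bool" where
  "cenv s \<longleftrightarrow> env s \<and> vec s 11 (length xs) = xs \<and> vec s 12 (length ys) = ys \<and>
     regs s 23 = length xs - 1 \<and> regs s 24 = i \<and> regs s 26 = j"

lemma cenv_sem:
  "safe p \<Longrightarrow> warrs p \<inter> {0, 1, 4, 5, 6, 11, 12} = {} \<Longrightarrow> wregs p \<inter> {23, 24, 26} = {} \<Longrightarrow> cenv (sem p s) = cenv s"
  unfolding cenv_def by (subst env_sem) (auto simp: vec_sem regs_sem)

lemma cenv_setreg: "x \<ge> 10 \<Longrightarrow> x \<notin> {23, 24, 26} \<Longrightarrow> cenv (setreg x v s) = cenv s"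
proof -
  assume "x \<ge> 10" "x \<notin> {23, 24, 26}"
  moreover have "cenv (setreg x v s) = cenv (sem (Set x (Const 0)) (setreg x v s))"
    using calculation by (subst cenv_sem) auto
  moreover have "cenv s = cenv (sem (Set x (Const 0)) s)" using calculation by (subst cenv_sem) auto
  moreover have "sem (Set x (Const 0)) (setreg x v s) = sem (Set x (Const 0)) s" by (simp add: setreg_def)
  ultimately show ?thesis by simp
qed

lemma cenv_env: "cenv s \<Longrightarrow> env s"
  by (simp add: cenv_def)

lemma cenv_nth: "cenv s \<Longrightarrow> k < length xs \<Longrightarrow> arrays s 11 k = xs ! k"
  by (metis cenv_def vec_nth)

text \<open>\<open>B\<close> counts all vertices pushed so far, including those that have cancelled;
  it bounds the top index of the stack.\<close>

definition on_axis :: "ram_state \<Rightarrow> int \<Rightarrow> nat \<Rightarrow> bool" where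
  "on_axis s t B \<longleftrightarrow> (\<exists>ws. stk s ws \<and> hd ws = \<alpha> q \<and> last ws = z t \<and> path ws = \<gamma> t \<and> length ws \<le> B) \<and>
     regs s 17 = i + nat (t mod int d)"

lemma on_axis_setreg: "x \<notin> {10, 17} \<Longrightarrow> on_axis (setreg x v s) t B = on_axis s t B"
  by (simp add: on_axis_def)

lemma on_axis_push:
  assumes c: "cenv s" and a: "on_axis s0 t B" and B: "B < V"
    and s: "arrays s 9 = arrays s0 9" "regs s 10 = regs s0 10" "regs s 17 = i + nat (t' mod int d)"
    and g: "\<gamma> t' = \<gamma> t + ed (z t) (z t')"
  shows "on_axis (sem (PUSH (Elem 11 (Reg 17))) s) t' (Suc B)"
proof -
  obtain ws where ws: "stk s0 ws" "hd ws = \<alpha> q" "last ws = z t" "path ws = \<gamma> t" "length ws \<le> B"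
    using a by (auto simp: on_axis_def)
  have st: "stk s ws" using ws(1) s stk_cong[of s s0 ws] by simp
  have ne: "ws \<noteq> []" using st by (simp add: stk_def)
  have r: "regs s 9 = V" using c cenv_env by simp
  have e: "eval_rexp s (Elem 11 (Reg 17)) = z t'"
    using cenv_nth[OF c, of "i + nat (t' mod int d)"] z_pos[of t'] d s(3) by simp
  have "stk (sem (PUSH (Elem 11 (Reg 17))) s) (ws @ [z t'])"
    using stk_push[OF st, of "Elem 11 (Reg 17)"] ws(5) B r unfolding e by simp
  moreover have "path (ws @ [z t']) = \<gamma> t'" using ws g ne by (simp add: path_snoc)
  moreover have "regs (sem (PUSH (Elem 11 (Reg 17))) s) 17 = i + nat (t' mod int d)"
    using s(3) by (simp add: regs_sem)
  ultimately show ?thesis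
    unfolding on_axis_def using ws ne by (intro conjI exI[of _ "ws @ [z t']"]) auto
qed

lemma on_axis_STEP:
  assumes c: "cenv s" and a: "on_axis s t B" and B: "B < V"
  shows "on_axis (sem STEPB s) (t - 1) (Suc B)" and "on_axis (sem STEPF s) (t + 1) (Suc B)"
proof -
  define m where "m = nat (t mod int d)"
  have r: "regs s 17 = i + m" "regs s 24 = i" "regs s 23 - i = i + d" "regs s 9 = V"
    using a c d cenv_env[OF c] by (auto simp: on_axis_def cenv_def m_def)
  have m: "m < d" using z_pos(1) by (simp add: m_def)
  have V': "(i + m + 1) mod V = i + m + 1" using m d lx V n2 by simp
  have tr: "\<gamma> (k + 1) = \<gamma> k + ed (z k) (z (k + 1))" for k
    using core_data_axis(2)[OF X] by (simp add: trail_of_def)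
  have trb: "\<gamma> (t - 1) = \<gamma> t + ed (z t) (z (t - 1))" using tr[of "t - 1"] by (simp add: add.assoc)
  define sb where "sb = sem (Cond (Op Equal (Reg 17) (Reg 24)) (Set 17 (Reg 23 .- Reg 24)) Nop ;; Set 17 (Reg 17 .- Const 1)) s"
  have b1: "regs sb 17 = i + nat ((t - 1) mod int d)"
    unfolding mod_pred(1)[OF d(1)] m_def[symmetric] sb_def using r m by auto
  have b2: "arrays sb 9 = arrays s 9" "regs sb 10 = regs s 10" "cenv sb"
    unfolding sb_def using c by (simp_all add: arrays_sem regs_sem cenv_sem del: sem.simps)
  show "on_axis (sem STEPB s) (t - 1) (Suc B)"
    using on_axis_push[OF b2(3) a B b2(1,2) b1 trb] by (simp add: STEPB_def sb_def)
  define sf where "sf = sem (Set 17 (Reg 17 .+ Const 1) ;; Cond (Op Equal (Reg 17) (Reg 23 .- Reg 24)) (Set 17 (Reg 24)) Nop) s"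
  have f1: "regs sf 17 = i + nat ((t + 1) mod int d)"
    unfolding mod_pred(2)[OF d(1)] m_def[symmetric] sf_def using r m V' by auto
  have f2: "arrays sf 9 = arrays s 9" "regs sf 10 = regs s 10" "cenv sf"
    unfolding sf_def using c by (simp_all add: arrays_sem regs_sem cenv_sem del: sem.simps)
  show "on_axis (sem STEPF s) (t + 1) (Suc B)"
    using on_axis_push[OF f2(3) a B f2(1,2) f1 tr[of t]] by (simp add: STEPF_def sf_def)
qed

lemma take_Suc_nth: "k < length zs \<Longrightarrow> take (Suc k) zs = take k zs @ [zs ! k]"
  by (rule take_Suc_conv_app_nth)

lemma BUILD_spec:
  assumes c: "cenv s" and f: "f \<in> {4, 5}" and Z: "core_data (col f) u0 v0 zs j' \<xi>"
    and zs: "vec s a (length zs) = zs" "length zs \<le> 2 * n + 1" "regs s r = j'" "a \<noteq> 9" "r \<notin> {10, 11, 12, 17, 19}"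
    and k: "regs s 16 < 20 * n + 1"
  defines "t \<equiv> int (regs s 16) - 10 * int n"
  shows "regs (sem (BUILD a r) s) 19 \<noteq> 0 \<longleftrightarrow> z t = core_walk zs j' 0"
    and "z t = core_walk zs j' 0 \<Longrightarrow> \<exists>ws. stk (sem (BUILD a r) s) ws \<and> hd ws = \<alpha> q \<and> last ws = col f q \<and>
      path ws = \<gamma> t - \<xi> 0 \<and> length ws \<le> 36 * n"
proof -
  have i: "i < length xs" "i < 2 * n" using d lx by auto
  have j': "j' < length zs" "j' < 2 * n"
    using palindromic_length[of zs j'] Z core_data_length[OF Z] zs(2) by (auto simp: core_data_def core_index_def)
  define sa where "sa = sem (RESET (Elem 11 (Const 0))) s"
  have x0: "xs ! 0 = \<alpha> q" "xs \<noteq> []" using X by (auto simp: core_data_def H.vwalk_def hd_conv_nth)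
  have z0: "zs ! 0 = col f q" "zs \<noteq> []" using Z by (auto simp: core_data_def H.vwalk_def hd_conv_nth)
  have ca: "cenv sa" unfolding sa_def using c by (simp add: cenv_sem)
  have "stk sa [xs ! 0]"
    unfolding sa_def using stk_reset[of "Elem 11 (Const 0)" s] cenv_nth[OF c, of 0] x0 by simp
  define A where "A = Cond (Op Less (Reg 24) (Reg 12)) Nop (PUSH (Elem 11 (Reg 12)))"
  define sb where "sb = sem (For 12 5 A) sa"
  have r5: "regs s' 5 = 2 * n" "regs s' 6 = 10 * n" "regs s' 7 = 20 * n + 1" "regs s' 9 = V" if "cenv s'" for s'
    using cenv_env[OF that] by auto
  have "(\<lambda>k (s' :: ram_state). stk s' (xs ! 0 # take (min k (Suc i)) xs)) (regs sa 5) sb"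
    unfolding sb_def
  proof (rule sem_for)
    fix k and s' :: ram_state
    assume k: "k < regs sa 5" "regs s' 12 = k" and st: "stk s' (xs ! 0 # take (min k (Suc i)) xs)"
      and fr: "\<And>y. y \<notin> wregs A \<Longrightarrow> y \<noteq> 12 \<Longrightarrow> regs s' y = regs sa y"
      "\<And>b. b \<notin> warrs A \<Longrightarrow> arrays s' b = arrays sa b"
    have R: "regs s' 24 = i" "regs s' 9 = V" "arrays s' 11 = arrays sa 11"
      using fr[of 24] fr(1)[of 9] fr(2)[of 11] ca r5[OF ca] by (auto simp: A_def cenv_def)
    show "stk (setreg 12 (Suc k) (sem A s')) (xs ! 0 # take (min (Suc k) (Suc i)) xs)"
    proof (cases "i < k")
      case True
      then show ?thesis using st k(2) R by (simp add: A_def)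
    next
      case False
      then have ki: "k < length xs" "k \<le> i" using i by auto
      have e: "eval_rexp s' (Elem 11 (Reg 12)) = xs ! k" using R(3) k(2) cenv_nth[OF ca ki(1)] by simp
      have "length (xs ! 0 # take (min k (Suc i)) xs) < regs s' 9" using R(2) ki lx V n2 by (simp add: min_def)
      from stk_push[OF st this, of "Elem 11 (Reg 12)"]
      have "stk (sem (PUSH (Elem 11 (Reg 12))) s') ((xs ! 0 # take k xs) @ [xs ! k])" using ki unfolding e by simp
      then show ?thesis using False R k(2) ki by (simp add: A_def take_Suc_nth)
    qed
  qed (use \<open>stk sa [xs ! 0]\<close> in \<open>auto simp: A_def\<close>)
  moreover have "min (regs sa 5) (Suc i) = Suc i" using r5[OF ca] i by simp
  ultimately have stb: "stk sb (xs ! 0 # take (Suc i) xs)" by metis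
  have cb: "cenv sb" unfolding sb_def using ca by (simp add: cenv_sem A_def)
  define sc where "sc = sem (Set 17 (Reg 24)) sb"
  have cc: "cenv sc" unfolding sc_def using cb by (simp add: cenv_sem del: sem.simps)
  \<comment> \<open>One vertex from the reset and at most \<open>2 * n + 1\<close> from the closed
    walk.\<close>
  have "on_axis sc 0 (2 * n + 2)"
    unfolding on_axis_def
  proof (intro conjI exI[of _ "xs ! 0 # take (Suc i) xs"])
    show "stk sc (xs ! 0 # take (Suc i) xs)" using stb by (simp add: sc_def)
    show "hd (xs ! 0 # take (Suc i) xs) = \<alpha> q" using x0 by simp
    show "last (xs ! 0 # take (Suc i) xs) = z 0" using i by (simp add: take_Suc_nth core_walk_def)
    have "path ([xs ! 0] @ take (Suc i) xs) = path (take (Suc i) xs)"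
      using x0 i by (subst path_append) (auto simp: hd_conv_nth)
    then show "path (xs ! 0 # take (Suc i) xs) = \<gamma> 0" using X by (simp add: core_data_def)
    show "length (xs ! 0 # take (Suc i) xs) \<le> 2 * n + 2" using lx by simp
    show "regs sc 17 = i + nat (0 mod int d)" using cb by (simp add: sc_def cenv_def)
  qed
  define sd where "sd = sem (For 12 6 STEPB) sc"
  have "(\<lambda>k (s' :: ram_state). cenv s' \<and> on_axis s' (- int k) (2 * n + 2 + k)) (regs sc 6) sd"
    unfolding sd_def
  proof (rule sem_for)
    fix k and s' :: ram_state
    assume "k < regs sc 6" "cenv s' \<and> on_axis s' (- int k) (2 * n + 2 + k)"
    then have *: "cenv s'" "on_axis s' (- int k) (2 * n + 2 + k)" "k < 10 * n" using r5[OF cc] by auto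
    have "cenv (sem STEPB s')" using * by (simp add: cenv_sem)
    moreover have "on_axis (sem STEPB s') (- int k - 1) (Suc (2 * n + 2 + k))"
      by (rule on_axis_STEP(1)[OF *(1,2)]) (use * V n2 in auto)
    moreover have "- int k - 1 = - int (Suc k)" "Suc (2 * n + 2 + k) = 2 * n + 2 + Suc k" by simp_all
    ultimately have "cenv (sem STEPB s')" "on_axis (sem STEPB s') (- int (Suc k)) (2 * n + 2 + Suc k)" by metis+
    then show "cenv (setreg 12 (Suc k) (sem STEPB s')) \<and> on_axis (setreg 12 (Suc k) (sem STEPB s')) (- int (Suc k)) (2 * n + 2 + Suc k)"
      by (simp add: cenv_setreg on_axis_setreg del: of_nat_Suc add_Suc_right)
  qed (use cc \<open>on_axis sc 0 (2 * n + 2)\<close> in \<open>auto simp: cenv_setreg on_axis_setreg\<close>)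
  then have cd: "cenv sd" and atd: "on_axis sd (- (10 * int n)) (12 * n + 2)" using r5[OF cc] by auto
  have k16: "regs sd 16 = regs s 16"
    by (simp add: sd_def sc_def sb_def sa_def A_def regs_sem del: sem.simps)
  define F where "F = Cond (Op Less (Reg 12) (Reg 16)) STEPF Nop"
  define se where "se = sem (For 12 7 F) sd"
  have "(\<lambda>k (s' :: ram_state). cenv s' \<and> on_axis s' (int (min k (regs s 16)) - 10 * int n) (12 * n + 2 + k)) (regs sd 7) se"
    unfolding se_def
  proof (rule sem_for)
    fix k and s' :: ram_state
    assume "k < regs sd 7" "cenv s' \<and> on_axis s' (int (min k (regs s 16)) - 10 * int n) (12 * n + 2 + k)" and r12: "regs s' 12 = k"
      and fr: "\<And>y. y \<notin> wregs F \<Longrightarrow> y \<noteq> 12 \<Longrightarrow> regs s' y = regs sd y"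
    then have *: "cenv s'" "on_axis s' (int (min k (regs s 16)) - 10 * int n) (12 * n + 2 + k)" "k < 20 * n + 1"
      using r5[OF cd] by auto
    have r16: "regs s' 16 = regs s 16" using fr[of 16] k16 by (simp add: F_def)
    have c': "cenv (sem F s')" using * by (simp add: cenv_sem F_def)
    have "on_axis (sem F s') (int (min (Suc k) (regs s 16)) - 10 * int n) (12 * n + 2 + Suc k)"
    proof (cases "k < regs s 16")
      case True
      have "on_axis (sem STEPF s') (int (min k (regs s 16)) - 10 * int n + 1) (Suc (12 * n + 2 + k))"
        by (rule on_axis_STEP(2)[OF *(1,2)]) (use *(3) V n2 in auto)
      moreover have "int (min k (regs s 16)) - 10 * int n + 1 = int (min (Suc k) (regs s 16)) - 10 * int n"
        "Suc (12 * n + 2 + k) = 12 * n + 2 + Suc k"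
        using True by (simp_all add: min_def)
      moreover have "sem F s' = sem STEPF s'" using True r12 r16 by (simp add: F_def)
      ultimately show ?thesis by metis
    next
      case False
      then have "min (Suc k) (regs s 16) = min k (regs s 16)" by (simp add: min_def)
      moreover have "sem F s' = s'" using False r12 r16 by (simp add: F_def)
      moreover have "on_axis s' t (12 * n + 2 + Suc k)" if "on_axis s' t (12 * n + 2 + k)" for t
        using that unfolding on_axis_def by fastforce
      ultimately show ?thesis using *(2) by metis
    qed
    then show "cenv (setreg 12 (Suc k) (sem F s')) \<and>
      on_axis (setreg 12 (Suc k) (sem F s')) (int (min (Suc k) (regs s 16)) - 10 * int n) (12 * n + 2 + Suc k)"
      using c' by (simp add: cenv_setreg on_axis_setreg del: of_nat_Suc add_Suc_right)
  qed (use cd atd in \<open>auto simp: cenv_setreg on_axis_setreg F_def\<close>)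
  moreover have "min (regs sd 7) (regs s 16) = regs s 16" "12 * n + 2 + regs sd 7 = 32 * n + 3"
    using r5[OF cd] k by simp_all
  ultimately have ce: "cenv se" and ate: "on_axis se t (32 * n + 3)" unfolding t_def by metis+
  have arr: "arrays se b = arrays s b" if "b \<noteq> 9" for b
    using that by (simp add: se_def sd_def sc_def sb_def sa_def A_def F_def arrays_sem del: sem.simps)
  have reg: "regs se r = j'"
    using zs(3,5) by (simp add: se_def sd_def sc_def sb_def sa_def A_def F_def regs_sem del: sem.simps)
  have azs: "arrays s a m = zs ! m" if "m < length zs" for m using zs(1) that by (metis vec_nth)
  define sg where "sg = sem (Set 19 (Op Equal (Elem 11 (Reg 17)) (Elem a (Reg r)))) se"
  define T where "T = Cond (Op Less (Reg r) (Reg 12)) Nop (PUSH (Elem a (Reg r .- Reg 12)))"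
  have B: "sem (BUILD a r) s = sem (For 12 5 T) sg"
    by (simp add: BUILD_def sg_def se_def sd_def sc_def sb_def sa_def T_def F_def A_def)
  have z': "core_walk zs j' 0 = zs ! j'" by (simp add: core_walk_def)
  have "arrays se 11 (regs se 17) = z t"
    using ate cenv_nth[OF ce, of "i + nat (t mod int d)"] z_pos[of t] d by (simp add: on_axis_def)
  moreover have "arrays se a (regs se r) = zs ! j'" using arr[OF zs(4)] reg azs j' by simp
  ultimately have "regs sg 19 = (if z t = core_walk zs j' 0 then 1 else 0)" by (simp add: sg_def z')
  then show "regs (sem (BUILD a r) s) 19 \<noteq> 0 \<longleftrightarrow> z t = core_walk zs j' 0"
    unfolding B by (simp add: T_def regs_sem)
  assume eq: "z t = core_walk zs j' 0"
  obtain ws where ws: "stk se ws" "hd ws = \<alpha> q" "last ws = z t" "path ws = \<gamma> t" "length ws \<le> 32 * n + 3"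
    using ate by (auto simp: on_axis_def)
  have cg: "cenv sg" unfolding sg_def using ce by (simp add: cenv_sem del: sem.simps)
  define R where "R = rev (take (Suc j') zs)"
  have lR: "length R = Suc j'" using j' by (simp add: R_def)
  have "(\<lambda>k (s' :: ram_state). stk s' (ws @ take (min k (Suc j')) R)) (regs sg 5) (sem (For 12 5 T) sg)"
  proof (rule sem_for)
    fix k and s' :: ram_state
    assume k: "k < regs sg 5" "regs s' 12 = k" and st: "stk s' (ws @ take (min k (Suc j')) R)"
      and fr: "\<And>y. y \<notin> wregs T \<Longrightarrow> y \<noteq> 12 \<Longrightarrow> regs s' y = regs sg y"
      "\<And>b. b \<notin> warrs T \<Longrightarrow> arrays s' b = arrays sg b"
    have k2: "k < 2 * n" using k(1) r5[OF cg] by simp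
    have R: "regs s' r = j'" "regs s' 9 = V" "arrays s' a = arrays s a"
      using fr(1)[of r] fr(1)[of 9] fr(2)[of a] zs(4,5) reg arr[OF zs(4)] r5[OF cg] by (auto simp: T_def sg_def)
    show "stk (setreg 12 (Suc k) (sem T s')) (ws @ take (min (Suc k) (Suc j')) R)"
    proof (cases "j' < k")
      case True
      then show ?thesis using st k(2) R by (simp add: T_def)
    next
      case False
      then have kj: "k \<le> j'" "k < length R" using lR by auto
      have "R ! k = zs ! (j' - k)" using kj j' by (simp add: R_def rev_nth)
      then have e: "eval_rexp s' (Elem a (Reg r .- Reg 12)) = R ! k" using R k(2) azs[of "j' - k"] j' by simp
      have "length (ws @ take (min k (Suc j')) R) < regs s' 9" using R(2) ws(5) kj k2 V n2 by (simp add: min_def)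
      from stk_push[OF st this, of "Elem a (Reg r .- Reg 12)"]
      have "stk (sem (PUSH (Elem a (Reg r .- Reg 12))) s') (ws @ take k R @ [R ! k])" using kj unfolding e by simp
      then show ?thesis using False R k(2) kj by (simp add: T_def take_Suc_nth)
    qed
  qed (use ws zs(4,5) in \<open>auto simp: T_def sg_def\<close>)
  moreover have "min (regs sg 5) (Suc j') = Suc j'" "take (Suc j') R = R" using r5[OF cg] j' lR by simp_all
  ultimately have st: "stk (sem (BUILD a r) s) (ws @ R)" unfolding B by metis
  have ne: "ws \<noteq> []" "R \<noteq> []" using ws(1) lR by (auto simp: stk_def)
  have hR: "hd R = zs ! j'" using j' by (simp add: R_def hd_rev take_Suc_nth)
  have "last R = col f q" using z0 by (simp add: R_def last_rev hd_conv_nth)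
  moreover have "path R = - \<xi> 0" using Z by (simp add: R_def path_rev core_data_def)
  moreover have "path (ws @ R) = \<gamma> t - \<xi> 0"
    unfolding path_append[OF ne] ws(3,4) hR using calculation eq z' by simp
  \<comment> \<open>\<open>2n + 2\<close> vertices for the tail, \<open>10n\<close> for the steps
    back, at most \<open>20n + 1\<close> for those forward and at most \<open>2n\<close> for the
    other tail; \<open>n\<close> is at least 2.\<close>
  moreover have "length (ws @ R) \<le> 36 * n" using ws(5) lR j' n2 by simp
  ultimately show "\<exists>ws. stk (sem (BUILD a r) s) ws \<and> hd ws = \<alpha> q \<and> last ws = col f q \<and>
      path ws = \<gamma> t - \<xi> 0 \<and> length ws \<le> 36 * n"
    using st ne ws(2) by (intro exI[of _ "ws @ R"]) auto
qed

end

lemma vec_setreg[simp]: "vec (setreg x v s) a l = vec s a l"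
  by (simp add: vec_def)

context ram_tree
begin

lemma saved_setreg[simp]: "saved (setreg x v s) a l b c p = saved s a l b c p"
  by (simp add: saved_def)

lemma env_setreg: "10 \<le> x \<Longrightarrow> env (setreg x v s) = env s"
  using inp_cong[of "setreg x v s" s] by (simp add: env_def)

end

context ram_core
begin

definition passes :: "nat \<Rightarrow> nat \<Rightarrow> nat \<Rightarrow> nat list \<Rightarrow> nat \<Rightarrow> (int \<Rightarrow> nat fg) \<Rightarrow> nat \<Rightarrow> bool" where
  "passes f u v zs j' \<xi> k \<longleftrightarrow> (let t = int k - 10 * int n; p = \<gamma> t - \<xi> 0 in
     z t = core_walk zs j' 0 \<and> loop_of \<alpha> u0 v0 + p = p + loop_of (col f) u0 v0 \<and>
     loop_of \<alpha> u v + p = p + loop_of (col f) u v)"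

lemma TRY_spec:
  assumes c: "cenv s" and f: "f \<in> {4, 5}" and Z: "core_data (col f) u0 v0 zs j' \<xi>"
    and zs: "vec s a (length zs) = zs" "length zs \<le> 2 * n + 1" "regs s rj = j'" "a \<in> {11, 12}" "rj \<in> {24, 26}"
    and W8: "vec s 8 (2 * n) = closed_path u0 v0" and W10: "vec s 10 (2 * n) = closed_path u v" "(u, v) \<in> parcs G"
    and b: "b \<notin> {9, 13}" and r: "r \<notin> {10, 12, 18}"
    and k: "regs s 16 = k" "k < 20 * n + 1" "regs s 18 = 0" "\<not> k < eval_rexp s kx"
  defines "s' \<equiv> sem (TRY a rj f kx b r) s"
  shows "if passes f u v zs j' \<xi> k then regs s' 18 \<noteq> 0 \<and> saved s' b (regs s' r) (\<alpha> q) (col f q) (\<gamma> (int k - 10 * int n) - \<xi> 0) \<and> regs s' r \<le> 36 * n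
    else regs s' 18 = 0"
proof -
  define t where "t = int k - 10 * int n"
  define p where "p = \<gamma> t - \<xi> 0"
  define s1 where "s1 = sem (BUILD a rj) s"
  have B: "regs s1 19 \<noteq> 0 \<longleftrightarrow> z t = core_walk zs j' 0"
    unfolding s1_def t_def k(1)[symmetric]
    by (rule BUILD_spec(1)[OF c f Z zs(1,2,3)]) (use zs k in auto)
  have P: "passes f u v zs j' \<xi> k \<longleftrightarrow> z t = core_walk zs j' 0 \<and> loop_of \<alpha> u0 v0 + p = p + loop_of (col f) u0 v0 \<and>
     loop_of \<alpha> u v + p = p + loop_of (col f) u v" by (simp add: passes_def Let_def t_def p_def)
  have r18: "regs s1 18 = 0" using k by (simp add: s1_def regs_sem)
  show ?thesis
  proof (cases "z t = core_walk zs j' 0")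
    case False
    then have "s' = s1" using B k by (simp add: s'_def TRY_def s1_def)
    then show ?thesis using False P r18 by simp
  next
    case True
    have "\<exists>ws. stk s1 ws \<and> hd ws = \<alpha> q \<and> last ws = col f q \<and> path ws = p \<and> length ws \<le> 36 * n"
      unfolding s1_def p_def t_def k(1)[symmetric]
      by (rule BUILD_spec(2)[OF c f Z zs(1,2,3)]) (use zs k True in \<open>auto simp: t_def\<close>)
    then obtain ws where ws: "stk s1 ws" "hd ws = \<alpha> q" "last ws = col f q" "path ws = p" "length ws \<le> 36 * n" by blast
    have e1: "env s1" using cenv_env[OF c] by (simp add: s1_def env_sem)
    have lp: "len p < 36 * n" using stk_len[OF ws(1)] ws by (simp add: stk_def)
    define s2 where "s2 = sem (SAVE 13 29) s1"
    have "len (path ws) < 100 * n" using lp ws by simp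
    note sv = SAVE_spec[OF e1 ws(1) this, of 13 29]
    have s2: "saved s2 13 (len p) (\<alpha> q) (col f q) p" "regs s2 29 = len p" using sv ws by (simp_all add: s2_def)
    have e2: "env s2" "vec s2 8 (2 * n) = closed_path u0 v0" "vec s2 10 (2 * n) = closed_path u v" "regs s2 18 = 0"
      using e1 W8 W10 r18 by (simp_all add: s2_def env_sem vec_sem regs_sem) (simp_all add: s1_def vec_sem)
    have arc: "(u0, v0) \<in> parcs G" by (rule arc0)
    define s3 where "s3 = sem (TEST 8 4 f 13) s2"
    have T3: "regs s3 10 = 0 \<longleftrightarrow> loop_of \<alpha> u0 v0 + p = p + loop_of (col f) u0 v0"
      using TEST_spec[OF e2(1) _ f _ _ e2(2) arc, of 4 13 "len p" p] s2(1) by (simp add: s3_def col_cases)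
    have s3: "saved s3 13 (len p) (\<alpha> q) (col f q) p" "regs s3 29 = len p" "env s3"
      "vec s3 10 (2 * n) = closed_path u v" "regs s3 18 = 0"
      using s2 e2 by (simp_all add: s3_def saved_sem env_sem vec_sem regs_sem)
    define s4 where "s4 = sem (TEST 10 4 f 13) s3"
    have T4: "regs s4 10 = 0 \<longleftrightarrow> loop_of \<alpha> u v + p = p + loop_of (col f) u v"
      using TEST_spec[OF s3(3) _ f _ _ s3(4) W10(2), of 4 13 "len p" p] s3(1) by (simp add: s4_def col_cases)
    have s4: "saved s4 13 (len p) (\<alpha> q) (col f q) p" "regs s4 29 = len p" "env s4" "regs s4 18 = 0"
      using s3 by (simp_all add: s4_def saved_sem env_sem regs_sem)
    define s5 where "s5 = sem (Set 18 (Const 1)) s4"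
    have s5: "saved s5 13 (len p) (\<alpha> q) (col f q) p" "env s5" "regs s5 29 = len p" "regs s5 18 = 1"
      using s4 by (simp_all add: s5_def saved_sem env_sem regs_sem del: sem.simps) simp
    have "b \<noteq> 13" using b by simp
    note cp = COPY_spec[OF s5(2,1) this]
    define s6 where "s6 = sem (Set r (Reg 29)) (sem (COPY b 13) s5)"
    have s6: "saved s6 b (len p) (\<alpha> q) (col f q) p" "regs s6 r = len p" "regs s6 18 = 1"
      using cp s5 r by (simp_all add: s6_def regs_sem)
    have S: "s' = (if regs s3 10 \<noteq> 0 then s3 else if regs s4 10 \<noteq> 0 then s4 else s6)"
      using B True k(3,4) r18 unfolding s'_def TRY_def
      by (simp add: k(1) flip: s1_def s2_def s3_def s4_def) (simp add: s6_def s5_def)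
    show ?thesis
    proof (cases "passes f u v zs j' \<xi> k")
      case True
      then have "s' = s6" using S T3 T4 P by simp
      then show ?thesis using True s6 lp by (simp add: p_def t_def)
    next
      case False
      then have "s' = s3 \<or> s' = s4" using S T3 T4 P \<open>z t = core_walk zs j' 0\<close> by auto
      then show ?thesis using False s3 s4 by auto
    qed
  qed
qed

lemma SEARCH_spec:
  assumes c: "cenv s" and f: "f \<in> {4, 5}" and Z: "core_data (col f) u0 v0 zs j' \<xi>"
    and zs: "vec s a (length zs) = zs" "length zs \<le> 2 * n + 1" "regs s rj = j'" "a \<in> {11, 12}" "rj \<in> {24, 26}"
    and W8: "vec s 8 (2 * n) = closed_path u0 v0" and W10: "vec s 10 (2 * n) = closed_path u v" "(u, v) \<in> parcs G"
    and b: "b \<notin> {0, 1, 4, 5, 6, 8, 9, 10, 11, 12, 13}" and r: "30 \<le> r"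
    and kx: "bexp kx" "\<And>s'. (\<And>x. x < 10 \<Longrightarrow> regs s' x = regs s x) \<Longrightarrow> eval_rexp s' kx = K"
  defines "s' \<equiv> sem (SEARCH a rj f kx b r) s"
  shows "if regs s' 18 = 0 then \<forall>k < 20 * n + 1. K \<le> k \<longrightarrow> \<not> passes f u v zs j' \<xi> k
    else \<exists>k < 20 * n + 1. K \<le> k \<and> passes f u v zs j' \<xi> k \<and> (\<forall>k' < k. K \<le> k' \<longrightarrow> \<not> passes f u v zs j' \<xi> k') \<and>
      saved s' b (regs s' r) (\<alpha> q) (col f q) (\<gamma> (int k - 10 * int n) - \<xi> 0) \<and> regs s' r \<le> 36 * n"
proof -
  define T where "T = TRY a rj f kx b r"
  define s0 where "s0 = setreg 18 0 s"
  have wT: "wregs T = {10, 11, 12, 17, 18, 19, 29, r}" "warrs T = {9, 13, b}" "safe T"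
    using r kx(1) by (simp_all add: T_def)
  define I where "I N s' \<longleftrightarrow> (if regs s' 18 = 0 then \<forall>k < N. K \<le> k \<longrightarrow> \<not> passes f u v zs j' \<xi> k
    else \<exists>k < N. K \<le> k \<and> passes f u v zs j' \<xi> k \<and> (\<forall>k' < k. K \<le> k' \<longrightarrow> \<not> passes f u v zs j' \<xi> k') \<and>
      saved s' b (regs s' r) (\<alpha> q) (col f q) (\<gamma> (int k - 10 * int n) - \<xi> 0) \<and> regs s' r \<le> 36 * n)"
    for N and s' :: ram_state
  have I_set: "I N (setreg 16 v s') = I N s'" for N v s'
    using r by (simp add: I_def)
  have r7: "regs s0 7 = 20 * n + 1" using cenv_env[OF c] by (simp add: s0_def)
  have "I (regs s0 7) (sem (For 16 7 T) s0)"
  proof (rule sem_for)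
    show "I 0 (setreg 16 0 s0)" by (simp add: I_def s0_def)
    fix k and s' :: ram_state
    assume k: "k < regs s0 7" and Ik: "I k s'" and r16: "regs s' 16 = k"
      and fr: "\<And>y. y \<notin> wregs T \<Longrightarrow> y \<noteq> 16 \<Longrightarrow> regs s' y = regs s0 y"
      "\<And>a. a \<notin> warrs T \<Longrightarrow> arrays s' a = arrays s0 a"
    have regs: "regs s' y = regs s y" if "y < 10 \<or> y \<in> {23, 24, 26}" for y
      using fr(1)[of y] that r by (auto simp: wT s0_def)
    have arrs: "arrays s' y = arrays s y" if "y \<notin> {9, 13, b}" for y using fr(2)[of y] that by (simp add: wT s0_def)
    have vecs: "vec s' y l = vec s y l" if "y \<in> {8, 10, 11, 12}" for y l using arrs[of y] that b by (auto simp: vec_def)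
    have "inp s' = inp s" by (rule inp_cong) (use regs arrs b in auto)
    then have "inp s'" using cenv_env[OF c] by (simp add: env_def)
    then have c': "cenv s'" using c arrs[of 6] vecs regs b unfolding cenv_def env_def by auto
    have K: "eval_rexp s' kx = K" using regs by (intro kx) simp
    show "I (Suc k) (setreg 16 (Suc k) (sem T s'))"
    proof (cases "regs s' 18 = 0 \<and> K \<le> k")
      case False
      then have "sem T s' = s'" using r16 K by (auto simp: T_def TRY_def)
      then show ?thesis unfolding I_set using False Ik by (auto simp: I_def less_Suc_eq)
    next
      case True
      have no: "\<forall>k' < k. K \<le> k' \<longrightarrow> \<not> passes f u v zs j' \<xi> k'" using Ik True by (simp add: I_def)
      have "if passes f u v zs j' \<xi> k then regs (sem T s') 18 \<noteq> 0 \<and>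
          saved (sem T s') b (regs (sem T s') r) (\<alpha> q) (col f q) (\<gamma> (int k - 10 * int n) - \<xi> 0) \<and> regs (sem T s') r \<le> 36 * n
        else regs (sem T s') 18 = 0"
        unfolding T_def
        by (rule TRY_spec[OF c' f Z]) (use zs W8 W10 b r r16 k r7 True K vecs regs in auto)
      then show ?thesis
        unfolding I_set using no True by (auto simp: I_def less_Suc_eq split: if_splits)
    qed
  qed (use wT r in auto)
  moreover have "sem (For 16 7 T) s0 = s'" by (simp add: s'_def SEARCH_def T_def s0_def)
  ultimately show ?thesis unfolding r7 I_def by metis
qed

end

section \<open>Checking a candidate\<close>

text \<open>Array 10 contains \<open>closed_path v v\<close>, whose first half is the tree path from
  \<open>q\<close> to \<open>v\<close> and whose second half is the way back.\<close>

definition DOWN :: "nat \<Rightarrow> stm" where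
  "DOWN f = For 12 0 (PUSH (Elem f (Elem 10 (Reg 12))))"

definition UP :: "nat \<Rightarrow> stm" where
  "UP f = For 12 0 (PUSH (Elem f (Elem 10 (Reg 0 .+ Reg 12))))"

definition VALID :: "nat \<Rightarrow> stm" where
  "VALID a = Set 30 (Const 1) ;; For 15 1 (LOAD 10 (Elem 0 (Reg 15)) (Elem 1 (Reg 15)) ;; TEST 10 4 5 a ;;
     Cond (Reg 10) (Set 30 (Const 0)) Nop)"

text \<open>The top index of the stack is the number of moves that a vertex has to make, and the
  entry at index 1 is its next color.\<close>

definition TRANS :: "nat \<Rightarrow> stm" where
  "TRANS a = For 15 0 (LOAD 10 (Reg 15) (Reg 15) ;; RESET (Elem 4 (Reg 15)) ;; UP 4 ;; PUSHV a ;; DOWN 5 ;;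
     Put 16 (Reg 15) (Reg 10) ;; Put 17 (Reg 15) (Elem 9 (Const 1)))"

definition MARK :: stm where
  "MARK = Set 13 (Elem 0 (Reg 15)) ;; Set 14 (Elem 1 (Reg 15)) ;;
     Cond (Elem 16 (Reg 13)) (Cond (Elem 16 (Reg 14))
       (Cond (Op Equal (Elem 4 (Reg 14)) (Elem 4 (Reg 13))) Nop
         (Cond (Op Equal (Elem 4 (Reg 14)) (Elem 17 (Reg 13))) Nop
           (Put 18 (Reg 13) (Const 1) ;; Put 19 (Reg 13) (Reg 14)))) Nop) Nop"

text \<open>Removes the vertices that have no blocker among the remaining ones. The result is
  collected in array 18 and copied after the scan, so that all removals of one round refer to the
  same set.\<close>

definition ROUND :: stm where
  "ROUND = For 15 0 (Put 18 (Reg 15) (Const 0)) ;; For 15 1 MARK ;; For 15 0 (Put 16 (Reg 15) (Elem 18 (Reg 15)))"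

definition CYCLE :: stm where
  "CYCLE = Set 31 (Const 1) ;; Set 32 (Const 0) ;;
     For 15 0 (Cond (Elem 16 (Reg 15)) (Set 31 (Const 0) ;; Set 32 (Reg 15)) Nop) ;;
     For 15 0 (Cond (Reg 31) Nop (Set 32 (Elem 19 (Reg 32))))"

definition CHECK :: "nat \<Rightarrow> stm" where
  "CHECK a = VALID a ;; TRANS a ;; For 16 0 ROUND ;; CYCLE"

lemma wregs_9[simp]: "wregs (DOWN f) = {10, 11, 12}" "wregs (UP f) = {10, 11, 12}" "wregs (VALID a) = {10, 11, 12, 13, 14, 15, 30}"
    "wregs (TRANS a) = {10, 11, 12, 13, 14, 15}" "wregs MARK = {13, 14}" "wregs ROUND = {13, 14, 15}" "wregs CYCLE = {15, 31, 32}"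
    "wregs (CHECK a) = {10, 11, 12, 13, 14, 15, 16, 30, 31, 32}"
  by (auto simp: DOWN_def UP_def VALID_def TRANS_def MARK_def ROUND_def CYCLE_def CHECK_def)

lemma warrs_9[simp]: "warrs (DOWN f) = {9}" "warrs (UP f) = {9}" "warrs (VALID a) = {9, 10}"
    "warrs (TRANS a) = {9, 10, 16, 17}" "warrs MARK = {18, 19}" "warrs ROUND = {16, 18, 19}" "warrs CYCLE = {}"
    "warrs (CHECK a) = {9, 10, 16, 17, 18, 19}"
  by (auto simp: DOWN_def UP_def VALID_def TRANS_def MARK_def ROUND_def CYCLE_def CHECK_def)

lemma safe_9[simp]: "safe (DOWN f)" "safe (UP f)" "safe (VALID a)" "safe (TRANS a)" "safe MARK" "safe ROUND" "safe CYCLE" "safe (CHECK a)"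
  by (auto simp: DOWN_def UP_def VALID_def TRANS_def MARK_def ROUND_def CYCLE_def CHECK_def)

text \<open>Two of the iterates with exponents 0 to \<open>n\<close> coincide, so the orbit has
  entered a cycle by then and the iterate with exponent \<open>n\<close> lies on it.\<close>

lemma funpow_cycle:
  assumes Z: "finite Z" "card Z \<le> n" and f: "\<And>x. x \<in> Z \<Longrightarrow> f x \<in> Z \<and> (x, f x) \<in> B" and v: "v \<in> Z"
  shows "((f ^^ n) v, (f ^^ n) v) \<in> B\<^sup>+"
proof -
  have fZ: "(f ^^ k) x \<in> Z" if "x \<in> Z" for x k using that f by (induction k) auto
  have tr: "(x, (f ^^ Suc k) x) \<in> B\<^sup>+" if "x \<in> Z" for x k
  proof (induction k)
    case (Suc k)
    have "((f ^^ Suc k) x, (f ^^ Suc (Suc k)) x) \<in> B" using f[OF fZ[OF that, of "Suc k"]] by simp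
    then show ?case using Suc by (rule trancl.trancl_into_trancl[rotated])
  qed (use f that in auto)
  have "card ((\<lambda>k. (f ^^ k) v) ` {..n}) \<le> card Z" using Z(1) fZ[OF v] by (intro card_mono) auto
  then have "\<not> inj_on (\<lambda>k. (f ^^ k) v) {..n}" using Z(2) by (metis card_atMost card_image not_less_eq_eq order_trans)
  then obtain i j where ij: "i < j" "j \<le> n" "(f ^^ i) v = (f ^^ j) v"
    unfolding inj_on_def by (metis atMost_iff linorder_neqE_nat)
  obtain p where p: "j = i + Suc p" using ij(1) less_iff_Suc_add[of i j] by auto
  have fa: "(f ^^ a) ((f ^^ b) x) = (f ^^ (a + b)) x" for a b x by (simp add: funpow_add)
  have "(f ^^ Suc p) ((f ^^ n) v) = (f ^^ (n - i)) ((f ^^ j) v)"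
  proof -
    have "Suc p + n = (n - i) + j" using ij p by simp
    then show ?thesis unfolding fa by (rule arg_cong)
  qed
  also have "\<dots> = (f ^^ (n - i)) ((f ^^ i) v)" using ij(3) by simp
  also have "\<dots> = (f ^^ n) v" using ij unfolding fa by simp
  finally show ?thesis using tr[OF fZ[OF v, of n], of p] by simp
qed

context ram_tree
begin

lemma HALF_spec:
  assumes s: "env s" "f \<in> {4, 5}" "vec s 10 (2 * n) = closed_path v v" "v < n" and st: "stk s xs" "length xs + n \<le> V"
  shows "stk (sem (DOWN f) s) (xs @ map (col f) (W v))" "stk (sem (UP f) s) (xs @ rev (map (col f) (W v)))"
proof -
  have r: "regs s 0 = n" "regs s 9 = V" using s by auto
  have cw: "arrays s 10 k = closed_path v v ! k" if "k < 2 * n" for k using s(3) that by (metis vec_nth)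
  have Wl: "W v ! k < n" if "k < n" for k using that s(4) by (simp add: W_def rev_nth par_pow_less)
  have c1: "arrays s 10 k = W v ! k" if "k < n" for k using cw[of k] that by (simp add: closed_path_def nth_append)
  have c2: "arrays s 10 (n + k) = rev (W v) ! k" if "k < n" for k using cw[of "n + k"] that by (simp add: closed_path_def nth_append)
  have W2: "rev (W v) ! k < n" if "k < n" for k using Wl[of "n - 1 - k"] that by (simp add: rev_nth)
  have e: "arrays s f x = col f x" if "x < n" for x using env_col s(1,2) that by blast
  have "stk (sem (For 12 0 (PUSH (Elem f (Elem 10 (Reg 12))))) s) (xs @ map (\<lambda>k. col f (W v ! k)) [0..<regs s 0])"
    by (rule stk_push_for[OF st(1)]) (use s st r c1 Wl e in auto)
  moreover have "map (\<lambda>k. col f (W v ! k)) [0..<regs s 0] = map (col f) (W v)"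
    by (rule nth_equalityI) (use r in auto)
  ultimately show "stk (sem (DOWN f) s) (xs @ map (col f) (W v))" by (simp add: DOWN_def)
  have "stk (sem (For 12 0 (PUSH (Elem f (Elem 10 (Reg 0 .+ Reg 12))))) s) (xs @ map (\<lambda>k. col f (rev (W v) ! k)) [0..<regs s 0])"
    by (rule stk_push_for[OF st(1)]) (use s st r c2 W2 e V in auto)
  moreover have "map (\<lambda>k. col f (rev (W v) ! k)) [0..<regs s 0] = rev (map (col f) (W v))"
    by (rule nth_equalityI) (use r in \<open>auto simp: rev_map\<close>)
  ultimately show "stk (sem (UP f) s) (xs @ rev (map (col f) (W v)))" by (simp add: UP_def)
qed

lemma VALID_spec:
  assumes s: "env s" "saved s a l (\<alpha> q) (\<beta> q) p" "a \<notin> {9, 10}"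
  shows "regs (sem (VALID a) s) 30 \<noteq> 0 \<longleftrightarrow> valid p"
proof -
  define B where "B = LOAD 10 (Elem 0 (Reg 15)) (Elem 1 (Reg 15)) ;; TEST 10 4 5 a ;; Cond (Reg 10) (Set 30 (Const 0)) Nop"
  have wB: "wregs B = {10, 11, 12, 13, 14, 30}" "warrs B = {9, 10}" "safe B" by (auto simp: B_def)
  define s0 where "s0 = setreg 30 1 s"
  have e0: "env s0" using env_sem[of "Set 30 (Const 1)" s] s(1) by (simp add: s0_def)
  define good where "good k \<longleftrightarrow> loop_of \<alpha> (fst (gs ! k)) (snd (gs ! k)) + p = p + loop_of \<beta> (fst (gs ! k)) (snd (gs ! k))" for k
  define I where "I N s' \<longleftrightarrow> env s' \<and> saved s' a l (\<alpha> q) (\<beta> q) p \<and> (regs s' 30 \<noteq> 0 \<longleftrightarrow> (\<forall>k < N. good k))" for N and s' :: ram_state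
  have I_set: "I N (setreg 15 v s') = I N s'" for N v s'
    by (simp add: I_def env_setreg)
  have r1: "regs s0 1 = length gs" using e0 by simp
  have "I (regs s0 1) (sem (For 15 1 B) s0)"
  proof (rule sem_for)
    show "I 0 (setreg 15 0 s0)" using e0 s unfolding I_set by (simp add: I_def s0_def)
    fix k and s' :: ram_state
    assume k: "k < regs s0 1" "regs s' 15 = k" and I: "I k s'"
    have kl: "k < length gs" using k r1 by simp
    obtain x y where xy: "gs ! k = (x, y)" by fastforce
    have arc: "(x, y) \<in> parcs G" using gs_nth[OF kl] xy by simp
    have e: "env s'" and sv: "saved s' a l (\<alpha> q) (\<beta> q) p" using I by (auto simp: I_def)
    have xa: "arrays s' 0 k = x" "arrays s' (Suc 0) k = y" using env_arcs[OF e kl] xy by auto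
    define s1 where "s1 = sem (LOAD 10 (Elem 0 (Reg 15)) (Elem 1 (Reg 15))) s'"
    have w: "vec s1 10 (2 * n) = closed_path x y"
      unfolding s1_def by (rule LOAD_spec[OF e]) (use xa k in auto)
    have 1: "env s1" "saved s1 a l (\<alpha> q) (\<beta> q) p" using e sv s(3) by (simp_all add: s1_def env_sem saved_sem)
    define s2 where "s2 = sem (TEST 10 4 5 a) s1"
    have T: "regs s2 10 = 0 \<longleftrightarrow> good k"
      unfolding s2_def good_def xy using TEST_spec[OF 1(1) _ _ _ _ w arc, of 4 5 a l p] 1(2) s(3) by (simp add: col_cases)
    have "regs s2 30 = regs s' 30" by (simp add: s2_def s1_def regs_sem)
    moreover have "sem B s' = (if regs s2 10 \<noteq> 0 then setreg 30 0 s2 else s2)"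
      by (simp add: B_def s1_def s2_def)
    ultimately have "regs (sem B s') 30 \<noteq> 0 \<longleftrightarrow> regs s' 30 \<noteq> 0 \<and> good k" using T by simp
    then show "I (Suc k) (setreg 15 (Suc k) (sem B s'))"
      unfolding I_set using I wB s(3) by (auto simp: I_def env_sem saved_sem less_Suc_eq)
  qed (use wB in auto)
  then have "regs (sem (VALID a) s) 30 \<noteq> 0 \<longleftrightarrow> (\<forall>k < length gs. good k)"
    unfolding r1 by (simp add: I_def VALID_def B_def s0_def)
  also have "\<dots> \<longleftrightarrow> valid p"
    unfolding valid_def good_def using gs by (metis (mono_tags, lifting) case_prod_unfold in_set_conv_nth)
  finally show ?thesis .
qed

lemma TRANS_spec:
  assumes s: "env s" "saved s a l (\<alpha> q) (\<beta> q) p" "a \<notin> {9, 10, 16, 17}" and v: "v < n"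
  shows "arrays (sem (TRANS a) s) 16 v \<noteq> 0 \<longleftrightarrow> trans_of p v \<noteq> 0"
    and "trans_of p v \<noteq> 0 \<Longrightarrow> arrays (sem (TRANS a) s) 17 v = snd (hd (rep (trans_of p v)))"
proof -
  define B where "B = LOAD 10 (Reg 15) (Reg 15) ;; RESET (Elem 4 (Reg 15)) ;; UP 4 ;; PUSHV a ;; DOWN 5 ;;
     Put 16 (Reg 15) (Reg 10) ;; Put 17 (Reg 15) (Elem 9 (Const 1))"
  have wB: "wregs B = {10, 11, 12, 13, 14}" "warrs B = {9, 10, 16, 17}" "safe B" by (auto simp: B_def)
  define ok where "ok s' v \<longleftrightarrow> (arrays s' 16 v \<noteq> 0 \<longleftrightarrow> trans_of p v \<noteq> 0) \<and>
    (trans_of p v \<noteq> 0 \<longrightarrow> arrays s' 17 v = snd (hd (rep (trans_of p v))))" for v and s' :: ram_state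
  define I where "I N s' \<longleftrightarrow> env s' \<and> saved s' a l (\<alpha> q) (\<beta> q) p \<and> (\<forall>v < N. ok s' v)" for N and s' :: ram_state
  have I_set: "I N (setreg 15 v s') = I N s'" for N v s'
    by (simp add: I_def ok_def env_setreg)
  have r0: "regs s 0 = n" using s by simp
  have "I (regs s 0) (sem (For 15 0 B) s)"
  proof (rule sem_for)
    show "I 0 (setreg 15 0 s)" using s unfolding I_set by (simp add: I_def)
    fix k and s' :: ram_state
    assume k: "k < regs s 0" "regs s' 15 = k" and I: "I k s'"
    have kn: "k < n" using k r0 by simp
    have e: "env s'" and sv: "saved s' a l (\<alpha> q) (\<beta> q) p" using I by (auto simp: I_def)
    define s1 where "s1 = sem (LOAD 10 (Reg 15) (Reg 15)) s'"
    have w1: "vec s1 10 (2 * n) = closed_path k k"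
      unfolding s1_def by (rule LOAD_spec[OF e]) (use k in auto)
    have 1: "env s1" "saved s1 a l (\<alpha> q) (\<beta> q) p" "regs s1 15 = k"
      using e sv s(3) k by (simp_all add: s1_def env_sem saved_sem regs_sem)
    define s2 where "s2 = sem (RESET (Elem 4 (Reg 15))) s1"
    have st2: "stk s2 [\<alpha> k]"
      using stk_reset[of "Elem 4 (Reg 15)" s1] env_col[OF 1(1), of 4 k] 1(3) kn by (simp add: s2_def col_cases)
    have 2: "env s2" "saved s2 a l (\<alpha> q) (\<beta> q) p" "vec s2 10 (2 * n) = closed_path k k" "regs s2 15 = k"
      using 1 w1 s(3) by (simp_all add: s2_def env_sem saved_sem vec_sem regs_sem)
    define s3 where "s3 = sem (UP 4) s2"
    have st3: "stk s3 ([\<alpha> k] @ rev (map \<alpha> (W k)))"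
      using HALF_spec(2)[OF 2(1) _ 2(3) kn st2, of 4] V n2 by (simp add: s3_def col_cases)
    have 3: "env s3" "saved s3 a l (\<alpha> q) (\<beta> q) p" "vec s3 10 (2 * n) = closed_path k k" "regs s3 15 = k"
      using 2 s(3) by (simp_all add: s3_def env_sem saved_sem vec_sem regs_sem)
    define Q where "Q = vec s3 a (100 * n)"
    have lQ: "length Q = 100 * n" by (simp add: Q_def)
    note pQ = saved_path[OF 3(2), folded Q_def]
    define s4 where "s4 = sem (PUSHV a) s3"
    have st4: "stk s4 (([\<alpha> k] @ rev (map \<alpha> (W k))) @ Q)"
      unfolding s4_def Q_def by (rule PUSHV_spec(1)[OF 3(1) _ st3]) (use s(3) V n2 in auto)
    have 4: "env s4" "vec s4 10 (2 * n) = closed_path k k" "saved s4 a l (\<alpha> q) (\<beta> q) p" "regs s4 15 = k"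
      using 3 s(3) by (simp_all add: s4_def env_sem saved_sem vec_sem regs_sem)
    define s5 where "s5 = sem (DOWN 5) s4"
    define ws where "ws = (([\<alpha> k] @ rev (map \<alpha> (W k))) @ Q) @ map \<beta> (W k)"
    have st5: "stk s5 ws"
      using HALF_spec(1)[OF 4(1) _ 4(2) kn st4, of 5] lQ V n2 by (simp add: s5_def ws_def col_cases)
    have r5: "regs s5 15 = k" using 4 by (simp add: s5_def regs_sem)
    have kG: "k \<in> pverts G" using kn VG by simp
    have Wk: "W k \<noteq> []" "hd (W k) = q" "last (W k) = k" using W[OF kG] by (auto simp: G.vwalk_def)
    have pws: "path ws = trans_of p k"
      using Wk pQ
      by (simp add: ws_def path_append path_rev hd_rev last_rev hd_append last_append hd_map last_map trans_of_def tree_path_def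
          add.assoc del: append_assoc append_Cons)
    have len5: "regs s5 10 = len (trans_of p k)" using stk_len[OF st5] pws by simp
    have rp: "rep (trans_of p k) = arcs_of (stack s5)" using rep_path_stack[of "stack s5"] st5 pws by (simp add: stk_def)
    have F: "arrays s5 9 1 = snd (hd (rep (trans_of p k)))" if "trans_of p k \<noteq> 0"
    proof -
      have "0 < regs s5 10" using that len5 by (metis len_eq_0 neq0_conv)
      then have "stack s5 = arrays s5 9 0 # arrays s5 9 1 # map (arrays s5 9) [2..<Suc (regs s5 10)]"
        by (simp add: stack_def upt_conv_Cons numeral_2_eq_2 del: upt_Suc)
      then show ?thesis unfolding rp by simp
    qed
    have S: "sem B s' = setarr 17 k (arrays s5 9 1) (setarr 16 k (regs s5 10) s5)"
      using r5 by (simp add: B_def s1_def s2_def s3_def s4_def s5_def)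
    have "ok (sem B s') k" unfolding ok_def S using F len5 by simp
    moreover have "ok (sem B s') v" if "v < k" for v
    proof -
      have "arrays s5 16 v = arrays s' 16 v" "arrays s5 17 v = arrays s' 17 v"
        by (simp_all add: s5_def s4_def s3_def s2_def s1_def arrays_sem)
      then show ?thesis using I that unfolding S by (simp add: I_def ok_def)
    qed
    ultimately show "I (Suc k) (setreg 15 (Suc k) (sem B s'))"
      unfolding I_set using I wB s(3) by (auto simp: I_def env_sem saved_sem less_Suc_eq)
  qed (use wB in auto)
  then have "ok (sem (TRANS a) s) v" using v unfolding r0 by (simp add: I_def TRANS_def B_def)
  then show "arrays (sem (TRANS a) s) 16 v \<noteq> 0 \<longleftrightarrow> trans_of p v \<noteq> 0"
    "trans_of p v \<noteq> 0 \<Longrightarrow> arrays (sem (TRANS a) s) 17 v = snd (hd (rep (trans_of p v)))"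
    by (auto simp: ok_def)
qed

end

section \<open>Detection of blocking cycles\<close>

context ram_tree
begin

definition alive :: "ram_state \<Rightarrow> nat set" where
  "alive s = {v. v < n \<and> arrays s 16 v \<noteq> 0}"

definition firsts :: "nat fg \<Rightarrow> ram_state \<Rightarrow> bool" where
  "firsts p s \<longleftrightarrow> alive s \<subseteq> {v. trans_of p v \<noteq> 0} \<and>
     (\<forall>v < n. trans_of p v \<noteq> 0 \<longrightarrow> arrays s 17 v = snd (hd (rep (trans_of p v))))"

abbreviation block :: "nat fg \<Rightarrow> (nat \<times> nat) set" where
  "block p \<equiv> blocking \<alpha> (trans_of p)"

lemma alive_setreg[simp]: "alive (setreg x v s) = alive s" "firsts p (setreg x v s) = firsts p s"
  by (simp_all add: alive_def firsts_def)

lemma ROUND_spec: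
  assumes s: "env s" "firsts p s"
  shows "alive (sem ROUND s) = {x \<in> alive s. \<exists>y \<in> alive s. (x, y) \<in> block p}"
    and "\<And>x. x \<in> alive (sem ROUND s) \<Longrightarrow> arrays (sem ROUND s) 19 x \<in> alive s \<and> (x, arrays (sem ROUND s) 19 x) \<in> block p"
proof -
  define A where "A = alive s"
  define good where "good x y \<longleftrightarrow> x \<in> A \<and> y \<in> A \<and> (x, y) \<in> block p" for x y
  define sa where "sa = sem (For 15 0 (Put 18 (Reg 15) (Const 0))) s"
  have r: "regs s 0 = n" using s by simp
  define I where "I N s' \<longleftrightarrow> (\<forall>v < N. arrays s' 18 v = 0)" for N and s' :: ram_state
  have "I (regs s 0) sa"
    unfolding sa_def by (rule sem_for) (auto simp: I_def less_Suc_eq)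
  then have a0: "\<And>v. v < n \<Longrightarrow> arrays sa 18 v = 0" using r by (simp add: I_def)
  have ea: "env sa" using s by (simp add: sa_def env_sem)
  have aa: "arrays sa 16 = arrays s 16" "arrays sa 17 = arrays s 17" by (simp_all add: sa_def arrays_sem)
  define sb where "sb = sem (For 15 1 MARK) sa"
  define J where "J N s' \<longleftrightarrow> (\<forall>x < n. arrays s' 18 x \<noteq> 0 \<longrightarrow> good x (arrays s' 19 x)) \<and>
      (\<forall>k < N. good (fst (gs ! k)) (snd (gs ! k)) \<longrightarrow> arrays s' 18 (fst (gs ! k)) \<noteq> 0)" for N and s' :: ram_state
  have r1: "regs sa 1 = length gs" using ea by simp
  have "J (regs sa 1) sb"
    unfolding sb_def
  proof (rule sem_for)
    show "J 0 (setreg 15 0 sa)" using a0 by (simp add: J_def)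
    fix k and s' :: ram_state
    assume k: "k < regs sa 1" "regs s' 15 = k" and J: "J k s'"
      and fr: "\<And>y. y \<notin> wregs MARK \<Longrightarrow> y \<noteq> 15 \<Longrightarrow> regs s' y = regs sa y"
      "\<And>a. a \<notin> warrs MARK \<Longrightarrow> arrays s' a = arrays sa a"
    have kl: "k < length gs" using k r1 by simp
    obtain x y where xy: "gs ! k = (x, y)" by fastforce
    have arc: "(x, y) \<in> parcs G" using gs_nth[OF kl] xy by simp
    have xyn: "x < n" "y < n" using arc_less[OF arc] by auto
    have ar: "arrays s' b = arrays sa b" if "b \<notin> {18, 19}" for b using fr(2)[of b] that by simp
    have ar0: "arrays s' 0 k = x" "arrays s' (Suc 0) k = y"
      using env_arcs[OF ea kl] ar[of 0] ar[of "Suc 0"] xy by auto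
    have ar4: "arrays s' 4 x = \<alpha> x" "arrays s' 4 y = \<alpha> y"
      using env_col[OF ea, of 4] ar[of 4] xyn by (auto simp: col_cases)
    have al: "arrays s' 16 v \<noteq> 0 \<longleftrightarrow> v \<in> A" if "v < n" for v
      using that ar[of 16] aa by (simp add: A_def alive_def)
    have fi: "arrays s' 17 x = snd (hd (rep (trans_of p x)))" "trans_of p x \<noteq> 0" if "x \<in> A"
      using s(2) that ar[of 17] aa xyn by (auto simp: firsts_def A_def)
    have cond: "good x y \<longleftrightarrow> x \<in> A \<and> y \<in> A \<and> \<alpha> y \<noteq> \<alpha> x \<and> \<alpha> y \<noteq> arrays s' 17 x"
      using arc fi by (auto simp: good_def blocking_def)
    define s1 where "s1 = setreg 14 y (setreg 13 x s')"
    have M: "sem MARK s' = (if good x y then setarr 19 x y (setarr 18 x 1 s1) else s1)"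
    proof -
      have "sem (Set 14 (Elem 1 (Reg 15))) (sem (Set 13 (Elem 0 (Reg 15))) s') = s1"
        using k(2) ar0 by (simp add: s1_def)
      moreover have "arrays s1 = arrays s'" "regs s1 13 = x" "regs s1 14 = y" by (simp_all add: s1_def)
      ultimately show ?thesis using cond al[OF xyn(1)] al[OF xyn(2)] ar4 by (simp add: MARK_def)
    qed
    show "J (Suc k) (setreg 15 (Suc k) (sem MARK s'))"
    proof (cases "good x y")
      case True
      then have "arrays (sem MARK s') 18 = (arrays s' 18)(x := 1)" "arrays (sem MARK s') 19 = (arrays s' 19)(x := y)"
        by (simp_all add: M s1_def)
      then show ?thesis using J True xy unfolding J_def arrays_setreg less_Suc_eq by auto
    next
      case False
      then have "arrays (sem MARK s') = arrays s'" by (simp add: M s1_def)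
      then show ?thesis using J False xy unfolding J_def arrays_setreg less_Suc_eq by auto
    qed
  qed auto
  then have Jb: "\<And>x. x < n \<Longrightarrow> arrays sb 18 x \<noteq> 0 \<Longrightarrow> good x (arrays sb 19 x)"
    "\<And>k. k < length gs \<Longrightarrow> good (fst (gs ! k)) (snd (gs ! k)) \<Longrightarrow> arrays sb 18 (fst (gs ! k)) \<noteq> 0"
    unfolding r1 J_def by blast+
  have rb: "regs sb 0 = n" using ea env_sem[of "For 15 1 MARK" sa] by (simp add: sb_def)
  define sc where "sc = sem (For 15 0 (Put 16 (Reg 15) (Elem 18 (Reg 15)))) sb"
  define L where "L N s' \<longleftrightarrow> arrays s' 18 = arrays sb 18 \<and> (\<forall>v < N. arrays s' 16 v = arrays sb 18 v)" for N and s' :: ram_state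
  have "L (regs sb 0) sc"
    unfolding sc_def by (rule sem_for) (auto simp: L_def less_Suc_eq)
  then have c16: "\<And>v. v < n \<Longrightarrow> arrays sc 16 v = arrays sb 18 v" using rb by (simp add: L_def)
  have c19: "arrays sc 19 = arrays sb 19" by (simp add: sc_def arrays_sem)
  have S: "sem ROUND s = sc" by (simp add: ROUND_def sa_def sb_def sc_def)
  have mem: "x \<in> alive sc \<longleftrightarrow> x < n \<and> arrays sb 18 x \<noteq> 0" for x using c16 by (auto simp: alive_def)
  show "alive (sem ROUND s) = {x \<in> alive s. \<exists>y \<in> alive s. (x, y) \<in> block p}"
  proof (intro set_eqI iffI)
    fix x assume "x \<in> alive (sem ROUND s)"
    then show "x \<in> {x \<in> alive s. \<exists>y \<in> alive s. (x, y) \<in> block p}"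
      using Jb(1)[of x] unfolding S mem by (auto simp: good_def A_def)
  next
    fix x assume "x \<in> {x \<in> alive s. \<exists>y \<in> alive s. (x, y) \<in> block p}"
    then obtain y where "good x y" by (auto simp: good_def A_def)
    moreover obtain k where "k < length gs" "gs ! k = (x, y)"
      using calculation gs_ex by (auto simp: good_def blocking_def)
    ultimately show "x \<in> alive (sem ROUND s)"
      unfolding S mem using Jb(2)[of k] by (auto simp: good_def A_def alive_def)
  qed
  show "arrays (sem ROUND s) 19 x \<in> alive s \<and> (x, arrays (sem ROUND s) 19 x) \<in> block p" if "x \<in> alive (sem ROUND s)" for x
    using that Jb(1)[of x] unfolding S mem c19 by (auto simp: good_def A_def)
qed

lemma CYCLE_spec:
  assumes s: "env s"
  shows "regs (sem CYCLE s) 31 \<noteq> 0 \<longleftrightarrow> alive s = {}"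
    and "regs (sem CYCLE s) 31 = 0 \<Longrightarrow> \<exists>v \<in> alive s. regs (sem CYCLE s) 32 = (arrays s 19 ^^ n) v"
proof -
  define s0 where "s0 = setreg 32 0 (setreg 31 1 s)"
  define B where "B = Cond (Elem 16 (Reg 15)) (Set 31 (Const 0) ;; Set 32 (Reg 15)) Nop"
  define sa where "sa = sem (For 15 0 B) s0"
  have r: "regs s0 0 = n" using s by (simp add: s0_def)
  define I where "I N s' \<longleftrightarrow> arrays s' = arrays s \<and> (if regs s' 31 = 0 then regs s' 32 \<in> alive s else \<forall>v < N. v \<notin> alive s)"
    for N and s' :: ram_state
  have "I (regs s0 0) sa"
    unfolding sa_def
  proof (rule sem_for)
    fix k and s' :: ram_state
    assume k: "k < regs s0 0" "regs s' 15 = k" and I: "I k s'"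
    have "arrays s' 16 k \<noteq> 0 \<longleftrightarrow> k \<in> alive s" using I k r by (auto simp: alive_def I_def)
    then have "sem B s' = (if k \<in> alive s then setreg 32 k (setreg 31 0 s') else s')" using k(2) by (simp add: B_def)
    then show "I (Suc k) (setreg 15 (Suc k) (sem B s'))" using I by (auto simp: I_def less_Suc_eq)
  qed (auto simp: I_def s0_def B_def)
  then have sa: "arrays sa = arrays s" "if regs sa 31 = 0 then regs sa 32 \<in> alive s else \<forall>v < n. v \<notin> alive s"
    using r by (auto simp: I_def)
  define C where "C = Cond (Reg 31) Nop (Set 32 (Elem 19 (Reg 32)))"
  define J where "J N s' \<longleftrightarrow> arrays s' = arrays s \<and> regs s' 31 = regs sa 31 \<and>
    (regs sa 31 = 0 \<longrightarrow> regs s' 32 = (arrays s 19 ^^ N) (regs sa 32))" for N and s' :: ram_state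
  have ra: "regs sa 0 = n" using r by (simp add: sa_def regs_sem B_def)
  have "J (regs sa 0) (sem (For 15 0 C) sa)"
    by (rule sem_for) (auto simp: J_def sa C_def)
  then have fin: "regs (sem CYCLE s) 31 = regs sa 31"
    "regs sa 31 = 0 \<Longrightarrow> regs (sem CYCLE s) 32 = (arrays s 19 ^^ n) (regs sa 32)"
    unfolding ra by (simp_all add: J_def CYCLE_def sa_def s0_def B_def C_def)
  show "regs (sem CYCLE s) 31 \<noteq> 0 \<longleftrightarrow> alive s = {}"
    using sa(2) unfolding fin(1) by (auto simp: alive_def split: if_splits)
  show "\<exists>v \<in> alive s. regs (sem CYCLE s) 32 = (arrays s 19 ^^ n) v" if "regs (sem CYCLE s) 31 = 0"
    using sa(2) fin that by auto
qed

text \<open>The rounds shrink the set of moving vertices to the largest set in which everyone has a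
  blocker inside, which is empty exactly if blocking is acyclic. A round that removes nothing shows
  that this set is reached, so \<open>n\<close> rounds suffice.\<close>

lemma CHECK_spec:
  assumes s: "env s" "saved s a l (\<alpha> q) (\<beta> q) p" "a \<notin> {9, 10, 16, 17}"
  shows "regs (sem (CHECK a) s) 30 \<noteq> 0 \<longleftrightarrow> valid p"
    and "regs (sem (CHECK a) s) 31 \<noteq> 0 \<longleftrightarrow> acyclic (block p)"
    and "regs (sem (CHECK a) s) 31 = 0 \<Longrightarrow> (regs (sem (CHECK a) s) 32, regs (sem (CHECK a) s) 32) \<in> (block p)\<^sup>+"
proof -
  define s1 where "s1 = sem (VALID a) s"
  have 1: "regs s1 30 \<noteq> 0 \<longleftrightarrow> valid p" unfolding s1_def by (rule VALID_spec[OF s(1,2)]) (use s(3) in auto)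
  have e1: "env s1" "saved s1 a l (\<alpha> q) (\<beta> q) p" using s by (simp_all add: s1_def env_sem saved_sem)
  define s2 where "s2 = sem (TRANS a) s1"
  have e2: "env s2" "regs s2 30 = regs s1 30" using e1 by (simp_all add: s2_def env_sem regs_sem)
  have al2: "alive s2 = {v. v < n \<and> trans_of p v \<noteq> 0}"
    using TRANS_spec(1)[OF e1 s(3)] by (auto simp: alive_def s2_def)
  have f2: "firsts p s2" using TRANS_spec(2)[OF e1 s(3)] al2 by (auto simp: firsts_def s2_def)
  define clsd where "clsd X \<longleftrightarrow> (\<forall>x \<in> X. \<exists>y \<in> X. (x, y) \<in> block p)" for X
  \<comment> \<open>In a stable state, array 19 is a successor function on the surviving vertices,
    which \<open>CYCLE\<close> iterates to get onto a cycle.\<close>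
  define stable where "stable s' \<longleftrightarrow> (\<forall>x \<in> alive s'. arrays s' 19 x \<in> alive s' \<and> (x, arrays s' 19 x) \<in> block p)" for s' :: ram_state
  define K where "K N s' \<longleftrightarrow> env s' \<and> firsts p s' \<and> (\<forall>X. clsd X \<longrightarrow> X \<subseteq> alive s') \<and>
    (stable s' \<or> card (alive s') + N \<le> n)" for N and s' :: ram_state
  have fin: "finite (alive s')" for s' by (simp add: alive_def)
  have K_set: "K N (setreg 16 v s') = K N s'" for N v s' by (simp add: K_def stable_def env_setreg)
  define s3 where "s3 = sem (For 16 0 ROUND) s2"
  have r2: "regs s2 0 = n" using e2 by simp
  have "K (regs s2 0) s3"
    unfolding s3_def
  proof (rule sem_for)
    have "clsd X \<Longrightarrow> X \<subseteq> alive s2" for X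
      unfolding al2 clsd_def using arc_less by (fastforce simp: blocking_def)
    moreover have "card (alive s2) \<le> card {..<n}" by (rule card_mono) (auto simp: alive_def)
    ultimately show "K 0 (setreg 16 0 s2)" unfolding K_set using e2 f2 by (simp add: K_def)
    fix k and s' :: ram_state
    assume K: "K k s'"
    then have e: "env s'" and f: "firsts p s'" by (auto simp: K_def)
    note R = ROUND_spec[OF e f]
    let ?s = "sem ROUND s'"
    have sub: "alive ?s \<subseteq> alive s'" unfolding R(1) by blast
    have "env ?s" using e by (simp add: env_sem)
    moreover have "firsts p ?s" using f sub by (simp add: firsts_def arrays_sem) blast
    moreover have "X \<subseteq> alive ?s" if X: "clsd X" for X
    proof
      fix x assume x: "x \<in> X"
      then obtain y where "y \<in> X" "(x, y) \<in> block p" using X by (auto simp: clsd_def)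
      moreover have "X \<subseteq> alive s'" using K X by (auto simp: K_def)
      ultimately show "x \<in> alive ?s" unfolding R(1) using x by blast
    qed
    moreover have "stable ?s \<or> card (alive ?s) + Suc k \<le> n"
    proof (cases "alive ?s = alive s'")
      case True
      then show ?thesis using R(2) by (auto simp: stable_def)
    next
      case False
      then have "\<not> stable s'" unfolding stable_def R(1) by blast
      moreover have "card (alive ?s) < card (alive s')" using False sub by (intro psubset_card_mono fin) auto
      ultimately show ?thesis using K by (simp add: K_def)
    qed
    ultimately show "K (Suc k) (setreg 16 (Suc k) ?s)" unfolding K_set by (simp add: K_def)
  qed auto
  then have K3: "K n s3" unfolding r2 .
  have e3: "env s3" and fx: "stable s3"
  proof -
    show "env s3" using K3 by (simp add: K_def)
    show "stable s3"
    proof (cases "stable s3")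
      case False
      then have "card (alive s3) = 0" using K3 by (simp add: K_def)
      then show ?thesis using fin[of s3] by (simp add: stable_def)
    qed
  qed
  have S: "sem (CHECK a) s = sem CYCLE s3" by (simp add: CHECK_def s1_def s2_def s3_def)
  have r30: "regs (sem (CHECK a) s) 30 = regs s1 30" unfolding S using e2 by (simp add: regs_sem s3_def)
  show "regs (sem (CHECK a) s) 30 \<noteq> 0 \<longleftrightarrow> valid p" unfolding r30 by (rule 1)
  have "acyclic (block p) \<longleftrightarrow> alive s3 = {}"
  proof
    assume "acyclic (block p)"
    then show "alive s3 = {}" using not_acyclicI[OF finite_blocking, of "alive s3"] fx unfolding stable_def by blast
  next
    assume e: "alive s3 = {}"
    show "acyclic (block p)"
      unfolding acyclic_blocking_iff
    proof
      assume "\<exists>X. bicore (block p) X"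
      then obtain X where "clsd X" "X \<noteq> {}" by (auto simp: bicore_def clsd_def)
      then show False using K3 e by (auto simp: K_def)
    qed
  qed
  then show "regs (sem (CHECK a) s) 31 \<noteq> 0 \<longleftrightarrow> acyclic (block p)" unfolding S using CYCLE_spec(1)[OF e3] by simp
  assume "regs (sem (CHECK a) s) 31 = 0"
  then obtain v where v: "v \<in> alive s3" "regs (sem (CHECK a) s) 32 = (arrays s3 19 ^^ n) v"
    unfolding S using CYCLE_spec(2)[OF e3] by blast
  have "card (alive s3) \<le> card {..<n}" by (rule card_mono) (auto simp: alive_def)
  then show "(regs (sem (CHECK a) s) 32, regs (sem (CHECK a) s) 32) \<in> (block p)\<^sup>+"
    unfolding v(2) by (intro funpow_cycle[OF fin _ _ v(1)]) (use fx in \<open>auto simp: stable_def\<close>)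
qed

end

section \<open>The program\<close>

definition LOAD_ARC :: "nat \<Rightarrow> nat \<Rightarrow> stm" where
  "LOAD_ARC a r = LOAD a (Elem 0 (Reg r)) (Elem 1 (Reg r))"

definition BASE :: stm where
  "BASE = Set 20 (Const 0) ;; Set 21 (Const 0) ;; Set 22 (Const 0) ;;
     For 15 1 (LOAD_ARC 8 15 ;; LOOP 4 8 ;; Cond (Reg 10) (Set 20 (Const 1) ;; Set 21 (Reg 15)) Nop ;;
       LOOP 5 8 ;; Cond (Reg 10) (Set 22 (Const 1)) Nop)"

definition WITNESS :: stm where
  "WITNESS = Set 27 (Reg 21) ;;
     For 15 1 (LOAD_ARC 10 15 ;; TEST 10 4 4 11 ;; Cond (Reg 10) (Set 27 (Reg 15)) Nop) ;; LOAD_ARC 10 27"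

text \<open>
  Arrays 11 and 12 contain the reductions of \<open>\<alpha>(C)\<close> and \<open>\<beta>(C)\<close> for the closed walk \<open>C\<close> in array 8,
  registers 23 and 25 their lengths and registers 24 and 26 the positions of their cyclic cores.
  Array 14 contains \<open>P\<close>, array 15 contains \<open>R\<close>, and array 13 a further candidate for a realizable
  walk; their lengths are in registers 34, 33 and 29. CHECK leaves in register 30 whether a candidate
  is valid, in register 31 whether its blocking relation is acyclic, and otherwise in register 32 a
  vertex on a cycle. In the end, register 40 contains the outcome, registers 41 and 42 the lengths of
  the walks.
\<close>

definition NONE :: stm where
  "NONE = Set 40 (Const 1)"

definition SINGLE :: "nat \<Rightarrow> nat \<Rightarrow> stm" where
  "SINGLE a r = For 12 8 (Put 0 (Reg 12) (Elem a (Reg 12)) ;; Put 1 (Reg 12) (Elem a (Reg 12 .+ Const 1))) ;;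
     Set 41 (Reg r) ;; Set 40 (Const 2)"

definition POWERS :: stm where
  "POWERS = For 12 8 (Put 0 (Reg 12) (Elem 15 (Reg 12)) ;; Put 1 (Reg 12) (Elem 15 (Reg 12 .+ Const 1)) ;;
       Put 2 (Reg 12) (Elem 14 (Reg 12)) ;; Put 3 (Reg 12) (Elem 14 (Reg 12 .+ Const 1))) ;;
     Set 41 (Reg 33) ;; Set 42 (Reg 34) ;; Set 40 (Const 3)"

definition FREE :: stm where
  "FREE = LOAD_ARC 10 21 ;; SEARCH 11 24 4 (Reg 6 .+ Const 1) 15 33 ;; RESET (Elem 15 (Const 0)) ;;
     PUSHV 15 ;; PUSHV 14 ;; SAVE 13 29 ;; CHECK 13 ;;
     Cond (Reg 30) (Cond (Reg 31) POWERS (SINGLE 14 34)) (SINGLE 14 34)"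

text \<open>Builds \<open>tree_path \<alpha> v - tree_path \<beta> v\<close> for the vertex
  \<open>v\<close> in register 32, the only candidate left by \<open>cycle_outcome\<close>.\<close>

definition TIGHT :: stm where
  "TIGHT = Cond (Op Equal (Elem 4 (Reg 32)) (Elem 5 (Reg 32)))
     (LOAD 10 (Reg 32) (Reg 32) ;; RESET (Elem 4 (Elem 10 (Const 0))) ;; DOWN 4 ;; UP 5 ;; SAVE 13 29 ;; CHECK 13 ;;
       Cond (Reg 30) (Cond (Reg 31) (SINGLE 13 29) NONE) NONE) NONE"

definition CORES :: stm where
  "CORES = LOAD_ARC 8 21 ;; LOOP 4 8 ;; SAVE 11 23 ;; CORE_INDEX 11 23 24 ;; LOOP 5 8 ;; SAVE 12 25"

definition SOLVE :: stm where
  "SOLVE = WITNESS ;; SEARCH 12 26 5 (Const 0) 14 34 ;;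
     Cond (Reg 18) (CHECK 14 ;; Cond (Reg 30) (Cond (Reg 31) FREE TIGHT) NONE) NONE"

text \<open>The tests of registers 25 and 22 catch a closed walk with exactly one trivial image, for
  which the equation has no solution.\<close>

definition MAIN :: stm where
  "MAIN = TREE ;; BASE ;; Cond (Reg 20)
     (CORES ;; Cond (Reg 25) (CORE_INDEX 12 25 26 ;; SOLVE) NONE)
     (Cond (Reg 22) NONE (Set 40 (Const 4)))"

lemma wregs_11[simp]: "wregs (LOAD_ARC a r) = {12, 13, 14}" "wregs BASE = {10, 11, 12, 13, 14, 15, 20, 21, 22}"
    "wregs WITNESS = {10, 11, 12, 13, 14, 15, 27}" "wregs CORES = {10, 11, 12, 13, 14, 23, 24, 25}"
  by (auto simp: LOAD_ARC_def BASE_def WITNESS_def CORES_def)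

lemma warrs_11[simp]: "warrs (LOAD_ARC a r) = {a}" "warrs BASE = {8, 9}"
    "warrs WITNESS = {9, 10}" "warrs CORES = {8, 9, 11, 12}"
  by (auto simp: LOAD_ARC_def BASE_def WITNESS_def CORES_def)

lemma safe_11[simp]: "safe (LOAD_ARC a r)" "safe BASE" "safe WITNESS" "safe CORES" "safe NONE" "safe (SINGLE a r)" "safe POWERS"
    "safe FREE" "safe TIGHT" "safe SOLVE" "safe MAIN"
  by (auto simp: LOAD_ARC_def BASE_def WITNESS_def CORES_def NONE_def SINGLE_def POWERS_def FREE_def TIGHT_def SOLVE_def MAIN_def)

lemma len_path: "len (path ws) \<le> length ws - 1"
proof (induction ws rule: path.induct)
  case (3 x y ws)
  have "len (ed x y) \<le> 1" by (cases "x = y") (auto simp: len_def rep_ed)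
  then show ?case using 3 len_add_le[of "ed x y" "path (y # ws)"] by simp
qed auto

lemma (in refl_graph) vwalk_arcs_of:
  "xs \<noteq> [] \<Longrightarrow> is_walk G (hd xs) (arcs_of xs) v \<Longrightarrow> vwalk xs"
proof (induction xs rule: arcs_of.induct)
  case (3 x y xs)
  then have "(x, y) \<in> parcs G" "vwalk (y # xs)" by auto
  then show ?case by (auto simp: vwalk_def wellformed')
qed (auto simp: vwalk_def)

section \<open>Correctness of the outcomes\<close>

context ram_tree
begin

definition answer :: "ram_state \<Rightarrow> bool" where
  "answer s \<longleftrightarrow> regs s 40 = 1 \<and> outcome_none G H \<alpha> \<beta> q \<or>
     regs s 40 = 2 \<and> (\<exists>P. stored_walk s 0 1 (regs s 41) = rep P \<and> len P \<le> 100 * n \<and> outcome_single G H \<alpha> \<beta> q (rep P)) \<or>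
     regs s 40 = 3 \<and> (\<exists>R P. stored_walk s 0 1 (regs s 41) = rep R \<and> stored_walk s 2 3 (regs s 42) = rep P \<and>
       len R \<le> 100 * n \<and> len P \<le> 100 * n \<and> outcome_powers G H \<alpha> \<beta> q (rep R) (rep P)) \<or>
     regs s 40 = 4 \<and> outcome_all G H \<alpha> \<beta> q"

lemma answer_NONE: "outcome_none G H \<alpha> \<beta> q \<Longrightarrow> answer (sem NONE s)"
  by (simp add: NONE_def answer_def)

lemma stored_saved:
  assumes "saved s a l x y p" "\<And>i. i < l \<Longrightarrow> arrays s' b i = arrays s a i \<and> arrays s' c i = arrays s a (i + 1)"
  shows "stored_walk s' b c l = rep p"
  unfolding saved_rep(1)[OF assms(1)] arcs_of_conv_map stored_walk_def
  using assms(2) by (intro map_cong) auto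

lemma answer_SINGLE:
  assumes s: "env s" "saved s a (regs s r) x y P" and a: "a \<notin> {0, 1}" and r: "r \<notin> {12}"
    and o: "outcome_single G H \<alpha> \<beta> q (rep P)"
  shows "answer (sem (SINGLE a r) s)"
proof -
  define B where "B = Put 0 (Reg 12) (Elem a (Reg 12)) ;; Put 1 (Reg 12) (Elem a (Reg 12 .+ Const 1))"
  define sa where "sa = sem (For 12 8 B) s"
  have r8: "regs s 8 = 100 * n" "regs s 9 = V" using s by auto
  define I where "I N s' \<longleftrightarrow> arrays s' a = arrays s a \<and> regs s' 9 = V \<and>
    (\<forall>i < N. arrays s' 0 i = arrays s a i \<and> arrays s' 1 i = arrays s a (i + 1))" for N and s' :: ram_state
  have "I (regs s 8) sa"
    unfolding sa_def
  proof (rule sem_for)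
    fix k and s' :: ram_state
    assume k: "k < regs s 8" "regs s' 12 = k" and I: "I k s'"
    have "(k + 1) mod V = k + 1" using k r8 V n2 by simp
    moreover have "arrays s' a = arrays s a" "regs s' 9 = V" using I by (auto simp: I_def)
    ultimately have "sem B s' = setarr 1 k (arrays s a (k + 1)) (setarr 0 k (arrays s a k) s')"
      using k(2) a by (simp add: B_def)
    then show "I (Suc k) (setreg 12 (Suc k) (sem B s'))" using I a by (auto simp: I_def less_Suc_eq)
  qed (use r8 in \<open>auto simp: I_def B_def\<close>)
  then have A: "\<And>i. i < 100 * n \<Longrightarrow> arrays sa 0 i = arrays s a i \<and> arrays sa 1 i = arrays s a (i + 1)"
    using r8 by (simp add: I_def)
  have l: "regs s r < 100 * n" "regs s r = len P" using s(2) saved_rep(2)[OF s(2)] by (auto simp: saved_def)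
  have rr: "regs sa r = regs s r" using r by (simp add: sa_def B_def regs_sem)
  have S: "sem (SINGLE a r) s = setreg 40 2 (setreg 41 (regs s r) sa)"
    using rr by (simp add: SINGLE_def sa_def B_def)
  have "stored_walk (sem (SINGLE a r) s) 0 1 (regs s r) = rep P"
    by (rule stored_saved[OF s(2)]) (use A l(1) in \<open>auto simp: S\<close>)
  then have "stored_walk (sem (SINGLE a r) s) 0 1 (regs (sem (SINGLE a r) s) 41) = rep P" by (simp add: S)
  moreover have "regs (sem (SINGLE a r) s) 40 = 2" by (simp add: S)
  ultimately show ?thesis using o l unfolding answer_def by auto
qed

lemma answer_POWERS:
  assumes s: "env s" "saved s 15 (regs s 33) x y R" "saved s 14 (regs s 34) x' y' P"
    and o: "outcome_powers G H \<alpha> \<beta> q (rep R) (rep P)"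
  shows "answer (sem POWERS s)"
proof -
  define B where "B = Put 0 (Reg 12) (Elem 15 (Reg 12)) ;; Put 1 (Reg 12) (Elem 15 (Reg 12 .+ Const 1)) ;;
       Put 2 (Reg 12) (Elem 14 (Reg 12)) ;; Put 3 (Reg 12) (Elem 14 (Reg 12 .+ Const 1))"
  define sa where "sa = sem (For 12 8 B) s"
  have r8: "regs s 8 = 100 * n" "regs s 9 = V" using s by auto
  define I where "I N s' \<longleftrightarrow> arrays s' 15 = arrays s 15 \<and> arrays s' 14 = arrays s 14 \<and> regs s' 9 = V \<and>
    (\<forall>i < N. arrays s' 0 i = arrays s 15 i \<and> arrays s' 1 i = arrays s 15 (i + 1) \<and>
      arrays s' 2 i = arrays s 14 i \<and> arrays s' 3 i = arrays s 14 (i + 1))" for N and s' :: ram_state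
  have "I (regs s 8) sa"
    unfolding sa_def
  proof (rule sem_for)
    fix k and s' :: ram_state
    assume k: "k < regs s 8" "regs s' 12 = k" and I: "I k s'"
    have "(k + 1) mod V = k + 1" using k r8 V n2 by simp
    moreover have "arrays s' 15 = arrays s 15" "arrays s' 14 = arrays s 14" "regs s' 9 = V" using I by (auto simp: I_def)
    ultimately have "sem B s' = setarr 3 k (arrays s 14 (k + 1)) (setarr 2 k (arrays s 14 k)
       (setarr 1 k (arrays s 15 (k + 1)) (setarr 0 k (arrays s 15 k) s')))"
      using k(2) by (simp add: B_def)
    then show "I (Suc k) (setreg 12 (Suc k) (sem B s'))" using I by (auto simp: I_def less_Suc_eq)
  qed (use r8 in \<open>auto simp: I_def B_def\<close>)
  then have A: "\<And>i. i < 100 * n \<Longrightarrow> arrays sa 0 i = arrays s 15 i \<and> arrays sa 1 i = arrays s 15 (i + 1) \<and>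
      arrays sa 2 i = arrays s 14 i \<and> arrays sa 3 i = arrays s 14 (i + 1)"
    using r8 by (simp add: I_def)
  have l: "regs s 33 < 100 * n" "regs s 33 = len R" "regs s 34 < 100 * n" "regs s 34 = len P"
    using s(2,3) saved_rep(2)[OF s(2)] saved_rep(2)[OF s(3)] by (auto simp: saved_def)
  have rr: "regs sa 33 = regs s 33" "regs sa 34 = regs s 34" by (simp_all add: sa_def B_def regs_sem)
  have S: "sem POWERS s = setreg 40 3 (setreg 42 (regs s 34) (setreg 41 (regs s 33) sa))"
    using rr by (simp add: POWERS_def sa_def B_def)
  have "stored_walk (sem POWERS s) 0 1 (regs s 33) = rep R"
    by (rule stored_saved[OF s(2)]) (use A l(1) in \<open>auto simp: S\<close>)
  then have "stored_walk (sem POWERS s) 0 1 (regs (sem POWERS s) 41) = rep R" by (simp add: S)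
  moreover have "stored_walk (sem POWERS s) 2 3 (regs s 34) = rep P"
    by (rule stored_saved[OF s(3)]) (use A l(3) in \<open>auto simp: S\<close>)
  then have "stored_walk (sem POWERS s) 2 3 (regs (sem POWERS s) 42) = rep P" by (simp add: S)
  moreover have "regs (sem POWERS s) 40 = 3" by (simp add: S)
  moreover have "len R \<le> 100 * n" "len P \<le> 100 * n" using l by simp_all
  ultimately show ?thesis using o unfolding answer_def by blast
qed

lemma LOAD_ARC_spec:
  assumes s: "env s" "a \<notin> {0, 1, 4, 5, 6}" "r \<noteq> 13" "regs s r < length gs" "gs ! regs s r = (u, v)"
  shows "vec (sem (LOAD_ARC a r) s) a (2 * n) = closed_path u v"
  unfolding LOAD_ARC_def
  by (rule LOAD_spec[OF s(1,2)]) (use env_arcs[OF s(1,4)] s(3,5) in auto)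

lemma loop_of_len: "(u, v) \<in> parcs G \<Longrightarrow> len (loop_of f u v) \<le> 2 * n"
  using len_path[of "map f (closed_path u v)"] closed_path_props(5)[of u v f] by simp

lemma BASE_spec:
  assumes s: "env s"
  shows "regs (sem BASE s) 20 = 0 \<Longrightarrow> (u, v) \<in> parcs G \<Longrightarrow> loop_of \<alpha> u v = 0"
    and "regs (sem BASE s) 22 = 0 \<longleftrightarrow> (\<forall>(u, v) \<in> parcs G. loop_of \<beta> u v = 0)"
    and "regs (sem BASE s) 20 \<noteq> 0 \<Longrightarrow> regs (sem BASE s) 21 < length gs \<and>
      loop_of \<alpha> (fst (gs ! regs (sem BASE s) 21)) (snd (gs ! regs (sem BASE s) 21)) \<noteq> 0"
proof -
  define B where "B = LOAD_ARC 8 15 ;; LOOP 4 8 ;; Cond (Reg 10) (Set 20 (Const 1) ;; Set 21 (Reg 15)) Nop ;;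
       LOOP 5 8 ;; Cond (Reg 10) (Set 22 (Const 1)) Nop"
  have wB: "wregs B = {10, 11, 12, 13, 14, 20, 21, 22}" "warrs B = {8, 9}" "safe B" by (auto simp: B_def)
  define s0 where "s0 = setreg 22 0 (setreg 21 0 (setreg 20 0 s))"
  have e0: "env s0" using s by (simp add: s0_def env_setreg)
  define L where "L f k = loop_of f (fst (gs ! k)) (snd (gs ! k))" for f k
  define I where "I N s' \<longleftrightarrow> env s' \<and> (if regs s' 20 = 0 then \<forall>k < N. L \<alpha> k = 0 else regs s' 21 < N \<and> L \<alpha> (regs s' 21) \<noteq> 0) \<and>
    (regs s' 22 = 0 \<longleftrightarrow> (\<forall>k < N. L \<beta> k = 0))" for N and s' :: ram_state
  have r1: "regs s0 1 = length gs" using e0 by simp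
  have "I (regs s0 1) (sem (For 15 1 B) s0)"
  proof (rule sem_for)
    show "I 0 (setreg 15 0 s0)" using e0 by (simp add: I_def env_setreg) (simp add: s0_def)
    fix k and s' :: ram_state
    assume k: "k < regs s0 1" "regs s' 15 = k" and I: "I k s'"
    have e: "env s'" using I by (simp add: I_def)
    have kl: "k < length gs" using k r1 by simp
    obtain x y where xy: "gs ! k = (x, y)" by fastforce
    have arc: "(x, y) \<in> parcs G" using gs_nth[OF kl] xy by simp
    define s1 where "s1 = sem (LOAD_ARC 8 15) s'"
    have w1: "vec s1 8 (2 * n) = closed_path x y" unfolding s1_def by (rule LOAD_ARC_spec[OF e]) (use k kl xy in auto)
    have 1: "env s1" "\<And>y. y \<in> {15, 20, 21, 22} \<Longrightarrow> regs s1 y = regs s' y" using e by (auto simp: s1_def env_sem regs_sem)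
    define s2 where "s2 = sem (LOOP 4 8) s1"
    have l2: "regs s2 10 = len (L \<alpha> k)"
      using stk_len[OF LOOP_spec(1)[OF 1(1) _ _ w1 arc, of 4]] LOOP_spec(2)[OF 1(1) _ _ w1 arc, of 4] xy
      by (simp add: s2_def L_def col_cases)
    have 2: "env s2" "vec s2 8 (2 * n) = closed_path x y" "\<And>y. y \<in> {15, 20, 21, 22} \<Longrightarrow> regs s2 y = regs s1 y"
    proof -
      show "env s2" using 1(1) by (simp add: s2_def env_sem)
      show "vec s2 8 (2 * n) = closed_path x y" using w1 by (simp add: s2_def vec_sem)
    qed (auto simp: s2_def regs_sem)
    define s3 where "s3 = (if L \<alpha> k \<noteq> 0 then setreg 21 k (setreg 20 1 s2) else s2)"
    have 3: "env s3" "vec s3 8 (2 * n) = closed_path x y" using 2 by (auto simp: s3_def env_setreg)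
    define s4 where "s4 = sem (LOOP 5 8) s3"
    have l4: "regs s4 10 = len (L \<beta> k)"
      using stk_len[OF LOOP_spec(1)[OF 3(1) _ _ 3(2) arc, of 5]] LOOP_spec(2)[OF 3(1) _ _ 3(2) arc, of 5] xy
      by (simp add: s4_def L_def col_cases)
    have 4: "\<And>y. y \<in> {15, 20, 21, 22} \<Longrightarrow> regs s4 y = regs s3 y" by (auto simp: s4_def regs_sem)
    have "sem (Cond (Reg 10) (Set 20 (Const 1) ;; Set 21 (Reg 15)) Nop) s2 = s3"
      using l2 1(2)[of 15] 2(3)[of 15] k(2) by (simp add: s3_def)
    then have S: "sem B s' = (if L \<beta> k \<noteq> 0 then setreg 22 1 s4 else s4)"
      using l4 by (simp add: B_def flip: s1_def s2_def s4_def)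
    have R: "regs (sem B s') 20 = (if L \<alpha> k \<noteq> 0 then 1 else regs s' 20)" "regs (sem B s') 21 = (if L \<alpha> k \<noteq> 0 then k else regs s' 21)"
      "regs (sem B s') 22 = (if L \<beta> k \<noteq> 0 then 1 else regs s' 22)"
      using 1(2) 2(3) 4 unfolding S s3_def by auto
    have "env (sem B s')" using e wB by (simp add: env_sem)
    then show "I (Suc k) (setreg 15 (Suc k) (sem B s'))"
      using I unfolding I_def by (simp add: env_setreg R less_Suc_eq) auto
  qed (use wB in auto)
  moreover have "sem BASE s = sem (For 15 1 B) s0" by (simp add: BASE_def s0_def B_def)
  ultimately have I: "I (length gs) (sem BASE s)" unfolding r1 by simp
  show "loop_of \<alpha> u v = 0" if "regs (sem BASE s) 20 = 0" "(u, v) \<in> parcs G"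
    using I that gs_ex[OF that(2)] by (auto simp: I_def L_def)
  show "regs (sem BASE s) 22 = 0 \<longleftrightarrow> (\<forall>(u, v) \<in> parcs G. loop_of \<beta> u v = 0)"
  proof -
    have "(\<forall>k < length gs. L \<beta> k = 0) \<longleftrightarrow> (\<forall>(u, v) \<in> parcs G. loop_of \<beta> u v = 0)"
      unfolding L_def gs[symmetric] all_set_conv_all_nth by (simp add: case_prod_beta)
    then show ?thesis using I by (simp add: I_def)
  qed
  show "regs (sem BASE s) 20 \<noteq> 0 \<Longrightarrow> regs (sem BASE s) 21 < length gs \<and>
      loop_of \<alpha> (fst (gs ! regs (sem BASE s) 21)) (snd (gs ! regs (sem BASE s) 21)) \<noteq> 0"
    using I by (simp add: I_def L_def)
qed

lemma core_data_saved:
  assumes f: "f \<in> homs G H" and e: "(u, v) \<in> parcs G" "loop_of f u v \<noteq> 0"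
    and s: "saved s a l (f q) (f q) (loop_of f u v)" "core_index (vec s a (Suc l)) i"
  shows "\<exists>\<gamma>. core_data f u v (vec s a (Suc l)) i \<gamma>"
proof -
  let ?xs = "vec s a (Suc l)"
  have hd: "?xs \<noteq> []" "hd ?xs = f q" using s(1) by (auto simp: saved_def vec_def hd_map simp del: upt_Suc)
  have "is_walk H (f q) (arcs_of ?xs) (f q)"
    using loop_of_pwalk[OF f e(1)] saved_rep(1)[OF s(1)] by (simp add: H.pwalk_def)
  then have "H.vwalk ?xs" using H.vwalk_arcs_of hd by metis
  moreover obtain \<gamma> where "\<gamma> 0 = path (take (Suc i) ?xs)" "trail_of (core_walk ?xs i) \<gamma>" using ex_trail by blast
  ultimately show ?thesis using e s hd unfolding core_data_def saved_def by blast
qed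

lemma CORES_spec:
  assumes s: "env s" "regs s 21 < length gs" "gs ! regs s 21 = (u, v)" "loop_of \<alpha> u v \<noteq> 0"
  defines "s' \<equiv> sem CORES s"
  shows "env s'" "regs s' 21 = regs s 21" "vec s' 8 (2 * n) = closed_path u v"
    and "saved s' 11 (regs s' 23) (\<alpha> q) (\<alpha> q) (loop_of \<alpha> u v)" "core_index (vec s' 11 (Suc (regs s' 23))) (regs s' 24)"
    and "saved s' 12 (regs s' 25) (\<beta> q) (\<beta> q) (loop_of \<beta> u v)"
proof -
  have arc: "(u, v) \<in> parcs G" using gs_nth[OF s(2)] s(3) by simp
  note c = closed_path_props[OF arc]
  have lst: "last (f q # map f (closed_path u v)) = f q" for f :: "nat \<Rightarrow> nat" using c by (simp add: last_map)
  have l100: "len (loop_of f u v) < 100 * n" for f using loop_of_len[OF arc, of f] n2 by simp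
  define s1 where "s1 = sem (LOAD_ARC 8 21) s"
  have 1: "env s1" "vec s1 8 (2 * n) = closed_path u v" using s LOAD_ARC_spec[OF s(1) _ _ s(2,3)] by (simp_all add: s1_def env_sem)
  define s2 where "s2 = sem (LOOP 4 8) s1"
  note L2 = LOOP_spec[OF 1(1) _ _ 1(2) arc, of 4, unfolded col_cases]
  have st2: "stk s2 (\<alpha> q # map \<alpha> (closed_path u v))" using L2 by (simp add: s2_def)
  have 2: "env s2" "vec s2 8 (2 * n) = closed_path u v" using 1 by (simp_all add: s2_def env_sem vec_sem)
  define s3 where "s3 = sem (SAVE 11 23) s2"
  have "saved s3 11 (len (loop_of \<alpha> u v)) (\<alpha> q) (\<alpha> q) (loop_of \<alpha> u v)" "regs s3 23 = len (loop_of \<alpha> u v)"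
    using SAVE_spec[OF 2(1) st2, of 11 23] L2(2) l100 lst[of \<alpha>] by (simp_all add: s3_def)
  then have sv3: "saved s3 11 (regs s3 23) (\<alpha> q) (\<alpha> q) (loop_of \<alpha> u v)" "regs s3 23 \<le> 2 * n"
    using loop_of_len[OF arc, of \<alpha>] by simp_all
  have 3: "env s3" "vec s3 8 (2 * n) = closed_path u v" using 2 by (simp_all add: s3_def env_sem vec_sem)
  define s4 where "s4 = sem (CORE_INDEX 11 23 24) s3"
  have ci: "core_index (vec s3 11 (Suc (regs s3 23))) (regs s4 24)"
    unfolding s4_def by (rule CORE_INDEX_spec[OF 3(1) sv3(1) s(4) sv3(2)]) auto
  have 4: "env s4" "vec s4 8 (2 * n) = closed_path u v" "regs s4 23 = regs s3 23" "arrays s4 11 = arrays s3 11"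
    using 3 by (simp_all add: s4_def env_sem vec_sem regs_sem arrays_sem)
  define s5 where "s5 = sem (LOOP 5 8) s4"
  note L5 = LOOP_spec[OF 4(1) _ _ 4(2) arc, of 5, unfolded col_cases]
  have st5: "stk s5 (\<beta> q # map \<beta> (closed_path u v))" using L5 by (simp add: s5_def)
  have 5: "env s5" "vec s5 8 (2 * n) = closed_path u v" "regs s5 23 = regs s4 23" "regs s5 24 = regs s4 24" "arrays s5 11 = arrays s4 11"
    using 4 by (simp_all add: s5_def env_sem vec_sem regs_sem arrays_sem)
  have S: "s' = sem (SAVE 12 25) s5" by (simp add: s'_def CORES_def s1_def s2_def s3_def s4_def s5_def)
  show "env s'" "vec s' 8 (2 * n) = closed_path u v" using 5 by (simp_all add: S env_sem vec_sem)
  show "regs s' 21 = regs s 21" by (simp add: s'_def regs_sem)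
  have r: "regs s' 23 = regs s3 23" "regs s' 24 = regs s4 24" "arrays s' 11 = arrays s3 11"
    using 4 5 by (simp_all add: S regs_sem arrays_sem)
  show "saved s' 11 (regs s' 23) (\<alpha> q) (\<alpha> q) (loop_of \<alpha> u v)"
    using sv3(1) by (simp add: saved_def vec_def r del: upt_Suc)
  show "core_index (vec s' 11 (Suc (regs s' 23))) (regs s' 24)" using ci by (simp add: vec_def r del: upt_Suc)
  show "saved s' 12 (regs s' 25) (\<beta> q) (\<beta> q) (loop_of \<beta> u v)"
    using SAVE_spec[OF 5(1) st5, of 12 25] L5(2) l100 lst[of \<beta>] by (simp add: S)
qed

end

context ram_core
begin

lemma WITNESS_spec:
  assumes c: "cenv s" and sv: "saved s 11 l (\<alpha> q) (\<alpha> q) (loop_of \<alpha> u0 v0)"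
    and r: "regs s 21 < length gs" "gs ! regs s 21 = (u0, v0)"
  shows "\<exists>u v. witness u v \<and> vec (sem WITNESS s) 10 (2 * n) = closed_path u v"
proof -
  define B where "B = LOAD_ARC 10 15 ;; TEST 10 4 4 11 ;; Cond (Reg 10) (Set 27 (Reg 15)) Nop"
  have wB: "wregs B = {10, 11, 12, 13, 14, 27}" "warrs B = {9, 10}" "safe B" by (auto simp: B_def)
  define s0 where "s0 = setreg 27 (regs s 21) s"
  have e0: "env s0" "regs s0 1 = length gs" using cenv_env[OF c] by (simp_all add: s0_def env_setreg)
  define com where "com k \<longleftrightarrow> loop_of \<alpha> (fst (gs ! k)) (snd (gs ! k)) + g = g + loop_of \<alpha> (fst (gs ! k)) (snd (gs ! k))" for k
  define I where "I N s' \<longleftrightarrow> env s' \<and> saved s' 11 l (\<alpha> q) (\<alpha> q) g \<and> regs s' 27 < length gs \<and>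
    (\<not> com (regs s' 27) \<or> regs s' 27 = regs s 21 \<and> (\<forall>k < N. com k))" for N and s' :: ram_state
  have "I (regs s0 1) (sem (For 15 1 B) s0)"
  proof (rule sem_for)
    show "I 0 (setreg 15 0 s0)" using e0 sv r by (simp add: I_def env_setreg) (simp add: s0_def)
    fix k and s' :: ram_state
    assume k: "k < regs s0 1" "regs s' 15 = k" and I: "I k s'"
    have e: "env s'" and sv': "saved s' 11 l (\<alpha> q) (\<alpha> q) g" using I by (auto simp: I_def)
    have kl: "k < length gs" using k e0 by simp
    obtain x y where xy: "gs ! k = (x, y)" by fastforce
    have arc: "(x, y) \<in> parcs G" using gs_nth[OF kl] xy by simp
    define s1 where "s1 = sem (LOAD_ARC 10 15) s'"
    have w1: "vec s1 10 (2 * n) = closed_path x y" unfolding s1_def by (rule LOAD_ARC_spec[OF e]) (use k kl xy in auto)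
    have 1: "env s1" "saved s1 11 l (\<alpha> q) (\<alpha> q) g" "regs s1 15 = k" "regs s1 27 = regs s' 27"
      using e sv' k(2) by (simp_all add: s1_def env_sem saved_sem regs_sem)
    define s2 where "s2 = sem (TEST 10 4 4 11) s1"
    have T: "regs s2 10 = 0 \<longleftrightarrow> com k"
      unfolding s2_def com_def xy using TEST_spec[OF 1(1) _ _ _ _ w1 arc, of 4 4 11 l g] 1(2) by (simp add: col_cases)
    have 2: "env s2" "saved s2 11 l (\<alpha> q) (\<alpha> q) g" "regs s2 15 = k" "regs s2 27 = regs s' 27"
      using 1 by (simp_all add: s2_def env_sem saved_sem regs_sem)
    have "sem B s' = (if \<not> com k then setreg 27 k s2 else s2)"
      using T 2(3) by (simp add: B_def flip: s1_def s2_def)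
    then show "I (Suc k) (setreg 15 (Suc k) (sem B s'))"
      using I 2 kl by (auto simp: I_def env_setreg less_Suc_eq)
  qed (use wB in auto)
  then have I: "I (length gs) (sem (For 15 1 B) s0)" unfolding e0(2) .
  define s1 where "s1 = sem (For 15 1 B) s0"
  define k where "k = regs s1 27"
  obtain u v where uv: "gs ! k = (u, v)" by fastforce
  have e1: "env s1" "k < length gs" "\<not> com k \<or> k = regs s 21 \<and> (\<forall>k < length gs. com k)"
    using I by (auto simp: I_def s1_def k_def)
  have "sem WITNESS s = sem (LOAD_ARC 10 27) s1" by (simp add: WITNESS_def s1_def s0_def B_def)
  then have "vec (sem WITNESS s) 10 (2 * n) = closed_path u v"
    using LOAD_ARC_spec[OF e1(1), of 10 27 u v] e1(2) uv by (simp add: k_def)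
  moreover have "witness u v"
  proof -
    have "(u, v) \<in> parcs G" using gs_nth[OF e1(2)] uv by simp
    moreover have "\<forall>(x, y) \<in> parcs G. loop_of \<alpha> x y + g = g + loop_of \<alpha> x y" if "\<forall>k < length gs. com k"
      using that gs_ex unfolding com_def by fastforce
    ultimately show ?thesis using e1(3) uv r(2) unfolding witness_def com_def by auto
  qed
  ultimately show ?thesis by blast
qed

definition senv :: "ram_state \<Rightarrow> bool" where
  "senv s \<longleftrightarrow> cenv s \<and> vec s 8 (2 * n) = closed_path u0 v0 \<and> regs s 21 < length gs \<and> gs ! regs s 21 = (u0, v0)"

lemma senv_sem:
  "safe p \<Longrightarrow> warrs p \<inter> {0, 1, 4, 5, 6, 8, 11, 12} = {} \<Longrightarrow> wregs p \<inter> {21, 23, 24, 26} = {} \<Longrightarrow> senv s \<Longrightarrow> senv (sem p s)"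
  unfolding senv_def by (subst cenv_sem) (auto simp: vec_sem regs_sem)

lemma senv_env: "senv s \<Longrightarrow> env s"
  by (simp add: senv_def cenv_env)

lemma core_saved:
  assumes "cenv s"
  shows "vec s 11 (length xs) = xs" "vec s 12 (length ys) = ys" "regs s 24 = i" "regs s 26 = j"
  using assms by (auto simp: cenv_def)

lemma X4: "core_data (col 4) u0 v0 xs i \<gamma>" and Y5: "core_data (col 5) u0 v0 ys j \<eta>"
  using X Y by (simp_all add: col_cases)

lemma passes_period: "passes 4 u0 v0 xs i \<gamma> (10 * n + k) \<longleftrightarrow> z (int k) = z 0 \<and> (\<gamma> (int k) - \<gamma> 0) + g = g + (\<gamma> (int k) - \<gamma> 0)"
  by (auto simp: passes_def Let_def col_cases)

text \<open>The search for the generator succeeds, as one turn around the core is a period, and its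
  first hit is the least period. With it, \<open>period_outcome\<close> reduces the decision to the
  test of \<open>R + P\<close>.\<close>

lemma FREE_spec:
  assumes s: "senv s" and P: "saved s 14 (regs s 34) (\<alpha> q) (\<beta> q) P" "regs s 34 \<le> 36 * n"
    and good: "valid P" "acyclic (block P)"
  shows "answer (sem FREE s)"
proof -
  define s1 where "s1 = sem (LOAD_ARC 10 21) s"
  have arc: "(u0, v0) \<in> parcs G" by (rule arc0)
  have w1: "vec s1 10 (2 * n) = closed_path u0 v0"
    unfolding s1_def by (rule LOAD_ARC_spec[OF senv_env[OF s]]) (use s in \<open>auto simp: senv_def\<close>)
  have 1: "senv s1" "saved s1 14 (regs s1 34) (\<alpha> q) (\<beta> q) P" "regs s1 34 \<le> 36 * n"
    using s P by (auto simp: s1_def saved_sem regs_sem intro!: senv_sem)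
  have c1: "cenv s1" and v8: "vec s1 8 (2 * n) = closed_path u0 v0" using 1(1) by (auto simp: senv_def)
  define s2 where "s2 = sem (SEARCH 11 24 4 (Reg 6 .+ Const 1) 15 33) s1"
  have kx: "eval_rexp s' (Reg 6 .+ Const 1) = 10 * n + 1" if "\<And>x. x < 10 \<Longrightarrow> regs s' x = regs s1 x" for s'
    using that[of 6] that[of 9] cenv_env[OF c1] V n2 by simp
  have "if regs s2 18 = 0 then \<forall>k < 20 * n + 1. 10 * n + 1 \<le> k \<longrightarrow> \<not> passes 4 u0 v0 xs i \<gamma> k
    else \<exists>k < 20 * n + 1. 10 * n + 1 \<le> k \<and> passes 4 u0 v0 xs i \<gamma> k \<and> (\<forall>k' < k. 10 * n + 1 \<le> k' \<longrightarrow> \<not> passes 4 u0 v0 xs i \<gamma> k') \<and>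
      saved s2 15 (regs s2 33) (\<alpha> q) (col 4 q) (\<gamma> (int k - 10 * int n) - \<gamma> 0) \<and> regs s2 33 \<le> 36 * n"
    unfolding s2_def
    by (rule SEARCH_spec[OF c1 _ X4 core_saved(1)[OF c1] lx core_saved(3)[OF c1] _ _ v8 w1 arc _ _ _ kx]) auto
  moreover have "\<not> (\<forall>k < 20 * n + 1. 10 * n + 1 \<le> k \<longrightarrow> \<not> passes 4 u0 v0 xs i \<gamma> k)"
  proof -
    have "d \<le> 2 * n" using lx by (simp add: core_length_def)
    moreover have "passes 4 u0 v0 xs i \<gamma> (10 * n + d)" using period_core_length unfolding passes_period by (simp add: period_def)
    moreover have "0 < d" using period_core_length by (simp add: period_def)
    moreover have "10 * n + d < 20 * n + 1" "10 * n + 1 \<le> 10 * n + d" using calculation n2 by simp_all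
    ultimately show ?thesis by blast
  qed
  ultimately obtain k where k: "10 * n + 1 \<le> k" "passes 4 u0 v0 xs i \<gamma> k" "\<forall>k' < k. 10 * n + 1 \<le> k' \<longrightarrow> \<not> passes 4 u0 v0 xs i \<gamma> k'"
      "saved s2 15 (regs s2 33) (\<alpha> q) (\<alpha> q) (\<gamma> (int k - 10 * int n) - \<gamma> 0)" "regs s2 33 \<le> 36 * n"
    unfolding col_cases by (auto split: if_splits)
  define r where "r = k - 10 * n"
  have kr: "k = 10 * n + r" "0 < r" "int k - 10 * int n = int r" using k(1) by (auto simp: r_def)
  have per: "period r" using k(2) kr unfolding kr(1) passes_period by (simp add: period_def)
  have least: "\<not> period m" if "0 < m" "m < r" for m
    using k(3)[rule_format, of "10 * n + m"] that kr unfolding passes_period by (auto simp: period_def)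
  define R where "R = \<gamma> (int r) - \<gamma> 0"
  have sR: "saved s2 15 (regs s2 33) (\<alpha> q) (\<alpha> q) R" using k(4) by (simp add: R_def kr(3))
  have 2: "senv s2" "saved s2 14 (regs s2 34) (\<alpha> q) (\<beta> q) P" "regs s2 34 \<le> 36 * n"
    using 1 by (auto simp: s2_def saved_sem regs_sem intro!: senv_sem)
  define s3 where "s3 = sem (RESET (Elem 15 (Const 0))) s2"
  have "arrays s2 15 0 = \<alpha> q" using sR by (simp add: saved_def)
  then have st3: "stk s3 [\<alpha> q]" using stk_reset[of "Elem 15 (Const 0)" s2] by (simp add: s3_def)
  have 3: "senv s3" "saved s3 15 (regs s3 33) (\<alpha> q) (\<alpha> q) R" "saved s3 14 (regs s3 34) (\<alpha> q) (\<beta> q) P"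
    using 2 sR by (auto simp: s3_def saved_sem regs_sem intro!: senv_sem)
  define s4 where "s4 = sem (PUSHV 15) s3"
  have st4: "stk s4 ([\<alpha> q] @ vec s3 15 (100 * n))"
    unfolding s4_def by (rule PUSHV_spec(1)[OF senv_env[OF 3(1)] _ st3]) (use V n2 in auto)
  have 4: "senv s4" "saved s4 15 (regs s4 33) (\<alpha> q) (\<alpha> q) R" "saved s4 14 (regs s4 34) (\<alpha> q) (\<beta> q) P"
    using 3 by (auto simp: s4_def saved_sem regs_sem intro!: senv_sem)
  define s5 where "s5 = sem (PUSHV 14) s4"
  define ws where "ws = ([\<alpha> q] @ vec s3 15 (100 * n)) @ vec s4 14 (100 * n)"
  have st5: "stk s5 ws"
    unfolding s5_def ws_def by (rule PUSHV_spec(1)[OF senv_env[OF 4(1)] _ st4]) (use V n2 in auto)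
  have 5: "senv s5" "saved s5 15 (regs s5 33) (\<alpha> q) (\<alpha> q) R" "saved s5 14 (regs s5 34) (\<alpha> q) (\<beta> q) P"
    using 4 by (auto simp: s5_def saved_sem regs_sem intro!: senv_sem)
  note pR = saved_path[OF 3(2)] and pP = saved_path[OF 4(3)]
  have ws: "hd ws = \<alpha> q" "last ws = \<beta> q" "path ws = R + P"
    using pR pP by (simp_all add: ws_def path_append hd_append last_append del: append_assoc append_Cons)
  have "len R \<le> 36 * n" "len P \<le> 36 * n"
    using saved_rep(2)[OF sR] k(5) saved_rep(2)[OF 2(2)] 2(3) by simp_all
  \<comment> \<open>Both walks have length at most \<open>36 * n\<close>, so the product fits into
    the \<open>100 * n\<close> places reserved for a walk.\<close>
  then have "len (path ws) < 100 * n" using len_add_le[of R P] n2 ws(3) by simp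
  note sv = SAVE_spec[OF senv_env[OF 5(1)] st5 this, of 13 29]
  define s6 where "s6 = sem (SAVE 13 29) s5"
  have 6: "senv s6" "saved s6 15 (regs s6 33) (\<alpha> q) (\<alpha> q) R" "saved s6 14 (regs s6 34) (\<alpha> q) (\<beta> q) P"
    "saved s6 13 (len (R + P)) (\<alpha> q) (\<beta> q) (R + P)"
    using 5 sv(1) ws by (auto simp: s6_def saved_sem regs_sem intro!: senv_sem)
  define s7 where "s7 = sem (CHECK 13) s6"
  have C: "regs s7 30 \<noteq> 0 \<longleftrightarrow> valid (R + P)" "regs s7 31 \<noteq> 0 \<longleftrightarrow> acyclic (block (R + P))"
    using CHECK_spec[OF senv_env[OF 6(1)] 6(4)] by (simp_all add: s7_def)
  have 7: "env s7" "saved s7 15 (regs s7 33) (\<alpha> q) (\<alpha> q) R" "saved s7 14 (regs s7 34) (\<alpha> q) (\<beta> q) P"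
    using 6 senv_env[OF 6(1)] by (auto simp: s7_def saved_sem regs_sem env_sem)
  have S: "sem FREE s = (if regs s7 30 \<noteq> 0 \<and> regs s7 31 \<noteq> 0 then sem POWERS s7 else sem (SINGLE 14 34) s7)"
    by (simp add: FREE_def flip: s1_def s2_def s3_def s4_def s5_def s6_def s7_def)
      (simp add: s1_def s2_def s3_def s4_def s5_def s6_def s7_def)
  show ?thesis
  proof (cases "valid (R + P) \<and> acyclic (block (R + P))")
    case True
    then have "outcome_powers G H \<alpha> \<beta> q (rep R) (rep P)"
      using period_outcome(1)[OF per least good] by (simp add: R_def)
    then show ?thesis using S C True answer_POWERS[OF 7] by simp
  next
    case False
    then have "outcome_single G H \<alpha> \<beta> q (rep P)"
      using period_outcome(2)[OF per least good] by (simp add: R_def)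
    then show ?thesis using S C False answer_SINGLE[OF 7(1,3)] by auto
  qed
qed

lemma TIGHT_spec:
  assumes s: "senv s" and P: "valid P" "(regs s 32, regs s 32) \<in> (block P)\<^sup>+"
  shows "answer (sem TIGHT s)"
proof -
  define v where "v = regs s 32"
  define Q where "Q = tree_path \<alpha> v - tree_path \<beta> v"
  have Pw: "H.pwalk (\<alpha> q) P (\<beta> q)" using core_intertwine(2)[OF X Y] valid_core P(1) by blast
  note o = cycle_outcome[OF Pw P[folded v_def] Q_def]
  obtain u where "(v, u) \<in> block P" using tranclD[OF P(2)] by (auto simp: v_def)
  then have vG: "v \<in> pverts G" and vn: "v < n" using arc_less VG by (auto simp: blocking_def)
  have e: "env s" by (rule senv_env[OF s])
  have col: "arrays s 4 v = \<alpha> v" "arrays s 5 v = \<beta> v"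
    using env_col[OF e, of 4 v] env_col[OF e, of 5 v] vn by (simp_all add: col_cases)
  show ?thesis
  proof (cases "\<alpha> v = \<beta> v")
    case False
    then have "sem TIGHT s = sem NONE s" using col by (simp add: TIGHT_def v_def)
    then show ?thesis using answer_NONE o(1) False by simp
  next
    case True
    define s1 where "s1 = sem (LOAD 10 (Reg 32) (Reg 32)) s"
    have w1: "vec s1 10 (2 * n) = closed_path v v"
      unfolding s1_def by (rule LOAD_spec[OF e]) (auto simp: v_def)
    have 1: "env s1" using e by (simp add: s1_def env_sem)
    have Wv: "W v \<noteq> []" "hd (W v) = q" "last (W v) = v" using W[OF vG] by (auto simp: G.vwalk_def)
    define s2 where "s2 = sem (RESET (Elem 4 (Elem 10 (Const 0)))) s1"
    have "vec s1 10 (2 * n) ! 0 = arrays s1 10 0" using n2 by (intro vec_nth) simp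
    then have "arrays s1 10 0 = q" using Wv n2 unfolding w1 by (simp add: closed_path_def nth_append hd_conv_nth)
    then have st2: "stk s2 [\<alpha> q]"
      using stk_reset[of "Elem 4 (Elem 10 (Const 0))" s1] env_col[OF 1, of 4 q] q_less by (simp add: s2_def col_cases)
    have 2: "env s2" "vec s2 10 (2 * n) = closed_path v v" using 1 w1 by (simp_all add: s2_def env_sem vec_sem)
    define s3 where "s3 = sem (DOWN 4) s2"
    have st3: "stk s3 ([\<alpha> q] @ map \<alpha> (W v))"
      using HALF_spec(1)[OF 2(1) _ 2(2) vn st2, of 4] V n2 by (simp add: s3_def col_cases)
    have 3: "env s3" "vec s3 10 (2 * n) = closed_path v v" using 2 by (simp_all add: s3_def env_sem vec_sem)
    define s4 where "s4 = sem (UP 5) s3"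
    define ws where "ws = ([\<alpha> q] @ map \<alpha> (W v)) @ rev (map \<beta> (W v))"
    have st4: "stk s4 ws"
      using HALF_spec(2)[OF 3(1) _ 3(2) vn st3, of 5] V n2 by (simp add: s4_def ws_def col_cases)
    have 4: "env s4" using 3 by (simp add: s4_def env_sem)
    have ws: "hd ws = \<alpha> q" "last ws = \<beta> q" "path ws = Q"
      using Wv True
      by (simp_all add: ws_def path_append path_rev hd_rev last_rev hd_append last_append hd_map last_map Q_def tree_path_def
          del: append_assoc append_Cons)
    have "len (path ws) \<le> length ws - 1" by (rule len_path)
    then have "len (path ws) < 100 * n" using n2 by (simp add: ws_def)
    note sv = SAVE_spec[OF 4 st4 this, of 13 29]
    define s5 where "s5 = sem (SAVE 13 29) s4"
    have 5: "env s5" "saved s5 13 (regs s5 29) (\<alpha> q) (\<beta> q) Q" using 4 sv ws by (simp_all add: s5_def env_sem)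
    define s6 where "s6 = sem (CHECK 13) s5"
    have C: "regs s6 30 \<noteq> 0 \<longleftrightarrow> valid Q" "regs s6 31 \<noteq> 0 \<longleftrightarrow> acyclic (block Q)"
      using CHECK_spec[OF 5] by (simp_all add: s6_def)
    have 6: "env s6" "saved s6 13 (regs s6 29) (\<alpha> q) (\<beta> q) Q" using 5 by (simp_all add: s6_def env_sem saved_sem regs_sem)
    have S: "sem TIGHT s = (if regs s6 30 \<noteq> 0 \<and> regs s6 31 \<noteq> 0 then sem (SINGLE 13 29) s6 else sem NONE s6)"
      using True col by (simp add: TIGHT_def s1_def s2_def s3_def s4_def s5_def s6_def v_def)
    show ?thesis
    proof (cases "valid Q \<and> acyclic (block Q)")
      case True
      then show ?thesis using S C answer_SINGLE[OF 6] o(2) \<open>\<alpha> v = \<beta> v\<close> by simp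
    next
      case False
      then have "sem TIGHT s = sem NONE s6" using S C by auto
      then show ?thesis using answer_NONE o(3) False by simp
    qed
  qed
qed

text \<open>A search without a hit refutes validity by \<open>search_complete\<close>, an invalid
  hit does so by \<open>pass_valid\<close>. A valid hit is treated according to whether it has a
  blocking cycle.\<close>

lemma SOLVE_spec:
  assumes s: "senv s" and sv: "saved s 11 l (\<alpha> q) (\<alpha> q) (loop_of \<alpha> u0 v0)"
  shows "answer (sem SOLVE s)"
proof -
  define s1 where "s1 = sem WITNESS s"
  obtain u v where w: "witness u v" and w1: "vec s1 10 (2 * n) = closed_path u v"
    using WITNESS_spec[of s l] s sv by (auto simp: senv_def s1_def)
  have arc: "(u, v) \<in> parcs G" using w by (simp add: witness_def)
  have 1: "senv s1" using s by (auto simp: s1_def intro!: senv_sem)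
  have c1: "cenv s1" and v8: "vec s1 8 (2 * n) = closed_path u0 v0" using 1 by (auto simp: senv_def)
  define s2 where "s2 = sem (SEARCH 12 26 5 (Const 0) 14 34) s1"
  have kx: "eval_rexp s' (Const 0) = 0" for s' by simp
  have srch: "if regs s2 18 = 0 then \<forall>k < 20 * n + 1. 0 \<le> k \<longrightarrow> \<not> passes 5 u v ys j \<eta> k
    else \<exists>k < 20 * n + 1. 0 \<le> k \<and> passes 5 u v ys j \<eta> k \<and> (\<forall>k' < k. 0 \<le> k' \<longrightarrow> \<not> passes 5 u v ys j \<eta> k') \<and>
      saved s2 14 (regs s2 34) (\<alpha> q) (col 5 q) (\<gamma> (int k - 10 * int n) - \<eta> 0) \<and> regs s2 34 \<le> 36 * n"
    unfolding s2_def
    by (rule SEARCH_spec[OF c1 _ Y5 core_saved(2)[OF c1] ly core_saved(4)[OF c1] _ _ v8 w1 arc _ _ _ kx]) auto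
  have 2: "senv s2" using 1 by (auto simp: s2_def intro!: senv_sem)
  obtain r where r: "period r" "\<And>k. 0 < k \<Longrightarrow> k < r \<Longrightarrow> \<not> period k"
    using exists_least_iff[of period] period_core_length by blast
  have pass: "passes 5 u v ys j \<eta> k \<longleftrightarrow> z (int k - 10 * int n) = core_walk ys j 0 \<and> pass u v (\<gamma> (int k - 10 * int n) - \<eta> 0)" for k
    by (simp add: passes_def Let_def pass_def col_cases)
  show ?thesis
  proof (cases "regs s2 18 = 0")
    case True
    have "\<not> valid Q" for Q
    proof
      assume Q: "valid Q"
      obtain t where t: "\<bar>t\<bar> \<le> 10 * int n" "z t = core_walk ys j 0" "pass u v (\<gamma> t - \<eta> 0)"
        using search_complete[OF r w Q, of n] loop_of_len by blast
      have "int (nat (t + 10 * int n)) - 10 * int n = t" using t(1) by linarith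
      then have "passes 5 u v ys j \<eta> (nat (t + 10 * int n))" unfolding pass using t(2,3) by presburger
      moreover have "nat (t + 10 * int n) < 20 * n + 1" using t(1) by linarith
      ultimately show False using srch True by simp
    qed
    then have "outcome_none G H \<alpha> \<beta> q" by (intro outcome_noneI) (simp add: good_def)
    moreover have "sem SOLVE s = sem NONE s2" using True by (simp add: SOLVE_def flip: s1_def s2_def)
    ultimately show ?thesis using answer_NONE by simp
  next
    case found: False
    then obtain k where k: "passes 5 u v ys j \<eta> k" "saved s2 14 (regs s2 34) (\<alpha> q) (\<beta> q) (\<gamma> (int k - 10 * int n) - \<eta> 0)"
        "regs s2 34 \<le> 36 * n"
      using srch unfolding col_cases by auto
    define P where "P = \<gamma> (int k - 10 * int n) - \<eta> 0"
    define s3 where "s3 = sem (CHECK 14) s2"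
    have sP: "saved s2 14 (regs s2 34) (\<alpha> q) (\<beta> q) P" using k(2) by (simp add: P_def)
    have C: "regs s3 30 \<noteq> 0 \<longleftrightarrow> valid P" "regs s3 31 \<noteq> 0 \<longleftrightarrow> acyclic (block P)"
      "regs s3 31 = 0 \<Longrightarrow> (regs s3 32, regs s3 32) \<in> (block P)\<^sup>+"
      using CHECK_spec[OF senv_env[OF 2] sP] by (simp_all add: s3_def)
    have 3: "senv s3" "saved s3 14 (regs s3 34) (\<alpha> q) (\<beta> q) P" "regs s3 34 \<le> 36 * n"
      using 2 sP k(3) by (auto simp: s3_def saved_sem regs_sem intro!: senv_sem)
    have S: "sem SOLVE s = (if regs s3 30 \<noteq> 0 then if regs s3 31 \<noteq> 0 then sem FREE s3 else sem TIGHT s3 else sem NONE s3)"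
      using found by (simp add: SOLVE_def flip: s1_def s2_def s3_def)
    show ?thesis
    proof (cases "valid P")
      case False
      have "\<not> valid Q" for Q using pass_valid[OF r w, of P Q] k(1) False unfolding pass P_def by blast
      then have "outcome_none G H \<alpha> \<beta> q" by (intro outcome_noneI) (simp add: good_def)
      then show ?thesis using S C(1) False answer_NONE by simp
    next
      case True
      show ?thesis
      proof (cases "acyclic (block P)")
        case a: True
        then show ?thesis using S C(1,2) \<open>valid P\<close> FREE_spec[OF 3 \<open>valid P\<close> a] by simp
      next
        case False
        then have "regs s3 31 = 0" using C(2) by simp
        then show ?thesis using S C(1) True TIGHT_spec[OF 3(1) True C(3)] by simp
      qed
    qed
  qed
qed

end

lemma (in ram_tree) after_TREE:
  assumes s: "env s"
  defines "b \<equiv> sem BASE s"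
  shows "answer (sem (Cond (Reg 20) (CORES ;; Cond (Reg 25) (CORE_INDEX 12 25 26 ;; SOLVE) NONE)
     (Cond (Reg 22) NONE (Set 40 (Const 4)))) b)"
proof (cases "regs b 20 = 0")
  case True
  have a: "\<And>u v. (u, v) \<in> parcs G \<Longrightarrow> loop_of \<alpha> u v = 0" using BASE_spec(1)[OF s] True by (simp add: b_def)
  show ?thesis
  proof (cases "regs b 22 = 0")
    case b: True
    then have "outcome_all G H \<alpha> \<beta> q" using a BASE_spec(2)[OF s] by (intro trivial_all) (auto simp: b_def)
    then show ?thesis using True b by (simp add: answer_def)
  next
    case b: False
    then obtain u v where "(u, v) \<in> parcs G" "loop_of \<beta> u v \<noteq> 0" using BASE_spec(2)[OF s] by (auto simp: b_def)
    then have "outcome_none G H \<alpha> \<beta> q" using trivial_none a by blast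
    then show ?thesis using True b answer_NONE by simp
  qed
next
  case False
  obtain u v where uv: "gs ! regs b 21 = (u, v)" by fastforce
  have r: "regs b 21 < length gs" "loop_of \<alpha> u v \<noteq> 0" using BASE_spec(3)[OF s] False uv by (auto simp: b_def)
  have arc: "(u, v) \<in> parcs G" using gs_nth[OF r(1)] uv by simp
  have eb: "env b" using s by (simp add: b_def env_sem)
  define c where "c = sem CORES b"
  note C = CORES_spec[OF eb r(1) uv r(2), folded c_def]
  have lb: "regs c 25 = len (loop_of \<beta> u v)" "regs c 23 = len (loop_of \<alpha> u v)" using saved_rep(2) C(4,6) by auto
  show ?thesis
  proof (cases "regs c 25 = 0")
    case True
    then have "loop_of \<beta> u v = 0" using lb by simp
    then have "\<not> valid Q" for Q
      using arc r(2) unfolding valid_def by (metis (mono_tags, lifting) add.right_neutral add_0 add_right_cancel case_prodD)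
    then have "outcome_none G H \<alpha> \<beta> q" by (intro outcome_noneI) (simp add: good_def)
    then show ?thesis using False True answer_NONE by (simp flip: c_def)
  next
    case nz: False
    then have bnz: "loop_of \<beta> u v \<noteq> 0" using lb by (metis len_eq_0)
    define e where "e = sem (CORE_INDEX 12 25 26) c"
    define xs where "xs = vec c 11 (Suc (regs c 23))"
    define ys where "ys = vec c 12 (Suc (regs c 25))"
    have l: "regs c 23 \<le> 2 * n" "regs c 25 \<le> 2 * n" using lb loop_of_len[OF arc] by simp_all
    have ci: "core_index ys (regs e 26)"
      unfolding ys_def e_def by (rule CORE_INDEX_spec[OF C(1,6) bnz l(2)]) auto
    obtain \<gamma> where \<gamma>: "core_data \<alpha> u v xs (regs c 24) \<gamma>"
      using core_data_saved[OF \<alpha>H arc r(2) C(4,5)] by (auto simp: xs_def)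
    obtain \<eta> where \<eta>: "core_data \<beta> u v ys (regs e 26) \<eta>"
      using core_data_saved[OF \<beta>H arc bnz C(6)] ci by (auto simp: ys_def)
    interpret ram_core G H \<alpha> \<beta> q n V gs par u v xs ys "regs c 24" "regs e 26" \<gamma> \<eta>
      by unfold_locales (use \<gamma> \<eta> l in \<open>auto simp: xs_def ys_def\<close>)
    have e: "env e" "vec e 8 (2 * n) = closed_path u v" "regs e 21 = regs b 21" "regs e 23 = regs c 23" "regs e 24 = regs c 24"
      using C(1,2,3) by (simp_all add: e_def env_sem vec_sem regs_sem)
    have ev: "vec e a l' = vec c a l'" for a l' by (simp add: e_def vec_sem)
    have "senv e"
      unfolding senv_def cenv_def using e r(1) uv by (simp add: ev xs_def ys_def del: upt_Suc)
    moreover have "saved e 11 (regs c 23) (\<alpha> q) (\<alpha> q) (loop_of \<alpha> u v)" using C(4) by (simp add: e_def saved_sem)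
    ultimately have "answer (sem SOLVE e)" by (rule SOLVE_spec)
    then show ?thesis using False nz by (simp add: e_def flip: c_def)
  qed
qed

section \<open>Running time, input and output\<close>

text \<open>The nesting of loops gives a polynomial of degree two without a term
  \<open>m * m\<close>. Its coefficients add up to 957482, and \<open>1 \<le> n \<le> m\<close>
  bounds every monomial by \<open>n * m\<close>.\<close>

lemma tm_MAIN:
  assumes u: "u 0 = n" "u 1 = m" "u 5 = 2 * n" "u 6 = 10 * n" "u 7 = 20 * n + 1" "u 8 = 100 * n"
    and n: "1 \<le> n" "n \<le> m"
  shows "tm u MAIN \<le> 1000000 * (n * m)"
proof -
  have u1: "u (Suc 0) = m" using u(2) by simp
  have "tm u MAIN = 801 + (m * 282 + (m * (n * 32285) + (n * 75341 + n * (n * 848773))))"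
    using u(1,3-) u1
    by (simp add: MAIN_def TREE_def BASE_def CORES_def SOLVE_def WITNESS_def FREE_def TIGHT_def SINGLE_def POWERS_def NONE_def
      LOAD_ARC_def LOAD_def LOOP_def TEST_def COPY_def CORE_INDEX_def STEPB_def STEPF_def BUILD_def TRY_def SEARCH_def
      PUSHW_def PUSHR_def PUSHV_def PUSHVR_def SAVE_def DOWN_def UP_def VALID_def TRANS_def MARK_def ROUND_def CYCLE_def CHECK_def
      algebra_simps)
  also have "\<dots> = 801 + 282 * m + 32285 * (n * m) + 75341 * n + 848773 * (n * n)" by simp
  also have "\<dots> \<le> 1000000 * (n * m)"
  proof -
    have "n * n \<le> n * m" "n \<le> n * m" "m \<le> n * m" "1 \<le> n * m" using n by auto
    then show ?thesis by linarith
  qed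
  finally show ?thesis .
qed

text \<open>Register 9 has to exceed the length of all lists that are pushed, a few hundred times
  \<open>n\<close>, and to bound all inputs. The numbers of arcs cover the names of vertices and
  colors, since every vertex has a loop.\<close>

definition PROLOGUE :: com where
  "PROLOGUE = Seq (Assign 5 (Op Mul (Const 2) (Reg 0))) (Seq (Assign 6 (Op Mul (Const 10) (Reg 0)))
     (Seq (Assign 7 (Op Add (Op Mul (Const 20) (Reg 0)) (Const 1))) (Seq (Assign 8 (Op Mul (Const 100) (Reg 0)))
       (Assign 9 (Op Add (Op Add (Op Add (Op Mul (Const 1000) (Reg 0)) (Reg 1)) (Reg 3)) (Const 1))))))"

definition prologue :: "ram_state \<Rightarrow> ram_state" where
  "prologue s = setreg 9 (1000 * regs s 0 + regs s 1 + regs s 3 + 1)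
     (setreg 8 (100 * regs s 0) (setreg 7 (20 * regs s 0 + 1) (setreg 6 (10 * regs s 0) (setreg 5 (2 * regs s 0) s))))"

definition EPILOGUE :: com where
  "EPILOGUE = Seq (Assign 0 (Reg 40)) (Seq (Assign 1 (Reg 41)) (Assign 2 (Reg 42)))"

definition epilogue :: "ram_state \<Rightarrow> ram_state" where
  "epilogue s = setreg 2 (regs s 42) (setreg 1 (regs s 41) (setreg 0 (regs s 40) s))"

lemma run_assign:
  "fits w s e \<Longrightarrow> t = 1 + cost e \<Longrightarrow> v = eval_rexp s e \<Longrightarrow> run w (Assign x e) s t (setreg x v s)"
  by (simp only: setreg_def run.Assign)

lemma run_seq: "run w c s ta s' \<Longrightarrow> run w d s' tb s'' \<Longrightarrow> t = ta + tb \<Longrightarrow> run w (Seq c d) s t s''"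
  by (simp only: run.Seq)

lemma run_PROLOGUE:
  assumes "1000 * regs s 0 + regs s 1 + regs s 3 + 1001 \<le> w"
  shows "run w PROLOGUE s 28 (prologue s)"
proof -
  have h: "regs s (Suc 0) \<le> w" "regs s 1 \<le> w" "regs s 3 \<le> w" "1000 * regs s 0 \<le> w" "1001 \<le> w" using assms by auto
  show ?thesis
    unfolding PROLOGUE_def prologue_def
    by (rule run_seq[OF run_assign[where v = "2 * regs s 0", OF _ refl]
          run_seq[OF run_assign[where v = "10 * regs s 0", OF _ refl]
            run_seq[OF run_assign[where v = "20 * regs s 0 + 1", OF _ refl]
              run_seq[OF run_assign[where v = "100 * regs s 0", OF _ refl] run_assign[OF _ refl] refl] refl] refl]])
      (use assms h in auto)
qed

lemma run_EPILOGUE: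
  assumes "\<And>x. regs s x \<le> w"
  shows "run w EPILOGUE s 6 (epilogue s)"
  unfolding EPILOGUE_def epilogue_def
  by (rule run_seq[OF run_assign[where v = "regs s 40", OF _ refl]
        run_seq[OF run_assign[where v = "regs s 41", OF _ refl] run_assign[OF _ refl] refl]])
    (use assms in auto)

text \<open>An edge comes from at most two arcs, so the length of the input list is bounded by the
  number of edges up to a factor of 2.\<close>

lemma card_parcs_le:
  assumes "finite (parcs G)"
  shows "card (parcs G) \<le> 2 * card (edges G)"
proof -
  let ?f = "\<lambda>(u, v). {u, v}"
  have E: "edges G = ?f ` parcs G" by (auto simp: edges_def)
  have "card (parcs G) = (\<Sum>e \<in> edges G. card {a \<in> parcs G. ?f a = e})"
    unfolding E card_eq_sum using assms by (rule sum.image_gen)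
  also have "\<dots> \<le> (\<Sum>e \<in> edges G. 2)"
  proof (rule sum_mono)
    fix e assume "e \<in> edges G"
    then obtain u v where e: "e = {u, v}" by (auto simp: edges_def)
    have "a \<in> {(u, v), (v, u)}" if "?f a = e" for a
    proof (cases a)
      case (Pair x y)
      then have "{x, y} = {u, v}" using that e by simp
      then show ?thesis unfolding doubleton_eq_iff Pair by blast
    qed
    then have "{a \<in> parcs G. ?f a = e} \<subseteq> {(u, v), (v, u)}" by blast
    then have "card {a \<in> parcs G. ?f a = e} \<le> card {(u, v), (v, u)}" by (rule card_mono[rotated]) simp
    also have "\<dots> \<le> 2" using card_length[of "[(u, v), (v, u)]"] by simp
    finally show "card {a \<in> parcs G. ?f a = e} \<le> 2" .
  qed
  finally show ?thesis by simp
qed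

lemma card_parcs_ge:
  assumes "reflexive_graph G" "finite (parcs G)"
  shows "card (pverts G) \<le> card (parcs G)"
proof -
  have "(\<lambda>v. (v, v)) ` pverts G \<subseteq> parcs G" using assms(1) by (auto simp: reflexive_graph_def)
  then have "card ((\<lambda>v. (v, v)) ` pverts G) \<le> card (parcs G)" using assms(2) by (rule card_mono[rotated])
  then show ?thesis by (simp add: card_image inj_on_def)
qed

lemma (in ram_input) MAIN_spec:
  assumes s: "inp s" "\<And>i. arrays s 6 i = 0" "\<And>i. arrays s 7 i = 0"
    and l: "100 * n \<le> l"
  shows "correct_output G H \<alpha> \<beta> q l (epilogue (sem MAIN s))"
proof -
  define s' where "s' = sem TREE s"
  interpret ram_tree G H \<alpha> \<beta> q n V gs "arrays s' 6"
    by unfold_locales (use TREE_spec[OF s] in \<open>auto simp: s'_def\<close>)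
  have "env s'" unfolding env_def using TREE_spec(1)[OF s] by (simp add: s'_def)
  from after_TREE[OF this] have a: "answer (sem MAIN s)" by (simp add: MAIN_def s'_def)
  define r where "r = sem MAIN s"
  have st: "stored_walk (epilogue r) a b k = stored_walk r a b k" for a b k
    by (simp add: stored_walk_def epilogue_def)
  have rep: "reduced (rep p)" "len p \<le> 100 * n \<Longrightarrow> length (rep p) \<le> l" for p :: "nat fg"
    using l by (auto simp: reduced_iff_is_red len_def)
  show ?thesis
    using a rep unfolding answer_def correct_output_def st r_def[symmetric]
    by (simp add: epilogue_def) metis
qed

lemma list_array_le: "(\<And>x. x \<in> set xs \<Longrightarrow> x \<le> b) \<Longrightarrow> list_array xs i \<le> b"
  by (simp add: list_array_def)

definition program :: com where
  "program = Seq PROLOGUE (Seq (compile MAIN) EPILOGUE)"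

lemma program_correct:
  fixes G H :: "nat pair_pre_digraph"
  assumes hp: "hom_pair G H \<alpha> \<beta> q"
    and G: "pverts G = {..<nG}" "distinct gs" "set gs = parcs G"
    and H: "pverts H = {..<nH}" "distinct hs" "set hs = parcs H"
  defines "w \<equiv> 3000000 * size_bound G H"
  shows "\<exists>t s. run w program (input_state nG gs nH hs \<alpha> \<beta> q) t s \<and> t \<le> w \<and> correct_output G H \<alpha> \<beta> q w s"
proof -
  define s where "s = input_state nG gs nH hs \<alpha> \<beta> q"
  define V where "V = 1000 * nG + length gs + length hs + 1"
  have r: "reflexive_graph G" "reflexive_graph H" "\<alpha> \<in> homs G H" "\<beta> \<in> homs G H" "q < nG" "2 \<le> nG"
    using hp G(1) by (auto simp: hom_pair_def conn_reflexive_graph_def)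
  have f: "finite (parcs G)" "finite (parcs H)" using G(3) H(3) by (metis List.finite_set)+
  have c: "card (parcs G) = length gs" "card (parcs H) = length hs"
    using G(2,3) H(2,3) by (metis distinct_card)+
  have m: "nG \<le> length gs" "length gs \<le> 2 * card (edges G)" "nH \<le> length hs" "length hs \<le> 2 * card (edges H)"
    using card_parcs_ge[OF r(1) f(1)] card_parcs_ge[OF r(2) f(2)] card_parcs_le[OF f(1)] card_parcs_le[OF f(2)] c G(1) H(1)
    by simp_all
  define N where "N = nG * card (edges G)"
  have sz: "size_bound G H = N + card (edges H)" by (simp add: size_bound_def N_def G(1))
  have N: "1 \<le> N" "nG \<le> N" "length gs \<le> 2 * N" "nG * length gs \<le> 2 * N"
  proof -
    have e: "1 \<le> card (edges G)" using m r(6) by linarith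
    then show "nG \<le> N" "1 \<le> N" unfolding N_def using r(6) by (auto simp: Suc_le_eq)
    have "nG * length gs \<le> nG * (2 * card (edges G))" using m(2) by (rule mult_le_mono2)
    then show "nG * length gs \<le> 2 * N" by (simp add: N_def)
    moreover have "length gs \<le> nG * length gs" using r(6) by simp
    ultimately show "length gs \<le> 2 * N" by linarith
  qed
  have wV: "w = 3000000 * N + 3000000 * card (edges H)" "V = 1000 * nG + length gs + length hs + 1"
    by (simp_all add: w_def sz V_def)
  \<comment> \<open>The list of arcs is at most twice as long as the set of edges, so the main part
    takes time at most \<open>2000000 * N\<close>, and the rest of \<open>w\<close> pays for the
    prologue and the epilogue. The bound \<open>2 * V\<close> is the one that \<open>run_sem\<close>
    asks for.\<close>
  have w: "2 * V \<le> w" "V + 1000 \<le> w" "2000000 * N + 100 \<le> w" "100 * nG \<le> w"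
    using N m wV by simp_all
  interpret ram_input G H \<alpha> \<beta> q nG V gs
    by unfold_locales (use hp G m r(6) in \<open>auto simp: V_def\<close>)
  have regs: "regs s 0 = nG" "regs s (Suc 0) = length gs" "regs s 2 = nH" "regs s 3 = length hs" "regs s 4 = q"
    by (simp_all add: s_def input_state_def list_array_def)
  have regs_le: "regs s x \<le> V" for x
    unfolding s_def input_state_def ram_state.select_convs
    by (rule list_array_le) (use m r in \<open>auto simp: V_def\<close>)
  define s1 where "s1 = prologue s"
  have arrays1: "arrays s1 = arrays s" by (simp add: s1_def prologue_def)
  have arrays: "arrays s = (\<lambda>_ _. 0)(0 := list_array (map fst gs), 1 := list_array (map snd gs),
      2 := list_array (map fst hs), 3 := list_array (map snd hs),
      4 := list_array (map \<alpha> [0..<nG]), 5 := list_array (map \<beta> [0..<nG]))"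
    by (simp add: s_def input_state_def)
  have i: "inp s1"
    using regs unfolding inp_def arrays1 arrays by (simp add: s1_def prologue_def V_def list_array_def)
  have z: "arrays s1 6 i = 0" "arrays s1 7 i = 0" for i by (simp_all add: arrays1 arrays)
  have Gv: "x < nG" "y < nG" if "(x, y) \<in> parcs G" for x y using that arc_less by auto
  have Hv: "x < nH" "y < nH" if "(x, y) \<in> parcs H" for x y
    using that H.in_arcsD1 H.in_arcsD2 H(1) by auto
  have hv: "\<alpha> v < nH" "\<beta> v < nH" if "v < nG" for v
    using that r(3,4) G(1) H(1) by (auto simp: homs_def PiE_iff)
  have le: "x < nG \<Longrightarrow> x \<le> V" "x < nH \<Longrightarrow> x \<le> V" for x using m by (simp_all add: V_def)
  have arrays_le: "arrays s a i \<le> V" for a i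
  proof -
    have "list_array (map fst gs) i \<le> V" "list_array (map snd gs) i \<le> V"
      using G(3) Gv le(1) by (force intro!: list_array_le)+
    moreover have "list_array (map fst hs) i \<le> V" "list_array (map snd hs) i \<le> V"
      using H(3) Hv le(2) by (force intro!: list_array_le)+
    moreover have "list_array (map \<alpha> [0..<nG]) i \<le> V" "list_array (map \<beta> [0..<nG]) i \<le> V"
      using hv le(2) by (auto intro!: list_array_le)
    ultimately show ?thesis by (simp add: arrays)
  qed
  have b: "bounded V s1"
    using regs_le arrays_le r(6) unfolding bounded_def arrays1
    by (auto simp: s1_def prologue_def regs V_def)
  have u: "tm (regs s1) MAIN \<le> 1000000 * (nG * length gs)"
    by (rule tm_MAIN) (use i m r in \<open>auto simp: inp_def\<close>)
  obtain t where t: "t \<le> tm (regs s1) MAIN" "run w (compile MAIN) s1 t (sem MAIN s1)"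
    using run_sem(1)[OF _ b w(1), of MAIN "regs s1"] by auto
  have bM: "bounded V (sem MAIN s1)" using run_sem(2)[OF _ b w(1), of MAIN "regs s1"] by auto
  have "run w PROLOGUE s 28 s1"
    unfolding s1_def by (rule run_PROLOGUE) (use w(2) regs in \<open>simp add: V_def\<close>)
  moreover have "run w EPILOGUE (sem MAIN s1) 6 (epilogue (sem MAIN s1))"
    by (rule run_EPILOGUE) (use bM w(1) in \<open>auto simp: bounded_def intro: le_trans[of _ V]\<close>)
  ultimately have "run w program s (28 + (t + 6)) (epilogue (sem MAIN s1))"
    unfolding program_def using t(2) by (blast intro: run.Seq)
  moreover have "28 + (t + 6) \<le> w" using t(1) u N(4) w(3) by linarith
  moreover have "correct_output G H \<alpha> \<beta> q w (epilogue (sem MAIN s1))"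
    by (rule MAIN_spec[OF i z w(4)])
  ultimately show ?thesis unfolding s_def by blast
qed

theorem theorem28:
  shows
    "(\<forall>(G :: 'a pair_pre_digraph) (H :: 'b pair_pre_digraph) \<alpha> \<beta> q. hom_pair G H \<alpha> \<beta> q \<longrightarrow>
        (outcome_none G H \<alpha> \<beta> q \<or>
         (\<exists>Q. outcome_single G H \<alpha> \<beta> q Q) \<or>
         (\<exists>R P. outcome_powers G H \<alpha> \<beta> q R P) \<or>
         outcome_all G H \<alpha> \<beta> q) \<and>
        ((\<forall>C \<in> closed_walks G. pi_class H (map_walk \<alpha> C) = pi_class H [] \<and>
                                pi_class H (map_walk \<beta> C) = pi_class H []) \<longrightarrow>
         outcome_all G H \<alpha> \<beta> q)) \<and>
     (\<exists>(prog :: com) (c :: nat).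
        \<forall>(G :: nat pair_pre_digraph) (H :: nat pair_pre_digraph) \<alpha> \<beta> q nG nH gs hs.
          hom_pair G H \<alpha> \<beta> q \<and>
          pverts G = {..<nG} \<and> distinct gs \<and> set gs = parcs G \<and>
          pverts H = {..<nH} \<and> distinct hs \<and> set hs = parcs H \<longrightarrow>
          (\<exists>t s. run (c * size_bound G H) prog (input_state nG gs nH hs \<alpha> \<beta> q) t s \<and>
                 t \<le> c * size_bound G H \<and>
                 correct_output G H \<alpha> \<beta> q (c * size_bound G H) s))"
proof (intro conjI)
  show "\<exists>(prog :: com) (c :: nat).
        \<forall>(G :: nat pair_pre_digraph) (H :: nat pair_pre_digraph) \<alpha> \<beta> q nG nH gs hs.
          hom_pair G H \<alpha> \<beta> q \<and>
          pverts G = {..<nG} \<and> distinct gs \<and> set gs = parcs G \<and>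
          pverts H = {..<nH} \<and> distinct hs \<and> set hs = parcs H \<longrightarrow>
          (\<exists>t s. run (c * size_bound G H) prog (input_state nG gs nH hs \<alpha> \<beta> q) t s \<and>
                 t \<le> c * size_bound G H \<and>
                 correct_output G H \<alpha> \<beta> q (c * size_bound G H) s)"
    using program_correct by blast
qed (intro allI impI conjI classification; assumption)

end
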